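(* Let $X$ be a complex manifold of complex dimension $n$ endowed with a holomorphic principal $G$-bundle $P$. Assume that $(g,h)$, with $g$ a Hermitian metric on $X$ with Hermitian form $\omega$ and $h$ a reduction of $P$ to a maximal compact subgroup $K$ with Lie algebra $\mathfrak{k}$, solves the coupled Hermitian-Einstein system $$F_h\wedge\omega^{n-1}=\frac{z}{n}\omega^n,\qquad\rho_B+\langle z,F_h\rangle=0,\qquad dd^c\omega+\langle F_h\wedge F_h\rangle=0,$$ where $z$ is a central element of $\mathfrak{k}$. Then $(g,h)$ solves the equations $$\operatorname{Rc}-\tfrac14H^2+\sum_i\langle i_{e_i}F_\theta,i_{e_i}F_\theta\rangle+\tfrac12L_{\varphi^\sharp}g=0,$$ $$d^*H-d\varphi+i_{\varphi^\sharp}H=0,$$ $$d^{\theta*}F_\theta+i_{\varphi^\sharp}F_\theta+*(F_\theta\wedge*H)=0,$$ where $\operatorname{Rc}$ is the Riemannian Ricci tensor of $g$ and $H=-d^c\omega$, $\theta=\theta^h$, $\varphi=\theta_\omega$.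
   Context: $G$ is a complex reductive Lie group with Lie algebra $\mathfrak{g}$ carrying a fixed non-degenerate bi-invariant symmetric bilinear form $\langle\,,\rangle:\mathfrak{g}\otimes\mathfrak{g}\to\mathbb{C}$ with $\langle\mathfrak{k},\mathfrak{k}\rangle\subset\mathbb{R}$ for every compact Lie subalgebra $\mathfrak{k}\subset\mathfrak{g}$. $\theta^h$ is the Chern connection of $h$, $F_h=F_{\theta^h}$ its curvature, $d^\theta$ the covariant exterior derivative with formal adjoint $d^{\theta*}$; $z$ is viewed as a section of the adjoint bundle of the $K$-bundle defined by $h$. $J$ is the complex structure, $\omega=g(J\cdot,\cdot)$, $d^c=i(\bar\partial-\partial)$ (so $dd^c=2i\partial\bar\partial$), $*$ the Hodge star of $g$, $e_1,\dots,e_{2n}$ any local $g$-orthonormal frame of $T$, $L$ the Lie derivative, $\varphi^\sharp$ the $g$-dual vector field of $\varphi$. $H^2$ is the symmetric tensor $H^2(V,W)=\sum_{i,j}H(e_i,e_j,V)H(e_i,e_j,W)$, and $\langle i_{e_i}F_\theta,i_{e_i}F_\theta\rangle(V,W)=\langle F_\theta(e_i,V),F_\theta(e_i,W)\rangle$. The Lee form is $\theta_\omega=Jd^*\omega$, i.e. $\theta_\omega(V)=\frac12\sum_jd\omega(e_j,Je_j,V)$ (equivalently $d\omega^{n-1}=\theta_\omega\wedge\omega^{n-1}$). The Bismut connection is $\nabla^B=\nabla-\frac12g^{-1}d^c\omega$, with $\nabla$ the Levi-Civita connection and $(g^{-1}d^c\omega)(V,W)=g^{-1}(d^c\omega(V,W,\cdot))$,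 and the Bismut Ricci form is $\rho_B(V,W)=\frac12\sum_{j=1}^{2n}g(R_{\nabla^B}(V,W)Je_j,e_j)$. *)

theory Defs
  imports
    "HOL-Analysis.Analysis"
    "HOL-Algebra.Group"
    "HOL-Combinatorics.Permutations"
begin

section \<open>Smooth and holomorphic maps between open subsets of normed spaces\<close>

text \<open>The definitions are used for finite-dimensional spaces and open sets only.  Model spaces are
  taken in the class of real normed spaces (with an explicit hypothesis of finite dimension), rather
  than Euclidean spaces, so that Lie groups of dimension zero are not excluded.\<close>

fun Ck_on :: "nat \<Rightarrow> 'a::real_normed_vector set \<Rightarrow> ('a \<Rightarrow> 'b::real_normed_vector) \<Rightarrow> bool" where
  "Ck_on 0 S f = continuous_on S f"
| "Ck_on (Suc k) S f =
    ((\<forall>x\<in>S. f differentiable (at x)) \<and> (\<forall>v. Ck_on k S (\<lambda>x. frechet_derivative f (at x) v)))"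

definition smooth_on :: "'a::real_normed_vector set \<Rightarrow> ('a \<Rightarrow> 'b::real_normed_vector) \<Rightarrow> bool" where
  "smooth_on S f \<longleftrightarrow> (\<forall>k. Ck_on k S f)"

text \<open>\<open>I1\<close> and \<open>I2\<close> are the complex structures (multiplication by the imaginary unit) of the two
  spaces; on an open set, holomorphic means complex differentiable at every point.\<close>

definition holo_on ::
  "('a::real_normed_vector \<Rightarrow> 'a) \<Rightarrow> ('b::real_normed_vector \<Rightarrow> 'b) \<Rightarrow> 'a set \<Rightarrow> ('a \<Rightarrow> 'b) \<Rightarrow> bool"
  where
  "holo_on I1 I2 S f \<longleftrightarrow>
    (\<forall>x\<in>S. \<exists>D. (f has_derivative D) (at x) \<and> (\<forall>v. D (I1 v) = I2 (D v)))"


section \<open>Complex manifolds\<close>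

type_synonym ('x, 'v) chart = "'x set \<times> ('x \<Rightarrow> 'v)"

record ('x, 'v) cmfd =
  mtop :: "'x topology"
  atlas :: "('x, 'v) chart set"
  cstr :: "'v \<Rightarrow> 'v"

definition chart_inv :: "('x, 'v) chart \<Rightarrow> 'v \<Rightarrow> 'x" where
  "chart_inv c = inv_into (fst c) (snd c)"

definition finite_dimensional :: "'v::real_vector itself \<Rightarrow> bool" where
  "finite_dimensional _ \<longleftrightarrow> (\<exists>B :: 'v set. finite B \<and> span B = UNIV)"

definition complex_manifold :: "('x, 'v::real_normed_vector) cmfd \<Rightarrow> bool" where
  "complex_manifold M \<longleftrightarrow>
    finite_dimensional TYPE('v) \<and> linear (cstr M) \<and> (\<forall>v. cstr M (cstr M v) = - v) \<and>
    Hausdorff_space (mtop M) \<and> second_countable (mtop M) \<and>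
    (\<Union>c\<in>atlas M. fst c) = topspace (mtop M) \<and>
    (\<forall>c\<in>atlas M. openin (mtop M) (fst c) \<and> open (snd c ` fst c) \<and>
        homeomorphic_map (subtopology (mtop M) (fst c)) (top_of_set (snd c ` fst c)) (snd c)) \<and>
    (\<forall>c\<in>atlas M. \<forall>c'\<in>atlas M.
        holo_on (cstr M) (cstr M) (snd c ` (fst c \<inter> fst c')) (snd c' \<circ> chart_inv c))"

text \<open>Maps between manifolds defined on an open set \<open>W\<close>, with local regularity \<open>reg\<close> in charts.\<close>

definition regular_map_on ::
  "('v::real_normed_vector set \<Rightarrow> ('v \<Rightarrow> 'w::real_normed_vector) \<Rightarrow> bool)
    \<Rightarrow> ('x, 'v) cmfd \<Rightarrow> ('y, 'w) cmfd \<Rightarrow> 'x set \<Rightarrow> ('x \<Rightarrow> 'y) \<Rightarrow> bool" where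
  "regular_map_on reg M N W f \<longleftrightarrow> openin (mtop M) W \<and> f ` W \<subseteq> topspace (mtop N) \<and>
    (\<forall>x\<in>W. \<forall>c\<in>atlas M. \<forall>c'\<in>atlas N. x \<in> fst c \<and> f x \<in> fst c' \<longrightarrow>
      (\<exists>O'. openin (mtop M) O' \<and> x \<in> O' \<and> O' \<subseteq> W \<inter> fst c \<and> f ` O' \<subseteq> fst c' \<and>
        reg (snd c ` O') (snd c' \<circ> f \<circ> chart_inv c)))"

definition smooth_map_on ::
  "('x, 'v::real_normed_vector) cmfd \<Rightarrow> ('y, 'w::real_normed_vector) cmfd \<Rightarrow> 'x set \<Rightarrow> ('x \<Rightarrow> 'y) \<Rightarrow> bool"
  where "smooth_map_on M N = regular_map_on smooth_on M N"

definition holo_map_on ::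
  "('x, 'v::real_normed_vector) cmfd \<Rightarrow> ('y, 'w::real_normed_vector) cmfd \<Rightarrow> 'x set \<Rightarrow> ('x \<Rightarrow> 'y) \<Rightarrow> bool"
  where "holo_map_on M N = regular_map_on (holo_on (cstr M) (cstr N)) M N"

definition prod_cmfd :: "('x, 'v) cmfd \<Rightarrow> ('y, 'w) cmfd \<Rightarrow> ('x \<times> 'y, 'v \<times> 'w) cmfd" where
  "prod_cmfd M N = \<lparr> mtop = prod_topology (mtop M) (mtop N),
     atlas = {(fst c \<times> fst c', map_prod (snd c) (snd c')) |c c'. c \<in> atlas M \<and> c' \<in> atlas N},
     cstr = map_prod (cstr M) (cstr N) \<rparr>"


section \<open>Complex Lie groups\<close>

text \<open>\<open>id_chart\<close> is a chart around the unit; its differential is used to identify the Lie algebra,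
  i.e. the tangent space at the unit, with the model space \<open>'v\<close>.\<close>

record ('g, 'v) lie_group = "'g monoid" +
  gmfd :: "('g, 'v) cmfd"
  id_chart :: "('g, 'v) chart"

definition complex_lie_group :: "('g, 'v::real_normed_vector) lie_group \<Rightarrow> bool" where
  "complex_lie_group G \<longleftrightarrow>
    group G \<and> complex_manifold (gmfd G) \<and> topspace (mtop (gmfd G)) = carrier G \<and>
    holo_map_on (prod_cmfd (gmfd G) (gmfd G)) (gmfd G) (carrier G \<times> carrier G)
      (\<lambda>(a, b). a \<otimes>\<^bsub>G\<^esub> b) \<and>
    holo_map_on (gmfd G) (gmfd G) (carrier G) (\<lambda>a. inv\<^bsub>G\<^esub> a) \<and>
    id_chart G \<in> atlas (gmfd G) \<and> \<one>\<^bsub>G\<^esub> \<in> fst (id_chart G)"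

definition lie_I :: "('g, 'v) lie_group \<Rightarrow> 'v \<Rightarrow> 'v" where
  "lie_I G = cstr (gmfd G)"

definition Ad :: "('g, 'v::real_normed_vector) lie_group \<Rightarrow> 'g \<Rightarrow> 'v \<Rightarrow> 'v" where
  "Ad G a = frechet_derivative
     (\<lambda>u. snd (id_chart G) (a \<otimes>\<^bsub>G\<^esub> chart_inv (id_chart G) u \<otimes>\<^bsub>G\<^esub> inv\<^bsub>G\<^esub> a))
     (at (snd (id_chart G) \<one>\<^bsub>G\<^esub>))"

text \<open>The bracket is \<open>[\<xi>, \<eta>] = ad \<xi> \<eta>\<close>, where \<open>ad\<close> is the differential of \<open>Ad\<close> at the unit.\<close>

definition bracket :: "('g, 'v::real_normed_vector) lie_group \<Rightarrow> 'v \<Rightarrow> 'v \<Rightarrow> 'v" where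
  "bracket G \<xi> \<eta> = frechet_derivative (\<lambda>u. Ad G (chart_inv (id_chart G) u) \<eta>)
     (at (snd (id_chart G) \<one>\<^bsub>G\<^esub>)) \<xi>"

text \<open>\<open>left_log_deriv G a p v\<close> is \<open>a\<^sup>-\<^sup>1 da\<close> (the pulled back Maurer-Cartan form) at \<open>p\<close> on \<open>v\<close>.\<close>

definition left_log_deriv ::
  "('g, 'v::real_normed_vector) lie_group \<Rightarrow> ('w::real_normed_vector \<Rightarrow> 'g) \<Rightarrow> 'w \<Rightarrow> 'w \<Rightarrow> 'v" where
  "left_log_deriv G a p v =
     frechet_derivative (\<lambda>q. snd (id_chart G) (inv\<^bsub>G\<^esub> (a p) \<otimes>\<^bsub>G\<^esub> a q)) (at p) v"

text \<open>Compact subgroups are closed, hence Lie subgroups; the Lie algebra is the space of velocities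
  at the unit of curves in the subgroup.\<close>

definition compact_subgroup :: "('g, 'v) lie_group \<Rightarrow> 'g set \<Rightarrow> bool" where
  "compact_subgroup G K \<longleftrightarrow> subgroup K G \<and> compactin (mtop (gmfd G)) K"

definition maximal_compact :: "('g, 'v) lie_group \<Rightarrow> 'g set \<Rightarrow> bool" where
  "maximal_compact G K \<longleftrightarrow>
    compact_subgroup G K \<and> (\<forall>K'. compact_subgroup G K' \<and> K \<subseteq> K' \<longrightarrow> K' = K)"

definition lie_algebra :: "('g, 'v::real_normed_vector) lie_group \<Rightarrow> 'g set \<Rightarrow> 'v set" where
  "lie_algebra G K = {\<xi>. \<exists>\<gamma>. (\<forall>t::real. \<gamma> t \<in> K \<inter> fst (id_chart G)) \<and> \<gamma> 0 = \<one>\<^bsub>G\<^esub> \<and>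
     ((\<lambda>t. snd (id_chart G) (\<gamma> t)) has_vector_derivative \<xi>) (at 0)}"

definition one_param_subgroup ::
  "('g, 'v::real_normed_vector) lie_group \<Rightarrow> (real \<Rightarrow> 'g) \<Rightarrow> 'v \<Rightarrow> bool" where
  "one_param_subgroup G \<gamma> \<xi> \<longleftrightarrow>
    continuous_map euclideanreal (mtop (gmfd G)) \<gamma> \<and> (\<forall>s t. \<gamma> (s + t) = \<gamma> s \<otimes>\<^bsub>G\<^esub> \<gamma> t) \<and>
    ((\<lambda>t. snd (id_chart G) (\<gamma> t)) has_vector_derivative \<xi>) (at 0)"

text \<open>\<open>G\<close> is the complexification of its compact subgroup \<open>K\<close>: the Lie algebra of \<open>K\<close> is a real form
  of that of \<open>G\<close>, and every \<open>a \<in> G\<close> has a unique polar decomposition \<open>a = k exp (i \<eta>)\<close>.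
  A complex Lie group is reductive if it is the complexification of its maximal compact subgroup;
  the latter is unique up to conjugation.\<close>

definition complexification_of :: "('g, 'v::real_normed_vector) lie_group \<Rightarrow> 'g set \<Rightarrow> bool" where
  "complexification_of G K \<longleftrightarrow>
    (\<forall>\<zeta>. \<exists>!(\<xi>, \<eta>). \<xi> \<in> lie_algebra G K \<and> \<eta> \<in> lie_algebra G K \<and> \<zeta> = \<xi> + lie_I G \<eta>) \<and>
    (\<forall>a\<in>carrier G. \<exists>!(k, \<eta>). k \<in> K \<and> \<eta> \<in> lie_algebra G K \<and>
       (\<exists>\<gamma>. one_param_subgroup G \<gamma> (lie_I G \<eta>) \<and> a = k \<otimes>\<^bsub>G\<^esub> \<gamma> 1))"

definition complex_reductive :: "('g, 'v::real_normed_vector) lie_group \<Rightarrow> bool" where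
  "complex_reductive G \<longleftrightarrow> complex_lie_group G \<and> (\<exists>K. maximal_compact G K) \<and>
    (\<forall>K. maximal_compact G K \<longrightarrow> complexification_of G K)"

text \<open>In the reality condition, compact Lie subalgebras are the Lie algebras of compact subgroups.\<close>

definition admissible_pairing ::
  "('g, 'v::real_normed_vector) lie_group \<Rightarrow> ('v \<Rightarrow> 'v \<Rightarrow> complex) \<Rightarrow> bool" where
  "admissible_pairing G B \<longleftrightarrow>
    (\<forall>\<eta>. linear (\<lambda>\<xi>. B \<xi> \<eta>)) \<and> (\<forall>\<xi> \<eta>. B (lie_I G \<xi>) \<eta> = \<i> * B \<xi> \<eta>) \<and>
    (\<forall>\<xi> \<eta>. B \<xi> \<eta> = B \<eta> \<xi>) \<and>
    (\<forall>\<xi>. (\<forall>\<eta>. B \<xi> \<eta> = 0) \<longrightarrow> \<xi> = 0) \<and>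
    (\<forall>a\<in>carrier G. \<forall>\<xi> \<eta>. B (Ad G a \<xi>) (Ad G a \<eta>) = B \<xi> \<eta>) \<and>
    (\<forall>K. compact_subgroup G K \<longrightarrow>
       (\<forall>\<xi>\<in>lie_algebra G K. \<forall>\<eta>\<in>lie_algebra G K. B \<xi> \<eta> \<in> \<real>))"


section \<open>Holomorphic principal bundles, reductions and connections\<close>

text \<open>The holomorphic structure of a principal bundle is given by a bundle atlas.  A local
  trivialization \<open>(x, a) \<mapsto> s x \<cdot> a\<close> is recorded through its local section \<open>s\<close> over an open set \<open>W\<close>.\<close>

type_synonym ('x, 'p) local_sec = "'x set \<times> ('x \<Rightarrow> 'p)"

record ('x, 'p, 'g) pbundle =
  tot_space :: "'p set"
  bproj :: "'p \<Rightarrow> 'x"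
  bact :: "'p \<Rightarrow> 'g \<Rightarrow> 'p"
  trivs :: "('x, 'p) local_sec set"

definition bdiv :: "('g, 'v) lie_group \<Rightarrow> ('x, 'p, 'g) pbundle \<Rightarrow> 'p \<Rightarrow> 'p \<Rightarrow> 'g" where
  "bdiv G P p q = (THE a. a \<in> carrier G \<and> q = bact P p a)"

definition local_section ::
  "('x, 'w) cmfd \<Rightarrow> ('x, 'p, 'g) pbundle \<Rightarrow> ('x, 'p) local_sec \<Rightarrow> bool" where
  "local_section X P s \<longleftrightarrow> openin (mtop X) (fst s) \<and>
    (\<forall>x\<in>fst s. snd s x \<in> tot_space P \<and> bproj P (snd s x) = x)"

definition holo_principal_bundle ::
  "('x, 'w::real_normed_vector) cmfd \<Rightarrow> ('g, 'v::real_normed_vector) lie_group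
    \<Rightarrow> ('x, 'p, 'g) pbundle \<Rightarrow> bool" where
  "holo_principal_bundle X G P \<longleftrightarrow>
    bproj P ` tot_space P \<subseteq> topspace (mtop X) \<and>
    (\<forall>p\<in>tot_space P. bact P p \<one>\<^bsub>G\<^esub> = p) \<and>
    (\<forall>p\<in>tot_space P. \<forall>a\<in>carrier G. bact P p a \<in> tot_space P \<and> bproj P (bact P p a) = bproj P p) \<and>
    (\<forall>p\<in>tot_space P. \<forall>a\<in>carrier G. \<forall>b\<in>carrier G. bact P (bact P p a) b = bact P p (a \<otimes>\<^bsub>G\<^esub> b)) \<and>
    (\<forall>p\<in>tot_space P. \<forall>q\<in>tot_space P. bproj P p = bproj P q \<longrightarrow> (\<exists>!a. a \<in> carrier G \<and> q = bact P p a)) \<and>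
    (\<forall>s\<in>trivs P. local_section X P s) \<and>
    (\<Union>s\<in>trivs P. fst s) = topspace (mtop X) \<and>
    (\<forall>s\<in>trivs P. \<forall>s'\<in>trivs P.
       holo_map_on X (gmfd G) (fst s \<inter> fst s') (\<lambda>x. bdiv G P (snd s x) (snd s' x)))"

definition smooth_section ::
  "('x, 'w::real_normed_vector) cmfd \<Rightarrow> ('g, 'v::real_normed_vector) lie_group
    \<Rightarrow> ('x, 'p, 'g) pbundle \<Rightarrow> ('x, 'p) local_sec \<Rightarrow> bool" where
  "smooth_section X G P s \<longleftrightarrow> local_section X P s \<and>
    (\<forall>s'\<in>trivs P. smooth_map_on X (gmfd G) (fst s' \<inter> fst s) (\<lambda>x. bdiv G P (snd s' x) (snd s x)))"

definition holo_section ::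
  "('x, 'w::real_normed_vector) cmfd \<Rightarrow> ('g, 'v::real_normed_vector) lie_group
    \<Rightarrow> ('x, 'p, 'g) pbundle \<Rightarrow> ('x, 'p) local_sec \<Rightarrow> bool" where
  "holo_section X G P s \<longleftrightarrow> local_section X P s \<and>
    (\<forall>s'\<in>trivs P. holo_map_on X (gmfd G) (fst s' \<inter> fst s) (\<lambda>x. bdiv G P (snd s' x) (snd s x)))"

text \<open>A reduction of \<open>P\<close> to \<open>K\<close>, given by its total space \<open>h \<subseteq> P\<close>, a smooth principal
  \<open>K\<close>-subbundle.\<close>

definition reduced_section ::
  "('x, 'w::real_normed_vector) cmfd \<Rightarrow> ('g, 'v::real_normed_vector) lie_group
    \<Rightarrow> ('x, 'p, 'g) pbundle \<Rightarrow> 'p set \<Rightarrow> ('x, 'p) local_sec \<Rightarrow> bool" where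
  "reduced_section X G P h s \<longleftrightarrow> smooth_section X G P s \<and> (\<forall>x\<in>fst s. snd s x \<in> h)"

definition reduction ::
  "('x, 'w::real_normed_vector) cmfd \<Rightarrow> ('g, 'v::real_normed_vector) lie_group
    \<Rightarrow> ('x, 'p, 'g) pbundle \<Rightarrow> 'g set \<Rightarrow> 'p set \<Rightarrow> bool" where
  "reduction X G P K h \<longleftrightarrow> h \<subseteq> tot_space P \<and>
    (\<forall>p\<in>h. \<forall>k\<in>K. bact P p k \<in> h) \<and>
    (\<forall>p\<in>h. \<forall>q\<in>h. bproj P p = bproj P q \<longrightarrow> (\<exists>k\<in>K. q = bact P p k)) \<and>
    (\<forall>x\<in>topspace (mtop X). \<exists>s. x \<in> fst s \<and> reduced_section X G P h s)"

text \<open>A connection is given by its local connection forms \<open>\<theta> s c p\<close>: the pull-back of the connection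
  form by the smooth local section \<open>s\<close>, written in the chart \<open>c\<close> at the point \<open>p\<close> of the image of
  \<open>c\<close>.  The two last conditions are the transformation laws under changes of chart and of section
  (\<open>\<theta>\<^bsub>sa\<^esub> = Ad (a\<^sup>-\<^sup>1) \<theta>\<^bsub>s\<^esub> + a\<^sup>-\<^sup>1 da\<close>).\<close>

type_synonym ('x, 'w, 'p, 'v) conn =
  "('x, 'p) local_sec \<Rightarrow> ('x, 'w) chart \<Rightarrow> 'w \<Rightarrow> 'w \<Rightarrow> 'v"

definition connection ::
  "('x, 'w::real_normed_vector) cmfd \<Rightarrow> ('g, 'v::real_normed_vector) lie_group
    \<Rightarrow> ('x, 'p, 'g) pbundle \<Rightarrow> ('x, 'w, 'p, 'v) conn \<Rightarrow> bool" where
  "connection X G P \<theta> \<longleftrightarrow>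
    (\<forall>s c. smooth_section X G P s \<and> c \<in> atlas X \<longrightarrow>
      (\<forall>p \<in> snd c ` (fst c \<inter> fst s). linear (\<theta> s c p)) \<and>
      (\<forall>v. smooth_on (snd c ` (fst c \<inter> fst s)) (\<lambda>p. \<theta> s c p v))) \<and>
    (\<forall>s c c'. smooth_section X G P s \<and> c \<in> atlas X \<and> c' \<in> atlas X \<longrightarrow>
      (\<forall>x \<in> fst c \<inter> fst c' \<inter> fst s. \<forall>v.
        \<theta> s c (snd c x) v =
        \<theta> s c' (snd c' x) (frechet_derivative (snd c' \<circ> chart_inv c) (at (snd c x)) v))) \<and>
    (\<forall>s s' c. smooth_section X G P s \<and> smooth_section X G P s' \<and> c \<in> atlas X \<longrightarrow>
      (let a = (\<lambda>p. bdiv G P (snd s (chart_inv c p)) (snd s' (chart_inv c p))) in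
       \<forall>p \<in> snd c ` (fst c \<inter> fst s \<inter> fst s'). \<forall>v.
         \<theta> s' c p v = Ad G (inv\<^bsub>G\<^esub> (a p)) (\<theta> s c p v) + left_log_deriv G a p v))"

text \<open>The Chern connection of \<open>h\<close> is the connection which reduces to \<open>h\<close> and induces the holomorphic
  structure of \<open>P\<close>, i.e. whose connection form is of type \<open>(1,0)\<close>.\<close>

definition chern_connection ::
  "('x, 'w::real_normed_vector) cmfd \<Rightarrow> ('g, 'v::real_normed_vector) lie_group
    \<Rightarrow> ('x, 'p, 'g) pbundle \<Rightarrow> 'g set \<Rightarrow> 'p set \<Rightarrow> ('x, 'w, 'p, 'v) conn \<Rightarrow> bool" where
  "chern_connection X G P K h \<theta> \<longleftrightarrow> connection X G P \<theta> \<and>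
    (\<forall>s. reduced_section X G P h s \<longrightarrow>
      (\<forall>c\<in>atlas X. \<forall>p \<in> snd c ` (fst c \<inter> fst s). \<forall>v. \<theta> s c p v \<in> lie_algebra G K)) \<and>
    (\<forall>s. holo_section X G P s \<longrightarrow>
      (\<forall>c\<in>atlas X. \<forall>p \<in> snd c ` (fst c \<inter> fst s). \<forall>v.
        \<theta> s c p (cstr X v) = lie_I G (\<theta> s c p v)))"


section \<open>Exterior calculus on open subsets of a vector space\<close>

text \<open>A \<open>k\<close>-form at a point is a function on lists of length \<open>k\<close>; its values on lists of other lengths
  are irrelevant.  A form on an open set is a map from points to such functions.\<close>

type_synonym ('w, 'b) form = "'w list \<Rightarrow> 'b"

definition ext_d ::
  "('w::real_normed_vector \<Rightarrow> ('w, 'b::real_normed_vector) form) \<Rightarrow> 'w \<Rightarrow> ('w, 'b) form" where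
  "ext_d \<alpha> p vs = (\<Sum>i<length vs. (- 1) ^ i *\<^sub>R
     frechet_derivative (\<lambda>q. \<alpha> q (take i vs @ drop (Suc i) vs)) (at p) (vs ! i))"

definition wedge ::
  "('a \<Rightarrow> 'b \<Rightarrow> 'c::real_vector) \<Rightarrow> nat \<Rightarrow> nat \<Rightarrow> ('w, 'a) form \<Rightarrow> ('w, 'b) form \<Rightarrow> ('w, 'c) form" where
  "wedge m k l \<alpha> \<beta> vs = (1 / (fact k * fact l)) *\<^sub>R
    (\<Sum>\<sigma> | \<sigma> permutes {..<k + l}. of_int (sign \<sigma>) *\<^sub>R
      m (\<alpha> (map (\<lambda>i. vs ! \<sigma> i) [0..<k])) (\<beta> (map (\<lambda>i. vs ! \<sigma> i) [k..<k + l])))"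

primrec wedge_power :: "('w, real) form \<Rightarrow> nat \<Rightarrow> ('w, real) form" where
  "wedge_power \<alpha> 0 = (\<lambda>vs. 1)"
| "wedge_power \<alpha> (Suc j) = wedge (*) 2 (2 * j) \<alpha> (wedge_power \<alpha> j)"

text \<open>Component of type \<open>(r, s)\<close> of an \<open>(r + s)\<close>-form: the complex multilinear extension of \<open>\<alpha>\<close> is
  evaluated on \<open>(v - i J v) / 2\<close> in the \<open>r\<close> slots belonging to \<open>S\<close>, on \<open>(v + i J v) / 2\<close> in the other
  ones, and summed over \<open>S\<close>; \<open>T\<close> is the set of slots from which the summand with \<open>J v\<close> is taken.\<close>

definition type_part ::
  "('w \<Rightarrow> 'w) \<Rightarrow> nat \<Rightarrow> nat \<Rightarrow> ('w, complex) form \<Rightarrow> ('w, complex) form" where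
  "type_part J r s \<alpha> vs = 1 / 2 ^ (r + s) *
    (\<Sum>S | S \<subseteq> {..<r + s} \<and> card S = r. \<Sum>T\<in>Pow {..<r + s}.
      (\<Prod>j\<in>T. if j \<in> S then - \<i> else \<i>) *
      \<alpha> (map (\<lambda>j. if j \<in> T then J (vs ! j) else vs ! j) [0..<r + s]))"

definition del :: "('w::real_normed_vector \<Rightarrow> 'w) \<Rightarrow> nat
    \<Rightarrow> ('w \<Rightarrow> ('w, complex) form) \<Rightarrow> 'w \<Rightarrow> ('w, complex) form" where
  "del J k \<alpha> p vs =
    (\<Sum>r\<le>k. type_part J (Suc r) (k - r) (ext_d (\<lambda>q. type_part J r (k - r) (\<alpha> q)) p) vs)"

definition delbar :: "('w::real_normed_vector \<Rightarrow> 'w) \<Rightarrow> nat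
    \<Rightarrow> ('w \<Rightarrow> ('w, complex) form) \<Rightarrow> 'w \<Rightarrow> ('w, complex) form" where
  "delbar J k \<alpha> p vs =
    (\<Sum>r\<le>k. type_part J r (Suc (k - r)) (ext_d (\<lambda>q. type_part J r (k - r) (\<alpha> q)) p) vs)"

definition dc :: "('w::real_normed_vector \<Rightarrow> 'w) \<Rightarrow> nat
    \<Rightarrow> ('w \<Rightarrow> ('w, complex) form) \<Rightarrow> 'w \<Rightarrow> ('w, complex) form" where
  "dc J k \<alpha> p vs = \<i> * (delbar J k \<alpha> p vs - del J k \<alpha> p vs)"


section \<open>Hermitian geometry in a chart\<close>

text \<open>From now on the base is modelled on \<open>complex ^ 'n\<close>, so \<open>n = CARD('n)\<close>.  In a chart, \<open>g p\<close> is the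
  metric at the point \<open>p\<close>; \<open>m\<close> denotes the metric at a single point.\<close>

definition Jstd :: "complex ^ 'n \<Rightarrow> complex ^ 'n" where
  "Jstd v = \<i> *s v"

type_synonym 'n metric = "complex ^ 'n \<Rightarrow> complex ^ 'n \<Rightarrow> complex ^ 'n \<Rightarrow> real"

text \<open>A Hermitian metric on the manifold \<open>X\<close>, given by its coordinate expressions in all charts.\<close>

definition hermitian_metric ::
  "('x, complex ^ 'n) cmfd \<Rightarrow> (('x, complex ^ 'n) chart \<Rightarrow> 'n::finite metric) \<Rightarrow> bool" where
  "hermitian_metric X g \<longleftrightarrow>
    (\<forall>c\<in>atlas X.
      (\<forall>p \<in> snd c ` fst c.
        (\<forall>w. linear (\<lambda>v. g c p v w)) \<and> (\<forall>v w. g c p v w = g c p w v) \<and>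
        (\<forall>v. v \<noteq> 0 \<longrightarrow> g c p v v > 0) \<and> (\<forall>v w. g c p (Jstd v) (Jstd w) = g c p v w)) \<and>
      (\<forall>v w. smooth_on (snd c ` fst c) (\<lambda>p. g c p v w))) \<and>
    (\<forall>c\<in>atlas X. \<forall>c'\<in>atlas X. \<forall>x \<in> fst c \<inter> fst c'.
      let D = frechet_derivative (snd c' \<circ> chart_inv c) (at (snd c x)) in
      \<forall>v w. g c (snd c x) v w = g c' (snd c' x) (D v) (D w))"

text \<open>A chosen orthonormal basis.  It is only used in expressions which do not depend on the choice.\<close>

definition onb :: "(complex ^ 'n \<Rightarrow> complex ^ 'n \<Rightarrow> real) \<Rightarrow> (complex ^ 'n) set" where
  "onb m = (SOME E. span E = UNIV \<and> (\<forall>e\<in>E. \<forall>f\<in>E. m e f = (if e = f then 1 else 0)))"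

definition herm_form :: "(complex ^ 'n \<Rightarrow> complex ^ 'n \<Rightarrow> real) \<Rightarrow> (complex ^ 'n, real) form" where
  "herm_form m vs = m (Jstd (vs ! 0)) (vs ! 1)"

definition vol_form :: "(complex ^ 'n \<Rightarrow> complex ^ 'n \<Rightarrow> real) \<Rightarrow> (complex ^ 'n, real) form" where
  "vol_form m vs = wedge_power (herm_form m) CARD('n) vs / fact CARD('n)"

text \<open>Hodge star of a \<open>k\<close>-form, with the convention \<open>\<alpha> \<and> *\<beta> = \<langle>\<alpha>, \<beta>\<rangle> \<omega>^n / n!\<close>.\<close>

definition hodge :: "(complex ^ 'n \<Rightarrow> complex ^ 'n \<Rightarrow> real) \<Rightarrow> nat
    \<Rightarrow> (complex ^ 'n, 'b::real_vector) form \<Rightarrow> (complex ^ 'n, 'b) form" where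
  "hodge m k \<alpha> ws = (1 / fact k) *\<^sub>R
    (\<Sum>es | set es \<subseteq> onb m \<and> length es = k. vol_form m (es @ ws) *\<^sub>R \<alpha> es)"

text \<open>The codifferential \<open>d\<^sup>* = - * d *\<close> of a \<open>k\<close>-form; the real dimension is even.\<close>

definition codiff :: "'n::finite metric \<Rightarrow> nat
    \<Rightarrow> (complex ^ 'n \<Rightarrow> (complex ^ 'n, real) form) \<Rightarrow> complex ^ 'n \<Rightarrow> (complex ^ 'n, real) form" where
  "codiff g k \<alpha> p vs = - hodge (g p) (2 * CARD('n) + 1 - k)
     (ext_d (\<lambda>q. hodge (g q) k (\<alpha> q)) p) vs"

definition sharp :: "(complex ^ 'n \<Rightarrow> complex ^ 'n \<Rightarrow> real) \<Rightarrow> (complex ^ 'n \<Rightarrow> real) \<Rightarrow> complex ^ 'n" where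
  "sharp m \<phi> = (THE u. \<forall>w. m u w = \<phi> w)"

definition omega :: "'n::finite metric \<Rightarrow> complex ^ 'n \<Rightarrow> (complex ^ 'n, real) form" where
  "omega g p = herm_form (g p)"

definition dc_omega :: "'n::finite metric \<Rightarrow> complex ^ 'n \<Rightarrow> (complex ^ 'n, complex) form" where
  "dc_omega g = dc Jstd 2 (\<lambda>p vs. complex_of_real (omega g p vs))"

text \<open>\<open>H = - d\<^sup>c \<omega>\<close>; this form is real.\<close>

definition torsion :: "'n::finite metric \<Rightarrow> complex ^ 'n \<Rightarrow> (complex ^ 'n, real) form" where
  "torsion g p vs = - Re (dc_omega g p vs)"

definition lee_form :: "'n::finite metric \<Rightarrow> complex ^ 'n \<Rightarrow> (complex ^ 'n, real) form" where
  "lee_form g p vs = (1 / 2) * (\<Sum>e\<in>onb (g p). ext_d (omega g) p [e, Jstd e, vs ! 0])"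

definition lee_field :: "'n::finite metric \<Rightarrow> complex ^ 'n \<Rightarrow> complex ^ 'n" where
  "lee_field g p = sharp (g p) (\<lambda>w. lee_form g p [w])"

text \<open>An affine connection \<open>\<nabla>\<^bsub>v\<^esub> W = D\<^bsub>v\<^esub> W + \<Gamma> v W\<close> is given in the chart by \<open>\<Gamma>\<close>.\<close>

type_synonym 'n christoffel = "complex ^ 'n \<Rightarrow> complex ^ 'n \<Rightarrow> complex ^ 'n \<Rightarrow> complex ^ 'n"

definition levi_civita :: "'n::finite metric \<Rightarrow> 'n christoffel" where
  "levi_civita g p v w = sharp (g p) (\<lambda>u. (1 / 2) *
     (frechet_derivative (\<lambda>q. g q w u) (at p) v + frechet_derivative (\<lambda>q. g q v u) (at p) w
      - frechet_derivative (\<lambda>q. g q v w) (at p) u))"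

definition bismut :: "'n::finite metric \<Rightarrow> 'n christoffel" where
  "bismut g p v w =
     levi_civita g p v w - (1 / 2) *\<^sub>R sharp (g p) (\<lambda>u. Re (dc_omega g p [v, w, u]))"

definition curvature :: "'n::finite christoffel
    \<Rightarrow> complex ^ 'n \<Rightarrow> complex ^ 'n \<Rightarrow> complex ^ 'n \<Rightarrow> complex ^ 'n \<Rightarrow> complex ^ 'n" where
  "curvature \<Gamma> p v w u =
     frechet_derivative (\<lambda>q. \<Gamma> q w u) (at p) v - frechet_derivative (\<lambda>q. \<Gamma> q v u) (at p) w
     + \<Gamma> p v (\<Gamma> p w u) - \<Gamma> p w (\<Gamma> p v u)"

definition ricci :: "'n::finite metric \<Rightarrow> complex ^ 'n \<Rightarrow> complex ^ 'n \<Rightarrow> complex ^ 'n \<Rightarrow> real" where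
  "ricci g p v w = (\<Sum>e\<in>onb (g p). g p (curvature (levi_civita g) p e v w) e)"

definition bismut_ricci :: "'n::finite metric \<Rightarrow> complex ^ 'n \<Rightarrow> complex ^ 'n \<Rightarrow> complex ^ 'n \<Rightarrow> real" where
  "bismut_ricci g p v w = (1 / 2) * (\<Sum>e\<in>onb (g p). g p (curvature (bismut g) p v w (Jstd e)) e)"

definition torsion_sq :: "'n::finite metric \<Rightarrow> complex ^ 'n \<Rightarrow> complex ^ 'n \<Rightarrow> complex ^ 'n \<Rightarrow> real" where
  "torsion_sq g p v w =
     (\<Sum>e\<in>onb (g p). \<Sum>f\<in>onb (g p). torsion g p [e, f, v] * torsion g p [e, f, w])"

definition lie_deriv_metric :: "(complex ^ 'n \<Rightarrow> complex ^ 'n) \<Rightarrow> 'n::finite metric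
    \<Rightarrow> complex ^ 'n \<Rightarrow> complex ^ 'n \<Rightarrow> complex ^ 'n \<Rightarrow> real" where
  "lie_deriv_metric Y g p v w = frechet_derivative (\<lambda>q. g q v w) (at p) (Y p)
     + g p (frechet_derivative Y (at p) v) w + g p v (frechet_derivative Y (at p) w)"


section \<open>Curvature and covariant derivative of a connection, in a chart and a local section\<close>

text \<open>\<open>A p v\<close> is a local connection form.\<close>

definition cov_ext_d :: "('g, 'v::real_normed_vector) lie_group
    \<Rightarrow> ('w::real_normed_vector \<Rightarrow> 'w \<Rightarrow> 'v) \<Rightarrow> nat
    \<Rightarrow> ('w \<Rightarrow> ('w, 'v) form) \<Rightarrow> 'w \<Rightarrow> ('w, 'v) form" where
  "cov_ext_d G A k \<alpha> p vs =
     ext_d \<alpha> p vs + wedge (bracket G) 1 k (\<lambda>us. A p (us ! 0)) (\<alpha> p) vs"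

definition curv_form :: "('g, 'v::real_normed_vector) lie_group
    \<Rightarrow> ('w::real_normed_vector \<Rightarrow> 'w \<Rightarrow> 'v) \<Rightarrow> 'w \<Rightarrow> ('w, 'v) form" where
  "curv_form G A p vs = ext_d (\<lambda>q us. A q (us ! 0)) p vs
     + (1 / 2) *\<^sub>R wedge (bracket G) 1 1 (\<lambda>us. A p (us ! 0)) (\<lambda>us. A p (us ! 0)) vs"

text \<open>\<open>d\<^bsup>\<theta>*\<^esup> = - * d\<^sup>\<theta> *\<close> on \<open>k\<close>-forms.\<close>

definition cov_codiff :: "('g, 'v::real_normed_vector) lie_group \<Rightarrow> 'n::finite metric
    \<Rightarrow> (complex ^ 'n \<Rightarrow> complex ^ 'n \<Rightarrow> 'v) \<Rightarrow> nat
    \<Rightarrow> (complex ^ 'n \<Rightarrow> (complex ^ 'n, 'v) form) \<Rightarrow> complex ^ 'n \<Rightarrow> (complex ^ 'n, 'v) form" where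
  "cov_codiff G g A k \<alpha> p vs = - hodge (g p) (2 * CARD('n) + 1 - k)
     (cov_ext_d G A (2 * CARD('n) - k) (\<lambda>q. hodge (g q) k (\<alpha> q)) p) vs"


section \<open>The coupled Hermitian-Einstein system\<close>

text \<open>The system is imposed in all charts and all local sections of the reduction.  The central
  element \<open>z\<close>, as a section of the adjoint bundle of the reduction, is the constant \<open>z\<close> in each of
  these sections.\<close>

definition coupled_hermitian_einstein ::
  "('x, complex ^ 'n) cmfd \<Rightarrow> ('g, 'v::real_normed_vector) lie_group \<Rightarrow> ('v \<Rightarrow> 'v \<Rightarrow> complex)
    \<Rightarrow> ('x, 'p, 'g) pbundle \<Rightarrow> 'p set \<Rightarrow> ('x, complex ^ 'n, 'p, 'v) conn
    \<Rightarrow> (('x, complex ^ 'n) chart \<Rightarrow> 'n::finite metric) \<Rightarrow> 'v \<Rightarrow> bool" where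
  "coupled_hermitian_einstein X G B P h \<theta> g z \<longleftrightarrow>
    (\<forall>c s. c \<in> atlas X \<and> reduced_section X G P h s \<longrightarrow>
      (\<forall>p \<in> snd c ` (fst c \<inter> fst s).
        let \<omega> = omega (g c) p; F = curv_form G (\<theta> s c) p; n = CARD('n) in
        (\<forall>vs. length vs = 2 * n \<longrightarrow>
           wedge (\<lambda>\<xi> r. r *\<^sub>R \<xi>) 2 (2 * (n - 1)) F (wedge_power \<omega> (n - 1)) vs
           = (wedge_power \<omega> n vs / real n) *\<^sub>R z) \<and>
        (\<forall>v w. complex_of_real (bismut_ricci (g c) p v w) + B z (F [v, w]) = 0) \<and>
        (\<forall>vs. length vs = 4 \<longrightarrow> ext_d (dc_omega (g c)) p vs + wedge B 2 2 F F vs = 0)))"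

end

theory Submission
  imports Defs "HOL-Complex_Analysis.Cauchy_Integral_Formula" "HOL-Combinatorics.Multiset_Permutations"
begin

text \<open>
  All three equations are traces of Bianchi identities for the Bismut connection \<open>\<nabla>\<^sup>B\<close>.  Its advantage over
  the Levi-Civita connection is that it preserves both \<open>g\<close> and \<open>J\<close>, its torsion being \<open>H = - d\<^sup>c \<omega>\<close>.

  The first Bianchi identity of a metric connection with skew torsion \<open>H\<close> expresses the cyclic sum of the
  curvature over its last three arguments through \<open>\<nabla>\<^sup>B H\<close> and \<open>dH\<close> (lemma \<open>RB_Bianchi\<close>).  Its trace over
  the pairs \<open>J e, e\<close> relates the Bismut Ricci form \<open>\<rho>\<^sub>B\<close>, the Ricci tensor of \<open>\<nabla>\<^sup>B\<close>, the derivative of the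
  Lee form \<open>\<phi>\<close> and the trace of \<open>dH\<close> (lemma \<open>bismut_ricci_RicB\<close>).  By the equation for
  \<open>dd\<^sup>c \<omega>\<close> the latter is the trace of \<open>\<langle>F \<and> F\<rangle>\<close>; since \<open>F\<close> is of type \<open>(1, 1)\<close> with trace \<open>2 z\<close>, this trace
  consists of \<open>\<langle>z, F\<rangle>\<close> and of the contraction of \<open>F\<close> with itself.  The first part cancels \<open>\<rho>\<^sub>B\<close>, and
    \<open>Rc\<^sup>B (v, w) + (\<nabla>\<^sup>B\<^sub>v \<phi>) (w) + \<Sum>\<^sub>i \<langle>F (e\<^sub>i, v), F (e\<^sub>i, w)\<rangle> = 0\<close>
  remains (lemma \<open>RicB_equation\<close>).  As \<open>Rc\<^sup>B = Rc - d\<^sup>*H / 2 - H\<^sup>2 / 4\<close>, the symmetric part of this equation is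
  the first equation of the theorem, and the skew part is the second one (lemma
  \<open>coupled_equations_from_RicB\<close>).

  The third equation comes from \<open>d\<^sup>\<theta> F = 0\<close>, written with \<open>\<nabla>\<^sup>B\<close> and traced over \<open>e, J e\<close>: two terms give the
  divergence of \<open>F\<close>, the third one vanishes since the trace of \<open>F\<close> is the parallel section \<open>2 z\<close>, and the
  torsion contributes \<open>F (\<phi>\<^sup>\<sharp>, v)\<close> (lemma \<open>sum_DF\<close>).  The passage to the Levi-Civita divergence, which is
  \<open>- d\<^sup>\<theta>\<^sup>* F\<close>, accounts for \<open>* (F \<and> * H)\<close>.

  Three facts enter as preparations.  The curvature of the Chern connection is of type \<open>(1, 1)\<close>: near every
  point a holomorphic section differs from the given one by a gauge transformation, and in it the
  connection form is of type \<open>(1, 0)\<close> (lemma \<open>chern_curvature_type_11\<close>).  This uses the Lie algebra of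
  the group, whose bracket is obtained from the second-order expansion of the group law in a
  chart.  The equation \<open>F \<and> \<omega>\<^sup>n\<^sup>-\<^sup>1 = (z / n) \<omega>\<^sup>n\<close> means that \<open>F\<close> has trace \<open>2 z\<close> over \<open>e, J e\<close> (lemma
  \<open>hermitian_einstein_trace\<close>).  Finally, \<open>d\<^sup>*\<close> and \<open>d\<^sup>\<theta>\<^sup>*\<close>, defined by means of the Hodge star, are divergences
  (lemma \<open>star_d_star\<close>), because the volume form \<open>\<omega>\<^sup>n / n!\<close> is parallel.
\<close>

section \<open>Finite-dimensional normed spaces\<close>

text \<open>The bound makes the coefficients of a convergent sequence Cauchy; their limits are the coefficients
  of the limit.\<close>

lemma closed_span_of_coefficient_bound:
  fixes B :: "'v::real_normed_vector set"
  assumes fin: "finite B" and C: "C > 0"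
    and bd: "\<And>c. (\<Sum>b\<in>B. \<bar>c b\<bar>) \<le> C * norm (\<Sum>b\<in>B. c b *\<^sub>R b)"
  shows "closed (span B)"
  unfolding closed_sequential_limits
proof (intro allI impI, elim conjE)
  fix y l assume y: "\<forall>n. y n \<in> span B" and l: "y \<longlonglongrightarrow> l"
  have "\<exists>c. \<forall>n. y n = (\<Sum>b\<in>B. c n b *\<^sub>R b)"
    using y unfolding span_finite[OF fin] by (intro choice) (force simp: image_iff)
  then obtain c where c: "\<And>n. y n = (\<Sum>b\<in>B. c n b *\<^sub>R b)" by blast
  have diff: "\<bar>c m b - c n b\<bar> \<le> C * norm (y m - y n)" if "b \<in> B" for m n b
  proof -
    have "\<bar>c m b - c n b\<bar> \<le> (\<Sum>b\<in>B. \<bar>c m b - c n b\<bar>)"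
      using that fin by (intro member_le_sum) auto
    also have "\<dots> \<le> C * norm (\<Sum>b\<in>B. (c m b - c n b) *\<^sub>R b)" by (rule bd)
    also have "(\<Sum>b\<in>B. (c m b - c n b) *\<^sub>R b) = y m - y n"
      by (simp add: c scaleR_diff_left sum_subtractf)
    finally show ?thesis .
  qed
  have "Cauchy y" using l by (auto intro: convergent_Cauchy convergentI)
  have "\<exists>l. (\<lambda>n. c n b) \<longlonglongrightarrow> l" if b: "b \<in> B" for b
  proof -
    have "Cauchy (\<lambda>n. c n b)"
    proof (rule CauchyI)
      fix e :: real assume "e > 0"
      then obtain M where M: "\<And>m n. m \<ge> M \<Longrightarrow> n \<ge> M \<Longrightarrow> norm (y m - y n) < e / C"
        using CauchyD[OF \<open>Cauchy y\<close>, of "e / C"] C by auto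
      have "norm (c m b - c n b) < e" if "m \<ge> M" "n \<ge> M" for m n
        using diff[OF b, of m n] M[OF that] C
        by (simp add: pos_less_divide_eq mult.commute)
      then show "\<exists>M. \<forall>m\<ge>M. \<forall>n\<ge>M. norm (c m b - c n b) < e" by blast
    qed
    then show ?thesis using real_Cauchy_convergent convergent_def by blast
  qed
  then obtain k where k: "\<And>b. b \<in> B \<Longrightarrow> (\<lambda>n. c n b) \<longlonglongrightarrow> k b" by metis
  have "(\<lambda>n. \<Sum>b\<in>B. c n b *\<^sub>R b) \<longlonglongrightarrow> (\<Sum>b\<in>B. k b *\<^sub>R b)"
    by (intro tendsto_sum tendsto_scaleR k tendsto_const)
  then have "l = (\<Sum>b\<in>B. k b *\<^sub>R b)"
    using l LIMSEQ_unique unfolding c[symmetric] by blast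
  then show "l \<in> span B" by (simp add: span_sum span_scale span_base)
qed

text \<open>Equivalence of norms, by induction: a new vector has positive distance \<open>d\<close> to the closed span of
  the previous ones, and \<open>d\<close> controls its coefficient.\<close>

lemma independent_coefficient_bound:
  fixes B :: "'v::real_normed_vector set"
  assumes "finite B" "independent B"
  shows "\<exists>C>0. \<forall>c. (\<Sum>b\<in>B. \<bar>c b\<bar>) \<le> C * norm (\<Sum>b\<in>B. c b *\<^sub>R b)"
  using assms
proof (induction B rule: finite_induct)
  case empty
  show ?case by (intro exI[of _ 1]) auto
next
  case (insert x B)
  have ind: "independent B" and x: "x \<notin> span B"
    using insert.prems insert.hyps by (auto simp: independent_insert)
  from insert.IH[OF ind] obtain C where C: "C > 0"
    and bd: "\<And>c. (\<Sum>b\<in>B. \<bar>c b\<bar>) \<le> C * norm (\<Sum>b\<in>B. c b *\<^sub>R b)" by blast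
  have "closed (span B)" by (rule closed_span_of_coefficient_bound[OF insert.hyps(1) C bd])
  then have "open (- span B)" by (simp add: open_Compl)
  with x obtain d where d: "d > 0" "ball x d \<subseteq> - span B"
    unfolding open_contains_ball by blast
  have far: "d \<le> norm (x - y)" if "y \<in> span B" for y
    using d that by (force simp: ball_def dist_norm not_less)
  define C' where "C' = 1 / d + C * (1 + norm x / d)"
  have "(\<Sum>b\<in>insert x B. \<bar>c b\<bar>) \<le> C' * norm (\<Sum>b\<in>insert x B. c b *\<^sub>R b)" for c
  proof -
    define a y where "a = c x" and "y = (\<Sum>b\<in>B. c b *\<^sub>R b)"
    have ysp: "y \<in> span B" unfolding y_def by (simp add: span_sum span_scale span_base)
    have tot: "(\<Sum>b\<in>insert x B. c b *\<^sub>R b) = a *\<^sub>R x + y"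
      using insert.hyps by (simp add: a_def y_def)
    have 1: "\<bar>a\<bar> * d \<le> norm (a *\<^sub>R x + y)"
    proof (cases "a = 0")
      case False
      have "d \<le> norm (x - (- (1 / a) *\<^sub>R y))" by (rule far) (intro span_scale ysp)
      then have "\<bar>a\<bar> * d \<le> norm (a *\<^sub>R (x + (1 / a) *\<^sub>R y))"
        by (simp add: mult_left_mono)
      then show ?thesis using False by (simp add: scaleR_add_right)
    qed auto
    then have a: "\<bar>a\<bar> \<le> norm (a *\<^sub>R x + y) / d" using d by (simp add: pos_le_divide_eq)
    have "norm y = norm ((a *\<^sub>R x + y) - a *\<^sub>R x)" by simp
    also have "\<dots> \<le> norm (a *\<^sub>R x + y) + \<bar>a\<bar> * norm x"
      using norm_triangle_ineq4[of "a *\<^sub>R x + y" "a *\<^sub>R x"] by simp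
    also have "\<dots> \<le> norm (a *\<^sub>R x + y) + norm (a *\<^sub>R x + y) / d * norm x"
      using a by (intro add_left_mono mult_right_mono) auto
    finally have y: "norm y \<le> norm (a *\<^sub>R x + y) * (1 + norm x / d)"
      by (simp add: algebra_simps)
    have "(\<Sum>b\<in>insert x B. \<bar>c b\<bar>) \<le> \<bar>a\<bar> + C * norm y"
      using bd[of c] insert.hyps by (simp add: a_def y_def)
    also have "\<dots> \<le> norm (a *\<^sub>R x + y) / d + C * (norm (a *\<^sub>R x + y) * (1 + norm x / d))"
      using a y C by (intro add_mono mult_left_mono) auto
    also have "\<dots> = C' * norm (a *\<^sub>R x + y)" by (simp add: C'_def algebra_simps)
    finally show ?thesis unfolding tot .
  qed
  moreover have "C' > 0" unfolding C'_def using d C by (intro add_pos_nonneg) auto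
  ultimately show ?case by blast
qed

text \<open>Model spaces are normed spaces with a finite spanning set.  Continuous coordinates reduce calculus
  on them to finite sums.\<close>

lemma finite_dimensional_coordinates:
  assumes "finite_dimensional TYPE('v::real_normed_vector)"
  obtains B :: "'v::real_normed_vector set" and \<phi> :: "'v \<Rightarrow> 'v \<Rightarrow> real"
  where "finite B" "\<And>b. bounded_linear (\<phi> b)" "\<And>v. v = (\<Sum>b\<in>B. \<phi> b v *\<^sub>R b)"
proof -
  from assms obtain S :: "'v set" where S: "finite S" "span S = UNIV"
    unfolding finite_dimensional_def by blast
  obtain B where B: "B \<subseteq> S" "independent B" "S \<subseteq> span B"
    by (rule maximal_independent_subset)
  have fin: "finite B" using B(1) S(1) by (rule finite_subset)
  have sp: "span B = UNIV"
    by (metis B(3) S(2) UNIV_eq_I span_minimal subspace_span subset_UNIV subset_antisym)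
  define \<phi> where "\<phi> b v = representation B v b" for b v
  have rep: "v = (\<Sum>b\<in>B. \<phi> b v *\<^sub>R b)" for v
    using sum_representation_eq[OF B(2), of v B] fin sp by (simp add: \<phi>_def)
  obtain C where C: "C > 0" "\<And>c. (\<Sum>b\<in>B. \<bar>c b\<bar>) \<le> C * norm (\<Sum>b\<in>B. c b *\<^sub>R b)"
    using independent_coefficient_bound[OF fin B(2)] by blast
  have "bounded_linear (\<phi> b)" for b
  proof (rule bounded_linear_intro[where K = C])
    fix x y :: 'v and r :: real
    show "\<phi> b (x + y) = \<phi> b x + \<phi> b y" "\<phi> b (r *\<^sub>R x) = r *\<^sub>R \<phi> b x"
      using sp by (simp_all add: \<phi>_def representation_add[OF B(2)] representation_scale[OF B(2)])
    show "norm (\<phi> b x) \<le> norm x * C"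
    proof (cases "b \<in> B")
      case True
      have "\<bar>\<phi> b x\<bar> \<le> (\<Sum>b\<in>B. \<bar>\<phi> b x\<bar>)" using True fin by (intro member_le_sum) auto
      also have "\<dots> \<le> C * norm (\<Sum>b\<in>B. \<phi> b x *\<^sub>R b)" by (rule C)
      finally show ?thesis using rep[of x] by (simp add: mult.commute)
    next
      case False
      then have "\<phi> b x = 0" unfolding \<phi>_def using representation_ne_zero by blast
      then show ?thesis using C by simp
    qed
  qed
  then show thesis using that fin rep by blast
qed

lemma linear_imp_bounded_linear:
  fixes f :: "'v::real_normed_vector \<Rightarrow> 'b::real_normed_vector"
  assumes "finite_dimensional TYPE('v)" and f: "linear f"
  shows "bounded_linear f"
proof -
  obtain B :: "'v set" and \<phi> where B: "finite B" "\<And>b. bounded_linear (\<phi> b)"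
    "\<And>v. v = (\<Sum>b\<in>B. \<phi> b v *\<^sub>R b)"
    using finite_dimensional_coordinates[OF assms(1)] by blast
  have "f v = (\<Sum>b\<in>B. \<phi> b v *\<^sub>R f b)" for v
    by (subst B(3)[of v]) (simp add: linear_sum[OF f] linear_scale[OF f])
  then have "f = (\<lambda>v. \<Sum>b\<in>B. \<phi> b v *\<^sub>R f b)" by blast
  moreover have "bounded_linear (\<lambda>v. \<Sum>b\<in>B. \<phi> b v *\<^sub>R f b)"
    by (intro bounded_linear_sum bounded_linear_scaleR_const B)
  ultimately show ?thesis by simp
qed

lemma closed_subspace_finite_dimensional:
  fixes S :: "'v::real_normed_vector set"
  assumes "finite_dimensional TYPE('v)" and S: "subspace S"
  shows "closed S"
proof -
  from assms(1) obtain T :: "'v set" where T: "finite T" "span T = UNIV"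
    unfolding finite_dimensional_def by blast
  obtain B where B: "B \<subseteq> S" "independent B" "S \<subseteq> span B"
    by (rule maximal_independent_subset)
  have fin: "finite B"
    using independent_span_bound[OF T(1) B(2)] T(2) by auto
  have "span B = S" using B S by (metis span_minimal subset_antisym)
  moreover obtain C where "C > 0" "\<And>c. (\<Sum>b\<in>B. \<bar>c b\<bar>) \<le> C * norm (\<Sum>b\<in>B. c b *\<^sub>R b)"
    using independent_coefficient_bound[OF fin B(2)] by blast
  ultimately show ?thesis using closed_span_of_coefficient_bound[OF fin] by metis
qed

lemma finite_dimensional_euclidean: "finite_dimensional TYPE('a::euclidean_space)"
  unfolding finite_dimensional_def using span_Basis finite_Basis by blast

section \<open>Derivatives\<close>

lemma frechet_derivative_eq:
  "(f has_derivative D) (at x) \<Longrightarrow> frechet_derivative f (at x) = D"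
  by (metis frechet_derivative_at)

lemma has_derivative_cong_eventually:
  assumes "eventually (\<lambda>y. f y = g y) (nhds x)"
  shows "(f has_derivative D) (at x) \<longleftrightarrow> (g has_derivative D) (at x)"
proof -
  have "(g has_derivative D) (at x)" if "(f has_derivative D) (at x)"
    "eventually (\<lambda>y. f y = g y) (nhds x)" for f g :: "'a \<Rightarrow> 'b"
  proof -
    from that(2) obtain S where "open S" "x \<in> S" "\<And>y. y \<in> S \<Longrightarrow> f y = g y"
      unfolding eventually_nhds by blast
    then show ?thesis using has_derivative_transform_within_open[OF that(1)] by blast
  qed
  from this[of f g] this[of g f] assms show ?thesis by (auto simp: eq_commute)
qed

lemma has_derivative_transform_nhds:
  assumes "(f has_derivative D) (at x)" "eventually (\<lambda>y. f y = g y) (nhds x)"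
  shows "(g has_derivative D) (at x)"
  using assms has_derivative_cong_eventually[OF assms(2)] by simp

text \<open>A product rule in which the linear map is only known to be differentiable vector by vector;
  in finite dimension that suffices.\<close>

lemma has_derivative_linear_family:
  fixes L :: "'x::real_normed_vector \<Rightarrow> 'v::real_normed_vector \<Rightarrow> 'b::real_normed_vector"
  assumes fd: "finite_dimensional TYPE('v)"
    and L: "\<And>v. ((\<lambda>y. L y v) has_derivative (\<lambda>h. L' h v)) (at x)"
    and lin: "eventually (\<lambda>y. linear (L y)) (nhds x)"
    and w: "(w has_derivative w') (at x)"
  shows "((\<lambda>y. L y (w y)) has_derivative (\<lambda>h. L' h (w x) + L x (w' h))) (at x)"
proof -
  obtain B :: "'v set" and \<phi> where B: "finite B" "\<And>b. bounded_linear (\<phi> b)"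
    "\<And>v. v = (\<Sum>b\<in>B. \<phi> b v *\<^sub>R b)"
    using finite_dimensional_coordinates[OF fd] by blast
  have linx: "linear (L x)" using lin by (rule eventually_nhds_x_imp_x)
  have exp: "L y v = (\<Sum>b\<in>B. \<phi> b v *\<^sub>R L y b)" if "linear (L y)" for y v
    by (subst B(3)[of v]) (simp add: linear_sum[OF that] linear_scale[OF that])
  have L'exp: "L' h v = (\<Sum>b\<in>B. \<phi> b v *\<^sub>R L' h b)" for h v
  proof -
    have "((\<lambda>y. \<Sum>b\<in>B. \<phi> b v *\<^sub>R L y b) has_derivative (\<lambda>h. \<Sum>b\<in>B. \<phi> b v *\<^sub>R L' h b)) (at x)"
      by (intro has_derivative_sum has_derivative_scaleR_right L)
    moreover have "eventually (\<lambda>y. (\<Sum>b\<in>B. \<phi> b v *\<^sub>R L y b) = L y v) (nhds x)"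
      using lin by eventually_elim (simp flip: exp)
    ultimately have "((\<lambda>y. L y v) has_derivative (\<lambda>h. \<Sum>b\<in>B. \<phi> b v *\<^sub>R L' h b)) (at x)"
      by (rule has_derivative_transform_nhds)
    from has_derivative_unique[OF this L] show ?thesis by metis
  qed
  have 1: "((\<lambda>y. \<Sum>b\<in>B. \<phi> b (w y) *\<^sub>R L y b) has_derivative
      (\<lambda>h. \<Sum>b\<in>B. \<phi> b (w x) *\<^sub>R L' h b + \<phi> b (w' h) *\<^sub>R L x b)) (at x)"
    by (intro has_derivative_sum has_derivative_scaleR L
          bounded_linear.has_derivative[OF B(2) w])
  have 2: "(\<Sum>b\<in>B. \<phi> b (w x) *\<^sub>R L' h b + \<phi> b (w' h) *\<^sub>R L x b)
      = L' h (w x) + L x (w' h)" for h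
    by (simp only: sum.distrib flip: L'exp exp[OF linx])
  have 3: "eventually (\<lambda>y. (\<Sum>b\<in>B. \<phi> b (w y) *\<^sub>R L y b) = L y (w y)) (nhds x)"
    using lin by eventually_elim (simp flip: exp)
  from has_derivative_transform_nhds[OF 1 3] show ?thesis by (simp only: 2)
qed

text \<open>Young's theorem, for a map which is twice differentiable at one point only: by the mean value
  inequality the second difference over a parallelogram with sides \<open>t v\<close> and \<open>t w\<close> is
  \<open>t\<^sup>2\<close> times the second derivative, up to an error \<open>o(t\<^sup>2)\<close>, and it is symmetric in \<open>v\<close> and \<open>w\<close>.\<close>

lemma second_difference_tendsto:
  fixes f :: "'a::real_normed_vector \<Rightarrow> 'b::real_normed_vector"
  assumes S: "open S" "x \<in> S" and diff: "\<And>y. y \<in> S \<Longrightarrow> f differentiable (at y)"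
    and D: "((\<lambda>y. frechet_derivative f (at y) v) has_derivative D) (at x)"
    and e: "e > 0"
  shows "\<exists>d>0. \<forall>t. 0 < t \<and> t < d \<longrightarrow>
    norm (f (x + t *\<^sub>R v + t *\<^sub>R w) - f (x + t *\<^sub>R v) - f (x + t *\<^sub>R w) + f x - t\<^sup>2 *\<^sub>R D w) \<le> e * t\<^sup>2"
proof -
  define N where "N = norm v + norm w + 1"
  have N: "N > 0" unfolding N_def by (simp add: add_nonneg_pos)
  define e' where "e' = e / (2 * N)"
  have e': "e' > 0" using e N by (simp add: e'_def)
  obtain r where r: "r > 0" "ball x r \<subseteq> S" using S open_contains_ball by blast
  from D obtain d1 where d1: "d1 > 0" and D1: "\<And>y. norm (y - x) < d1 \<Longrightarrow>
     norm (frechet_derivative f (at y) v - frechet_derivative f (at x) v - D (y - x)) \<le> e' * norm (y - x)"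
    using e' unfolding has_derivative_at_alt by blast
  interpret D: bounded_linear D using D by (rule has_derivative_bounded_linear)
  define d where "d = min r d1 / N"
  have "d > 0" using r d1 N by (simp add: d_def)
  moreover have "norm (f (x + t *\<^sub>R v + t *\<^sub>R w) - f (x + t *\<^sub>R v) - f (x + t *\<^sub>R w) + f x - t\<^sup>2 *\<^sub>R D w) \<le> e * t\<^sup>2"
    if t: "0 < t" "t < d" for t
  proof -
    have tN: "t * N < r" "t * N < d1" using t(2) N by (simp_all add: d_def pos_less_divide_eq)
    have small: "norm (s *\<^sub>R v + u *\<^sub>R w) \<le> t * N" if "0 \<le> s" "s \<le> t" "0 \<le> u" "u \<le> t" for s u
    proof -
      have "norm (s *\<^sub>R v + u *\<^sub>R w) \<le> s * norm v + u * norm w"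
        using norm_triangle_ineq[of "s *\<^sub>R v" "u *\<^sub>R w"] that by simp
      also have "\<dots> \<le> t * norm v + t * norm w" using that by (intro add_mono mult_right_mono) auto
      also have "\<dots> \<le> t * N" using t by (simp add: N_def algebra_simps)
      finally show ?thesis .
    qed
    \<comment> \<open>The difference in the direction \<open>w\<close>, moved along \<open>v\<close>, minus its expected value.\<close>
    define \<psi> where "\<psi> s = f (x + s *\<^sub>R v + t *\<^sub>R w) - f (x + s *\<^sub>R v) - (s * t) *\<^sub>R D w" for s
    have der: "(\<psi> has_derivative (\<lambda>h. h *\<^sub>R (frechet_derivative f (at (x + s *\<^sub>R v + t *\<^sub>R w)) v
        - frechet_derivative f (at (x + s *\<^sub>R v)) v - t *\<^sub>R D w))) (at s within {0..t})"
      if s: "s \<in> {0..t}" for s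
    proof -
      have fd: "(f has_derivative frechet_derivative f (at (x + s *\<^sub>R v + u *\<^sub>R w))) (at (x + s *\<^sub>R v + u *\<^sub>R w))"
        if "0 \<le> u" "u \<le> t" for u
      proof -
        have "dist x (x + s *\<^sub>R v + u *\<^sub>R w) = norm (s *\<^sub>R v + u *\<^sub>R w)"
          by (metis add.assoc add_diff_cancel_left' dist_norm dist_commute)
        then have "dist x (x + s *\<^sub>R v + u *\<^sub>R w) < r"
          using small[of s u] s that tN by auto
        then have "x + s *\<^sub>R v + u *\<^sub>R w \<in> S" using r by auto
        then show ?thesis using diff frechet_derivative_works by blast
      qed
      have lin: "((\<lambda>s. x + s *\<^sub>R v + u *\<^sub>R w) has_derivative (\<lambda>h. h *\<^sub>R v)) (at s within {0..t})" for u
        by (auto intro!: derivative_eq_intros)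
      have 1: "((\<lambda>s. f (x + s *\<^sub>R v + u *\<^sub>R w)) has_derivative
          (\<lambda>h. h *\<^sub>R frechet_derivative f (at (x + s *\<^sub>R v + u *\<^sub>R w)) v)) (at s within {0..t})"
        if "0 \<le> u" "u \<le> t" for u
        using has_derivative_compose[OF lin fd[OF that]]
          linear_scale[OF has_derivative_linear[OF fd[OF that]]] by simp
      show ?thesis unfolding \<psi>_def
        using t 1[of t] 1[of 0]
        by (auto intro!: derivative_eq_intros simp: algebra_simps scaleR_diff_right)
    qed
    have bound: "onorm (\<lambda>h::real. h *\<^sub>R (frechet_derivative f (at (x + s *\<^sub>R v + t *\<^sub>R w)) v
        - frechet_derivative f (at (x + s *\<^sub>R v)) v - t *\<^sub>R D w)) \<le> e * t" if s: "s \<in> {0..t}" for s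
    proof (rule onorm_le)
      fix h :: real
      let ?E = "\<lambda>u. frechet_derivative f (at (x + s *\<^sub>R v + u *\<^sub>R w)) v - frechet_derivative f (at x) v
         - D (s *\<^sub>R v + u *\<^sub>R w)"
      have E: "norm (?E u) \<le> e' * (t * N)" if "0 \<le> u" "u \<le> t" for u
      proof -
        have sm: "norm (s *\<^sub>R v + u *\<^sub>R w) \<le> t * N" using small that s by auto
        have "norm (?E u) \<le> e' * norm (s *\<^sub>R v + u *\<^sub>R w)"
          using D1[of "x + s *\<^sub>R v + u *\<^sub>R w"] sm tN by (simp add: add.assoc)
        also have "\<dots> \<le> e' * (t * N)" using sm e' by (intro mult_left_mono) auto
        finally show ?thesis .
      qed
      have eq: "frechet_derivative f (at (x + s *\<^sub>R v + t *\<^sub>R w)) v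
        - frechet_derivative f (at (x + s *\<^sub>R v)) v - t *\<^sub>R D w = ?E t - ?E 0"
        by (simp add: D.add D.scaleR)
      have "norm (?E t - ?E 0) \<le> norm (?E t) + norm (?E 0)" by (rule norm_triangle_ineq4)
      also have "\<dots> \<le> e' * (t * N) + e' * (t * N)" using t by (intro add_mono E) auto
      also have "\<dots> = e * t" using N by (simp add: e'_def field_simps)
      finally have "norm (?E t - ?E 0) * \<bar>h\<bar> \<le> e * t * \<bar>h\<bar>"
        by (rule mult_right_mono) simp
      then show "norm (h *\<^sub>R (frechet_derivative f (at (x + s *\<^sub>R v + t *\<^sub>R w)) v
        - frechet_derivative f (at (x + s *\<^sub>R v)) v - t *\<^sub>R D w)) \<le> e * t * norm h"
        unfolding eq by (simp only: norm_scaleR real_norm_def mult.commute)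
    qed
    have "norm (\<psi> t - \<psi> 0) \<le> e * t * norm (t - 0)"
      using t by (intro differentiable_bound[OF _ der bound]) auto
    then show ?thesis using t by (simp add: \<psi>_def power2_eq_square algebra_simps)
  qed
  ultimately show ?thesis by blast
qed

lemma second_derivative_symmetric:
  fixes f :: "'a::real_normed_vector \<Rightarrow> 'b::real_normed_vector"
  assumes S: "open S" "x \<in> S" and diff: "\<And>y. y \<in> S \<Longrightarrow> f differentiable (at y)"
    and v: "((\<lambda>y. frechet_derivative f (at y) v) has_derivative Dv) (at x)"
    and w: "((\<lambda>y. frechet_derivative f (at y) w) has_derivative Dw) (at x)"
  shows "Dv w = Dw v"
proof -
  have "norm (Dv w - Dw v) \<le> e" if e: "e > 0" for e
  proof -
    obtain d1 where d1: "d1 > 0" "\<And>t. 0 < t \<and> t < d1 \<Longrightarrow>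
      norm (f (x + t *\<^sub>R v + t *\<^sub>R w) - f (x + t *\<^sub>R v) - f (x + t *\<^sub>R w) + f x - t\<^sup>2 *\<^sub>R Dv w) \<le> e/2 * t\<^sup>2"
      using second_difference_tendsto[OF S diff v, where e = "e/2" and w = w] e by auto
    obtain d2 where d2: "d2 > 0" "\<And>t. 0 < t \<and> t < d2 \<Longrightarrow>
      norm (f (x + t *\<^sub>R w + t *\<^sub>R v) - f (x + t *\<^sub>R w) - f (x + t *\<^sub>R v) + f x - t\<^sup>2 *\<^sub>R Dw v) \<le> e/2 * t\<^sup>2"
      using second_difference_tendsto[OF S diff w, where e = "e/2" and w = v] e by auto
    define t where "t = min d1 d2 / 2"
    have t: "0 < t" "t < d1" "t < d2" using d1(1) d2(1) by (auto simp: t_def)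
    define Q where "Q = f (x + t *\<^sub>R v + t *\<^sub>R w) - f (x + t *\<^sub>R v) - f (x + t *\<^sub>R w) + f x"
    have Q1: "norm (Q - t\<^sup>2 *\<^sub>R Dv w) \<le> e/2 * t\<^sup>2" using d1(2) t unfolding Q_def by blast
    have "Q = f (x + t *\<^sub>R w + t *\<^sub>R v) - f (x + t *\<^sub>R w) - f (x + t *\<^sub>R v) + f x"
      unfolding Q_def by (simp add: add.assoc add.commute[of "t *\<^sub>R v" "t *\<^sub>R w"])
    then have Q2: "norm (Q - t\<^sup>2 *\<^sub>R Dw v) \<le> e/2 * t\<^sup>2" using d2(2) t by metis
    have "t\<^sup>2 * norm (Dv w - Dw v) = norm (t\<^sup>2 *\<^sub>R (Dv w - Dw v))" by simp
    also have "t\<^sup>2 *\<^sub>R (Dv w - Dw v) = (Q - t\<^sup>2 *\<^sub>R Dw v) - (Q - t\<^sup>2 *\<^sub>R Dv w)"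
      by (simp add: scaleR_diff_right)
    also have "norm \<dots> \<le> norm (Q - t\<^sup>2 *\<^sub>R Dw v) + norm (Q - t\<^sup>2 *\<^sub>R Dv w)"
      by (rule norm_triangle_ineq4)
    also have "\<dots> \<le> e/2 * t\<^sup>2 + e/2 * t\<^sup>2" by (intro add_mono Q1 Q2)
    also have "\<dots> = t\<^sup>2 * e" by (simp add: field_simps)
    finally show ?thesis using t by simp
  qed
  then have "norm (Dv w - Dw v) \<le> 0"
    by (meson dense_ge)
  then show ?thesis by simp
qed

lemma smooth_on_differentiable:
  assumes "smooth_on S f" "x \<in> S" shows "f differentiable (at x)"
proof -
  have "Ck_on (Suc 0) S f" using assms unfolding smooth_on_def by blast
  then show ?thesis using assms by simp
qed

lemma smooth_on_frechet_derivative: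
  assumes "smooth_on S f" shows "smooth_on S (\<lambda>x. frechet_derivative f (at x) v)"
  unfolding smooth_on_def
proof
  fix k
  have "Ck_on (Suc k) S f" using assms unfolding smooth_on_def by blast
  then show "Ck_on k S (\<lambda>x. frechet_derivative f (at x) v)" by simp
qed

lemma smooth_on_subset:
  assumes "smooth_on S f" "T \<subseteq> S" shows "smooth_on T f"
proof -
  have "Ck_on k T f" if "Ck_on k S f" for k
    using that by (induction k arbitrary: f) (use assms(2) continuous_on_subset in auto)
  then show ?thesis using assms unfolding smooth_on_def by blast
qed

section \<open>Holomorphic maps are smooth\<close>

text \<open>\<open>complex_line I x v\<close> parametrizes the complex line through \<open>x\<close> in direction \<open>v\<close>.\<close>

definition complex_line :: "('a::real_normed_vector \<Rightarrow> 'a) \<Rightarrow> 'a \<Rightarrow> 'a \<Rightarrow> complex \<Rightarrow> 'a" where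
  "complex_line I x v \<zeta> = x + Re \<zeta> *\<^sub>R v + Im \<zeta> *\<^sub>R I v"

lemma norm_complex_line:
  assumes "\<And>v. norm (I v) \<le> K * norm v" "K \<ge> 0"
  shows "norm (complex_line I x v \<zeta> - x) \<le> cmod \<zeta> * ((1 + K) * norm v)"
proof -
  have "norm (complex_line I x v \<zeta> - x) \<le> \<bar>Re \<zeta>\<bar> * norm v + \<bar>Im \<zeta>\<bar> * norm (I v)"
    unfolding complex_line_def
    using norm_triangle_ineq[of "Re \<zeta> *\<^sub>R v" "Im \<zeta> *\<^sub>R I v"] by (simp add: add.assoc)
  also have "\<dots> \<le> cmod \<zeta> * norm v + cmod \<zeta> * (K * norm v)"
    using assms abs_Re_le_cmod[of \<zeta>] abs_Im_le_cmod[of \<zeta>]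
    by (intro add_mono mult_mono mult_right_mono) auto
  finally show ?thesis by (simp add: algebra_simps)
qed

lemma holomorphic_along_complex_line:
  fixes g :: "'a::real_normed_vector \<Rightarrow> complex"
  assumes "(g has_derivative D) (at (complex_line I x v \<zeta>))" "\<And>v. D (I v) = \<i> * D v"
  shows "((g \<circ> complex_line I x v) has_field_derivative D v) (at \<zeta>)"
proof -
  have line: "(complex_line I x v has_derivative (\<lambda>k. Re k *\<^sub>R v + Im k *\<^sub>R I v)) (at \<zeta>)"
    unfolding complex_line_def by (auto intro!: derivative_eq_intros)
  have lin: "linear D" using assms(1) by (rule has_derivative_linear)
  have "D (Re k *\<^sub>R v + Im k *\<^sub>R I v) = D v * k" for k
    unfolding linear_add[OF lin] linear_scale[OF lin] assms(2)
    by (simp add: complex_eq_iff scaleR_conv_of_real algebra_simps)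
  then show ?thesis
    using diff_chain_at[OF line assms(1)] unfolding has_field_derivative_def
    by (simp add: o_def)
qed

text \<open>The inequality of Cauchy on a disc in the complex line through \<open>x\<close> with direction \<open>v\<close>; the factor
  \<open>1 + K\<close> bounds the embedding of the disc, and the factor 2 keeps it inside the open ball.\<close>

lemma Cauchy_derivative_estimate:
  fixes g :: "'a::real_normed_vector \<Rightarrow> complex"
  assumes K: "\<And>v. norm (I v) \<le> K * norm v" "K \<ge> 0" and r: "r > 0"
    and g: "\<And>y. y \<in> ball x r \<Longrightarrow> (g has_derivative D y) (at y)"
    and D: "\<And>y v. y \<in> ball x r \<Longrightarrow> D y (I v) = \<i> * D y v"
    and M: "\<And>y. y \<in> ball x r \<Longrightarrow> cmod (g y) \<le> M"
  shows "cmod (D x v) \<le> 2 * (1 + K) * M / r * norm v"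
proof (cases "v = 0")
  case True
  have "linear (D x)" using g[of x] r has_derivative_linear by auto
  then show ?thesis using True linear_0 by fastforce
next
  case False
  define c where "c = (1 + K) * norm v"
  have c: "c > 0" using K False by (simp add: c_def)
  define \<rho> where "\<rho> = r / (2 * c)"
  have \<rho>: "\<rho> > 0" using r c by (simp add: \<rho>_def)
  have inb: "complex_line I x v \<zeta> \<in> ball x r" if "cmod \<zeta> \<le> \<rho>" for \<zeta>
  proof -
    have "norm (complex_line I x v \<zeta> - x) \<le> \<rho> * c" unfolding c_def
      by (rule order_trans[OF norm_complex_line[OF K] mult_right_mono]) (use that K in auto)
    also have "\<dots> = r / 2" using c by (simp add: \<rho>_def)
    also have "\<dots> < r" using r by simp
    finally show ?thesis by (simp add: dist_norm norm_minus_commute)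
  qed
  let ?G = "g \<circ> complex_line I x v"
  have der: "(?G has_field_derivative D (complex_line I x v \<zeta>) v) (at \<zeta>)" if "cmod \<zeta> \<le> \<rho>" for \<zeta>
    by (rule holomorphic_along_complex_line[OF g[OF inb[OF that]] D[OF inb[OF that]]])
  have "?G holomorphic_on ball 0 \<rho>"
    unfolding holomorphic_on_open[OF open_ball] using der by (meson mem_ball_0 less_imp_le)
  moreover have "continuous_on (cball 0 \<rho>) ?G"
    by (intro continuous_at_imp_continuous_on ballI DERIV_isCont[OF der]) auto
  ultimately have "norm ((deriv ^^ 1) ?G 0) \<le> fact 1 * M / \<rho> ^ 1"
    using \<rho> M inb by (intro Cauchy_inequality) auto
  moreover have "deriv ?G 0 = D x v"
    using DERIV_imp_deriv[OF der[of 0]] \<rho> by (simp add: complex_line_def)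
  ultimately have "cmod (D x v) \<le> M / \<rho>" by simp
  also have "\<dots> = 2 * (1 + K) * M / r * norm v" by (simp add: \<rho>_def c_def)
  finally show ?thesis .
qed

text \<open>Taylor's formula on the disc of radius \<open>\<rho> / 2\<close>, the second derivative being bounded by the inequality
  of Cauchy on discs of radius \<open>\<rho> / 4\<close>; this yields the constant \<open>2 \<sqdot> 4\<^sup>2 = 32\<close>.\<close>

lemma difference_quotient_estimate:
  assumes hol: "G holomorphic_on ball 0 \<rho>" and \<rho>: "\<rho> > 0"
    and M: "\<And>\<zeta>. \<zeta> \<in> ball 0 \<rho> \<Longrightarrow> cmod (G \<zeta>) \<le> M"
    and t: "0 < t" "t < \<rho> / 2"
  shows "cmod ((G (of_real t) - G 0) / of_real t - deriv G 0) \<le> 32 * M / \<rho>\<^sup>2 * t"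
proof -
  have M0: "M \<ge> 0" using order_trans[OF norm_ge_zero M[of 0]] \<rho> by simp
  have "cmod (G (of_real t) - (\<Sum>i\<le>1. (deriv ^^ i) G 0 * (of_real t - 0) ^ i / fact i))
      \<le> (32 * M / \<rho>\<^sup>2) * cmod (of_real t - 0) ^ Suc 1 / fact 1"
  proof (rule complex_Taylor[where S = "ball 0 (\<rho>/2)" and f = "\<lambda>i. (deriv ^^ i) G", simplified funpow_0])
    show "((deriv ^^ i) G has_field_derivative (deriv ^^ Suc i) G x) (at x within ball 0 (\<rho>/2))"
      if "x \<in> ball 0 (\<rho>/2)" for i x
    proof -
      have "(deriv ^^ i) G holomorphic_on ball 0 \<rho>"
        using hol by (intro holomorphic_higher_deriv) auto
      moreover have "x \<in> ball 0 \<rho>" using that \<rho> unfolding mem_ball_0 by linarith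
      ultimately have "(deriv ^^ i) G field_differentiable at x"
        by (rule holomorphic_on_imp_differentiable_at[OF _ open_ball])
      then show ?thesis
        by (simp add: field_differentiable_derivI has_field_derivative_at_within)
    qed
    show "cmod ((deriv ^^ Suc 1) G x) \<le> 32 * M / \<rho>\<^sup>2" if x: "x \<in> ball 0 (\<rho>/2)" for x
    proof -
      have sub: "cball x (\<rho>/4) \<subseteq> ball 0 \<rho>"
      proof
        fix y assume "y \<in> cball x (\<rho>/4)"
        then have "dist x y \<le> \<rho>/4" by simp
        then show "y \<in> ball 0 \<rho>" using x dist_triangle[of 0 y x] \<rho> by simp
      qed
      have "norm ((deriv ^^ 2) G x) \<le> fact 2 * M / (\<rho>/4) ^ 2"
      proof (rule Cauchy_inequality)
        show "G holomorphic_on ball x (\<rho>/4)"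
          using hol sub ball_subset_cball by (meson holomorphic_on_subset order_trans)
        show "continuous_on (cball x (\<rho>/4)) G"
          using hol sub by (meson continuous_on_subset holomorphic_on_imp_continuous_on)
        show "norm (G y) \<le> M" if "norm (x - y) = \<rho>/4" for y
          using that sub M by (auto simp: dist_norm subset_iff)
      qed (use \<rho> in auto)
      then show ?thesis by (simp add: numeral_2_eq_2 power2_eq_square field_simps)
    qed
  qed (use t \<rho> in auto)
  then have *: "cmod (G (of_real t) - (G 0 + deriv G 0 * of_real t)) \<le> 32 * M / \<rho>\<^sup>2 * t\<^sup>2"
    using t by (simp add: numeral_2_eq_2)
  have "(G (of_real t) - G 0) / of_real t - deriv G 0
      = (G (of_real t) - (G 0 + deriv G 0 * of_real t)) / of_real t"
    using t by (simp add: field_simps)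
  also have "cmod \<dots> \<le> 32 * M / \<rho>\<^sup>2 * t\<^sup>2 / t"
    using divide_right_mono[OF *, of t] t unfolding norm_divide norm_of_real by simp
  also have "\<dots> = 32 * M / \<rho>\<^sup>2 * t" using t by (simp add: power2_eq_square)
  finally show ?thesis .
qed

text \<open>The difference quotients of \<open>g\<close> in a fixed direction are holomorphic and converge locally
  uniformly, with a rate; by the Cauchy estimate so do their derivatives.\<close>

lemma derivative_of_holomorphic_function:
  fixes g :: "'a::real_normed_vector \<Rightarrow> complex"
  assumes I: "bounded_linear I" and S: "open S" "x0 \<in> S"
    and g: "\<And>x. x \<in> S \<Longrightarrow> (g has_derivative D x) (at x)"
    and D: "\<And>x v. x \<in> S \<Longrightarrow> D x (I v) = \<i> * D x v"
  shows "\<exists>D2. ((\<lambda>x. D x v) has_derivative D2) (at x0) \<and> (\<forall>h. D2 (I h) = \<i> * D2 h)"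
proof (cases "v = 0")
  case True
  have "0 = D x v" if "x \<in> S" for x
    using True linear_0[OF has_derivative_linear[OF g[OF that]]] by simp
  moreover have "((\<lambda>x. 0::complex) has_derivative (\<lambda>h. 0)) (at x0)" by simp
  ultimately have "((\<lambda>x. D x v) has_derivative (\<lambda>h. 0)) (at x0)"
    using has_derivative_transform_within_open[OF _ S, of "\<lambda>x. 0" "\<lambda>h. 0" UNIV "\<lambda>x. D x v"] by simp
  then show ?thesis by (intro exI[of _ "\<lambda>h. 0"]) auto
next
  case False
  obtain K where K: "\<And>v. norm (I v) \<le> K * norm v" "K \<ge> 0"
    using bounded_linear.nonneg_bounded[OF I] by (metis mult.commute)
  define M where "M = cmod (g x0) + 1"
  have "isCont g x0" using g[OF S(2)] has_derivative_continuous by blast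
  then obtain d1 where d1: "d1 > 0" "\<And>y. dist y x0 < d1 \<Longrightarrow> dist (g y) (g x0) < 1"
    unfolding continuous_at_eps_delta by (metis zero_less_one)
  obtain d2 where d2: "d2 > 0" "ball x0 d2 \<subseteq> S" using S open_contains_ball by blast
  define d where "d = min d1 d2"
  have d: "d > 0" "ball x0 d \<subseteq> S" using d1 d2 by (auto simp: d_def)
  have gM: "cmod (g y) \<le> M" if "y \<in> ball x0 d" for y
    using d1(2)[of y] that norm_triangle_sub[of "g y" "g x0"]
    by (simp add: M_def d_def dist_commute dist_norm norm_minus_commute)
  define c where "c = (1 + K) * norm v"
  have c: "c > 0" using False K by (simp add: c_def)
  \<comment> \<open>Discs of this radius in lines through points of the half ball stay in the ball.\<close>
  define \<rho> where "\<rho> = d / (2 * c)"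
  have \<rho>: "\<rho> > 0" using d c by (simp add: \<rho>_def)
  have line: "complex_line I x v \<zeta> \<in> ball x0 d" if "x \<in> ball x0 (d/2)" "\<zeta> \<in> ball 0 \<rho>" for x \<zeta>
  proof -
    have "norm (complex_line I x v \<zeta> - x) \<le> cmod \<zeta> * c"
      unfolding c_def by (rule norm_complex_line[OF K])
    also have "\<dots> < \<rho> * c" using that(2) c by simp
    also have "\<dots> = d / 2" using c by (simp add: \<rho>_def)
    finally show ?thesis
      using that(1) dist_triangle[of x0 "complex_line I x v \<zeta>" x]
      by (simp add: dist_norm norm_minus_commute)
  qed
  define t where "t m = \<rho> / 2 / (real m + 2)" for m
  have t: "0 < t m" "t m < \<rho> / 2" "t m < \<rho>" for m
    using \<rho> by (auto simp: t_def field_simps add_pos_nonneg)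
  have "t = (\<lambda>m. \<rho> / 2 * inverse (real (Suc (Suc m))))"
    by (auto simp: t_def field_simps)
  then have t0: "t \<longlonglongrightarrow> 0"
    using tendsto_mult_left[OF LIMSEQ_Suc[OF LIMSEQ_inverse_real_of_nat], of "\<rho> / 2"] by simp
  have tv: "x + t m *\<^sub>R v \<in> ball x0 d" if "x \<in> ball x0 (d/2)" for x m
    using line[OF that, of "of_real (t m)"] t[of m] by (simp add: complex_line_def)
  have half: "x \<in> ball x0 d" if "x \<in> ball x0 (d/2)" for x using that d by auto
  define u where "u m x = (g (x + t m *\<^sub>R v) - g x) / of_real (t m)" for m x
  define du where "du m x h = (D (x + t m *\<^sub>R v) h - D x h) / of_real (t m)" for m x h
  define C where "C = 32 * M / \<rho>\<^sup>2"
  have close: "cmod (u m x - D x v) \<le> C * t m" if x: "x \<in> ball x0 (d/2)" for m x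
  proof -
    let ?G = "g \<circ> complex_line I x v"
    have der: "(?G has_field_derivative D (complex_line I x v \<zeta>) v) (at \<zeta>)" if "\<zeta> \<in> ball 0 \<rho>" for \<zeta>
      using line[OF x that] d(2)
      by (intro holomorphic_along_complex_line g D) auto
    have "?G holomorphic_on ball 0 \<rho>"
      unfolding holomorphic_on_open[OF open_ball] using der by blast
    from difference_quotient_estimate[OF this \<rho> _ t(1,2), of M m]
    have "cmod ((?G (of_real (t m)) - ?G 0) / of_real (t m) - deriv ?G 0) \<le> C * t m"
      unfolding C_def using gM line[OF x] by simp
    moreover have "deriv ?G 0 = D x v"
      using DERIV_imp_deriv[OF der[of 0]] \<rho> by (simp add: complex_line_def)
    ultimately show ?thesis by (simp add: u_def complex_line_def)
  qed
  have du: "(u m has_derivative du m x) (at x)" if x: "x \<in> ball x0 (d/2)" for m x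
  proof -
    have "((\<lambda>y. g (y + t m *\<^sub>R v)) has_derivative D (x + t m *\<^sub>R v)) (at x)"
    proof (rule has_derivative_compose[where f = "\<lambda>y. y + t m *\<^sub>R v" and f' = "\<lambda>h. h"])
      show "((\<lambda>y. y + t m *\<^sub>R v) has_derivative (\<lambda>h. h)) (at x)"
        by (auto intro!: derivative_eq_intros)
      show "(g has_derivative D (x + t m *\<^sub>R v)) (at (x + t m *\<^sub>R v))"
        using g tv[OF x] d(2) by blast
    qed
    moreover have "t m \<noteq> 0" using t(1)[of m] by simp
    ultimately show ?thesis unfolding u_def du_def using g[of x] half[OF x] d(2)
      by (auto intro!: derivative_eq_intros)
  qed
  have duI: "du m x (I h) = \<i> * du m x h" if "x \<in> ball x0 (d/2)" for m x h
    using D tv[OF that] half[OF that] d(2) by (simp add: du_def algebra_simps subset_iff)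
  define C2 where "C2 = 2 * (1 + K) * C / (d/4)"
  have cau: "cmod (du m x h - du n x h) \<le> C2 * (t m + t n) * norm h"
    if x: "x \<in> ball x0 (d/4)" for m n x h
  proof -
    have sub: "y \<in> ball x0 (d/2)" if "y \<in> ball x (d/4)" for y
      using x that dist_triangle[of x0 y x] by auto
    have "cmod (du m x h - du n x h) \<le> 2 * (1 + K) * (C * t m + C * t n) / (d/4) * norm h"
    proof (rule Cauchy_derivative_estimate[OF K, where g = "\<lambda>y. u m y - u n y" and D = "\<lambda>y h. du m y h - du n y h"])
      show "((\<lambda>y. u m y - u n y) has_derivative (\<lambda>h. du m y h - du n y h)) (at y)"
        if "y \<in> ball x (d/4)" for y
        using du[OF sub[OF that]] by (intro has_derivative_diff)
      show "du m y (I v) - du n y (I v) = \<i> * (du m y v - du n y v)" if "y \<in> ball x (d/4)" for y v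
        using duI[OF sub[OF that]] by (simp add: algebra_simps)
      show "cmod (u m y - u n y) \<le> C * t m + C * t n" if "y \<in> ball x (d/4)" for y
        using close[OF sub[OF that], of m] close[OF sub[OF that], of n]
          norm_triangle_ineq4[of "u m y - D y v" "u n y - D y v"] by simp
    qed (use d in auto)
    also have "\<dots> = C2 * (t m + t n) * norm h" by (simp add: C2_def algebra_simps)
    finally show ?thesis .
  qed
  have "M \<ge> 0" by (simp add: M_def)
  then have C2: "C2 \<ge> 0" using K d by (simp add: C2_def C_def)
  have "\<exists>l. (\<lambda>n. du n x h) \<longlonglongrightarrow> l" if x: "x \<in> ball x0 (d/4)" for x h
  proof -
    have "Cauchy (\<lambda>n. du n x h)"
    proof (rule CauchyI)
      fix e :: real assume e: "e > 0"
      have "(\<lambda>n. C2 * (t n + t n) * norm h) \<longlonglongrightarrow> C2 * (0 + 0) * norm h"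
        by (intro tendsto_intros t0)
      then have "\<forall>\<^sub>F n in sequentially. C2 * (t n + t n) * norm h < e"
        using e by (intro order_tendstoD(2)) auto
      then obtain N where N: "\<And>n. n \<ge> N \<Longrightarrow> C2 * (t n + t n) * norm h < e"
        unfolding eventually_sequentially by blast
      have mono: "t m \<le> t N" if "m \<ge> N" for m
        unfolding t_def using that \<rho> by (intro divide_left_mono) auto
      have "norm (du m x h - du n x h) < e" if "m \<ge> N" "n \<ge> N" for m n
      proof -
        have "norm (du m x h - du n x h) \<le> C2 * (t m + t n) * norm h" by (rule cau[OF x])
        also have "\<dots> \<le> C2 * (t N + t N) * norm h"
          using mono that C2 by (intro mult_right_mono mult_left_mono add_mono) auto
        finally show ?thesis using N[of N] by simp
      qed
      then show "\<exists>N. \<forall>m\<ge>N. \<forall>n\<ge>N. norm (du m x h - du n x h) < e" by blast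
    qed
    then show ?thesis using Cauchy_convergent convergent_def by blast
  qed
  then obtain g2 where g2: "\<And>x h. x \<in> ball x0 (d/4) \<Longrightarrow> (\<lambda>n. du n x h) \<longlonglongrightarrow> g2 x h" by metis
  have g2c: "cmod (du m x h - g2 x h) \<le> C2 * t m * norm h" if x: "x \<in> ball x0 (d/4)" for m x h
  proof (rule LIMSEQ_le)
    show "(\<lambda>n. cmod (du m x h - du n x h)) \<longlonglongrightarrow> cmod (du m x h - g2 x h)"
      by (intro tendsto_intros g2[OF x])
    have "(\<lambda>n. C2 * (t m + t n) * norm h) \<longlonglongrightarrow> C2 * (t m + 0) * norm h"
      by (intro tendsto_intros t0)
    then show "(\<lambda>n. C2 * (t m + t n) * norm h) \<longlonglongrightarrow> C2 * t m * norm h" by simp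
  qed (use cau[OF x] in blast)
  let ?B = "ball x0 (d/4)"
  have x0: "x0 \<in> ?B" using d by simp
  have "\<exists>G. \<forall>x\<in>?B. (\<lambda>n. u n x) \<longlonglongrightarrow> G x \<and> (G has_derivative g2 x) (at x within ?B)"
  proof (rule has_derivative_sequence)
    show "convex ?B" by simp
    show "(u n has_derivative du n x) (at x within ?B)" if "x \<in> ?B" for n x
      using du[of x n] that d by (auto intro: has_derivative_at_withinI)
    show "\<forall>\<^sub>F n in sequentially. \<forall>x\<in>?B. \<forall>h. norm (du n x h - g2 x h) \<le> e * norm h" if e: "e > 0" for e
    proof -
      have "(\<lambda>n. C2 * t n) \<longlonglongrightarrow> C2 * 0" by (intro tendsto_intros t0)
      then have "\<forall>\<^sub>F n in sequentially. C2 * t n < e" using e by (intro order_tendstoD(2)) auto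
      then show ?thesis
      proof eventually_elim
        case (elim n)
        show ?case using elim g2c[of _ n]
          by (meson less_imp_le mult_right_mono norm_ge_zero order_trans)
      qed
    qed
    show "x0 \<in> ?B" by (rule x0)
    show "(\<lambda>n. u n x0) \<longlonglongrightarrow> D x0 v"
    proof (rule LIM_zero_cancel, rule Lim_null_comparison)
      show "\<forall>\<^sub>F n in sequentially. norm (u n x0 - D x0 v) \<le> C * t n"
        using close[of x0] d by (intro always_eventually) auto
      show "(\<lambda>n. C * t n) \<longlonglongrightarrow> 0" using tendsto_mult_left[OF t0, of C] by simp
    qed
  qed
  then obtain G where G: "\<And>x. x \<in> ?B \<Longrightarrow> (\<lambda>n. u n x) \<longlonglongrightarrow> G x"
    "\<And>x. x \<in> ?B \<Longrightarrow> (G has_derivative g2 x) (at x within ?B)" by blast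
  have GD: "G x = D x v" if x: "x \<in> ?B" for x
  proof (rule LIMSEQ_unique[OF G(1)[OF x]], rule LIM_zero_cancel, rule Lim_null_comparison)
    show "\<forall>\<^sub>F n in sequentially. norm (u n x - D x v) \<le> C * t n"
      using close[of x] d x by (intro always_eventually) auto
    show "(\<lambda>n. C * t n) \<longlonglongrightarrow> 0" using tendsto_mult_left[OF t0, of C] by simp
  qed
  have "(G has_derivative g2 x0) (at x0)"
    using G(2)[OF x0] at_within_open[OF x0] by simp
  then have "((\<lambda>x. D x v) has_derivative g2 x0) (at x0)"
    by (rule has_derivative_transform_within_open[OF _ open_ball x0]) (rule GD)
  moreover have "g2 x0 (I h) = \<i> * g2 x0 h" for h
  proof (rule LIMSEQ_unique[OF g2[OF x0]])
    show "(\<lambda>n. du n x0 (I h)) \<longlonglongrightarrow> \<i> * g2 x0 h"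
      using tendsto_mult_left[OF g2[OF x0], of \<i> h] duI[of x0] d by simp
  qed
  ultimately show ?thesis by blast
qed

text \<open>The scalar case applies to \<open>w \<mapsto> \<phi>\<^sub>b w - \<i> \<phi>\<^sub>b (I2 w)\<close>, the complex linear functional whose real part is
  the coordinate \<open>\<phi>\<^sub>b\<close>.\<close>

lemma holo_on_frechet_derivative:
  fixes f :: "'a::real_normed_vector \<Rightarrow> 'b::real_normed_vector"
  assumes I1: "bounded_linear I1" and fd: "finite_dimensional TYPE('b)"
    and I2: "linear I2" "\<And>v. I2 (I2 v) = - v"
    and S: "open S" and f: "holo_on I1 I2 S f"
  shows "holo_on I1 I2 S (\<lambda>x. frechet_derivative f (at x) v)"
  unfolding holo_on_def
proof
  fix x0 assume x0: "x0 \<in> S"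
  obtain B :: "'b set" and \<phi> where B: "finite B" "\<And>b. bounded_linear (\<phi> b)"
    "\<And>v. v = (\<Sum>b\<in>B. \<phi> b v *\<^sub>R b)"
    using finite_dimensional_coordinates[OF fd] by blast
  interpret I2: bounded_linear I2 by (rule linear_imp_bounded_linear[OF fd I2(1)])
  define D where "D x = frechet_derivative f (at x)" for x
  have der: "(f has_derivative D x) (at x)" "D x (I1 v) = I2 (D x v)" if "x \<in> S" for x v
    using f that unfolding holo_on_def D_def by (metis frechet_derivative_eq)+
  define l where "l b w = Complex (\<phi> b w) (- \<phi> b (I2 w))" for b w
  have "\<exists>D2. ((\<lambda>x. l b (D x v)) has_derivative D2) (at x0) \<and> (\<forall>h. D2 (I1 h) = \<i> * D2 h)" for b
  proof (rule derivative_of_holomorphic_function[OF I1 S x0])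
    interpret \<phi>: bounded_linear "\<phi> b" by (rule B)
    have "bounded_linear (\<lambda>w. of_real (\<phi> b w) - \<i> * of_real (\<phi> b (I2 w)))"
      by (intro bounded_linear_sub bounded_linear_compose[OF bounded_linear_of_real]
          bounded_linear_compose[OF bounded_linear_mult_right] \<phi>.bounded_linear_axioms
          bounded_linear_compose[OF \<phi>.bounded_linear_axioms I2.bounded_linear_axioms])
    moreover have "(\<lambda>w. of_real (\<phi> b w) - \<i> * of_real (\<phi> b (I2 w))) = l b"
      by (auto simp: l_def complex_eq_iff)
    ultimately have "bounded_linear (l b)" by simp
    then show "((\<lambda>x. l b (f x)) has_derivative (\<lambda>w. l b (D x w))) (at x)" if "x \<in> S" for x
      using der(1)[OF that] by (rule bounded_linear.has_derivative)
    show "l b (D x (I1 w)) = \<i> * l b (D x w)" if "x \<in> S" for x w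
      using der(2)[OF that] I2(2) by (simp add: l_def complex_eq_iff \<phi>.neg)
  qed
  then obtain E where E: "\<And>b. ((\<lambda>x. l b (D x v)) has_derivative E b) (at x0)"
    "\<And>b h. E b (I1 h) = \<i> * E b h" by metis
  define D' where "D' h = (\<Sum>b\<in>B. Re (E b h) *\<^sub>R b)" for h
  have Re: "((\<lambda>x. \<phi> b (D x v)) has_derivative (\<lambda>h. Re (E b h))) (at x0)" for b
    using bounded_linear.has_derivative[OF bounded_linear_Re E(1)[of b]] by (simp add: l_def)
  have Im: "((\<lambda>x. \<phi> b (I2 (D x v))) has_derivative (\<lambda>h. - Im (E b h))) (at x0)" for b
    using has_derivative_minus[OF bounded_linear.has_derivative[OF bounded_linear_Im E(1)[of b]]]
    by (simp add: l_def)
  have D': "((\<lambda>x. D x v) has_derivative D') (at x0)"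
  proof -
    have "((\<lambda>x. \<Sum>b\<in>B. \<phi> b (D x v) *\<^sub>R b) has_derivative D') (at x0)"
      unfolding D'_def by (intro has_derivative_sum has_derivative_scaleR_left Re)
    then show ?thesis by (simp flip: B(3))
  qed
  have "D' (I1 h) = I2 (D' h)" for h
  proof -
    have "\<phi> b (D' (I1 h)) = \<phi> b (I2 (D' h))" for b
    proof -
      have "\<phi> b (D' (I1 h)) = Re (E b (I1 h))"
        by (metis has_derivative_unique[OF bounded_linear.has_derivative[OF B(2) D'] Re])
      also have "\<dots> = - Im (E b h)" by (simp add: E(2))
      also have "\<dots> = \<phi> b (I2 (D' h))"
        by (metis has_derivative_unique[OF bounded_linear.has_derivative[OF B(2)
              bounded_linear.has_derivative[OF I2.bounded_linear_axioms D']] Im])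
      finally show ?thesis .
    qed
    then have "(\<Sum>b\<in>B. \<phi> b (D' (I1 h)) *\<^sub>R b) = (\<Sum>b\<in>B. \<phi> b (I2 (D' h)) *\<^sub>R b)" by simp
    then show ?thesis by (simp only: B(3)[symmetric])
  qed
  with D' show "\<exists>E. ((\<lambda>x. frechet_derivative f (at x) v) has_derivative E) (at x0) \<and> (\<forall>v. E (I1 v) = I2 (E v))"
    unfolding D_def by blast
qed

lemma holo_on_imp_smooth_on:
  fixes f :: "'a::real_normed_vector \<Rightarrow> 'b::real_normed_vector"
  assumes I1: "bounded_linear I1" and fd: "finite_dimensional TYPE('b)"
    and I2: "linear I2" "\<And>v. I2 (I2 v) = - v"
    and S: "open S" and f: "holo_on I1 I2 S f"
  shows "smooth_on S f"
proof -
  have "Ck_on k S f" for k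
    using f
  proof (induction k arbitrary: f)
    case 0
    then show ?case unfolding holo_on_def
      by (auto intro!: continuous_at_imp_continuous_on dest!: has_derivative_continuous)
  next
    case (Suc k)
    have "f differentiable (at x)" if "x \<in> S" for x
      using Suc.prems that unfolding holo_on_def differentiable_def by blast
    then show ?case
      using Suc.IH holo_on_frechet_derivative[OF I1 fd I2 S Suc.prems] by simp
  qed
  then show ?thesis unfolding smooth_on_def by blast
qed

section \<open>Charts\<close>

lemma chart_properties:
  assumes M: "complex_manifold M" and c: "c \<in> atlas M"
  shows open_chart_domain: "openin (mtop M) (fst c)"
    and inj_on_chart: "inj_on (snd c) (fst c)"
    and open_image_chart: "\<And>W. openin (mtop M) W \<Longrightarrow> W \<subseteq> fst c \<Longrightarrow> open (snd c ` W)"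
proof -
  have c': "openin (mtop M) (fst c)" "open (snd c ` fst c)"
    "homeomorphic_map (subtopology (mtop M) (fst c)) (top_of_set (snd c ` fst c)) (snd c)"
    using assms unfolding complex_manifold_def by blast+
  have ts: "topspace (subtopology (mtop M) (fst c)) = fst c"
    using openin_subset[OF c'(1)] by auto
  show "openin (mtop M) (fst c)" by fact
  show "inj_on (snd c) (fst c)"
    using c'(3) ts unfolding homeomorphic_map_def by simp
  show "open (snd c ` W)" if "openin (mtop M) W" "W \<subseteq> fst c" for W
  proof -
    have "openin (subtopology (mtop M) (fst c)) W"
      using that openin_subset[OF that(1)] by (auto simp: openin_subtopology intro!: exI[of _ W])
    then have "openin (top_of_set (snd c ` fst c)) (snd c ` W)"
      using homeomorphic_imp_open_map[OF c'(3)] unfolding open_map_def by blast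
    then show ?thesis using c'(2) openin_open_trans by blast
  qed
qed

lemma chart_inv_chart:
  assumes "complex_manifold M" "c \<in> atlas M" "x \<in> fst c"
  shows "chart_inv c (snd c x) = x"
  unfolding chart_inv_def using inj_on_chart[OF assms(1,2)] assms(3) by simp

lemma chart_chart_inv:
  assumes "y \<in> snd c ` fst c"
  shows "snd c (chart_inv c y) = y" "chart_inv c y \<in> fst c"
  unfolding chart_inv_def using assms by (auto intro: f_inv_into_f inv_into_into)

lemma holo_on_cong:
  assumes "open S" "\<And>x. x \<in> S \<Longrightarrow> f x = g x" "holo_on I1 I2 S f"
  shows "holo_on I1 I2 S g"
  using assms has_derivative_transform_within_open unfolding holo_on_def by metis

lemma holo_on_subset: "holo_on I1 I2 S f \<Longrightarrow> T \<subseteq> S \<Longrightarrow> holo_on I1 I2 T f"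
  unfolding holo_on_def by blast

lemma holo_on_compose:
  assumes "holo_on I1 I2 S f" "holo_on I2 I3 T g" "f ` S \<subseteq> T"
  shows "holo_on I1 I3 S (\<lambda>x. g (f x))"
  unfolding holo_on_def
proof
  fix x assume x: "x \<in> S"
  obtain D where D: "(f has_derivative D) (at x)" "\<And>v. D (I1 v) = I2 (D v)"
    using assms(1) x unfolding holo_on_def by blast
  obtain E where E: "(g has_derivative E) (at (f x))" "\<And>v. E (I2 v) = I3 (E v)"
    using assms(2,3) x unfolding holo_on_def by blast
  show "\<exists>D. ((\<lambda>x. g (f x)) has_derivative D) (at x) \<and> (\<forall>v. D (I1 v) = I3 (D v))"
    using has_derivative_compose[OF D(1) E(1)] D(2) E(2) by (intro exI[of _ "\<lambda>x. E (D x)"]) auto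
qed

lemma holo_on_has_derivative:
  assumes "holo_on I1 I2 S f" "x \<in> S"
  shows "(f has_derivative frechet_derivative f (at x)) (at x)"
    "frechet_derivative f (at x) (I1 v) = I2 (frechet_derivative f (at x) v)"
  using assms unfolding holo_on_def by (metis frechet_derivative_eq)+

lemma regular_map_onE:
  assumes "regular_map_on reg M N W f" "x \<in> W" "c \<in> atlas M" "x \<in> fst c" "c' \<in> atlas N" "f x \<in> fst c'"
  obtains O' where "openin (mtop M) O'" "x \<in> O'" "O' \<subseteq> W \<inter> fst c" "f ` O' \<subseteq> fst c'"
    "reg (snd c ` O') (snd c' \<circ> f \<circ> chart_inv c)"
  using assms unfolding regular_map_on_def by blast

lemma has_derivative_pair:
  assumes "(g has_derivative g') (at (f1 x, f2 x))"
    "(f1 has_derivative f1') (at x)" "(f2 has_derivative f2') (at x)"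
  shows "((\<lambda>y. g (f1 y, f2 y)) has_derivative (\<lambda>h. g' (f1' h, f2' h))) (at x)"
  using has_derivative_compose[OF has_derivative_Pair[OF assms(2,3)] assms(1)] .

lemma has_derivative_pair_left:
  "(g has_derivative g') (at (x, k)) \<Longrightarrow> ((\<lambda>y. g (y, k)) has_derivative (\<lambda>h. g' (h, 0))) (at x)"
  and has_derivative_pair_right:
  "(g has_derivative g') (at (k, x)) \<Longrightarrow> ((\<lambda>y. g (k, y)) has_derivative (\<lambda>h. g' (0, h))) (at x)"
  by (rule has_derivative_pair[OF _ has_derivative_ident has_derivative_const], assumption)
    (rule has_derivative_pair[OF _ has_derivative_const has_derivative_ident], assumption)

section \<open>The local group law\<close>

locale complex_Lie =
  fixes G :: "('g, 'v::real_normed_vector) lie_group" (structure)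
  assumes complex_lie_group: "complex_lie_group G"
begin

abbreviation \<phi> where "\<phi> \<equiv> snd (id_chart G)"
abbreviation \<psi> where "\<psi> \<equiv> chart_inv (id_chart G)"
abbreviation unit_dom where "unit_dom \<equiv> fst (id_chart G)"
abbreviation e where "e \<equiv> \<phi> \<one>"
abbreviation I where "I \<equiv> lie_I G"

definition lmul :: "'v \<times> 'v \<Rightarrow> 'v" where "lmul p = \<phi> (\<psi> (fst p) \<otimes> \<psi> (snd p))"
definition linv :: "'v \<Rightarrow> 'v" where "linv x = \<phi> (inv (\<psi> x))"

lemma is_group: "group G" and G_manifold: "complex_manifold (gmfd G)"
  and id_chart: "id_chart G \<in> atlas (gmfd G)" "\<one> \<in> unit_dom"
  and topspace_G: "topspace (mtop (gmfd G)) = carrier G"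
  using complex_lie_group unfolding complex_lie_group_def by auto

lemma finite_dim: "finite_dimensional TYPE('v)" and linear_I: "linear I"
  and I_I [simp]: "I (I v) = - v"
  using G_manifold unfolding complex_manifold_def lie_I_def by auto

lemma bounded_linear_I: "bounded_linear I"
  by (rule linear_imp_bounded_linear[OF finite_dim linear_I])

sublocale I: bounded_linear I by (rule bounded_linear_I)

sublocale group G by (rule is_group)

lemma bounded_linear_II: "bounded_linear (map_prod I I)"
proof -
  have "bounded_linear (\<lambda>p. (I (fst p), I (snd p)))"
    by (intro bounded_linear_Pair bounded_linear_compose[OF bounded_linear_I] bounded_linear_fst bounded_linear_snd)
  then show ?thesis by (simp add: map_prod_def case_prod_unfold)
qed

lemma chart_dom_carrier: "c \<in> atlas (gmfd G) \<Longrightarrow> a \<in> fst c \<Longrightarrow> a \<in> carrier G"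
  using openin_subset[OF open_chart_domain[OF G_manifold]] topspace_G by blast

lemma exists_chart: "a \<in> carrier G \<Longrightarrow> \<exists>c\<in>atlas (gmfd G). a \<in> fst c"
  using G_manifold topspace_G unfolding complex_manifold_def by blast

lemma psi_phi [simp]: "a \<in> unit_dom \<Longrightarrow> \<psi> (\<phi> a) = a"
  by (rule chart_inv_chart[OF G_manifold id_chart(1)])

text \<open>Arbitrary charts are allowed, since conjugation by an element far from the unit passes through a
  chart around that element.\<close>

lemma mult_holo_in_charts:
  assumes c: "c \<in> atlas (gmfd G)" "a \<in> fst c" and c': "c' \<in> atlas (gmfd G)" "b \<in> fst c'"
    and c'': "c'' \<in> atlas (gmfd G)" "a \<otimes> b \<in> fst c''"
  obtains W where "open W" "(snd c a, snd c' b) \<in> W" "W \<subseteq> snd c ` fst c \<times> snd c' ` fst c'"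
    "\<And>x y. (x, y) \<in> W \<Longrightarrow> chart_inv c x \<otimes> chart_inv c' y \<in> fst c''"
    "holo_on (map_prod I I) I W (\<lambda>p. snd c'' (chart_inv c (fst p) \<otimes> chart_inv c' (snd p)))"
proof -
  let ?c = "(fst c \<times> fst c', map_prod (snd c) (snd c'))"
  have "?c \<in> atlas (prod_cmfd (gmfd G) (gmfd G))"
    unfolding prod_cmfd_def using c(1) c'(1) by (simp del: split_paired_Ex) blast
  note pc = this
  have hol: "regular_map_on (holo_on (map_prod I I) I) (prod_cmfd (gmfd G) (gmfd G)) (gmfd G)
      (carrier G \<times> carrier G) (\<lambda>(a, b). a \<otimes> b)"
    using complex_lie_group unfolding complex_lie_group_def holo_map_on_def lie_I_def
    by (simp add: prod_cmfd_def)
  have ab: "(a, b) \<in> carrier G \<times> carrier G"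
    using chart_dom_carrier c c' by blast
  obtain O' where O: "openin (mtop (prod_cmfd (gmfd G) (gmfd G))) O'"
    "(a, b) \<in> O'" "O' \<subseteq> carrier G \<times> carrier G \<inter> fst ?c" "(\<lambda>(a, b). a \<otimes> b) ` O' \<subseteq> fst c''"
    "holo_on (map_prod I I) I (snd ?c ` O') (snd c'' \<circ> (\<lambda>(a, b). a \<otimes> b) \<circ> chart_inv ?c)"
    by (rule regular_map_onE[OF hol ab pc _ c''(1)]) (use c c' c'' in auto)
  have O': "openin (prod_topology (mtop (gmfd G)) (mtop (gmfd G))) O'"
    "(a, b) \<in> O'" "O' \<subseteq> fst c \<times> fst c'" "(\<lambda>(a, b). a \<otimes> b) ` O' \<subseteq> fst c''"
    "holo_on (map_prod I I) I (map_prod (snd c) (snd c') ` O') (snd c'' \<circ> (\<lambda>(a, b). a \<otimes> b) \<circ> chart_inv ?c)"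
    using O by (simp_all add: prod_cmfd_def)
  let ?V = "map_prod (snd c) (snd c') ` O'"
  have inj: "inj_on (map_prod (snd c) (snd c')) (fst c \<times> fst c')"
    using inj_on_chart[OF G_manifold] c c' by (intro map_prod_inj_on) auto
  have inv: "chart_inv ?c (snd c x, snd c' y) = (x, y)" if "(x, y) \<in> O'" for x y
    using inv_into_f_f[OF inj, of "(x, y)"] that O'(3) unfolding chart_inv_def by auto
  obtain A A' where A: "openin (mtop (gmfd G)) A" "openin (mtop (gmfd G)) A'" "a \<in> A" "b \<in> A'" "A \<times> A' \<subseteq> O'"
    using openin_prod_topology_alt[THEN iffD1, OF O'(1), rule_format, OF O'(2)] by blast
  have AA: "A \<subseteq> fst c" "A' \<subseteq> fst c'"
    using A(3-5) O'(3) by blast+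
  define W where "W = (snd c ` A) \<times> (snd c' ` A')"
  have oW: "open W" unfolding W_def
    using open_image_chart[OF G_manifold] c c' A AA by (intro open_Times) auto
  have el: "(chart_inv c x, chart_inv c' y) \<in> O'" "chart_inv ?c (x, y) = (chart_inv c x, chart_inv c' y)"
    if xyW: "(x, y) \<in> W" for x y
  proof -
    obtain x' y' where xy: "x = snd c x'" "y = snd c' y'" "x' \<in> A" "y' \<in> A'" using xyW unfolding W_def by blast
    then have "chart_inv c x = x'" "chart_inv c' y = y'"
      using AA chart_inv_chart[OF G_manifold] c c' by blast+
    then show "(chart_inv c x, chart_inv c' y) \<in> O'" "chart_inv ?c (x, y) = (chart_inv c x, chart_inv c' y)"
      using inv[of x' y'] xy A(5) by auto
  qed
  have "W \<subseteq> ?V" unfolding W_def using A(5) by force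
  then have h: "holo_on (map_prod I I) I W (snd c'' \<circ> (\<lambda>(a, b). a \<otimes> b) \<circ> chart_inv ?c)"
    by (rule holo_on_subset[OF O'(5)])
  have "holo_on (map_prod I I) I W (\<lambda>p. snd c'' (chart_inv c (fst p) \<otimes> chart_inv c' (snd p)))"
    by (rule holo_on_cong[OF oW _ h]) (auto simp: el(2))
  moreover have "(snd c a, snd c' b) \<in> W" unfolding W_def using A by blast
  moreover have "W \<subseteq> snd c ` fst c \<times> snd c' ` fst c'" unfolding W_def using AA by blast
  moreover have "chart_inv c x \<otimes> chart_inv c' y \<in> fst c''" if "(x, y) \<in> W" for x y
    using el(1)[OF that] O'(4) by auto
  ultimately show thesis using that oW by blast
qed

lemma inv_holo_in_charts:
  obtains W where "open W" "e \<in> W" "W \<subseteq> \<phi> ` unit_dom"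
    "\<And>x. x \<in> W \<Longrightarrow> inv (\<psi> x) \<in> unit_dom"
    "holo_on I I W (\<lambda>x. \<phi> (inv (\<psi> x)))"
proof -
  have hol: "regular_map_on (holo_on I I) (gmfd G) (gmfd G) (carrier G) (\<lambda>a. inv a)"
    using complex_lie_group unfolding complex_lie_group_def holo_map_on_def lie_I_def by blast
  obtain O' where O': "openin (mtop (gmfd G)) O'" "\<one> \<in> O'" "O' \<subseteq> carrier G \<inter> unit_dom" "(\<lambda>a. inv a) ` O' \<subseteq> unit_dom"
    "holo_on I I (\<phi> ` O') (\<phi> \<circ> (\<lambda>a. inv a) \<circ> \<psi>)"
    by (rule regular_map_onE[OF hol one_closed id_chart id_chart(1)]) (use id_chart in auto)
  show thesis
  proof (rule that[of "\<phi> ` O'"])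
    show "open (\<phi> ` O')" using open_image_chart[OF G_manifold id_chart(1) O'(1)] O'(3) by simp
    show "holo_on I I (\<phi> ` O') (\<lambda>x. \<phi> (inv (\<psi> x)))" using O'(5) by (simp add: o_def)
    show "inv (\<psi> x) \<in> unit_dom" if "x \<in> \<phi> ` O'" for x
      using that O'(3,4) by (auto simp: subset_iff image_subset_iff)
  qed (use O' in auto)
qed

text \<open>Two nested neighbourhoods, since products of three factors occur: a product of elements of the
  smaller one can be multiplied once more within the chart.\<close>

lemma exists_unit_nbhds:
  "\<exists>V V2. open V \<and> e \<in> V \<and> V \<subseteq> \<phi> ` unit_dom \<and>
    (\<forall>x\<in>V. \<forall>y\<in>V. \<psi> x \<otimes> \<psi> y \<in> unit_dom) \<and> (\<forall>x\<in>V. inv (\<psi> x) \<in> unit_dom) \<and>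
    holo_on (map_prod I I) I (V \<times> V) lmul \<and> holo_on I I V linv \<and>
    open V2 \<and> e \<in> V2 \<and> V2 \<subseteq> V \<and> (\<forall>x\<in>V2. linv x \<in> V) \<and> (\<forall>x\<in>V2. \<forall>y\<in>V2. lmul (x, y) \<in> V)"
proof -
  obtain W where W: "open W" "(e, e) \<in> W" "W \<subseteq> \<phi> ` unit_dom \<times> \<phi> ` unit_dom"
    "\<And>x y. (x, y) \<in> W \<Longrightarrow> \<psi> x \<otimes> \<psi> y \<in> unit_dom"
    "holo_on (map_prod I I) I W lmul"
    unfolding lmul_def
    using mult_holo_in_charts[OF id_chart id_chart, of "id_chart G"] id_chart by auto
  obtain W' where W': "open W'" "e \<in> W'" "W' \<subseteq> \<phi> ` unit_dom"
    "\<And>x. x \<in> W' \<Longrightarrow> inv (\<psi> x) \<in> unit_dom" "holo_on I I W' linv"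
    by (rule inv_holo_in_charts[folded linv_def]) (rule that)
  obtain A B where AB: "open A" "open B" "(e, e) \<in> A \<times> B" "A \<times> B \<subseteq> W"
    by (rule open_prod_elim[OF W(1,2)])
  define V where "V = A \<inter> B \<inter> W'"
  have V: "open V" "e \<in> V" "V \<times> V \<subseteq> W" "V \<subseteq> W'" using AB W' by (auto simp: V_def)
  have hm: "holo_on (map_prod I I) I (V \<times> V) lmul" and hi: "holo_on I I V linv"
    using holo_on_subset W(5) W'(5) V by blast+
  have "continuous (at (e, e)) lmul"
    using holo_on_has_derivative(1)[OF hm, of "(e, e)"] V has_derivative_continuous by blast
  moreover have "lmul (e, e) = e" using id_chart by (simp add: lmul_def)
  ultimately have "eventually (\<lambda>p. lmul p \<in> V) (nhds (e, e))"
    using V unfolding isCont_def tendsto_at_iff_tendsto_nhds by (metis topological_tendstoD)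
  then obtain S where S: "open S" "(e, e) \<in> S" "\<And>p. p \<in> S \<Longrightarrow> lmul p \<in> V"
    unfolding eventually_nhds by blast
  obtain A2 B2 where AB2: "open A2" "open B2" "(e, e) \<in> A2 \<times> B2" "A2 \<times> B2 \<subseteq> S"
    by (rule open_prod_elim[OF S(1,2)])
  have "continuous (at e) linv"
    using holo_on_has_derivative(1)[OF hi] V has_derivative_continuous by blast
  moreover have "linv e = e" using id_chart by (simp add: linv_def)
  ultimately have "eventually (\<lambda>p. linv p \<in> V) (nhds e)"
    using V unfolding isCont_def tendsto_at_iff_tendsto_nhds by (metis topological_tendstoD)
  then obtain T where T: "open T" "e \<in> T" "\<And>p. p \<in> T \<Longrightarrow> linv p \<in> V"
    unfolding eventually_nhds by blast
  define V2 where "V2 = V \<inter> A2 \<inter> B2 \<inter> T"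
  show ?thesis
    apply (rule exI[of _ V], rule exI[of _ V2])
    using V W W' AB2 S T hm hi by (auto simp: V2_def)
qed

definition nbhds where "nbhds = (SOME (V, V2). open V \<and> e \<in> V \<and> V \<subseteq> \<phi> ` unit_dom \<and>
    (\<forall>x\<in>V. \<forall>y\<in>V. \<psi> x \<otimes> \<psi> y \<in> unit_dom) \<and> (\<forall>x\<in>V. inv (\<psi> x) \<in> unit_dom) \<and>
    holo_on (map_prod I I) I (V \<times> V) lmul \<and> holo_on I I V linv \<and>
    open V2 \<and> e \<in> V2 \<and> V2 \<subseteq> V \<and> (\<forall>x\<in>V2. linv x \<in> V) \<and> (\<forall>x\<in>V2. \<forall>y\<in>V2. lmul (x, y) \<in> V))"

definition V where "V = fst nbhds"
definition V2 where "V2 = snd nbhds"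

lemma unit_nbhds:
  "open V" "e \<in> V" "V \<subseteq> \<phi> ` unit_dom"
  "\<And>x y. x \<in> V \<Longrightarrow> y \<in> V \<Longrightarrow> \<psi> x \<otimes> \<psi> y \<in> unit_dom" "\<And>x. x \<in> V \<Longrightarrow> inv (\<psi> x) \<in> unit_dom"
  "holo_on (map_prod I I) I (V \<times> V) lmul" "holo_on I I V linv"
  "open V2" "e \<in> V2" "V2 \<subseteq> V" "\<And>x. x \<in> V2 \<Longrightarrow> linv x \<in> V"
  "\<And>x y. x \<in> V2 \<Longrightarrow> y \<in> V2 \<Longrightarrow> lmul (x, y) \<in> V"
proof -
  have "case nbhds of (A, A2) \<Rightarrow> open A \<and> e \<in> A \<and> A \<subseteq> \<phi> ` unit_dom \<and>
    (\<forall>x\<in>A. \<forall>y\<in>A. \<psi> x \<otimes> \<psi> y \<in> unit_dom) \<and> (\<forall>x\<in>A. inv (\<psi> x) \<in> unit_dom) \<and>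
    holo_on (map_prod I I) I (A \<times> A) lmul \<and> holo_on I I A linv \<and>
    open A2 \<and> e \<in> A2 \<and> A2 \<subseteq> A \<and> (\<forall>x\<in>A2. linv x \<in> A) \<and> (\<forall>x\<in>A2. \<forall>y\<in>A2. lmul (x, y) \<in> A)"
    unfolding nbhds_def by (rule someI_ex) (use exists_unit_nbhds in auto)
  then have *: "open V \<and> e \<in> V \<and> V \<subseteq> \<phi> ` unit_dom \<and>
    (\<forall>x\<in>V. \<forall>y\<in>V. \<psi> x \<otimes> \<psi> y \<in> unit_dom) \<and> (\<forall>x\<in>V. inv (\<psi> x) \<in> unit_dom) \<and>
    holo_on (map_prod I I) I (V \<times> V) lmul \<and> holo_on I I V linv \<and>
    open V2 \<and> e \<in> V2 \<and> V2 \<subseteq> V \<and> (\<forall>x\<in>V2. linv x \<in> V) \<and> (\<forall>x\<in>V2. \<forall>y\<in>V2. lmul (x, y) \<in> V)"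
    unfolding V_def V2_def by (cases nbhds) simp
  show "open V" "e \<in> V" "V \<subseteq> \<phi> ` unit_dom"
  "\<And>x y. x \<in> V \<Longrightarrow> y \<in> V \<Longrightarrow> \<psi> x \<otimes> \<psi> y \<in> unit_dom" "\<And>x. x \<in> V \<Longrightarrow> inv (\<psi> x) \<in> unit_dom"
  "holo_on (map_prod I I) I (V \<times> V) lmul" "holo_on I I V linv"
  "open V2" "e \<in> V2" "V2 \<subseteq> V" "\<And>x. x \<in> V2 \<Longrightarrow> linv x \<in> V"
  "\<And>x y. x \<in> V2 \<Longrightarrow> y \<in> V2 \<Longrightarrow> lmul (x, y) \<in> V" using * by blast+
qed

lemma phi_psi [simp]: "x \<in> V \<Longrightarrow> \<phi> (\<psi> x) = x"
  and psi_carrier [simp]: "x \<in> V \<Longrightarrow> \<psi> x \<in> carrier G"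
  using unit_nbhds(3) chart_chart_inv[of x "id_chart G"] chart_dom_carrier[OF id_chart(1)] by blast+

lemma psi_e [simp]: "\<psi> e = \<one>" using id_chart by simp

lemma psi_lmul: "x \<in> V \<Longrightarrow> y \<in> V \<Longrightarrow> \<psi> (lmul (x, y)) = \<psi> x \<otimes> \<psi> y"
  and psi_linv: "x \<in> V \<Longrightarrow> \<psi> (linv x) = inv (\<psi> x)"
  using unit_nbhds(4,5) by (simp_all add: lmul_def linv_def)

lemma lmul_unit [simp]: "x \<in> V \<Longrightarrow> lmul (x, e) = x" "x \<in> V \<Longrightarrow> lmul (e, x) = x"
  and lmul_linv: "x \<in> V \<Longrightarrow> linv x \<in> V \<Longrightarrow> lmul (x, linv x) = e"
  and linv_e [simp]: "linv e = e"
  using psi_linv by (simp_all add: lmul_def linv_def)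

subsection \<open>Second-order expansion of the group law\<close>

text \<open>In the chart, \<open>lmul (e + x, e + y) = e + x + y + mixed x y\<close> up to terms of third order: the unit laws
  kill the pure second derivatives.\<close>

definition Dm :: "'v \<times> 'v \<Rightarrow> 'v \<times> 'v \<Rightarrow> 'v" where "Dm p = frechet_derivative lmul (at p)"
definition D2m :: "'v \<times> 'v \<Rightarrow> 'v \<times> 'v \<Rightarrow> 'v" where
  "D2m v = frechet_derivative (\<lambda>p. Dm p v) (at (e, e))"
definition mixed :: "'v \<Rightarrow> 'v \<Rightarrow> 'v" where "mixed x y = D2m (x, 0) (0, y)"

lemma open_VV: "open (V \<times> V)" using unit_nbhds(1) by (intro open_Times)

lemma lmul_has_derivative: "x \<in> V \<Longrightarrow> y \<in> V \<Longrightarrow> (lmul has_derivative Dm (x, y)) (at (x, y))"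
  and Dm_I: "x \<in> V \<Longrightarrow> y \<in> V \<Longrightarrow> Dm (x, y) (I v, I w) = I (Dm (x, y) (v, w))"
  using holo_on_has_derivative[OF unit_nbhds(6), of "(x, y)"] unfolding Dm_def
  by (force simp: map_prod_def)+

lemma holo_Dm: "holo_on (map_prod I I) I (V \<times> V) (\<lambda>p. Dm p v)"
  unfolding Dm_def
  by (rule holo_on_frechet_derivative[OF bounded_linear_II finite_dim linear_I I_I open_VV unit_nbhds(6)])

lemma Dm_has_derivative: "((\<lambda>p. Dm p v) has_derivative D2m v) (at (e, e))"
  unfolding D2m_def using holo_on_has_derivative(1)[OF holo_Dm] unit_nbhds(2) by blast

lemma linear_Dm: "x \<in> V \<Longrightarrow> y \<in> V \<Longrightarrow> linear (Dm (x, y))"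
  using lmul_has_derivative has_derivative_linear by blast

lemma linear_D2m: "linear (D2m v)" using Dm_has_derivative has_derivative_linear by blast

lemma D2m_sym: "D2m v w = D2m w v"
proof (rule second_derivative_symmetric[OF open_VV])
  show "(e, e) \<in> V \<times> V" using unit_nbhds by blast
  show "lmul differentiable at y" if "y \<in> V \<times> V" for y
    using that lmul_has_derivative differentiable_def by blast
qed (use Dm_has_derivative in \<open>simp_all add: Dm_def\<close>)

lemma D2m_I: "D2m (I v, I w) u = I (D2m (v, w) u)"
proof -
  have "((\<lambda>p. I (Dm p (v, w))) has_derivative (\<lambda>u. I (D2m (v, w) u))) (at (e, e))"
    by (rule I.has_derivative[OF Dm_has_derivative])
  then have "((\<lambda>p. Dm p (I v, I w)) has_derivative (\<lambda>u. I (D2m (v, w) u))) (at (e, e))"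
    by (rule has_derivative_transform_within_open[OF _ open_VV]) (use unit_nbhds(2) Dm_I in auto)
  then show ?thesis using has_derivative_unique[OF Dm_has_derivative] by metis
qed

lemma Dm_left: "x \<in> V \<Longrightarrow> Dm (x, e) (\<xi>, 0) = \<xi>"
  and Dm_right: "x \<in> V \<Longrightarrow> Dm (e, x) (0, \<xi>) = \<xi>"
proof -
  assume x: "x \<in> V"
  have "((\<lambda>y. lmul (y, e)) has_derivative (\<lambda>h. Dm (x, e) (h, 0))) (at x)"
    by (rule has_derivative_pair_left[OF lmul_has_derivative[OF x unit_nbhds(2)]])
  then have "((\<lambda>y. y) has_derivative (\<lambda>h. Dm (x, e) (h, 0))) (at x)"
    by (rule has_derivative_transform_within_open[OF _ unit_nbhds(1) x]) simp
  then show "Dm (x, e) (\<xi>, 0) = \<xi>" using has_derivative_unique[OF has_derivative_ident] by metis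
  have "((\<lambda>y. lmul (e, y)) has_derivative (\<lambda>h. Dm (e, x) (0, h))) (at x)"
    by (rule has_derivative_pair_right[OF lmul_has_derivative[OF unit_nbhds(2) x]])
  then have "((\<lambda>y. y) has_derivative (\<lambda>h. Dm (e, x) (0, h))) (at x)"
    by (rule has_derivative_transform_within_open[OF _ unit_nbhds(1) x]) simp
  then show "Dm (e, x) (0, \<xi>) = \<xi>" using has_derivative_unique[OF has_derivative_ident] by metis
qed

lemma Dm_ee: "Dm (e, e) (x, y) = x + y"
  using linear_add[OF linear_Dm[OF unit_nbhds(2,2)], of "(x, 0)" "(0, y)"] Dm_left[OF unit_nbhds(2)] Dm_right[OF unit_nbhds(2)]
  by simp

lemma D2m_left: "D2m (x, 0) (y, 0) = 0" and D2m_right: "D2m (0, x) (0, y) = 0"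
proof -
  have "((\<lambda>z. Dm (z, e) (x, 0)) has_derivative (\<lambda>h. D2m (x, 0) (h, 0))) (at e)"
    by (rule has_derivative_pair_left[OF Dm_has_derivative])
  then have "((\<lambda>z. x) has_derivative (\<lambda>h. D2m (x, 0) (h, 0))) (at e)"
    by (rule has_derivative_transform_within_open[OF _ unit_nbhds(1,2)]) (simp add: Dm_left)
  then show "D2m (x, 0) (y, 0) = 0" using has_derivative_unique[OF has_derivative_const] by metis
  have "((\<lambda>z. Dm (e, z) (0, x)) has_derivative (\<lambda>h. D2m (0, x) (0, h))) (at e)"
    by (rule has_derivative_pair_right[OF Dm_has_derivative])
  then have "((\<lambda>z. x) has_derivative (\<lambda>h. D2m (0, x) (0, h))) (at e)"
    by (rule has_derivative_transform_within_open[OF _ unit_nbhds(1,2)]) (simp add: Dm_right)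
  then show "D2m (0, x) (0, y) = 0" using has_derivative_unique[OF has_derivative_const] by metis
qed

lemma mixed_sym: "D2m (0, y) (x, 0) = mixed x y"
  unfolding mixed_def by (rule D2m_sym)

lemma linv_has_derivative_at: "x \<in> V \<Longrightarrow> (linv has_derivative frechet_derivative linv (at x)) (at x)"
  by (rule holo_on_has_derivative(1)[OF unit_nbhds(7)])

lemma linv_has_derivative: "(linv has_derivative (\<lambda>h. - h)) (at e)"
proof -
  let ?D = "frechet_derivative linv (at e)"
  have "((\<lambda>x. lmul (x, linv x)) has_derivative (\<lambda>h. Dm (e, e) (h, ?D h))) (at e)"
    by (rule has_derivative_pair[OF _ has_derivative_ident linv_has_derivative_at[OF unit_nbhds(2)]])
      (simp add: lmul_has_derivative[OF unit_nbhds(2,2)])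
  then have "((\<lambda>x. e) has_derivative (\<lambda>h. h + ?D h)) (at e)"
    unfolding Dm_ee
    by (rule has_derivative_transform_within_open[OF _ unit_nbhds(8,9)]) (use unit_nbhds(10,11) lmul_linv in auto)
  then have "h + ?D h = 0" for h using has_derivative_unique[OF has_derivative_const] by metis
  then have "?D = (\<lambda>h. - h)" by (auto simp: eq_neg_iff_add_eq_0 add.commute)
  then show ?thesis using linv_has_derivative_at[OF unit_nbhds(2)] by simp
qed

lemma eventually_V: "eventually (\<lambda>x. x \<in> V) (nhds e)" and eventually_V2: "eventually (\<lambda>x. x \<in> V2) (nhds e)"
  by (rule eventually_nhds_in_open[OF unit_nbhds(1,2)], rule eventually_nhds_in_open[OF unit_nbhds(8,9)])

subsection \<open>The adjoint representation\<close>

text \<open>Conjugation by \<open>a\<close> is left translation into a chart around \<open>a\<close> followed by right translation back to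
  the chart at the unit.\<close>

lemma conj_holo:
  assumes a: "a \<in> carrier G"
  obtains S where "open S" "e \<in> S" "S \<subseteq> V" "\<And>u. u \<in> S \<Longrightarrow> a \<otimes> \<psi> u \<otimes> inv a \<in> unit_dom"
    "holo_on I I S (\<lambda>u. \<phi> (a \<otimes> \<psi> u \<otimes> inv a))"
proof -
  obtain c where c: "c \<in> atlas (gmfd G)" "a \<in> fst c" using exists_chart[OF a] by blast
  obtain d where d: "d \<in> atlas (gmfd G)" "inv a \<in> fst d" using exists_chart a by blast
  have "a \<otimes> \<one> \<in> fst c" using a c by simp
  from mult_holo_in_charts[OF c id_chart c(1) this]
  obtain W where W: "open W" "(snd c a, e) \<in> W" "W \<subseteq> snd c ` fst c \<times> \<phi> ` unit_dom"
    "\<And>x y. (x, y) \<in> W \<Longrightarrow> chart_inv c x \<otimes> \<psi> y \<in> fst c"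
    "holo_on (map_prod I I) I W (\<lambda>p. snd c (chart_inv c (fst p) \<otimes> \<psi> (snd p)))" by blast
  have "a \<otimes> inv a \<in> unit_dom" using a id_chart by simp
  note ai = this
  obtain W' where W0: "open W'" "(snd c a, snd d (inv a)) \<in> W'" "W' \<subseteq> snd c ` fst c \<times> snd d ` fst d"
    "\<And>x y. (x, y) \<in> W' \<Longrightarrow> chart_inv c x \<otimes> chart_inv d y \<in> unit_dom"
    "holo_on (map_prod I I) I W' (\<lambda>p. \<phi> (chart_inv c (fst p) \<otimes> chart_inv d (snd p)))"
    by (rule mult_holo_in_charts[OF c d id_chart(1) ai]) (rule that)
  note W' = W0(1,2,4,5)
  have ca: "chart_inv c (snd c a) = a" "chart_inv d (snd d (inv a)) = inv a"
    using chart_inv_chart[OF G_manifold] c d by blast+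
  have pair1: "holo_on I (map_prod I I) S (\<lambda>u. (k, u))" for S :: "'v set" and k :: 'v
    unfolding holo_on_def
  proof
    fix x
    show "\<exists>D. ((\<lambda>u. (k, u)) has_derivative D) (at x) \<and> (\<forall>v. D (I v) = map_prod I I (D v))"
      by (rule exI[of _ "\<lambda>h. (0, h)"]) (auto intro!: derivative_eq_intros simp: I.zero)
  qed
  have pair2: "holo_on I (map_prod I I) S (\<lambda>u. (u, k))" for S :: "'v set" and k :: 'v
    unfolding holo_on_def
  proof
    fix x
    show "\<exists>D. ((\<lambda>u. (u, k)) has_derivative D) (at x) \<and> (\<forall>v. D (I v) = map_prod I I (D v))"
      by (rule exI[of _ "\<lambda>h. (h, 0)"]) (auto intro!: derivative_eq_intros simp: I.zero)
  qed
  define S1 where "S1 = {u. (snd c a, u) \<in> W}"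
  have S1: "open S1" unfolding S1_def
    using continuous_open_vimage[OF W(1), of "\<lambda>u. (snd c a, u)"]
    by (auto simp: vimage_def intro!: continuous_intros)
  define l where "l = (\<lambda>u. snd c (a \<otimes> \<psi> u))"
  have hl: "holo_on I I S1 l"
  proof -
    have "holo_on I I S1 (\<lambda>u. (\<lambda>p. snd c (chart_inv c (fst p) \<otimes> \<psi> (snd p))) (snd c a, u))"
      by (rule holo_on_compose[OF pair1 W(5)]) (auto simp: S1_def)
    then show ?thesis by (simp add: l_def ca)
  qed
  define S2 where "S2 = {u. (u, snd d (inv a)) \<in> W'}"
  have S2: "open S2" unfolding S2_def
    using continuous_open_vimage[OF W'(1), of "\<lambda>u. (u, snd d (inv a))"]
    by (auto simp: vimage_def intro!: continuous_intros)
  have hr: "holo_on I I S2 (\<lambda>x. \<phi> (chart_inv c x \<otimes> inv a))"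
  proof -
    have "holo_on I I S2 (\<lambda>u. (\<lambda>p. \<phi> (chart_inv c (fst p) \<otimes> chart_inv d (snd p))) (u, snd d (inv a)))"
      by (rule holo_on_compose[OF pair2 W'(4)]) (auto simp: S2_def)
    then show ?thesis by (simp add: ca)
  qed
  have cl: "chart_inv c (l u) = a \<otimes> \<psi> u" if "u \<in> S1" for u
    unfolding l_def using chart_inv_chart[OF G_manifold c(1)] W(4)[of "snd c a" u] that ca by (simp add: S1_def)
  have "continuous_on S1 l"
    using holo_on_has_derivative(1)[OF hl] has_derivative_continuous
    by (intro continuous_at_imp_continuous_on) blast
  then have "open (S1 \<inter> l -` S2)" using S1 S2 by (simp add: continuous_on_open_vimage Int_commute)
  define S where "S = S1 \<inter> l -` S2 \<inter> V"
  show thesis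
  proof (rule that[of S])
    show "open S" unfolding S_def using \<open>open (S1 \<inter> l -` S2)\<close> unit_nbhds(1) by blast
    show "e \<in> S" unfolding S_def S1_def S2_def using W(2) W'(2) unit_nbhds(2) a by (simp add: l_def)
    show "S \<subseteq> V" by (auto simp: S_def)
    have "holo_on I I S (\<lambda>u. \<phi> (chart_inv c (l u) \<otimes> inv a))"
      by (rule holo_on_compose[OF holo_on_subset[OF hl] hr]) (auto simp: S_def)
    then show "holo_on I I S (\<lambda>u. \<phi> (a \<otimes> \<psi> u \<otimes> inv a))"
      by (rule holo_on_cong[rotated 2]) (use \<open>open S\<close> cl in \<open>auto simp: S_def\<close>)
    show "a \<otimes> \<psi> u \<otimes> inv a \<in> unit_dom" if "u \<in> S" for u
      using that cl[of u] W'(3)[of "l u" "snd d (inv a)"] ca by (auto simp: S_def S2_def)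
  qed
qed

lemma Ad_has_derivative:
  assumes "a \<in> carrier G"
  shows "((\<lambda>u. \<phi> (a \<otimes> \<psi> u \<otimes> inv a)) has_derivative Ad G a) (at e)"
    and Ad_I: "Ad G a (I v) = I (Ad G a v)"
    and eventually_conj: "eventually (\<lambda>u. a \<otimes> \<psi> u \<otimes> inv a \<in> unit_dom) (nhds e)"
proof -
  obtain S where S: "open S" "e \<in> S" "S \<subseteq> V" "\<And>u. u \<in> S \<Longrightarrow> a \<otimes> \<psi> u \<otimes> inv a \<in> unit_dom"
    "holo_on I I S (\<lambda>u. \<phi> (a \<otimes> \<psi> u \<otimes> inv a))"
    using conj_holo[OF assms] by blast
  show "((\<lambda>u. \<phi> (a \<otimes> \<psi> u \<otimes> inv a)) has_derivative Ad G a) (at e)"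
     "Ad G a (I v) = I (Ad G a v)"
    using holo_on_has_derivative[OF S(5,2)] unfolding Ad_def by simp_all
  show "eventually (\<lambda>u. a \<otimes> \<psi> u \<otimes> inv a \<in> unit_dom) (nhds e)"
    using S eventually_nhds by blast
qed

lemma bounded_linear_Ad: "a \<in> carrier G \<Longrightarrow> bounded_linear (Ad G a)"
  using Ad_has_derivative has_derivative_bounded_linear by blast

lemma Ad_mult:
  assumes a: "a \<in> carrier G" and b: "b \<in> carrier G"
  shows "Ad G (a \<otimes> b) v = Ad G a (Ad G b v)"
proof -
  let ?C = "\<lambda>a u. \<phi> (a \<otimes> \<psi> u \<otimes> inv a)"
  have be: "?C b e = e" using b by simp
  have "((\<lambda>u. ?C a (?C b u)) has_derivative (\<lambda>v. Ad G a (Ad G b v))) (at e)"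
    by (rule has_derivative_compose[OF Ad_has_derivative(1)[OF b]]) (simp only: be Ad_has_derivative(1)[OF a])
  moreover have "eventually (\<lambda>u. ?C a (?C b u) = ?C (a \<otimes> b) u) (nhds e)"
    using eventually_conj[OF b] eventually_V
    by eventually_elim (use a b in \<open>simp add: m_assoc inv_mult_group\<close>)
  ultimately have "(?C (a \<otimes> b) has_derivative (\<lambda>v. Ad G a (Ad G b v))) (at e)"
    by (rule has_derivative_transform_nhds)
  then show ?thesis using has_derivative_unique[OF Ad_has_derivative(1)[of "a \<otimes> b"]] a b by (metis m_closed)
qed

lemma Ad_one [simp]: "Ad G \<one> v = v"
proof -
  have "((\<lambda>u. u) has_derivative Ad G \<one>) (at e)"
    by (rule has_derivative_transform_nhds[OF Ad_has_derivative(1)])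
      (use eventually_V in \<open>auto elim!: eventually_mono\<close>)
  then show ?thesis using has_derivative_unique[OF has_derivative_ident] by metis
qed

lemma Ad_inv_Ad: "a \<in> carrier G \<Longrightarrow> Ad G (inv a) (Ad G a v) = v"
  using Ad_mult[of "inv a" a] by simp

text \<open>Near the unit the adjoint representation is a product of partial derivatives of the group law, hence
  differentiable in the group element.\<close>

lemma Ad_psi:
  assumes u: "u \<in> V2" shows "Ad G (\<psi> u) \<eta> = Dm (u, linv u) (Dm (u, e) (0, \<eta>), 0)"
proof -
  have uV: "u \<in> V" "linv u \<in> V" using u unit_nbhds by auto
  have 1: "((\<lambda>y. lmul (u, y)) has_derivative (\<lambda>h. Dm (u, e) (0, h))) (at e)"
    by (rule has_derivative_pair_right[OF lmul_has_derivative[OF uV(1) unit_nbhds(2)]])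
  have 2: "((\<lambda>y. lmul (y, linv u)) has_derivative (\<lambda>h. Dm (u, linv u) (h, 0))) (at (lmul (u, e)))"
    using uV by (intro has_derivative_pair_left) (simp add: lmul_has_derivative)
  have "((\<lambda>y. lmul (lmul (u, y), linv u)) has_derivative (\<lambda>h. Dm (u, linv u) (Dm (u, e) (0, h), 0))) (at e)"
    by (rule has_derivative_compose[OF 1 2])
  then have "((\<lambda>y. \<phi> (\<psi> u \<otimes> \<psi> y \<otimes> inv (\<psi> u))) has_derivative (\<lambda>h. Dm (u, linv u) (Dm (u, e) (0, h), 0))) (at e)"
  proof (rule has_derivative_transform_within_open[OF _ unit_nbhds(8,9)])
    fix y assume y: "y \<in> V2"
    then show "lmul (lmul (u, y), linv u) = \<phi> (\<psi> u \<otimes> \<psi> y \<otimes> inv (\<psi> u))"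
      using u uV unit_nbhds(10,12) psi_lmul[of u y] psi_linv[OF uV(1)] by (auto simp: lmul_def)
  qed
  then show ?thesis
    using has_derivative_unique[OF Ad_has_derivative(1)[OF psi_carrier[OF uV(1)]]] by metis
qed

text \<open>The product rule for the previous formula, together with \<open>d (x\<^sup>-\<^sup>1) = - dx\<close> at the unit.\<close>

lemma Ad_psi_has_derivative:
  "((\<lambda>u. Ad G (\<psi> u) \<eta>) has_derivative (\<lambda>h. mixed h \<eta> - mixed \<eta> h)) (at e)"
proof -
  have w: "((\<lambda>u. Dm (u, e) (0, \<eta>)) has_derivative (\<lambda>h. D2m (0, \<eta>) (h, 0))) (at e)"
    by (rule has_derivative_pair_left[OF Dm_has_derivative])
  have L: "((\<lambda>u. Dm (u, linv u) (v, 0)) has_derivative (\<lambda>h. D2m (v, 0) (h, - h))) (at e)" for v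
    by (rule has_derivative_pair[OF _ has_derivative_ident linv_has_derivative])
      (simp add: Dm_has_derivative)
  have lin: "eventually (\<lambda>u. linear (\<lambda>v. Dm (u, linv u) (v, 0))) (nhds e)"
    using eventually_V2
  proof eventually_elim
    case (elim u)
    then have 1: "linear (Dm (u, linv u))" using unit_nbhds(10,11) by (intro linear_Dm) auto
    have 2: "linear (\<lambda>v::'v. (v, 0::'v))" by (simp add: linear_iff)
    from linear_compose[OF 2 1] show ?case by (simp add: o_def)
  qed
  have "((\<lambda>u. Dm (u, linv u) (Dm (u, e) (0, \<eta>), 0)) has_derivative
     (\<lambda>h. D2m (Dm (e, e) (0, \<eta>), 0) (h, - h) + Dm (e, linv e) (D2m (0, \<eta>) (h, 0), 0))) (at e)"
    by (rule has_derivative_linear_family[OF finite_dim L lin w])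
  also have "(\<lambda>h. D2m (Dm (e, e) (0, \<eta>), 0) (h, - h) + Dm (e, linv e) (D2m (0, \<eta>) (h, 0), 0))
      = (\<lambda>h. mixed h \<eta> - mixed \<eta> h)"
  proof
    fix h
    have "D2m (\<eta>, 0) (h, - h) = D2m (\<eta>, 0) (h, 0) - D2m (\<eta>, 0) (0, h)"
      using linear_diff[OF linear_D2m, of "(\<eta>, 0)" "(h, 0)" "(0, h)"] by simp
    then show "D2m (Dm (e, e) (0, \<eta>), 0) (h, - h) + Dm (e, linv e) (D2m (0, \<eta>) (h, 0), 0) = mixed h \<eta> - mixed \<eta> h"
      by (simp add: Dm_ee D2m_left mixed_sym mixed_def[symmetric])
  qed
  finally show ?thesis
    by (rule has_derivative_transform_within_open[OF _ unit_nbhds(8,9)]) (simp add: Ad_psi)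
qed

lemma bracket_eq: "bracket G \<xi> \<eta> = mixed \<xi> \<eta> - mixed \<eta> \<xi>"
  unfolding bracket_def using frechet_derivative_eq[OF Ad_psi_has_derivative] by metis

lemma Ad_psi_has_derivative': "((\<lambda>u. Ad G (\<psi> u) \<eta>) has_derivative (\<lambda>h. bracket G h \<eta>)) (at e)"
  unfolding bracket_eq by (rule Ad_psi_has_derivative)

lemma bracket_antisym: "bracket G \<xi> \<eta> = - bracket G \<eta> \<xi>" by (simp add: bracket_eq)

lemma bounded_linear_bracket_left: "bounded_linear (\<lambda>\<xi>. bracket G \<xi> \<eta>)"
  using Ad_psi_has_derivative' has_derivative_bounded_linear by blast

lemma bounded_linear_bracket_right: "bounded_linear (\<lambda>\<eta>. bracket G \<xi> \<eta>)"
  using bounded_linear_minus[OF bounded_linear_bracket_left[of \<xi>]] bracket_antisym[of \<xi>] by simp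

lemma bracket_I_left: "bracket G (I \<xi>) \<eta> = I (bracket G \<xi> \<eta>)"
proof -
  have "mixed (I \<xi>) \<eta> = I (mixed \<xi> \<eta>)" unfolding mixed_def using D2m_I[of \<xi> 0] by (simp add: I.zero)
  moreover have "mixed \<eta> (I \<xi>) = I (mixed \<eta> \<xi>)"
    using D2m_I[of 0 \<xi> "(\<eta>, 0)"] by (simp add: I.zero mixed_sym)
  ultimately show ?thesis by (simp add: bracket_eq I.diff)
qed

lemma bracket_I_right: "bracket G \<xi> (I \<eta>) = I (bracket G \<xi> \<eta>)"
  using bracket_I_left[of \<eta> \<xi>] bracket_antisym by (metis I.neg)

lemma bracket_Ad:
  assumes a: "a \<in> carrier G"
  shows "Ad G a (bracket G x y) = bracket G (Ad G a x) (Ad G a y)"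
proof -
  let ?C = "\<lambda>u. \<phi> (a \<otimes> \<psi> u \<otimes> inv a)"
  have Ce: "?C e = e" using a by simp
  have 1: "((\<lambda>u. Ad G (\<psi> (?C u)) (Ad G a y)) has_derivative (\<lambda>x. bracket G (Ad G a x) (Ad G a y))) (at e)"
    by (rule has_derivative_compose[OF Ad_has_derivative(1)[OF a]]) (simp only: Ce Ad_psi_has_derivative')
  have "eventually (\<lambda>u. Ad G (\<psi> (?C u)) (Ad G a y) = Ad G a (Ad G (\<psi> u) y)) (nhds e)"
    using eventually_conj[OF a] eventually_V
    by eventually_elim (use a Ad_inv_Ad in \<open>simp add: Ad_mult\<close>)
  from has_derivative_transform_nhds[OF 1 this]
  have "((\<lambda>u. Ad G a (Ad G (\<psi> u) y)) has_derivative (\<lambda>x. bracket G (Ad G a x) (Ad G a y))) (at e)" .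
  moreover have "((\<lambda>u. Ad G a (Ad G (\<psi> u) y)) has_derivative (\<lambda>x. Ad G a (bracket G x y))) (at e)"
    by (rule bounded_linear.has_derivative[OF bounded_linear_Ad[OF a] Ad_psi_has_derivative'])
  ultimately show ?thesis using has_derivative_unique by metis
qed

lemma bracket_has_derivative:
  assumes "(f has_derivative f') (at x)" "(g has_derivative g') (at x)"
  shows "((\<lambda>y. bracket G (f y) (g y)) has_derivative (\<lambda>h. bracket G (f' h) (g x) + bracket G (f x) (g' h))) (at x)"
  by (rule has_derivative_linear_family[where L = "\<lambda>y. bracket G (f y)", OF finite_dim _ _ assms(2)])
    (auto intro!: bounded_linear.has_derivative[OF bounded_linear_bracket_left assms(1)]
      always_eventually bounded_linear.linear[OF bounded_linear_bracket_right])

text \<open>The derivative at the unit of the invariance of the bracket under the adjoint representation.\<close>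

lemma Jacobi: "bracket G z (bracket G x y) = bracket G (bracket G z x) y + bracket G x (bracket G z y)"
proof -
  have "((\<lambda>u. bracket G (Ad G (\<psi> u) x) (Ad G (\<psi> u) y)) has_derivative
     (\<lambda>z. bracket G (bracket G z x) (Ad G (\<psi> e) y) + bracket G (Ad G (\<psi> e) x) (bracket G z y))) (at e)"
    by (rule bracket_has_derivative[OF Ad_psi_has_derivative' Ad_psi_has_derivative'])
  then have "((\<lambda>u. Ad G (\<psi> u) (bracket G x y)) has_derivative
     (\<lambda>z. bracket G (bracket G z x) y + bracket G x (bracket G z y))) (at e)"
    unfolding psi_e Ad_one
    by (rule has_derivative_transform_within_open[OF _ unit_nbhds(1,2)]) (simp add: bracket_Ad)
  then show ?thesis using has_derivative_unique[OF Ad_psi_has_derivative'] by metis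
qed

end

section \<open>Lie algebras of subgroups\<close>

text \<open>Finite-dimensional subspaces are closed, so that they contain limits of difference quotients.\<close>

lemma derivative_in_subspace:
  fixes f :: "'a::real_normed_vector \<Rightarrow> 'b::real_normed_vector"
  assumes fd: "finite_dimensional TYPE('b)" and S: "subspace S"
    and f: "(f has_derivative D) (at x)" and ev: "eventually (\<lambda>y. f y \<in> S) (nhds x)"
  shows "D v \<in> S"
proof -
  have lin: "linear D" by (rule has_derivative_linear[OF f])
  have line: "((\<lambda>t::real. x + t *\<^sub>R v) has_derivative (\<lambda>t. t *\<^sub>R v)) (at 0)"
    by (auto intro!: derivative_eq_intros)
  have "((\<lambda>t::real. f (x + t *\<^sub>R v)) has_derivative (\<lambda>t. D (t *\<^sub>R v))) (at 0)"
    by (rule has_derivative_compose[OF line]) (simp add: f)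
  then have 1: "((\<lambda>t. norm (f (x + t *\<^sub>R v) - f x - D (t *\<^sub>R v)) / norm t) \<longlongrightarrow> 0) (at 0)"
    unfolding has_derivative_at by simp
  have 2: "norm (f (x + t *\<^sub>R v) - f x - D (t *\<^sub>R v)) / norm t
      = norm ((1 / t) *\<^sub>R (f (x + t *\<^sub>R v) - f x) - D v)" if "t \<noteq> 0" for t
  proof -
    have "(1 / t) *\<^sub>R (f (x + t *\<^sub>R v) - f x) - D v = (1 / t) *\<^sub>R (f (x + t *\<^sub>R v) - f x - D (t *\<^sub>R v))"
      using that by (simp add: linear_scale[OF lin] scaleR_diff_right)
    then show ?thesis by simp
  qed
  have "((\<lambda>t. norm ((1 / t) *\<^sub>R (f (x + t *\<^sub>R v) - f x) - D v)) \<longlongrightarrow> 0) (at 0)"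
    by (rule Lim_transform_within[OF 1 zero_less_one]) (use 2 in auto)
  then have lim: "((\<lambda>t. (1 / t) *\<^sub>R (f (x + t *\<^sub>R v) - f x)) \<longlongrightarrow> D v) (at 0)"
    using tendsto_norm_zero_iff LIM_zero_cancel by blast
  have "((\<lambda>t::real. x + t *\<^sub>R v) \<longlongrightarrow> x) (at 0)" by (auto intro!: tendsto_eq_intros)
  then have "eventually (\<lambda>t::real. f (x + t *\<^sub>R v) \<in> S) (at 0)"
    using ev eventually_compose_filterlim by fastforce
  moreover have "f x \<in> S" using ev by (rule eventually_nhds_x_imp_x)
  ultimately have "eventually (\<lambda>t. (1 / t) *\<^sub>R (f (x + t *\<^sub>R v) - f x) \<in> S) (at 0)"
    by (auto elim!: eventually_mono intro!: subspace_scale[OF S] subspace_diff[OF S])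
  then show ?thesis
    using Lim_in_closed_set[OF closed_subspace_finite_dimensional[OF fd S] _ _ lim] by simp
qed

context complex_Lie
begin

lemma lie_algebraE:
  assumes "\<xi> \<in> lie_algebra G K"
  obtains \<gamma> where "\<And>t::real. \<gamma> t \<in> K" "\<And>t. \<gamma> t \<in> unit_dom" "\<gamma> 0 = \<one>"
    "((\<lambda>t. \<phi> (\<gamma> t)) has_derivative (\<lambda>t. t *\<^sub>R \<xi>)) (at 0)"
    "filterlim (\<lambda>t. \<phi> (\<gamma> t)) (nhds e) (nhds 0)"
proof -
  obtain \<gamma> where g: "\<And>t::real. \<gamma> t \<in> K \<inter> unit_dom" "\<gamma> 0 = \<one>"
    "((\<lambda>t. \<phi> (\<gamma> t)) has_derivative (\<lambda>t. t *\<^sub>R \<xi>)) (at 0)"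
    using assms unfolding lie_algebra_def has_vector_derivative_def by blast
  have "isCont (\<lambda>t. \<phi> (\<gamma> t)) 0" using g(3) by (rule has_derivative_continuous)
  then have "filterlim (\<lambda>t. \<phi> (\<gamma> t)) (nhds (\<phi> (\<gamma> 0))) (nhds 0)"
    unfolding isCont_def using tendsto_at_iff_tendsto_nhds[of "\<lambda>t. \<phi> (\<gamma> t)" 0] by simp
  then have "filterlim (\<lambda>t. \<phi> (\<gamma> t)) (nhds e) (nhds 0)" by (simp only: g(2))
  with g show thesis using that by blast
qed

text \<open>A velocity depends on the curve near time 0 only; outside that neighbourhood the curve may be
  replaced by the unit.\<close>

lemma lie_algebraI:
  assumes "\<one> \<in> K" "\<gamma> 0 = \<one>" "eventually (\<lambda>t::real. \<gamma> t \<in> K \<and> \<gamma> t \<in> unit_dom) (nhds 0)"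
    "((\<lambda>t. \<phi> (\<gamma> t)) has_derivative (\<lambda>t. t *\<^sub>R \<xi>)) (at 0)"
  shows "\<xi> \<in> lie_algebra G K"
proof -
  define \<delta> where "\<delta> t = (if \<gamma> t \<in> K \<and> \<gamma> t \<in> unit_dom then \<gamma> t else \<one>)" for t
  have "((\<lambda>t. \<phi> (\<delta> t)) has_derivative (\<lambda>t. t *\<^sub>R \<xi>)) (at 0)"
    by (rule has_derivative_transform_nhds[OF assms(4)])
      (use assms(3) in \<open>auto simp: \<delta>_def elim!: eventually_mono\<close>)
  then show ?thesis unfolding lie_algebra_def has_vector_derivative_def
    using assms(1,2) id_chart by (auto simp: \<delta>_def intro!: exI[of _ \<delta>])
qed

lemma subspace_lie_algebra:
  assumes K: "subgroup K G" shows "subspace (lie_algebra G K)"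
  unfolding subspace_def
proof (intro conjI ballI allI)
  have one: "\<one> \<in> K" using K by (rule subgroup.one_closed)
  show "0 \<in> lie_algebra G K"
    by (rule lie_algebraI[of _ "\<lambda>t. \<one>"]) (use one id_chart in auto)
  fix x assume "x \<in> lie_algebra G K"
  then obtain \<gamma> where g: "\<And>t::real. \<gamma> t \<in> K" "\<And>t. \<gamma> t \<in> unit_dom" "\<gamma> 0 = \<one>"
    "((\<lambda>t. \<phi> (\<gamma> t)) has_derivative (\<lambda>t. t *\<^sub>R x)) (at 0)"
    "filterlim (\<lambda>t. \<phi> (\<gamma> t)) (nhds e) (nhds 0)" by (rule lie_algebraE) (rule that)
  show "c *\<^sub>R x \<in> lie_algebra G K" for c
  proof (rule lie_algebraI[of _ "\<lambda>t. \<gamma> (c * t)"])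
    have "((\<lambda>t. \<phi> (\<gamma> (c * t))) has_derivative (\<lambda>t. (c * t) *\<^sub>R x)) (at 0)"
      by (rule has_derivative_compose[where f = "\<lambda>t. c * t" and g = "\<lambda>t. \<phi> (\<gamma> t)"])
        (use g(4) in \<open>auto intro!: derivative_eq_intros\<close>)
    then show "((\<lambda>t. \<phi> (\<gamma> (c * t))) has_derivative (\<lambda>t. t *\<^sub>R c *\<^sub>R x)) (at 0)"
      by (simp add: mult.commute)
  qed (use g one in auto)
  fix y assume "y \<in> lie_algebra G K"
  then obtain \<delta> where d: "\<And>t::real. \<delta> t \<in> K" "\<And>t. \<delta> t \<in> unit_dom" "\<delta> 0 = \<one>"
    "((\<lambda>t. \<phi> (\<delta> t)) has_derivative (\<lambda>t. t *\<^sub>R y)) (at 0)"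
    "filterlim (\<lambda>t. \<phi> (\<delta> t)) (nhds e) (nhds 0)" by (rule lie_algebraE) (rule that)
  show "x + y \<in> lie_algebra G K"
  proof (rule lie_algebraI[of _ "\<lambda>t. \<gamma> t \<otimes> \<delta> t"])
    have "eventually (\<lambda>t. \<phi> (\<gamma> t) \<in> V) (nhds 0)" "eventually (\<lambda>t. \<phi> (\<delta> t) \<in> V) (nhds 0)"
      using eventually_V g(5) d(5) by (auto intro: eventually_compose_filterlim)
    then show "eventually (\<lambda>t. \<gamma> t \<otimes> \<delta> t \<in> K \<and> \<gamma> t \<otimes> \<delta> t \<in> unit_dom) (nhds 0)"
    proof eventually_elim
      case (elim t)
      then show ?case using unit_nbhds(4)[of "\<phi> (\<gamma> t)" "\<phi> (\<delta> t)"] g d subgroup.m_closed[OF K] by simp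
    qed
    have "((\<lambda>t. lmul (\<phi> (\<gamma> t), \<phi> (\<delta> t))) has_derivative (\<lambda>t. Dm (e, e) (t *\<^sub>R x, t *\<^sub>R y))) (at 0)"
      by (rule has_derivative_pair[OF _ g(4) d(4)])
        (simp only: g(3) d(3) lmul_has_derivative[OF unit_nbhds(2,2)])
    then show "((\<lambda>t. \<phi> (\<gamma> t \<otimes> \<delta> t)) has_derivative (\<lambda>t. t *\<^sub>R (x + y))) (at 0)"
      using g d by (simp add: lmul_def Dm_ee scaleR_add_right)
  qed (use g d one in auto)
qed

lemma Ad_lie_algebra:
  assumes K: "subgroup K G" and k: "k \<in> K" and x: "x \<in> lie_algebra G K"
  shows "Ad G k x \<in> lie_algebra G K"
proof -
  have kc: "k \<in> carrier G" using K k by (rule subgroup.mem_carrier)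
  obtain \<gamma> where g: "\<And>t::real. \<gamma> t \<in> K" "\<And>t. \<gamma> t \<in> unit_dom" "\<gamma> 0 = \<one>"
    "((\<lambda>t. \<phi> (\<gamma> t)) has_derivative (\<lambda>t. t *\<^sub>R x)) (at 0)"
    "filterlim (\<lambda>t. \<phi> (\<gamma> t)) (nhds e) (nhds 0)" by (rule lie_algebraE[OF x]) (rule that)
  show ?thesis
  proof (rule lie_algebraI[of _ "\<lambda>t. k \<otimes> \<gamma> t \<otimes> inv k"])
    show "\<one> \<in> K" using K by (rule subgroup.one_closed)
    have "eventually (\<lambda>t. k \<otimes> \<psi> (\<phi> (\<gamma> t)) \<otimes> inv k \<in> unit_dom) (nhds 0)"
      using eventually_conj[OF kc] g(5) by (rule eventually_compose_filterlim)
    then show "eventually (\<lambda>t. k \<otimes> \<gamma> t \<otimes> inv k \<in> K \<and> k \<otimes> \<gamma> t \<otimes> inv k \<in> unit_dom) (nhds 0)"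
      by eventually_elim (use g K k in \<open>auto intro!: subgroup.m_closed subgroup.m_inv_closed\<close>)
    have "((\<lambda>t. \<phi> (k \<otimes> \<psi> (\<phi> (\<gamma> t)) \<otimes> inv k)) has_derivative (\<lambda>t. Ad G k (t *\<^sub>R x))) (at 0)"
      by (rule has_derivative_compose[OF g(4)]) (simp only: g(3) Ad_has_derivative(1)[OF kc])
    then show "((\<lambda>t. \<phi> (k \<otimes> \<gamma> t \<otimes> inv k)) has_derivative (\<lambda>t. t *\<^sub>R Ad G k x)) (at 0)"
      using g(2) linear_scale[OF bounded_linear.linear[OF bounded_linear_Ad[OF kc]]] by simp
  qed (use g kc in auto)
qed

text \<open>Differentiate \<open>Ad (\<gamma> t) y\<close>, which stays in the Lie algebra, along a curve \<open>\<gamma>\<close> in \<open>K\<close>.\<close>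

lemma bracket_lie_algebra:
  assumes K: "subgroup K G" and x: "x \<in> lie_algebra G K" and y: "y \<in> lie_algebra G K"
  shows "bracket G x y \<in> lie_algebra G K"
proof -
  obtain \<gamma> where g: "\<And>t::real. \<gamma> t \<in> K" "\<And>t. \<gamma> t \<in> unit_dom" "\<gamma> 0 = \<one>"
    "((\<lambda>t. \<phi> (\<gamma> t)) has_derivative (\<lambda>t. t *\<^sub>R x)) (at 0)"
    "filterlim (\<lambda>t. \<phi> (\<gamma> t)) (nhds e) (nhds 0)" by (rule lie_algebraE[OF x]) (rule that)
  have "((\<lambda>t. Ad G (\<psi> (\<phi> (\<gamma> t))) y) has_derivative (\<lambda>t. bracket G (t *\<^sub>R x) y)) (at 0)"
    by (rule has_derivative_compose[OF g(4)]) (simp only: g(3) Ad_psi_has_derivative')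
  then have "bracket G (1 *\<^sub>R x) y \<in> lie_algebra G K"
    by (rule derivative_in_subspace[OF finite_dim subspace_lie_algebra[OF K]])
      (use g Ad_lie_algebra[OF K _ y] in simp)
  then show ?thesis by simp
qed

lemma real_form_trivial_intersection:
  assumes "complexification_of G K" "subgroup K G"
    and "\<xi> \<in> lie_algebra G K" "\<eta> \<in> lie_algebra G K" "\<xi> + I \<eta> = 0"
  shows "\<xi> = 0"
proof -
  have "0 \<in> lie_algebra G K" using subspace_lie_algebra[OF assms(2)] by (rule subspace_0)
  moreover have "\<exists>!(\<xi>, \<eta>). \<xi> \<in> lie_algebra G K \<and> \<eta> \<in> lie_algebra G K \<and> 0 = \<xi> + I \<eta>"
    using assms(1) unfolding complexification_of_def by blast
  ultimately have "(\<xi>, \<eta>) = (0, 0)"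
    using assms(3-5) I.zero by (elim ex1E) (metis (mono_tags, lifting) add.right_neutral case_prodI)
  then show ?thesis by simp
qed

section \<open>Change of gauge\<close>

text \<open>The gauge transformation is the unit at the point \<open>p\<close>.  There the Maurer-Cartan equation is the
  second-order expansion of the group law: the skew part of \<open>mixed\<close> is the bracket, and the second
  derivative of the gauge transformation is symmetric.\<close>

lemma gauge_transformed_curvature:
  fixes u :: "'w::real_normed_vector \<Rightarrow> 'v" and A A' :: "'w \<Rightarrow> 'w \<Rightarrow> 'v"
  assumes S: "open S" "p \<in> S" and up: "u p = e" and uV: "\<And>q. q \<in> S \<Longrightarrow> u q \<in> V2"
    and du: "\<And>q. q \<in> S \<Longrightarrow> (u has_derivative Du q) (at q)"
    and d2u: "\<And>v. ((\<lambda>q. Du q v) has_derivative D2u v) (at p)"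
    and A': "\<And>v. ((\<lambda>q. A' q v) has_derivative DA' v) (at p)"
    and A: "\<And>q v. q \<in> S \<Longrightarrow> A q v = Ad G (inv (\<psi> (u q))) (A' q v) + Dm (linv (u q), u q) (0, Du q v)"
  shows "\<exists>DA. (\<forall>v. ((\<lambda>q. A q v) has_derivative DA v) (at p)) \<and>
    (\<forall>v w. DA w v - DA v w + bracket G (A p v) (A p w) = DA' w v - DA' v w + bracket G (A' p v) (A' p w))"
proof -
  have inV: "u q \<in> V" "linv (u q) \<in> V" if "q \<in> S" for q
    using uV[OF that] unit_nbhds(10,11) by auto
  have evS: "eventually (\<lambda>q. q \<in> S) (nhds p)" by (rule eventually_nhds_in_open[OF S])
  have 1: "((\<lambda>q. Ad G (inv (\<psi> (u q))) \<eta>) has_derivative (\<lambda>h. - bracket G (Du p h) \<eta>)) (at p)" for \<eta>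
  proof -
    have a: "((\<lambda>q. linv (u q)) has_derivative (\<lambda>h. - Du p h)) (at p)"
      by (rule has_derivative_compose[OF du[OF S(2)]]) (simp only: up linv_has_derivative)
    have "((\<lambda>q. Ad G (\<psi> (linv (u q))) \<eta>) has_derivative (\<lambda>h. bracket G (- Du p h) \<eta>)) (at p)"
      by (rule has_derivative_compose[OF a]) (simp only: up linv_e Ad_psi_has_derivative')
    then have "((\<lambda>q. Ad G (inv (\<psi> (u q))) \<eta>) has_derivative (\<lambda>h. bracket G (- Du p h) \<eta>)) (at p)"
      by (rule has_derivative_transform_within_open[OF _ S]) (simp add: psi_linv inV)
    then show ?thesis
      using linear_neg[OF bounded_linear.linear[OF bounded_linear_bracket_left]] by simp
  qed
  have 2: "((\<lambda>q. Ad G (inv (\<psi> (u q))) (A' q v)) has_derivative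
      (\<lambda>h. - bracket G (Du p h) (A' p v) + Ad G (inv (\<psi> (u p))) (DA' v h))) (at p)" for v
  proof (rule has_derivative_linear_family[OF finite_dim 1 _ A'])
    show "eventually (\<lambda>q. linear (Ad G (inv (\<psi> (u q))))) (nhds p)"
      using evS by eventually_elim
        (use inV psi_carrier in \<open>auto intro!: bounded_linear.linear bounded_linear_Ad\<close>)
  qed
  have 3: "((\<lambda>q. Dm (linv (u q), u q) (0, y)) has_derivative (\<lambda>h. D2m (0, y) (- Du p h, Du p h))) (at p)" for y
  proof (rule has_derivative_pair[where g = "\<lambda>z. Dm z (0, y)"])
    show "((\<lambda>z. Dm z (0, y)) has_derivative D2m (0, y)) (at (linv (u p), u p))"
      by (simp add: up Dm_has_derivative)
    show "((\<lambda>q. linv (u q)) has_derivative (\<lambda>h. - Du p h)) (at p)"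
      by (rule has_derivative_compose[OF du[OF S(2)]]) (simp only: up linv_has_derivative)
  qed (rule du[OF S(2)])
  have 4: "((\<lambda>q. Dm (linv (u q), u q) (0, Du q v)) has_derivative
      (\<lambda>h. D2m (0, Du p v) (- Du p h, Du p h) + Dm (linv (u p), u p) (0, D2u v h))) (at p)" for v
  proof (rule has_derivative_linear_family[where L = "\<lambda>q y. Dm (linv (u q), u q) (0, y)", OF finite_dim 3 _ d2u])
    show "eventually (\<lambda>q. linear (\<lambda>y. Dm (linv (u q), u q) (0, y))) (nhds p)"
      using evS
    proof eventually_elim
      case (elim q)
      have 1: "linear (Dm (linv (u q), u q))" by (rule linear_Dm) (use inV[OF elim] in auto)
      have 2: "linear (\<lambda>v::'v. (0::'v, v))" by (simp add: linear_iff)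
      from linear_compose[OF 2 1] show ?case by (simp add: o_def)
    qed
  qed
  define DA where "DA v h = - bracket G (Du p h) (A' p v) + DA' v h + (- mixed (Du p h) (Du p v) + D2u v h)" for v h
  have m: "D2m (0, Du p v) (- Du p h, Du p h) = - mixed (Du p h) (Du p v)" for v h
    using linear_diff[OF linear_D2m, of "(0, Du p v)" "(0, Du p h)" "(Du p h, 0)"]
    by (simp add: D2m_right mixed_sym)
  have der: "((\<lambda>q. A q v) has_derivative DA v) (at p)" for v
  proof -
    have "((\<lambda>q. Ad G (inv (\<psi> (u q))) (A' q v) + Dm (linv (u q), u q) (0, Du q v)) has_derivative DA v) (at p)"
      using has_derivative_add[OF 2 4, of v v] unfolding DA_def m by (simp add: up Dm_ee)
    then show ?thesis
      by (rule has_derivative_transform_within_open[OF _ S]) (simp add: A)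
  qed
  have sym: "D2u v w = D2u w v" for v w
  proof (rule second_derivative_symmetric[OF S])
    show "u differentiable (at q)" if "q \<in> S" for q using du[OF that] differentiable_def by blast
    have "((\<lambda>q. frechet_derivative u (at q) v) has_derivative D2u v) (at p)" for v
      by (rule has_derivative_transform_within_open[OF d2u S]) (use frechet_derivative_eq[OF du] in auto)
    then show "((\<lambda>q. frechet_derivative u (at q) v) has_derivative D2u v) (at p)"
      "((\<lambda>q. frechet_derivative u (at q) w) has_derivative D2u w) (at p)" by blast+
  qed
  have Ap: "A p v = A' p v + Du p v" for v using A[OF S(2)] by (simp add: up Dm_ee)
  have add: "bracket G (x + y) z = bracket G x z + bracket G y z"
    "bracket G z (x + y) = bracket G z x + bracket G z y" for x y z
    by (simp_all add: linear_add[OF bounded_linear.linear[OF bounded_linear_bracket_left]]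
        linear_add[OF bounded_linear.linear[OF bounded_linear_bracket_right]])
  have "DA w v - DA v w + bracket G (A p v) (A p w) = DA' w v - DA' v w + bracket G (A' p v) (A' p w)" for v w
    unfolding DA_def Ap add
    using sym[of v w] bracket_antisym[of "Du p w" "A' p v"] bracket_eq[of "Du p v" "Du p w"]
    by (simp add: algebra_simps)
  with der show ?thesis by blast
qed

end

text \<open>The chain rule for second derivatives at a point, as it is used for a gauge transformation read in
  two charts of the group.\<close>

lemma smooth_compose_twice:
  fixes f :: "'a::real_normed_vector \<Rightarrow> 'v::real_normed_vector" and g :: "'v \<Rightarrow> 'b::real_normed_vector"
  assumes fd: "finite_dimensional TYPE('v)" and S: "open S" "p \<in> S" and T: "open T" "f p \<in> T"
    and f: "smooth_on S f" and g: "smooth_on T g"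
  obtains S' where "open S'" "p \<in> S'" "S' \<subseteq> S" "f ` S' \<subseteq> T"
    "\<And>q. q \<in> S' \<Longrightarrow> ((\<lambda>q. g (f q)) has_derivative frechet_derivative (\<lambda>q. g (f q)) (at q)) (at q)"
    "\<And>v. (\<lambda>q. frechet_derivative (\<lambda>q. g (f q)) (at q) v) differentiable (at p)"
proof -
  have df: "(f has_derivative frechet_derivative f (at q)) (at q)" if "q \<in> S" for q
    using smooth_on_differentiable[OF f that] frechet_derivative_works by blast
  have dg: "(g has_derivative frechet_derivative g (at y)) (at y)" if "y \<in> T" for y
    using smooth_on_differentiable[OF g that] frechet_derivative_works by blast
  have d2f: "(\<lambda>q. frechet_derivative f (at q) v) differentiable (at p)" for v
    using smooth_on_differentiable[OF smooth_on_frechet_derivative[OF f] S(2)] .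
  have d2g: "(\<lambda>y. frechet_derivative g (at y) v) differentiable (at (f p))" for v
    using smooth_on_differentiable[OF smooth_on_frechet_derivative[OF g] T(2)] .
  have "continuous_on S f"
    using df has_derivative_continuous by (intro continuous_at_imp_continuous_on) blast
  then have op: "open (S \<inter> f -` T)" using S T by (simp add: continuous_on_open_vimage Int_commute)
  define S' where "S' = S \<inter> f -` T"
  have S': "open S'" "p \<in> S'" "S' \<subseteq> S" "f ` S' \<subseteq> T" using op S T by (auto simp: S'_def)
  have comp: "((\<lambda>q. g (f q)) has_derivative (\<lambda>h. frechet_derivative g (at (f q)) (frechet_derivative f (at q) h))) (at q)"
    if "q \<in> S'" for q
    by (rule has_derivative_compose[OF df dg]) (use that in \<open>auto simp: S'_def\<close>)
  have "((\<lambda>q. g (f q)) has_derivative frechet_derivative (\<lambda>q. g (f q)) (at q)) (at q)" if "q \<in> S'" for q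
    using comp[OF that] frechet_derivative_eq by metis
  moreover have "(\<lambda>q. frechet_derivative (\<lambda>q. g (f q)) (at q) v) differentiable (at p)" for v
  proof -
    obtain D where D: "((\<lambda>q. frechet_derivative f (at q) v) has_derivative D) (at p)"
      using d2f differentiable_def by blast
    have "\<forall>w. \<exists>E. ((\<lambda>y. frechet_derivative g (at y) w) has_derivative E) (at (f p))"
      using d2g differentiable_def by blast
    then obtain E where E: "\<And>w. ((\<lambda>y. frechet_derivative g (at y) w) has_derivative E w) (at (f p))" by metis
    have "((\<lambda>q. frechet_derivative g (at (f q)) w) has_derivative (\<lambda>h. E w (frechet_derivative f (at p) h))) (at p)" for w
      by (rule has_derivative_compose[OF df[OF S(2)] E])
    moreover have "eventually (\<lambda>q. linear (frechet_derivative g (at (f q)))) (nhds p)"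
      using eventually_nhds_in_open[OF S'(1,2)]
      by eventually_elim (use dg has_derivative_linear S'(4) in blast)
    ultimately have "((\<lambda>q. frechet_derivative g (at (f q)) (frechet_derivative f (at q) v)) has_derivative
       (\<lambda>h. E (frechet_derivative f (at p) v) (frechet_derivative f (at p) h) + frechet_derivative g (at (f p)) (D h))) (at p)"
      by (rule has_derivative_linear_family[OF fd _ _ D])
    then have "((\<lambda>q. frechet_derivative (\<lambda>q. g (f q)) (at q) v) has_derivative
       (\<lambda>h. E (frechet_derivative f (at p) v) (frechet_derivative f (at p) h) + frechet_derivative g (at (f p)) (D h))) (at p)"
      by (rule has_derivative_transform_within_open[OF _ S'(1,2)]) (use frechet_derivative_eq[OF comp] in simp)
    then show ?thesis unfolding differentiable_def by blast
  qed
  ultimately show thesis using that S' by blast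
qed

section \<open>The curvature of the Chern connection\<close>

lemma ext_d_1_form:
  "ext_d (\<lambda>q us. A q (us ! 0)) p [v, w]
    = frechet_derivative (\<lambda>q. A q w) (at p) v - frechet_derivative (\<lambda>q. A q v) (at p) w"
  by (simp add: ext_d_def numeral_2_eq_2)

lemma permutes_lessThan_2: "{\<sigma>. \<sigma> permutes {..<2::nat}} = {id, Transposition.transpose 0 1}"
proof -
  have "{..<2::nat} = {0, 1}" by auto
  then show ?thesis by (simp only: permutes_doubleton_iff) auto
qed

lemma wedge_1_1: "wedge m 1 1 \<alpha> \<beta> [v, w] = m (\<alpha> [v]) (\<beta> [w]) - m (\<alpha> [w]) (\<beta> [v])"
proof -
  have "(Transposition.transpose 0 1 :: nat \<Rightarrow> nat) \<noteq> id" by (metis id_apply transpose_apply_first zero_neq_one)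
  then show ?thesis unfolding wedge_def one_add_one permutes_lessThan_2
    by (simp add: sign_swap_id numeral_2_eq_2)
qed

lemma holo_map_on_imp_smooth_map_on:
  assumes M: "complex_manifold M" and N: "complex_manifold N" and f: "holo_map_on M N W f"
  shows "smooth_map_on M N W f"
  unfolding smooth_map_on_def regular_map_on_def
proof (intro conjI ballI impI)
  show "openin (mtop M) W" "f ` W \<subseteq> topspace (mtop N)"
    using f unfolding holo_map_on_def regular_map_on_def by blast+
  fix x c c' assume x: "x \<in> W" and c: "c \<in> atlas M" and c': "c' \<in> atlas N" and xc: "x \<in> fst c \<and> f x \<in> fst c'"
  obtain O' where O': "openin (mtop M) O'" "x \<in> O'" "O' \<subseteq> W \<inter> fst c" "f ` O' \<subseteq> fst c'"
    "holo_on (cstr M) (cstr N) (snd c ` O') (snd c' \<circ> f \<circ> chart_inv c)"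
    using regular_map_onE[OF f[unfolded holo_map_on_def] x c _ c'] xc by blast
  have "smooth_on (snd c ` O') (snd c' \<circ> f \<circ> chart_inv c)"
  proof (rule holo_on_imp_smooth_on[OF _ _ _ _ _ O'(5)])
    show "bounded_linear (cstr M)"
      using M linear_imp_bounded_linear unfolding complex_manifold_def by blast
    show "open (snd c ` O')" using open_image_chart[OF M c O'(1)] O'(3) by blast
  qed (use N in \<open>auto simp: complex_manifold_def\<close>)
  with O' show "\<exists>O'. openin (mtop M) O' \<and> x \<in> O' \<and> O' \<subseteq> W \<inter> fst c \<and> f ` O' \<subseteq> fst c' \<and>
        smooth_on (snd c ` O') (snd c' \<circ> f \<circ> chart_inv c)" by blast
qed

lemma holo_principal_bundle_properties:
  assumes "holo_principal_bundle X G P"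
  shows trivs_local_section: "\<forall>s\<in>trivs P. local_section X P s"
    and trivs_cover: "(\<Union>s\<in>trivs P. fst s) = topspace (mtop X)"
    and trivs_holo: "\<forall>s\<in>trivs P. \<forall>s'\<in>trivs P.
       holo_map_on X (gmfd G) (fst s \<inter> fst s') (\<lambda>x. bdiv G P (snd s x) (snd s' x))"
    and bdiv_unique: "\<forall>p\<in>tot_space P. \<forall>q\<in>tot_space P. bproj P p = bproj P q \<longrightarrow> (\<exists>!a. a \<in> carrier G \<and> q = bact P p a)"
  using assms unfolding holo_principal_bundle_def by - (elim conjE, assumption)+

lemma connection_properties:
  assumes "connection X G P \<theta>" "smooth_section X G P s" "c \<in> atlas X"
  shows connection_linear: "p \<in> snd c ` (fst c \<inter> fst s) \<Longrightarrow> linear (\<theta> s c p)"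
    and connection_smooth: "smooth_on (snd c ` (fst c \<inter> fst s)) (\<lambda>p. \<theta> s c p v)"
    and connection_gauge: "smooth_section X G P s' \<Longrightarrow> p \<in> snd c ` (fst c \<inter> fst s \<inter> fst s') \<Longrightarrow>
      \<theta> s' c p v = Ad G (inv\<^bsub>G\<^esub> (bdiv G P (snd s (chart_inv c p)) (snd s' (chart_inv c p)))) (\<theta> s c p v)
        + left_log_deriv G (\<lambda>p. bdiv G P (snd s (chart_inv c p)) (snd s' (chart_inv c p))) p v"
  using assms unfolding connection_def Let_def by - (elim conjE, blast)+

context complex_Lie
begin

lemma curv_form_eq:
  "curv_form G A p [v, w] = frechet_derivative (\<lambda>q. A q w) (at p) v - frechet_derivative (\<lambda>q. A q v) (at p) w
     + bracket G (A p v) (A p w)"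
proof -
  have "bracket G (A p v) (A p w) - bracket G (A p w) (A p v) = 2 *\<^sub>R bracket G (A p v) (A p w)"
    using bracket_antisym[of "A p w" "A p v"] by (simp add: scaleR_2)
  then show ?thesis unfolding curv_form_def ext_d_1_form wedge_1_1 by simp
qed

lemma left_translation_smooth:
  assumes a: "a \<in> carrier G" and c: "c \<in> atlas (gmfd G)" "a \<in> fst c"
  obtains T where "open T" "snd c a \<in> T" "\<And>y. y \<in> T \<Longrightarrow> inv a \<otimes> chart_inv c y \<in> unit_dom"
    "smooth_on T (\<lambda>y. \<phi> (inv a \<otimes> chart_inv c y))"
proof -
  obtain d where d: "d \<in> atlas (gmfd G)" "inv a \<in> fst d" using exists_chart a by blast
  have "inv a \<otimes> a \<in> unit_dom" using a id_chart by simp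
  note ai = this
  obtain W where W: "open W" "(snd d (inv a), snd c a) \<in> W" "W \<subseteq> snd d ` fst d \<times> snd c ` fst c"
    "\<And>x y. (x, y) \<in> W \<Longrightarrow> chart_inv d x \<otimes> chart_inv c y \<in> unit_dom"
    "holo_on (map_prod I I) I W (\<lambda>p. \<phi> (chart_inv d (fst p) \<otimes> chart_inv c (snd p)))"
    by (rule mult_holo_in_charts[OF d c id_chart(1) ai]) (rule that)
  have di: "chart_inv d (snd d (inv a)) = inv a"
    using chart_inv_chart[OF G_manifold] d by blast
  define T where "T = {y. (snd d (inv a), y) \<in> W}"
  have T: "open T" unfolding T_def
    using continuous_open_vimage[OF W(1), of "\<lambda>u. (snd d (inv a), u)"]
    by (auto simp: vimage_def intro!: continuous_intros)
  have pair: "holo_on I (map_prod I I) T (\<lambda>u. (snd d (inv a), u))"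
    unfolding holo_on_def
  proof
    fix x
    show "\<exists>D. ((\<lambda>u. (snd d (inv a), u)) has_derivative D) (at x) \<and> (\<forall>v. D (I v) = map_prod I I (D v))"
      by (rule exI[of _ "\<lambda>h. (0, h)"]) (auto intro!: derivative_eq_intros simp: I.zero)
  qed
  have "holo_on I I T (\<lambda>u. (\<lambda>p. \<phi> (chart_inv d (fst p) \<otimes> chart_inv c (snd p))) (snd d (inv a), u))"
    by (rule holo_on_compose[OF pair W(5)]) (auto simp: T_def)
  then have "holo_on I I T (\<lambda>y. \<phi> (inv a \<otimes> chart_inv c y))" by (simp add: di)
  then have "smooth_on T (\<lambda>y. \<phi> (inv a \<otimes> chart_inv c y))"
    by (rule holo_on_imp_smooth_on[OF bounded_linear_I finite_dim linear_I I_I T])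
  moreover have "inv a \<otimes> chart_inv c y \<in> unit_dom" if "y \<in> T" for y
    using W(4)[of "snd d (inv a)" y] that by (simp add: T_def di)
  moreover have "snd c a \<in> T" using W(2) by (simp add: T_def)
  ultimately show thesis using that T by blast
qed

text \<open>Near a given point a smooth section differs from a holomorphic one by a gauge transformation
  \<open>a\<close>; splitting off the constant \<open>a p\<close>, which preserves the type of the connection form,
  one may assume that it is trivial at \<open>p\<close>.\<close>

lemma exists_type_10_gauge:
  fixes X :: "('x, 'w::real_normed_vector) cmfd"
  assumes X: "complex_manifold X" and P: "holo_principal_bundle X G P"
    and \<theta>: "chern_connection X G P K h \<theta>"
    and c: "c \<in> atlas X" and s: "smooth_section X G P s" and p: "p \<in> snd c ` (fst c \<inter> fst s)"
  shows "\<exists>A DA S. open S \<and> p \<in> S \<and> (\<forall>q\<in>S. \<forall>v. A q (cstr X v) = I (A q v)) \<and>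
    (\<forall>v. ((\<lambda>q. A q v) has_derivative DA v) (at p)) \<and>
    (\<forall>v w. curv_form G (\<theta> s c) p [v, w] = DA w v - DA v w + bracket G (A p v) (A p w))"
proof -
  obtain x0 where x0: "p = snd c x0" "x0 \<in> fst c" "x0 \<in> fst s" using p by blast
  have "x0 \<in> topspace (mtop X)" using x0 openin_subset[OF open_chart_domain[OF X c]] by blast
  then obtain t where t: "t \<in> trivs P" "x0 \<in> fst t"
    using trivs_cover[OF P] by blast
  have conn: "connection X G P \<theta>" using \<theta> unfolding chern_connection_def by blast
  have locs: "local_section X P s" and loct: "local_section X P t"
    using s t trivs_local_section[OF P] unfolding smooth_section_def by blast+
  have st: "smooth_section X G P t" and ht: "holo_section X G P t"
    using t loct trivs_holo[OF P] holo_map_on_imp_smooth_map_on[OF X G_manifold]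
    unfolding smooth_section_def holo_section_def by blast+
  define a where "a q = bdiv G P (snd t (chart_inv c q)) (snd s (chart_inv c q))" for q
  have acar: "bdiv G P (snd t x) (snd s x) \<in> carrier G" if "x \<in> fst t" "x \<in> fst s" for x
  proof -
    have "snd t x \<in> tot_space P" "snd s x \<in> tot_space P" "bproj P (snd t x) = bproj P (snd s x)"
      using that locs loct unfolding local_section_def by auto
    then have "\<exists>!a. a \<in> carrier G \<and> snd s x = bact P (snd t x) a"
      using bdiv_unique[OF P] by blast
    from theI'[OF this] show ?thesis unfolding bdiv_def by blast
  qed
  have trans: "\<theta> s c q v = Ad G (inv (a q)) (\<theta> t c q v) + left_log_deriv G a q v"
    if "q \<in> snd c ` (fst c \<inter> fst t \<inter> fst s)" for q v
    unfolding a_def by (rule connection_gauge[OF conn st c s that])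
  have "bdiv G P (snd t x0) (snd s x0) \<in> carrier G" using acar t x0 by blast
  then have a0: "a p \<in> carrier G" using chart_inv_chart[OF X c x0(2)] by (simp add: a_def x0(1))
  obtain c' where c': "c' \<in> atlas (gmfd G)" "a p \<in> fst c'" using exists_chart[OF a0] by blast
  have "smooth_map_on X (gmfd G) (fst t \<inter> fst s) (\<lambda>x. bdiv G P (snd t x) (snd s x))"
    using s t unfolding smooth_section_def by blast
  then have "regular_map_on smooth_on X (gmfd G) (fst t \<inter> fst s) (\<lambda>x. bdiv G P (snd t x) (snd s x))"
    unfolding smooth_map_on_def .
  moreover have "x0 \<in> fst t \<inter> fst s" using t x0 by blast
  moreover have "bdiv G P (snd t x0) (snd s x0) \<in> fst c'"
    using c' chart_inv_chart[OF X c x0(2)] by (simp add: a_def x0(1))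
  ultimately obtain O' where O': "openin (mtop X) O'" "x0 \<in> O'" "O' \<subseteq> (fst t \<inter> fst s) \<inter> fst c"
    "(\<lambda>x. bdiv G P (snd t x) (snd s x)) ` O' \<subseteq> fst c'"
    "smooth_on (snd c ` O') (snd c' \<circ> (\<lambda>x. bdiv G P (snd t x) (snd s x)) \<circ> chart_inv c)"
    using regular_map_onE[OF _ _ c x0(2) c'(1)] by blast
  define S1 where "S1 = snd c ` O'"
  have S1: "open S1" "p \<in> S1" unfolding S1_def
    using open_image_chart[OF X c O'(1)] O'(2,3) x0(1) by blast+
  have S1sub: "S1 \<subseteq> snd c ` (fst c \<inter> fst t \<inter> fst s)" unfolding S1_def using O'(3) by blast
  \<comment> \<open>\<open>a\<close> is read in a chart around \<open>a p\<close> as \<open>w\<close>, and \<open>a p\<^sup>-\<^sup>1 a\<close> in the chart at the unit as \<open>u\<close>.\<close>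
  define w where "w q = snd c' (a q)" for q
  have "w = snd c' \<circ> (\<lambda>x. bdiv G P (snd t x) (snd s x)) \<circ> chart_inv c"
    by (auto simp: w_def a_def)
  then have wsm: "smooth_on S1 w" unfolding S1_def using O'(5) by simp
  have ac': "a q \<in> fst c'" "a q \<in> carrier G" if qS: "q \<in> S1" for q
  proof -
    obtain x where x: "q = snd c x" "x \<in> O'" using qS unfolding S1_def by blast
    then have "x \<in> fst c" using O'(3) by blast
    then have "a q = bdiv G P (snd t x) (snd s x)"
      unfolding a_def x(1) by (simp add: chart_inv_chart[OF X c])
    then show "a q \<in> fst c'" using x O'(4) by blast
    then show "a q \<in> carrier G" by (rule chart_dom_carrier[OF c'(1)])
  qed
  obtain T where T: "open T" "snd c' (a p) \<in> T" "\<And>y. y \<in> T \<Longrightarrow> inv (a p) \<otimes> chart_inv c' y \<in> unit_dom"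
    "smooth_on T (\<lambda>y. \<phi> (inv (a p) \<otimes> chart_inv c' y))"
    by (rule left_translation_smooth[OF a0 c']) (rule that)
  define u where "u q = \<phi> (inv (a p) \<otimes> chart_inv c' (w q))" for q
  obtain S' where S': "open S'" "p \<in> S'" "S' \<subseteq> S1" "w ` S' \<subseteq> T"
    "\<And>q. q \<in> S' \<Longrightarrow> (u has_derivative frechet_derivative u (at q)) (at q)"
    "\<And>v. (\<lambda>q. frechet_derivative u (at q) v) differentiable (at p)"
    unfolding u_def using smooth_compose_twice[OF finite_dim S1 T(1) _ wsm T(4)] T(2) w_def by metis
  have aw: "chart_inv c' (w q) = a q" if "q \<in> S1" for q
    unfolding w_def using chart_inv_chart[OF G_manifold c'(1) ac'(1)[OF that]] .
  have ub: "\<psi> (u q) = inv (a p) \<otimes> a q" "u q = \<phi> (inv (a p) \<otimes> a q)" "a q \<in> carrier G" if "q \<in> S'" for q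
  proof -
    have q: "q \<in> S1" "w q \<in> T" using that S'(3,4) by auto
    have "inv (a p) \<otimes> a q \<in> unit_dom" using T(3)[OF q(2)] aw[OF q(1)] by simp
    with q show "\<psi> (u q) = inv (a p) \<otimes> a q" "u q = \<phi> (inv (a p) \<otimes> a q)" "a q \<in> carrier G"
      unfolding u_def using T(3) aw ac'(2) by auto
  qed
  have up: "u p = e" using ub(2)[OF S'(2)] a0 by simp
  have "continuous_on S' u"
    using S'(5) has_derivative_continuous by (intro continuous_at_imp_continuous_on) blast
  then have oS: "open (S' \<inter> u -` V2)" using S'(1) unit_nbhds(8) by (simp add: continuous_on_open_vimage Int_commute)
  define S where "S = S' \<inter> u -` V2"
  have S: "open S" "p \<in> S" "S \<subseteq> S'" using oS S'(2) up unit_nbhds(9) by (auto simp: S_def)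
  have uV2: "u q \<in> V2" if "q \<in> S" for q using that by (auto simp: S_def)
  have uV: "u q \<in> V" "linv (u q) \<in> V" if "q \<in> S" for q
    using uV2[OF that] unit_nbhds(10,11) by auto
  define A where "A q v = Ad G (inv (a p)) (\<theta> t c q v)" for q v
  obtain D2u where D2u: "\<And>v. ((\<lambda>q. frechet_derivative u (at q) v) has_derivative D2u v) (at p)"
    using S'(6) unfolding differentiable_def by metis
  have "smooth_on (snd c ` (fst c \<inter> fst t)) (\<lambda>q. \<theta> t c q v)" for v
    by (rule connection_smooth[OF conn st c])
  then have "\<exists>D. ((\<lambda>q. \<theta> t c q v) has_derivative D) (at p)" for v
    using smooth_on_differentiable[of "snd c ` (fst c \<inter> fst t)" _ p] x0 t(2) unfolding differentiable_def by blast
  then obtain D\<theta> where D\<theta>: "\<And>v. ((\<lambda>q. \<theta> t c q v) has_derivative D\<theta> v) (at p)" by metis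
  have Adb: "bounded_linear (Ad G (inv (a p)))" using a0 by (intro bounded_linear_Ad) simp
  have DA: "((\<lambda>q. A q v) has_derivative (\<lambda>h. Ad G (inv (a p)) (D\<theta> v h))) (at p)" for v
    unfolding A_def by (rule bounded_linear.has_derivative[OF Adb D\<theta>])
  have lld: "left_log_deriv G a q v = Dm (linv (u q), u q) (0, frechet_derivative u (at q) v)" if q: "q \<in> S" for q v
  proof -
    have "((\<lambda>q'. lmul (linv (u q), u q')) has_derivative (\<lambda>h. Dm (linv (u q), u q) (0, frechet_derivative u (at q) h))) (at q)"
      by (rule has_derivative_pair[OF lmul_has_derivative has_derivative_const S'(5)]) (use uV[OF q] q S(3) in auto)
    then have "((\<lambda>q'. \<phi> (inv (a q) \<otimes> a q')) has_derivative (\<lambda>h. Dm (linv (u q), u q) (0, frechet_derivative u (at q) h))) (at q)"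
    proof (rule has_derivative_transform_within_open[OF _ S(1) q])
      fix q' assume q': "q' \<in> S"
      have "\<psi> (linv (u q)) \<otimes> \<psi> (u q') = inv (inv (a p) \<otimes> a q) \<otimes> (inv (a p) \<otimes> a q')"
        using uV(1)[OF q] ub(1)[OF subsetD[OF S(3) q]] ub(1)[OF subsetD[OF S(3) q']] by (simp add: psi_linv)
      also have "\<dots> = inv (a q) \<otimes> a q'"
      proof -
        have "a q \<in> carrier G" "a q' \<in> carrier G" using ub(3) q q' S(3) by blast+
        then show ?thesis using a0 by (simp add: inv_mult_group m_assoc) (simp flip: m_assoc)
      qed
      finally show "lmul (linv (u q), u q') = \<phi> (inv (a q) \<otimes> a q')" by (simp add: lmul_def)
    qed
    from frechet_derivative_eq[OF this] show ?thesis unfolding left_log_deriv_def by simp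
  qed
  have A\<theta>: "\<theta> s c q v = Ad G (inv (\<psi> (u q))) (A q v) + Dm (linv (u q), u q) (0, frechet_derivative u (at q) v)"
    if q: "q \<in> S" for q v
  proof -
    have aq: "a q \<in> carrier G" "\<psi> (u q) = inv (a p) \<otimes> a q" using ub(1,3)[OF subsetD[OF S(3) q]] by auto
    have "inv (\<psi> (u q)) \<otimes> inv (a p) = inv (a q)"
      using aq a0 by (simp add: inv_mult_group m_assoc)
    then have "Ad G (inv (\<psi> (u q))) (A q v) = Ad G (inv (a q)) (\<theta> t c q v)"
      unfolding A_def using aq a0 by (subst Ad_mult[symmetric]) auto
    moreover have "q \<in> snd c ` (fst c \<inter> fst t \<inter> fst s)" using q S(3) S'(3) S1sub by blast
    ultimately show ?thesis using trans[of q v] lld[OF q] by simp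
  qed
  have "\<exists>DB. (\<forall>v. ((\<lambda>q. \<theta> s c q v) has_derivative DB v) (at p)) \<and>
    (\<forall>v w. DB w v - DB v w + bracket G (\<theta> s c p v) (\<theta> s c p w)
      = Ad G (inv (a p)) (D\<theta> w v) - Ad G (inv (a p)) (D\<theta> v w) + bracket G (A p v) (A p w))"
  proof (rule gauge_transformed_curvature[OF S(1,2) up uV2 _ D2u DA A\<theta>])
    show "(u has_derivative frechet_derivative u (at q)) (at q)" if "q \<in> S" for q
      by (rule S'(5)[OF subsetD[OF S(3) that]])
  qed
  then obtain DB where DB0: "\<forall>v. ((\<lambda>q. \<theta> s c q v) has_derivative DB v) (at p)"
    "\<forall>v w. DB w v - DB v w + bracket G (\<theta> s c p v) (\<theta> s c p w)
      = Ad G (inv (a p)) (D\<theta> w v) - Ad G (inv (a p)) (D\<theta> v w) + bracket G (A p v) (A p w)"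
    by (elim exE conjE) (rule that)
  note DB = DB0[rule_format]
  have I10: "A q (cstr X v) = I (A q v)" if "q \<in> S" for q v
  proof -
    have "q \<in> snd c ` (fst c \<inter> fst t)" using that S(3) S'(3) S1sub by blast
    then have "\<theta> t c q (cstr X v) = I (\<theta> t c q v)"
      using \<theta> ht c unfolding chern_connection_def by blast
    then show ?thesis unfolding A_def using Ad_I[of "inv (a p)"] a0 by simp
  qed
  have "curv_form G (\<theta> s c) p [v, w] = Ad G (inv (a p)) (D\<theta> w v) - Ad G (inv (a p)) (D\<theta> v w) + bracket G (A p v) (A p w)" for v w
    unfolding curv_form_eq frechet_derivative_eq[OF DB(1)] by (rule DB(2))
  with I10 DA S(1,2) show ?thesis
    by (intro exI[of _ A] exI[of _ "\<lambda>v h. Ad G (inv (a p)) (D\<theta> v h)"] exI[of _ S]) blast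
qed

text \<open>A connection form of type \<open>(1, 0)\<close> has a curvature without \<open>(0, 2)\<close>-part, i.e.
  \<open>F v w - F (J v) (J w) + I (F (J v) w + F v (J w)) = 0\<close>; since the values of \<open>F\<close> lie in a real form,
  both summands vanish separately.\<close>

lemma chern_curvature_type_11:
  fixes X :: "('x, 'w::real_normed_vector) cmfd"
  assumes X: "complex_manifold X" and P: "holo_principal_bundle X G P"
    and K: "subgroup K G" "complexification_of G K"
    and \<theta>: "chern_connection X G P K h \<theta>"
    and c: "c \<in> atlas X" and s: "reduced_section X G P h s" and p: "p \<in> snd c ` (fst c \<inter> fst s)"
  shows "curv_form G (\<theta> s c) p [cstr X v, cstr X w] = curv_form G (\<theta> s c) p [v, w]"
proof -
  let ?J = "cstr X" and ?F = "\<lambda>v w. curv_form G (\<theta> s c) p [v, w]"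
  have ss: "smooth_section X G P s" using s unfolding reduced_section_def by blast
  have "openin (mtop X) (fst c \<inter> fst s)"
    using open_chart_domain[OF X c] ss unfolding smooth_section_def local_section_def by blast
  from open_image_chart[OF X c this] have op: "open (snd c ` (fst c \<inter> fst s))" by blast
  have conn: "connection X G P \<theta>" using \<theta> unfolding chern_connection_def by blast
  have sub: "subspace (lie_algebra G K)" by (rule subspace_lie_algebra[OF K(1)])
  have Ak: "\<theta> s c q v \<in> lie_algebra G K" if "q \<in> snd c ` (fst c \<inter> fst s)" for q v
    using \<theta> s c that unfolding chern_connection_def by blast
  have Fk: "?F v w \<in> lie_algebra G K" for v w
  proof -
    have der: "((\<lambda>q. \<theta> s c q v) has_derivative frechet_derivative (\<lambda>q. \<theta> s c q v) (at p)) (at p)" for v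
    proof -
      have "smooth_on (snd c ` (fst c \<inter> fst s)) (\<lambda>q. \<theta> s c q v)"
        by (rule connection_smooth[OF conn ss c])
      from smooth_on_differentiable[OF this p] show ?thesis using frechet_derivative_works by blast
    qed
    have "frechet_derivative (\<lambda>q. \<theta> s c q v) (at p) w \<in> lie_algebra G K" for v w
      by (rule derivative_in_subspace[OF finite_dim sub der])
        (use eventually_nhds_in_open[OF op p] Ak in \<open>auto elim!: eventually_mono\<close>)
    then show ?thesis unfolding curv_form_eq
      using bracket_lie_algebra[OF K(1)] Ak[OF p] by (intro subspace_add[OF sub] subspace_diff[OF sub]) auto
  qed
  obtain A DA S where S: "open S" "p \<in> S" and A10: "\<And>q v. q \<in> S \<Longrightarrow> A q (?J v) = I (A q v)"
    and DA: "\<And>v. ((\<lambda>q. A q v) has_derivative DA v) (at p)"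
    and F: "\<And>v w. ?F v w = DA w v - DA v w + bracket G (A p v) (A p w)"
    using exists_type_10_gauge[OF X P \<theta> c ss p] by blast
  have DAJ: "DA (?J v) h = I (DA v h)" for v h
  proof -
    have "((\<lambda>q. I (A q v)) has_derivative (\<lambda>h. I (DA v h))) (at p)"
      by (rule I.has_derivative[OF DA])
    then have "((\<lambda>q. A q (?J v)) has_derivative (\<lambda>h. I (DA v h))) (at p)"
      by (rule has_derivative_transform_within_open[OF _ S]) (simp add: A10)
    then show ?thesis using has_derivative_unique[OF DA] by metis
  qed
  have "?F v w - ?F (?J v) (?J w) + I (?F (?J v) w + ?F v (?J w)) = 0"
    by (simp add: F DAJ A10[OF S(2)] bracket_I_left bracket_I_right I.add I.diff)
  then have "?F v w - ?F (?J v) (?J w) = 0"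
    by (rule real_form_trivial_intersection[OF K(2,1), rotated 2])
      (use Fk in \<open>auto intro!: subspace_add[OF sub] subspace_diff[OF sub]\<close>)
  then show "?F (?J v) (?J w) = ?F v w" by simp
qed

end

section \<open>Orthonormal bases\<close>

definition inner_form :: "('a::real_vector \<Rightarrow> 'a \<Rightarrow> real) \<Rightarrow> bool" where
  "inner_form m \<longleftrightarrow> (\<forall>w. linear (\<lambda>v. m v w)) \<and> (\<forall>v w. m v w = m w v) \<and> (\<forall>v. v \<noteq> 0 \<longrightarrow> m v v > 0)"

definition orthonormal_basis :: "('a::real_vector \<Rightarrow> 'a \<Rightarrow> real) \<Rightarrow> 'a set \<Rightarrow> bool" where
  "orthonormal_basis m E \<longleftrightarrow> span E = UNIV \<and> (\<forall>e\<in>E. \<forall>f\<in>E. m e f = (if e = f then 1 else 0))"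

lemma inner_formD:
  assumes "inner_form m"
  shows inner_form_linear_left: "linear (\<lambda>v. m v w)" and inner_form_linear_right: "linear (m w)"
    and inner_form_sym: "m v w = m w v" and inner_form_pos: "v \<noteq> 0 \<Longrightarrow> m v v > 0"
proof -
  show l: "linear (\<lambda>v. m v w)" for w using assms unfolding inner_form_def by blast
  show s: "m v w = m w v" for v w using assms unfolding inner_form_def by blast
  have "m w = (\<lambda>v. m v w)" using s by (intro ext)
  then show "linear (m w)" using l[of w] by metis
  show "v \<noteq> 0 \<Longrightarrow> m v v > 0" using assms unfolding inner_form_def by blast
qed

lemma inner_form_bilinear:
  assumes "inner_form m"
  shows "m (x + y) z = m x z + m y z" "m z (x + y) = m z x + m z y"
    "m (c *\<^sub>R x) z = c * m x z" "m z (c *\<^sub>R x) = c * m z x"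
    "m (x - y) z = m x z - m y z" "m z (x - y) = m z x - m z y"
    "m (- x) z = - m x z" "m z (- x) = - m z x" "m 0 z = 0" "m z 0 = 0"
  using linear_add[OF inner_form_linear_left[OF assms]] linear_add[OF inner_form_linear_right[OF assms]]
    linear_scale[OF inner_form_linear_left[OF assms]] linear_scale[OF inner_form_linear_right[OF assms]]
    linear_diff[OF inner_form_linear_left[OF assms]] linear_diff[OF inner_form_linear_right[OF assms]]
    linear_neg[OF inner_form_linear_left[OF assms]] linear_neg[OF inner_form_linear_right[OF assms]]
    linear_0[OF inner_form_linear_left[OF assms]] linear_0[OF inner_form_linear_right[OF assms]]
  by auto

lemma inner_form_sum:
  assumes "inner_form m"
  shows "m (\<Sum>i\<in>A. c i *\<^sub>R x i) z = (\<Sum>i\<in>A. c i * m (x i) z)"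
  using linear_sum[OF inner_form_linear_left[OF assms], of "\<lambda>i. c i *\<^sub>R x i" A z] by (simp add: inner_form_bilinear[OF assms])

lemma inner_form_eqI:
  assumes "inner_form m" "\<And>w. m x w = m y w" shows "x = y"
proof (rule ccontr)
  assume "x \<noteq> y"
  then have "m (x - y) (x - y) > 0" using assms by (intro inner_form_pos) auto
  then show False using assms by (simp add: inner_form_bilinear)
qed

lemma orthonormal_independent:
  assumes m: "inner_form m" and E: "\<forall>e\<in>E. \<forall>f\<in>E. m e f = (if e = f then 1 else 0)"
  shows "independent E"
  unfolding independent_explicit_module
proof (intro allI impI)
  fix t u v assume t: "finite t" "t \<subseteq> E" and s: "(\<Sum>v\<in>t. u v *\<^sub>R v) = 0" and v: "v \<in> t"
  have "0 = m (\<Sum>v\<in>t. u v *\<^sub>R v) v" using s by (simp add: inner_form_bilinear[OF m])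
  also have "\<dots> = (\<Sum>w\<in>t. u w * m w v)" by (rule inner_form_sum[OF m])
  also have "\<dots> = (\<Sum>w\<in>t. if w = v then u w else 0)"
    using E t v by (intro sum.cong) (auto simp: subset_iff)
  also have "\<dots> = u v" using t v by simp
  finally show "u v = 0" by simp
qed

lemma span_finite_coefficients:
  assumes "finite E" "span E = UNIV"
  obtains c where "v = (\<Sum>e\<in>E. c e *\<^sub>R e)"
proof -
  have "v \<in> range (\<lambda>u. \<Sum>v\<in>E. u v *\<^sub>R v)" using span_finite[OF assms(1)] assms(2) by simp
  then show thesis using that by blast
qed

context
  fixes m :: "'a::euclidean_space \<Rightarrow> 'a \<Rightarrow> real" and E
  assumes m: "inner_form m" and E: "orthonormal_basis m E"
begin

lemma orthonormal_basis_D: "e \<in> E \<Longrightarrow> f \<in> E \<Longrightarrow> m e f = (if e = f then 1 else 0)"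
  using E unfolding orthonormal_basis_def by blast

lemma finite_orthonormal_basis: "finite E"
  and card_orthonormal_basis: "card E = DIM('a)"
proof -
  have i: "independent E"
    using orthonormal_independent[OF m] E unfolding orthonormal_basis_def by blast
  then show "finite E" by (rule independent_imp_finite)
  show "card E = DIM('a)"
    using basis_card_eq_dim[OF _ _ i, of UNIV] E by (simp add: orthonormal_basis_def)
qed

lemma orthonormal_expansion: "v = (\<Sum>e\<in>E. m v e *\<^sub>R e)"
proof -
  obtain c where c: "v = (\<Sum>e\<in>E. c e *\<^sub>R e)"
    using E span_finite_coefficients[OF finite_orthonormal_basis] unfolding orthonormal_basis_def by metis
  have "m v e = c e" if "e \<in> E" for e
  proof -
    have "m v e = (\<Sum>f\<in>E. c f * m f e)" unfolding c by (rule inner_form_sum[OF m])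
    also have "\<dots> = (\<Sum>f\<in>E. if f = e then c f else 0)"
      using that orthonormal_basis_D by (intro sum.cong) auto
    finally show ?thesis using that finite_orthonormal_basis by simp
  qed
  then show ?thesis using c by (metis (no_types, lifting) sum.cong)
qed

lemma linear_orthonormal_expansion:
  assumes "linear f" shows "f v = (\<Sum>e\<in>E. m v e *\<^sub>R f e)"
  using arg_cong[OF orthonormal_expansion[of v], of f]
  by (simp add: linear_sum[OF assms] linear_scale[OF assms])

lemma parseval: "m v w = (\<Sum>e\<in>E. m v e * m w e)"
  using linear_orthonormal_expansion[OF inner_form_linear_left[OF m], of v w]
  by (simp add: inner_form_sym[OF m])

end

text \<open>The trace of a bilinear map with respect to one metric, computed in a basis which is
  orthonormal for another one: expand \<open>P b\<close> in the first basis and resum in the second.\<close>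

lemma trace_change_of_basis:
  fixes m :: "'a::euclidean_space \<Rightarrow> 'a \<Rightarrow> real" and f :: "'a \<Rightarrow> 'a \<Rightarrow> 'b::real_vector"
  assumes m: "inner_form m" and E: "orthonormal_basis m E"
    and m0: "inner_form m0" and E0: "orthonormal_basis m0 E0"
    and P: "\<And>b w. m (P b) w = m0 b w"
    and f: "\<And>y. linear (\<lambda>x. f x y)" "\<And>x. linear (f x)"
  shows "(\<Sum>e\<in>E. f e e) = (\<Sum>b\<in>E0. f b (P b))"
proof -
  have "(\<Sum>b\<in>E0. f b (P b)) = (\<Sum>b\<in>E0. \<Sum>e\<in>E. m0 b e *\<^sub>R f b e)"
    by (rule sum.cong[OF refl]) (simp add: linear_orthonormal_expansion[OF m E f(2), of _ "P _"] P)
  also have "\<dots> = (\<Sum>e\<in>E. \<Sum>b\<in>E0. m0 b e *\<^sub>R f b e)" by (rule sum.swap)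
  also have "\<dots> = (\<Sum>e\<in>E. f (\<Sum>b\<in>E0. m0 e b *\<^sub>R b) e)"
    by (simp add: linear_sum[OF f(1)] linear_scale[OF f(1)] inner_form_sym[OF m0])
  also have "\<dots> = (\<Sum>e\<in>E. f e e)" by (simp flip: orthonormal_expansion[OF m0 E0])
  finally show ?thesis ..
qed

text \<open>A maximal orthonormal set spans.\<close>

lemma exists_orthonormal_basis:
  assumes m: "inner_form (m :: 'a::euclidean_space \<Rightarrow> 'a \<Rightarrow> real)"
  shows "\<exists>E. orthonormal_basis m E"
proof -
  let ?Q = "\<lambda>E. \<forall>e\<in>E. \<forall>f\<in>E. m e f = (if e = f then 1 else 0)"
  have bd: "card E \<le> DIM('a)" if "?Q E" for E
    using independent_bound[OF orthonormal_independent[OF m that]] by blast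
  have "?Q {}" by simp
  from ex_has_greatest_nat[where P = ?Q and f = card and b = "Suc (DIM('a))", OF this]
  obtain E where E: "?Q E" "\<And>E'. ?Q E' \<Longrightarrow> card E' \<le> card E" using bd by (auto simp: less_Suc_eq_le)
  have fin: "finite E" using independent_imp_finite orthonormal_independent[OF m E(1)] by blast
  have "v \<in> span E" for v
  proof (rule ccontr)
    assume v: "v \<notin> span E"
    define w where "w = v - (\<Sum>e\<in>E. m v e *\<^sub>R e)"
    have "(\<Sum>e\<in>E. m v e *\<^sub>R e) \<in> span E" by (intro span_sum span_scale span_base)
    then have "w \<noteq> 0" using v unfolding w_def by auto
    then have pos: "m w w > 0" by (rule inner_form_pos[OF m])
    have we: "m w e = 0" if "e \<in> E" for e
    proof -
      have "m (\<Sum>e\<in>E. m v e *\<^sub>R e) e = (\<Sum>f\<in>E. m v f * m f e)" by (rule inner_form_sum[OF m])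
      also have "\<dots> = (\<Sum>f\<in>E. if f = e then m v f else 0)"
        using that E(1) by (intro sum.cong) auto
      finally show ?thesis using that fin by (simp add: w_def inner_form_bilinear[OF m])
    qed
    define u where "u = (1 / sqrt (m w w)) *\<^sub>R w"
    have uu: "m u u = 1" using pos by (simp add: u_def inner_form_bilinear[OF m])
    have ue: "m u e = 0" "m e u = 0" if "e \<in> E" for e
      using we[OF that] inner_form_sym[OF m] by (simp_all add: u_def inner_form_bilinear[OF m])
    have "u \<notin> E" using uu ue by force
    moreover have "?Q (insert u E)" using E(1) uu ue \<open>u \<notin> E\<close> by auto
    ultimately show False using E(2)[of "insert u E"] fin by simp
  qed
  then show ?thesis using E(1) unfolding orthonormal_basis_def by (intro exI[of _ E]) auto
qed

section \<open>Multilinear and alternating forms on lists\<close>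

text \<open>Sums over \<open>Ls E k\<close>, with \<open>E\<close> an orthonormal basis, are iterated traces.  As a form is a function on lists of
  all lengths, the degree is a parameter of the predicates below.\<close>

definition Ls :: "'a set \<Rightarrow> nat \<Rightarrow> 'a list set" where "Ls E k = {es. set es \<subseteq> E \<and> length es = k}"

definition mlin :: "nat \<Rightarrow> ('a::real_vector list \<Rightarrow> 'b::real_vector) \<Rightarrow> bool" where
  "mlin k \<alpha> \<longleftrightarrow> (\<forall>us vs. length us + Suc (length vs) = k \<longrightarrow> linear (\<lambda>x. \<alpha> (us @ x # vs)))"

definition alt :: "nat \<Rightarrow> ('a list \<Rightarrow> 'b::real_vector) \<Rightarrow> bool" where
  "alt k \<alpha> \<longleftrightarrow> (\<forall>ws \<sigma>. length ws = k \<longrightarrow> \<sigma> permutes {..<k} \<longrightarrow>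
      \<alpha> (permute_list \<sigma> ws) = of_int (sign \<sigma>) *\<^sub>R \<alpha> ws)"

lemma finite_Ls: "finite E \<Longrightarrow> finite (Ls E k)"
  unfolding Ls_def by (rule finite_lists_length_eq)

lemma length_Ls: "ws \<in> Ls E k \<Longrightarrow> length ws = k" by (simp add: Ls_def)

lemma Ls_0: "Ls E 0 = {[]}" by (auto simp: Ls_def)

lemma sum_Ls_Suc: "(\<Sum>es\<in>Ls E (Suc k). f es) = (\<Sum>e\<in>E. \<Sum>es\<in>Ls E k. f (e # es))"
proof -
  have "(\<Sum>e\<in>E. \<Sum>es\<in>Ls E k. f (e # es)) = (\<Sum>(e, es)\<in>E \<times> Ls E k. f (e # es))"
    by (rule sum.cartesian_product)
  also have "\<dots> = (\<Sum>es\<in>Ls E (Suc k). f es)"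
    by (rule sum.reindex_bij_witness[of _ "\<lambda>es. (hd es, tl es)" "\<lambda>(e, es). e # es"])
      (auto simp: Ls_def length_Suc_conv)
  finally show ?thesis ..
qed

lemma sum_Ls_add: "(\<Sum>es\<in>Ls E (k + l). f es) = (\<Sum>us\<in>Ls E k. \<Sum>vs\<in>Ls E l. f (us @ vs))"
  by (induction k arbitrary: f) (simp_all add: Ls_0 sum_Ls_Suc)

lemma sum_Ls_1: "(\<Sum>es\<in>Ls E (Suc 0). f es) = (\<Sum>e\<in>E. f [e])"
  and sum_Ls_2: "(\<Sum>es\<in>Ls E 2. f es) = (\<Sum>e\<in>E. \<Sum>e'\<in>E. f [e, e'])"
  by (simp_all add: sum_Ls_Suc Ls_0 numeral_2_eq_2)

lemma permute_list_Ls: "\<sigma> permutes {..<k} \<Longrightarrow> ws \<in> Ls E k \<Longrightarrow> permute_list \<sigma> ws \<in> Ls E k"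
  unfolding Ls_def using set_permute_list by auto

lemma sum_Ls_permute:
  assumes "\<sigma> permutes {..<k}"
  shows "(\<Sum>ws\<in>Ls E k. f (permute_list \<sigma> ws)) = (\<Sum>ws\<in>Ls E k. f ws)"
proof -
  have inv: "inv_into UNIV \<sigma> permutes {..<k}" by (rule permutes_inv[OF assms])
  have 1: "permute_list \<sigma> (permute_list (inv_into UNIV \<sigma>) ws) = ws"
    "permute_list (inv_into UNIV \<sigma>) (permute_list \<sigma> ws) = ws" if "ws \<in> Ls E k" for ws
    using permute_list_compose[of \<sigma> ws "inv_into UNIV \<sigma>"] permute_list_compose[of "inv_into UNIV \<sigma>" ws \<sigma>]
      length_Ls[OF that] assms inv permutes_inv_o[OF assms] by simp_all
  show ?thesis
    by (rule sum.reindex_bij_witness[of _ "permute_list (inv_into UNIV \<sigma>)" "permute_list \<sigma>"])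
      (use 1 permute_list_Ls assms inv in auto)
qed

lemma mlinD: "mlin k \<alpha> \<Longrightarrow> length us + Suc (length vs) = k \<Longrightarrow> linear (\<lambda>x. \<alpha> (us @ x # vs))"
  unfolding mlin_def by blast

lemma mlin_Cons: "mlin (Suc k) \<alpha> \<Longrightarrow> mlin k (\<lambda>vs. \<alpha> (x # vs))"
  using mlinD[of "Suc k" \<alpha> "x # us" for us] by (simp add: mlin_def)

lemma mlin_append_left:
  assumes "mlin (k + length ws) \<alpha>" shows "mlin k (\<lambda>us. \<alpha> (us @ ws))"
  using mlinD[OF assms, of us "vs @ ws" for us vs] by (simp add: mlin_def)

text \<open>The change of basis for traces, one slot after the other.\<close>

lemma trace_list_change_of_basis:
  fixes F :: "'a::euclidean_space list \<Rightarrow> 'a list \<Rightarrow> 'b::real_vector"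
  assumes m: "inner_form m" "orthonormal_basis m E" and m0: "inner_form m0" "orthonormal_basis m0 E0"
    and P: "\<And>b w. m (P b) w = m0 b w"
    and F: "\<And>vs. length vs = k \<Longrightarrow> mlin k (\<lambda>us. F us vs)" "\<And>us. length us = k \<Longrightarrow> mlin k (F us)"
  shows "(\<Sum>es\<in>Ls E k. F es es) = (\<Sum>bs\<in>Ls E0 k. F bs (map P bs))"
  using F
proof (induction k arbitrary: F)
  case 0
  then show ?case by (simp add: Ls_0)
next
  case (Suc k)
  have "(\<Sum>es\<in>Ls E (Suc k). F es es) = (\<Sum>e\<in>E. \<Sum>es\<in>Ls E k. F (e # es) (e # es))"
    by (rule sum_Ls_Suc)
  also have "\<dots> = (\<Sum>e\<in>E. \<Sum>bs\<in>Ls E0 k. F (e # bs) (e # map P bs))"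
  proof (rule sum.cong[OF refl])
    fix e assume "e \<in> E"
    show "(\<Sum>es\<in>Ls E k. F (e # es) (e # es)) = (\<Sum>bs\<in>Ls E0 k. F (e # bs) (e # map P bs))"
    proof (rule Suc.IH[where F = "\<lambda>us vs. F (e # us) (e # vs)"])
      show "mlin k (\<lambda>us. F (e # us) (e # vs))" if "length vs = k" for vs
        using Suc.prems(1)[of "e # vs"] that by (intro mlin_Cons[where \<alpha> = "\<lambda>us. F us (e # vs)"]) simp
      show "mlin k (\<lambda>vs. F (e # us) (e # vs))" if "length us = k" for us
        using Suc.prems(2)[of "e # us"] that by (intro mlin_Cons) simp
    qed
  qed
  also have "\<dots> = (\<Sum>bs\<in>Ls E0 k. \<Sum>e\<in>E. F (e # bs) (e # map P bs))" by (rule sum.swap)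
  also have "\<dots> = (\<Sum>bs\<in>Ls E0 k. \<Sum>b\<in>E0. F (b # bs) (P b # map P bs))"
  proof (rule sum.cong[OF refl])
    fix bs assume bs: "bs \<in> Ls E0 k"
    show "(\<Sum>e\<in>E. F (e # bs) (e # map P bs)) = (\<Sum>b\<in>E0. F (b # bs) (P b # map P bs))"
    proof (rule trace_change_of_basis[OF m m0 P, where f = "\<lambda>x y. F (x # bs) (y # map P bs)"])
      show "linear (\<lambda>x. F (x # bs) (y # map P bs))" for y
        using mlinD[OF Suc.prems(1)[of "y # map P bs"], of "[]" bs] length_Ls[OF bs] by simp
      show "linear (\<lambda>y. F (x # bs) (y # map P bs))" for x
        using mlinD[OF Suc.prems(2)[of "x # bs"], of "[]" "map P bs"] length_Ls[OF bs] by simp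
    qed
  qed
  also have "\<dots> = (\<Sum>b\<in>E0. \<Sum>bs\<in>Ls E0 k. F (b # bs) (P b # map P bs))" by (rule sum.swap)
  also have "\<dots> = (\<Sum>bs\<in>Ls E0 (Suc k). F bs (map P bs))" by (simp add: sum_Ls_Suc)
  finally show ?case .
qed

lemma mlin_eq_on_basis:
  fixes \<alpha> \<beta> :: "'a::euclidean_space list \<Rightarrow> 'b::real_vector"
  assumes m: "inner_form m" "orthonormal_basis m E" and "mlin k \<alpha>" "mlin k \<beta>"
    and "\<And>es. es \<in> Ls E k \<Longrightarrow> \<alpha> es = \<beta> es" and "length vs = k"
  shows "\<alpha> vs = \<beta> vs"
  using assms(3-)
proof (induction k arbitrary: \<alpha> \<beta> vs)
  case 0
  then show ?case by (simp add: Ls_0)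
next
  case (Suc k)
  obtain v ws where vs: "vs = v # ws" "length ws = k" using Suc.prems(4) by (cases vs) auto
  have "\<alpha> (e # ws) = \<beta> (e # ws)" if "e \<in> E" for e
    by (rule Suc.IH[OF mlin_Cons[OF Suc.prems(1)] mlin_Cons[OF Suc.prems(2)] _ vs(2)])
      (use Suc.prems(3) that in \<open>auto simp: Ls_def\<close>)
  moreover have "linear (\<lambda>x. \<alpha> (x # ws))" "linear (\<lambda>x. \<beta> (x # ws))"
    using mlinD[OF Suc.prems(1), of "[]" ws] mlinD[OF Suc.prems(2), of "[]" ws] vs(2) by simp_all
  ultimately have "\<alpha> (v # ws) = \<beta> (v # ws)"
    using linear_orthonormal_expansion[OF m, of "\<lambda>x. \<alpha> (x # ws)" v]
      linear_orthonormal_expansion[OF m, of "\<lambda>x. \<beta> (x # ws)" v] by (simp cong: sum.cong)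
  then show ?case by (simp add: vs)
qed

lemma altD: "alt k \<alpha> \<Longrightarrow> length ws = k \<Longrightarrow> \<sigma> permutes {..<k} \<Longrightarrow>
    \<alpha> (permute_list \<sigma> ws) = of_int (sign \<sigma>) *\<^sub>R \<alpha> ws"
  unfolding alt_def by blast

lemma alt_swap:
  assumes "alt k \<alpha>" "length us + length vs + 2 = k"
  shows "\<alpha> (us @ x # y # vs) = - \<alpha> (us @ y # x # vs)"
proof -
  let ?i = "length us" and ?ws = "us @ y # x # vs"
  let ?\<tau> = "Transposition.transpose ?i (Suc ?i)"
  have t: "?\<tau> permutes {..<k}" using assms(2) by (intro permutes_swap_id) auto
  have "permute_list ?\<tau> ?ws = us @ x # y # vs"
  proof (rule nth_equalityI)
    show "length (permute_list ?\<tau> ?ws) = length (us @ x # y # vs)" by simp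
    fix j assume "j < length (permute_list ?\<tau> ?ws)"
    then have j: "j < length ?ws" by simp
    have "permute_list ?\<tau> ?ws ! j = ?ws ! ?\<tau> j"
      using t j assms(2) by (intro permute_list_nth) auto
    also have "\<dots> = (us @ x # y # vs) ! j"
    proof -
      consider "j < ?i" | "j = ?i" | "j = Suc ?i" | "Suc ?i < j" by linarith
      then show ?thesis
        by cases (auto simp: Transposition.transpose_def nth_append nth_Cons')
    qed
    finally show "permute_list ?\<tau> ?ws ! j = (us @ x # y # vs) ! j" .
  qed
  moreover have "\<alpha> (permute_list ?\<tau> ?ws) = of_int (sign ?\<tau>) *\<^sub>R \<alpha> ?ws"
    using assms t by (intro altD) auto
  ultimately show ?thesis by (simp add: sign_swap_id)
qed

lemma alt_move:
  assumes "alt k \<alpha>" "length us + length xs + length vs + 1 = k"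
  shows "\<alpha> (us @ xs @ y # vs) = (- 1) ^ length xs *\<^sub>R \<alpha> (us @ y # xs @ vs)"
  using assms(2)
proof (induction xs arbitrary: us)
  case (Cons x xs)
  have "\<alpha> (us @ (x # xs) @ y # vs) = (- 1) ^ length xs *\<^sub>R \<alpha> ((us @ [x]) @ y # xs @ vs)"
    using Cons.IH[of "us @ [x]"] Cons.prems by simp
  also have "\<alpha> ((us @ [x]) @ y # xs @ vs) = - \<alpha> (us @ y # x # xs @ vs)"
    using alt_swap[OF assms(1), of us "xs @ vs" x y] Cons.prems by simp
  finally show ?case by simp
qed simp

lemma alt_swap_blocks:
  assumes "alt k \<alpha>" "length us + length xs + length ys + length vs = k"
  shows "\<alpha> (us @ xs @ ys @ vs) = (- 1) ^ (length xs * length ys) *\<^sub>R \<alpha> (us @ ys @ xs @ vs)"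
  using assms(2)
proof (induction ys arbitrary: us)
  case (Cons y ys)
  have "\<alpha> (us @ xs @ (y # ys) @ vs) = (- 1) ^ length xs *\<^sub>R \<alpha> ((us @ [y]) @ xs @ ys @ vs)"
    using alt_move[OF assms(1), of us xs "ys @ vs" y] Cons.prems by simp
  also have "\<alpha> ((us @ [y]) @ xs @ ys @ vs) = (- 1) ^ (length xs * length ys) *\<^sub>R \<alpha> (us @ (y # ys) @ xs @ vs)"
    using Cons.IH[of "us @ [y]"] Cons.prems by simp
  finally show ?case by (simp add: power_add)
qed simp

lemma alt_repeated:
  assumes a: "alt k \<alpha>" "length ws = k" and "\<not> distinct ws"
  shows "\<alpha> ws = 0"
proof -
  obtain us x vs zs where ws: "ws = us @ [x] @ vs @ [x] @ zs"
    using not_distinct_decomp[OF assms(3)] by blast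
  have "\<alpha> ws = (- 1) ^ length vs *\<^sub>R \<alpha> (us @ x # x # vs @ zs)"
    using alt_move[OF a(1), of "us @ [x]" vs zs x] a(2) by (simp add: ws)
  moreover have "\<alpha> (us @ x # x # vs @ zs) = - \<alpha> (us @ x # x # vs @ zs)"
    using alt_swap[OF a(1), of us "vs @ zs" x x] a(2) by (simp add: ws)
  then have "2 *\<^sub>R \<alpha> (us @ x # x # vs @ zs) = 0"
    by (metis scaleR_2 eq_neg_iff_add_eq_0)
  ultimately show ?thesis by simp
qed

lemma alt_append_left:
  fixes \<alpha> :: "'a list \<Rightarrow> 'b::real_vector"
  assumes "alt (k + length ws) \<alpha>" shows "alt k (\<lambda>us. \<alpha> (us @ ws))"
  unfolding alt_def
proof (intro allI impI)
  fix us :: "'a list" and \<sigma> assume us: "length us = k" and s: "\<sigma> permutes {..<k}"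
  have s': "\<sigma> permutes {..<k + length ws}" using s by (rule permutes_subset) auto
  have "permute_list \<sigma> (us @ ws) = permute_list \<sigma> us @ ws"
  proof (rule nth_equalityI)
    fix i assume i: "i < length (permute_list \<sigma> (us @ ws))"
    then have "permute_list \<sigma> (us @ ws) ! i = (us @ ws) ! \<sigma> i"
      using s' us by (intro permute_list_nth) auto
    also have "\<dots> = (permute_list \<sigma> us @ ws) ! i"
    proof (cases "i < k")
      case True
      then have "\<sigma> i < k" using permutes_in_image[OF s, of i] by simp
      then show ?thesis using True us s by (simp add: nth_append permute_list_nth)
    next
      case False
      then have "\<sigma> i = i" using permutes_not_in[OF s, of i] by simp
      then show ?thesis using False us by (simp add: nth_append)
    qed
    finally show "permute_list \<sigma> (us @ ws) ! i = (permute_list \<sigma> us @ ws) ! i" .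
  qed simp
  then show "\<alpha> (permute_list \<sigma> us @ ws) = of_int (sign \<sigma>) *\<^sub>R \<alpha> (us @ ws)"
    using altD[OF assms _ s', of "us @ ws"] us by simp
qed

lemma alt_append_right:
  fixes \<alpha> :: "'a list \<Rightarrow> 'b::real_vector"
  assumes "alt (length us + k) \<alpha>" shows "alt k (\<lambda>ws. \<alpha> (us @ ws))"
  unfolding alt_def
proof (intro allI impI)
  fix ws :: "'a list" and \<sigma> assume ws: "length ws = k" and s: "\<sigma> permutes {..<k}"
  have 1: "\<alpha> (us @ zs) = (- 1) ^ (length us * k) *\<^sub>R \<alpha> (zs @ us)" if "length zs = k" for zs
    using alt_swap_blocks[OF assms, of "[]" us zs "[]"] that by simp
  have "alt k (\<lambda>zs. \<alpha> (zs @ us))" using assms by (intro alt_append_left) (simp add: add.commute)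
  from altD[OF this ws s] show "\<alpha> (us @ permute_list \<sigma> ws) = of_int (sign \<sigma>) *\<^sub>R \<alpha> (us @ ws)"
    using 1[of ws] 1[of "permute_list \<sigma> ws"] ws by (simp add: mult.commute)
qed

lemma sign_squared: "real_of_int (sign \<sigma>) * real_of_int (sign \<sigma>) = 1"
  by (simp add: sign_def)

text \<open>In a sum of a product of two alternating forms only the rearrangements of one list of basis
  vectors contribute, all of them equally.\<close>

lemma sum_alt_product:
  fixes g :: "'a list \<Rightarrow> real" and \<beta> :: "'a list \<Rightarrow> 'b::real_vector"
  assumes E: "finite E" and g: "alt k g" and \<beta>: "alt k \<beta>"
    and bs: "set bs \<subseteq> E" "distinct bs" "length bs = k"
    and zero: "\<And>ws. ws \<in> Ls E k \<Longrightarrow> distinct ws \<Longrightarrow> set ws \<noteq> set bs \<Longrightarrow> g ws *\<^sub>R \<beta> ws = 0"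
  shows "(\<Sum>ws\<in>Ls E k. g ws *\<^sub>R \<beta> ws) = fact k *\<^sub>R (g bs *\<^sub>R \<beta> bs)"
proof -
  have sub: "permutations_of_set (set bs) \<subseteq> Ls E k"
  proof
    fix ws assume "ws \<in> permutations_of_set (set bs)"
    then have "set ws = set bs" "distinct ws" by (auto simp: permutations_of_set_def)
    then show "ws \<in> Ls E k" using bs distinct_card[of ws] distinct_card[of bs] by (simp add: Ls_def)
  qed
  have "(\<Sum>ws\<in>Ls E k. g ws *\<^sub>R \<beta> ws) = (\<Sum>ws\<in>permutations_of_set (set bs). g ws *\<^sub>R \<beta> ws)"
  proof (rule sum.mono_neutral_right[OF finite_Ls[OF E] sub], rule ballI)
    fix ws assume "ws \<in> Ls E k - permutations_of_set (set bs)"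
    then have ws: "ws \<in> Ls E k" "set ws \<noteq> set bs \<or> \<not> distinct ws"
      by (auto simp: permutations_of_set_def)
    show "g ws *\<^sub>R \<beta> ws = 0"
    proof (cases "distinct ws")
      case True
      then show ?thesis using ws zero by blast
    next
      case False
      then show ?thesis using alt_repeated[OF g length_Ls[OF ws(1)]] by simp
    qed
  qed
  also have "\<dots> = (\<Sum>ws\<in>permutations_of_set (set bs). g bs *\<^sub>R \<beta> bs)"
  proof (rule sum.cong[OF refl])
    fix ws assume "ws \<in> permutations_of_set (set bs)"
    then have "set ws = set bs" "distinct ws" by (auto simp: permutations_of_set_def)
    then have "mset ws = mset bs" using bs(2) set_eq_iff_mset_eq_distinct by blast
    then obtain \<sigma> where s: "\<sigma> permutes {..<length bs}" "permute_list \<sigma> bs = ws"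
      using mset_eq_permutation by metis
    have "g ws = of_int (sign \<sigma>) * g bs" "\<beta> ws = of_int (sign \<sigma>) *\<^sub>R \<beta> bs"
      using altD[OF g bs(3), of \<sigma>] altD[OF \<beta> bs(3), of \<sigma>] s bs(3) by auto
    then have "g ws *\<^sub>R \<beta> ws = (of_int (sign \<sigma>) * of_int (sign \<sigma>)) *\<^sub>R (g bs *\<^sub>R \<beta> bs)"
      by (simp add: mult.commute mult.left_commute)
    then show "g ws *\<^sub>R \<beta> ws = g bs *\<^sub>R \<beta> bs" by (simp only: sign_squared scaleR_one)
  qed
  also have "\<dots> = fact k *\<^sub>R (g bs *\<^sub>R \<beta> bs)"
    using bs distinct_card[OF bs(2)] by (simp add: card_permutations_of_set sum_constant_scaleR)
  finally show ?thesis .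
qed

section \<open>Wedge products\<close>

lemma wedge_permute_list:
  assumes "length vs = k + l"
  shows "wedge m k l \<alpha> \<beta> vs = (1 / (fact k * fact l)) *\<^sub>R
    (\<Sum>\<sigma> | \<sigma> permutes {..<k + l}. of_int (sign \<sigma>) *\<^sub>R
      m (\<alpha> (take k (permute_list \<sigma> vs))) (\<beta> (drop k (permute_list \<sigma> vs))))"
proof -
  have "map (\<lambda>i. vs ! \<sigma> i) [0..<k] = take k (permute_list \<sigma> vs)"
    "map (\<lambda>i. vs ! \<sigma> i) [k..<k + l] = drop k (permute_list \<sigma> vs)" for \<sigma>
    by (simp_all add: permute_list_def assms take_map drop_map)
  then show ?thesis by (simp add: wedge_def)
qed

lemma alt_wedge:
  fixes \<alpha> :: "'a list \<Rightarrow> 'b"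
  shows "alt (k + l) (wedge m k l \<alpha> \<beta>)"
  unfolding alt_def
proof (intro allI impI)
  fix vs :: "'a list" and \<tau> assume vs: "length vs = k + l" and t: "\<tau> permutes {..<k + l}"
  let ?G = "\<lambda>ws. m (\<alpha> (take k ws)) (\<beta> (drop k ws))"
  let ?P = "{\<sigma>. \<sigma> permutes {..<k + l}}"
  have "(\<Sum>\<sigma>\<in>?P. of_int (sign \<sigma>) *\<^sub>R ?G (permute_list \<sigma> (permute_list \<tau> vs)))
      = (\<Sum>\<sigma>\<in>?P. of_int (sign \<tau>) *\<^sub>R (of_int (sign (\<tau> \<circ> \<sigma>)) *\<^sub>R ?G (permute_list (\<tau> \<circ> \<sigma>) vs)))"
  proof (rule sum.cong[OF refl])
    fix \<sigma> assume "\<sigma> \<in> ?P"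
    then have s: "\<sigma> permutes {..<k + l}" by simp
    have "sign (\<tau> \<circ> \<sigma>) = sign \<tau> * sign \<sigma>"
      using s t by (intro sign_compose) (auto intro: permutes_imp_permutation[rotated])
    moreover have "permute_list (\<tau> \<circ> \<sigma>) vs = permute_list \<sigma> (permute_list \<tau> vs)"
      using s vs by (simp add: permute_list_compose)
    ultimately show "of_int (sign \<sigma>) *\<^sub>R ?G (permute_list \<sigma> (permute_list \<tau> vs))
      = of_int (sign \<tau>) *\<^sub>R (of_int (sign (\<tau> \<circ> \<sigma>)) *\<^sub>R ?G (permute_list (\<tau> \<circ> \<sigma>) vs))"
      by (simp add: sign_squared mult.assoc[symmetric])
  qed
  also have "\<dots> = of_int (sign \<tau>) *\<^sub>R (\<Sum>\<sigma>\<in>?P. of_int (sign (\<tau> \<circ> \<sigma>)) *\<^sub>R ?G (permute_list (\<tau> \<circ> \<sigma>) vs))"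
    by (simp add: scaleR_sum_right)
  also have "(\<Sum>\<sigma>\<in>?P. of_int (sign (\<tau> \<circ> \<sigma>)) *\<^sub>R ?G (permute_list (\<tau> \<circ> \<sigma>) vs))
      = (\<Sum>\<sigma>\<in>?P. of_int (sign \<sigma>) *\<^sub>R ?G (permute_list \<sigma> vs))"
    by (rule setum_permutations_compose_left[OF t, symmetric])
  finally show "wedge m k l \<alpha> \<beta> (permute_list \<tau> vs) = of_int (sign \<tau>) *\<^sub>R wedge m k l \<alpha> \<beta> vs"
    using vs by (simp add: wedge_permute_list mult.commute)
qed

text \<open>Paired with an alternating form, the antisymmetrization in a wedge product may be omitted.\<close>

lemma sum_alt_wedge:
  fixes g :: "'a list \<Rightarrow> real"
  assumes g: "alt (k + l) g"
  shows "(\<Sum>ws\<in>Ls E (k + l). g ws *\<^sub>R wedge m k l \<alpha> \<beta> ws)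
    = (fact (k + l) / (fact k * fact l)) *\<^sub>R (\<Sum>us\<in>Ls E k. \<Sum>vs\<in>Ls E l. g (us @ vs) *\<^sub>R m (\<alpha> us) (\<beta> vs))"
proof -
  let ?P = "{\<sigma>. \<sigma> permutes {..<k + l}}"
  let ?G = "\<lambda>ws. m (\<alpha> (take k ws)) (\<beta> (drop k ws))"
  have "(\<Sum>ws\<in>Ls E (k + l). g ws *\<^sub>R wedge m k l \<alpha> \<beta> ws)
     = (1 / (fact k * fact l)) *\<^sub>R (\<Sum>ws\<in>Ls E (k + l). \<Sum>\<sigma>\<in>?P. g (permute_list \<sigma> ws) *\<^sub>R ?G (permute_list \<sigma> ws))"
    unfolding scaleR_sum_right
  proof (rule sum.cong[OF refl])
    fix ws assume "ws \<in> Ls E (k + l)"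
    then have ws: "length ws = k + l" by (rule length_Ls)
    show "g ws *\<^sub>R wedge m k l \<alpha> \<beta> ws = (\<Sum>\<sigma>\<in>?P. (1 / (fact k * fact l)) *\<^sub>R (g (permute_list \<sigma> ws) *\<^sub>R ?G (permute_list \<sigma> ws)))"
      unfolding wedge_permute_list[OF ws] scaleR_sum_right
      by (rule sum.cong) (simp_all add: altD[OF g ws] mult.commute)
  qed
  also have "(\<Sum>ws\<in>Ls E (k + l). \<Sum>\<sigma>\<in>?P. g (permute_list \<sigma> ws) *\<^sub>R ?G (permute_list \<sigma> ws))
     = (\<Sum>\<sigma>\<in>?P. \<Sum>ws\<in>Ls E (k + l). g ws *\<^sub>R ?G ws)"
    by (subst sum.swap, rule sum.cong[OF refl])
      (use sum_Ls_permute[where f = "\<lambda>ws. g ws *\<^sub>R ?G ws"] in simp)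
  also have "\<dots> = fact (k + l) *\<^sub>R (\<Sum>ws\<in>Ls E (k + l). g ws *\<^sub>R ?G ws)"
    by (simp add: sum_constant_scaleR card_permutations[where n = "k + l"])
  also have "(\<Sum>ws\<in>Ls E (k + l). g ws *\<^sub>R ?G ws) = (\<Sum>us\<in>Ls E k. \<Sum>vs\<in>Ls E l. g (us @ vs) *\<^sub>R m (\<alpha> us) (\<beta> vs))"
    by (subst sum_Ls_add) (auto intro!: sum.cong simp: length_Ls)
  finally show ?thesis by simp
qed

text \<open>A permutation moves one distinguished entry to another place and leaves the others independent of it,
  so that it preserves multilinearity.\<close>

lemma permute_list_single_position:
  assumes s: "\<sigma> permutes {..<length us + Suc (length vs)}"
  shows "\<exists>A B. length A + Suc (length B) = length us + Suc (length vs) \<and>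
    (\<forall>x. permute_list \<sigma> (us @ x # vs) = A @ x # B)"
proof -
  define N where "N = length us + Suc (length vs)"
  define i0 where "i0 = inv_into UNIV \<sigma> (length us)"
  have i0: "\<sigma> i0 = length us" unfolding i0_def using permutes_inverses(1)[OF s] .
  have i0N: "i0 < N"
    using permutes_in_image[OF s, of i0] i0 by (simp add: N_def)
  have ne: "\<sigma> i \<noteq> length us" if "i \<noteq> i0" for i
    using i0 that permutes_inj[OF s] by (metis injD)
  have up: "[0..<N] = [0..<i0] @ i0 # [Suc i0..<N]"
    using i0N by (metis less_imp_le_nat le0 upt_add_eq_append upt_conv_Cons le_add_diff_inverse)
  define A B where "A = map (\<lambda>i. (us @ undefined # vs) ! \<sigma> i) [0..<i0]"
    and "B = map (\<lambda>i. (us @ undefined # vs) ! \<sigma> i) [Suc i0..<N]"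
  have eq: "(us @ x # vs) ! \<sigma> i = (us @ undefined # vs) ! \<sigma> i" if "i \<noteq> i0" for x i
    using ne[OF that] by (auto simp: nth_append nth_Cons')
  have "permute_list \<sigma> (us @ x # vs) = A @ x # B" for x
  proof -
    have "permute_list \<sigma> (us @ x # vs) = map (\<lambda>i. (us @ x # vs) ! \<sigma> i) [0..<N]"
      by (simp add: permute_list_def N_def)
    also have "\<dots> = A @ (us @ x # vs) ! \<sigma> i0 # B"
      unfolding up A_def B_def by (auto intro!: eq)
    finally show ?thesis by (simp add: i0)
  qed
  moreover have "length A + Suc (length B) = N" using i0N by (simp add: A_def B_def)
  ultimately show ?thesis unfolding N_def by blast
qed

lemma mlin_wedge:
  fixes \<alpha> \<beta> :: "'a::real_vector list \<Rightarrow> real"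
  assumes a: "mlin k \<alpha>" and b: "mlin l \<beta>"
  shows "mlin (k + l) (wedge (*) k l \<alpha> \<beta>)"
  unfolding mlin_def
proof (intro allI impI)
  fix us vs :: "'a list" assume len: "length us + Suc (length vs) = k + l"
  let ?G = "\<lambda>\<sigma> x. \<alpha> (take k (permute_list \<sigma> (us @ x # vs))) * \<beta> (drop k (permute_list \<sigma> (us @ x # vs)))"
  have lin: "linear (?G \<sigma>)" if s: "\<sigma> permutes {..<k + l}" for \<sigma>
  proof -
    obtain A B where AB: "length A + Suc (length B) = k + l" "\<And>x. permute_list \<sigma> (us @ x # vs) = A @ x # B"
      using permute_list_single_position[of \<sigma> us vs] s len by metis
    show ?thesis
    proof (cases "length A < k")
      case True
      then obtain d where d: "k = length A + Suc d" using less_iff_Suc_add by auto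
      have "linear (\<lambda>x. \<alpha> (A @ x # take d B))"
        using AB d by (intro mlinD[OF a]) simp
      then have "linear (\<lambda>x. \<beta> (drop d B) *\<^sub>R \<alpha> (A @ x # take d B))" by (rule linear_compose_scale_right)
      then show ?thesis by (simp add: AB d mult.commute)
    next
      case False
      then obtain d where d: "length A = k + d" using le_Suc_ex by (metis not_less)
      have "linear (\<lambda>x. \<beta> (drop k A @ x # B))"
        using AB d by (intro mlinD[OF b]) simp
      then have "linear (\<lambda>x. \<alpha> (take k A) *\<^sub>R \<beta> (drop k A @ x # B))" by (rule linear_compose_scale_right)
      then show ?thesis by (simp add: AB d)
    qed
  qed
  have "linear (\<lambda>x. (1 / (fact k * fact l)) *\<^sub>R (\<Sum>\<sigma> | \<sigma> permutes {..<k + l}. of_int (sign \<sigma>) *\<^sub>R ?G \<sigma> x))"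
    by (intro linear_compose_scale_right linear_compose_sum ballI lin) simp
  then show "linear (\<lambda>x. wedge (*) k l \<alpha> \<beta> (us @ x # vs))"
    using len by (simp add: wedge_permute_list)
qed

section \<open>The top power of the Hermitian form\<close>

text \<open>A test form: paired with it, an alternating form determines its value on \<open>vs\<close>, and pairings with wedge
  products are easy to compute.\<close>

lemma exists_alt_nonzero:
  assumes "distinct vs"
  shows "\<exists>\<gamma> :: 'a list \<Rightarrow> real. alt (length vs) \<gamma> \<and> \<gamma> vs \<noteq> 0"
proof -
  let ?k = "length vs"
  define \<gamma> :: "'a list \<Rightarrow> real" where "\<gamma> = wedge (*) ?k 0 (\<lambda>us. if us = vs then 1 else 0) (\<lambda>us. 1)"
  have "alt ?k \<gamma>" unfolding \<gamma>_def using alt_wedge[of ?k 0] by simp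
  moreover have "\<gamma> vs \<noteq> 0"
  proof -
    have id: "\<sigma> = id" if s: "\<sigma> permutes {..<?k}" "permute_list \<sigma> vs = vs" for \<sigma>
    proof
      fix i show "\<sigma> i = id i"
      proof (cases "i < ?k")
        case True
        then have "vs ! \<sigma> i = vs ! i" using permute_list_nth[OF s(1), of i] s(2) by simp
        moreover have "\<sigma> i < ?k" using permutes_in_image[OF s(1), of i] True by simp
        ultimately show ?thesis using True assms by (simp add: nth_eq_iff_index_eq)
      next
        case False
        then show ?thesis using permutes_not_in[OF s(1)] by simp
      qed
    qed
    have "\<gamma> vs = (1 / fact ?k) * (\<Sum>\<sigma> | \<sigma> permutes {..<?k}. of_int (sign \<sigma>) * (if permute_list \<sigma> vs = vs then 1 else 0))"
      unfolding \<gamma>_def by (simp add: wedge_permute_list)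
    also have "(\<Sum>\<sigma> | \<sigma> permutes {..<?k}. of_int (sign \<sigma>) * (if permute_list \<sigma> vs = vs then 1 else 0 :: real))
       = (\<Sum>\<sigma> | \<sigma> permutes {..<?k}. if \<sigma> = id then 1 else 0)"
      by (rule sum.cong) (auto dest: id)
    also have "\<dots> = 1" by (simp add: finite_permutations permutes_id)
    finally show ?thesis by simp
  qed
  ultimately show ?thesis by blast
qed

definition pairs :: "('a \<Rightarrow> 'a) \<Rightarrow> 'a list \<Rightarrow> 'a list" where
  "pairs J us = concat (map (\<lambda>u. [u, J u]) us)"

lemma pairs_simps [simp]: "pairs J [] = []" "pairs J (u # us) = u # J u # pairs J us"
  "pairs J (us @ vs) = pairs J us @ pairs J vs"
  by (simp_all add: pairs_def)

lemma set_pairs: "set (pairs J us) = set us \<union> J ` set us" by (induction us) auto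

lemma length_pairs [simp]: "length (pairs J us) = 2 * length us" by (induction us) auto

lemma distinct_pairs:
  "distinct (pairs J us) \<longleftrightarrow> distinct us \<and> inj_on J (set us) \<and> set us \<inter> J ` set us = {}"
  by (induction us) (auto simp: set_pairs)

text \<open>In the pairing of the wedge product with a test form, only the pairs \<open>u, J u\<close> in the two slots of \<open>F\<close>
  leave a list on which \<open>\<beta>\<close> does not vanish; both orders of the pair contribute equally.\<close>

lemma wedge_2_pairs:
  fixes F :: "'a list \<Rightarrow> 'b::real_vector" and \<beta> :: "'a list \<Rightarrow> real"
  assumes \<beta>: "alt (2 * j) \<beta>" and F: "\<And>x y. F [y, x] = - F [x, y]"
    and us: "length us = Suc j" "distinct (pairs J us)"
    and zero: "\<And>x y ws. x \<in> set (pairs J us) \<Longrightarrow> y \<in> set (pairs J us) \<Longrightarrow> distinct (x # y # ws) \<Longrightarrow>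
      set (x # y # ws) = set (pairs J us) \<Longrightarrow> length ws = 2 * j \<Longrightarrow>
      (\<And>u. u \<in> set us \<Longrightarrow> \<not> (x = u \<and> y = J u) \<and> \<not> (y = u \<and> x = J u)) \<Longrightarrow> \<beta> ws = 0"
    and val: "\<And>us'. length us' = j \<Longrightarrow> distinct us' \<Longrightarrow> set us' \<subseteq> set us \<Longrightarrow> \<beta> (pairs J us') = c"
  shows "wedge (\<lambda>\<xi> r. r *\<^sub>R \<xi>) 2 (2 * j) F \<beta> (pairs J us) = c *\<^sub>R (\<Sum>u\<in>set us. F [u, J u])"
proof -
  let ?vs = "pairs J us"
  define E where "E = set ?vs"
  define N where "N = 2 + 2 * j"
  have fin: "finite E" by (simp add: E_def)
  have lenvs: "length ?vs = N" using us by (simp add: N_def)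
  have cardE: "card E = N" unfolding E_def using distinct_card[OF us(2)] lenvs by simp
  have dis: "distinct us" "inj_on J (set us)" "set us \<inter> J ` set us = {}" using us(2) unfolding distinct_pairs by blast+
  obtain \<gamma> :: "'a list \<Rightarrow> real" where g: "alt N \<gamma>" "\<gamma> ?vs \<noteq> 0"
    using exists_alt_nonzero[OF us(2)] lenvs by auto
  have full: "set ws = E" if "distinct ws" "ws \<in> Ls E N" for ws
    using that fin cardE distinct_card[of ws] by (intro card_subset_eq) (auto simp: Ls_def)
  let ?W = "wedge (\<lambda>\<xi> r. r *\<^sub>R \<xi>) 2 (2 * j) F \<beta>"
  have aW: "alt N ?W" unfolding N_def by (rule alt_wedge)
  have A: "(\<Sum>ws\<in>Ls E N. \<gamma> ws *\<^sub>R ?W ws) = fact N *\<^sub>R (\<gamma> ?vs *\<^sub>R ?W ?vs)"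
    by (rule sum_alt_product[OF fin g(1) aW _ us(2) lenvs]) (use full in \<open>auto simp: E_def\<close>)
  define C where "C x y = (\<Sum>ws\<in>Ls E (2 * j). \<gamma> (x # y # ws) * \<beta> ws)" for x y
  have B: "(\<Sum>ws\<in>Ls E N. \<gamma> ws *\<^sub>R ?W ws) = (fact N / (2 * fact (2 * j))) *\<^sub>R (\<Sum>x\<in>E. \<Sum>y\<in>E. C x y *\<^sub>R F [x, y])"
    unfolding N_def
    by (subst sum_alt_wedge[OF g(1)[unfolded N_def]]) (simp add: sum_Ls_2 C_def scaleR_sum_left)
  have C_swap: "C y x = - C x y" for x y
  proof -
    have "\<gamma> (y # x # ws) * \<beta> ws = - (\<gamma> (x # y # ws) * \<beta> ws)" if "ws \<in> Ls E (2 * j)" for ws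
      using alt_swap[OF g(1), of "[]" ws y x] length_Ls[OF that] by (simp add: N_def)
    then show ?thesis unfolding C_def by (simp add: sum_negf cong: sum.cong)
  qed
  have C_pair: "C u (J u) = fact (2 * j) * (\<gamma> ?vs * c)" if u: "u \<in> set us" for u
  proof -
    obtain us1 us2 where s: "us = us1 @ u # us2" using split_list[OF u] by blast
    define bs where "bs = pairs J (us1 @ us2)"
    have lb: "length bs = 2 * j" using us(1) by (simp add: bs_def s)
    have vs: "?vs = pairs J us1 @ [u, J u] @ pairs J us2" by (simp add: s)
    have setbs: "set bs = E - {u, J u}" "distinct bs" "u \<noteq> J u"
      using us(2) unfolding E_def bs_def vs by auto
    have "\<gamma> (u # J u # bs) = \<gamma> ?vs"
      using alt_swap_blocks[OF g(1), of "[]" "pairs J us1" "[u, J u]" "pairs J us2"] lenvs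
      by (simp add: vs bs_def power_mult)
    moreover have "C u (J u) = (\<Sum>ws\<in>Ls E (2 * j). \<gamma> ([u, J u] @ ws) *\<^sub>R \<beta> ws)" by (simp add: C_def)
    moreover have "\<dots> = fact (2 * j) *\<^sub>R (\<gamma> ([u, J u] @ bs) *\<^sub>R \<beta> bs)"
    proof (rule sum_alt_product[OF fin _ \<beta> _ setbs(2) lb])
      show "alt (2 * j) (\<lambda>ws. \<gamma> ([u, J u] @ ws))"
        using g(1) by (intro alt_append_right) (simp add: N_def)
      fix ws assume ws: "ws \<in> Ls E (2 * j)" "distinct ws" "set ws \<noteq> set bs"
      show "\<gamma> ([u, J u] @ ws) *\<^sub>R \<beta> ws = 0"
      proof (cases "distinct ([u, J u] @ ws)")
        case True
        then have "set ([u, J u] @ ws) = E"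
          by (rule full) (use ws u in \<open>auto simp: Ls_def N_def E_def set_pairs\<close>)
        then have "set ws = set bs" using True setbs by auto
        then show ?thesis using ws by simp
      next
        case False
        then show ?thesis using alt_repeated[OF g(1) _ False] length_Ls[OF ws(1)] by (simp add: N_def)
      qed
    qed (use setbs in auto)
    moreover have "\<beta> bs = c" unfolding bs_def
      by (rule val) (use us(1) dis(1) in \<open>auto simp: s\<close>)
    ultimately show ?thesis by simp
  qed
  have C_zero: "C x y = 0" if xy: "x \<in> E" "y \<in> E" "\<And>u. u \<in> set us \<Longrightarrow> \<not> (x = u \<and> y = J u) \<and> \<not> (y = u \<and> x = J u)" for x y
    unfolding C_def
  proof (rule sum.neutral, rule ballI)
    fix ws assume ws: "ws \<in> Ls E (2 * j)"
    show "\<gamma> (x # y # ws) * \<beta> ws = 0"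
    proof (cases "distinct (x # y # ws)")
      case True
      then have "set (x # y # ws) = E"
        by (rule full) (use ws xy in \<open>auto simp: Ls_def N_def\<close>)
      then have "\<beta> ws = 0"
        using zero[OF _ _ True _ length_Ls[OF ws] xy(3)] xy(1,2) by (simp add: E_def)
      then show ?thesis by simp
    next
      case False
      then show ?thesis using alt_repeated[OF g(1) _ False] length_Ls[OF ws] by (simp add: N_def)
    qed
  qed
  have row1: "(\<Sum>y\<in>E. C u y *\<^sub>R F [u, y]) = C u (J u) *\<^sub>R F [u, J u]" if u: "u \<in> set us" for u
  proof -
    have "C u y = 0" if "y \<in> E" "y \<noteq> J u" for y
      using that u dis by (intro C_zero) (auto simp: E_def set_pairs)
    then have "(\<Sum>y\<in>E. C u y *\<^sub>R F [u, y]) = (\<Sum>y\<in>{J u}. C u y *\<^sub>R F [u, y])"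
      using fin u by (intro sum.mono_neutral_right) (auto simp: E_def set_pairs)
    then show ?thesis by simp
  qed
  have row2: "(\<Sum>y\<in>E. C (J u) y *\<^sub>R F [J u, y]) = C u (J u) *\<^sub>R F [u, J u]" if u: "u \<in> set us" for u
  proof -
    have "C (J u) y = 0" if "y \<in> E" "y \<noteq> u" for y
      using that u dis by (intro C_zero) (auto simp: E_def set_pairs inj_on_def)
    then have "(\<Sum>y\<in>E. C (J u) y *\<^sub>R F [J u, y]) = (\<Sum>y\<in>{u}. C (J u) y *\<^sub>R F [J u, y])"
      using fin u by (intro sum.mono_neutral_right) (auto simp: E_def set_pairs)
    also have "\<dots> = C u (J u) *\<^sub>R F [u, J u]" using C_swap[of "J u" u] F[of "J u" u] by simp
    finally show ?thesis .
  qed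
  have "(\<Sum>x\<in>E. \<Sum>y\<in>E. C x y *\<^sub>R F [x, y])
      = (\<Sum>x\<in>set us. \<Sum>y\<in>E. C x y *\<^sub>R F [x, y]) + (\<Sum>x\<in>J ` set us. \<Sum>y\<in>E. C x y *\<^sub>R F [x, y])"
    using dis(3) by (subst sum.union_disjoint[symmetric]) (auto simp: E_def set_pairs)
  also have "(\<Sum>x\<in>J ` set us. \<Sum>y\<in>E. C x y *\<^sub>R F [x, y]) = (\<Sum>u\<in>set us. C u (J u) *\<^sub>R F [u, J u])"
    by (simp add: sum.reindex[OF dis(2)] row2)
  also have "(\<Sum>x\<in>set us. \<Sum>y\<in>E. C x y *\<^sub>R F [x, y]) = (\<Sum>u\<in>set us. C u (J u) *\<^sub>R F [u, J u])"
    by (simp add: row1)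
  also have "(\<Sum>u\<in>set us. C u (J u) *\<^sub>R F [u, J u]) + (\<Sum>u\<in>set us. C u (J u) *\<^sub>R F [u, J u])
      = (2 * fact (2 * j) * \<gamma> ?vs) *\<^sub>R (c *\<^sub>R (\<Sum>u\<in>set us. F [u, J u]))"
    by (simp add: C_pair scaleR_sum_right mult.assoc flip: scaleR_2)
  finally have "fact N *\<^sub>R (\<gamma> ?vs *\<^sub>R ?W ?vs) = fact N *\<^sub>R (\<gamma> ?vs *\<^sub>R (c *\<^sub>R (\<Sum>u\<in>set us. F [u, J u])))"
    using A B by simp
  then show ?thesis using g(2) by (simp only: scaleR_cancel_left fact_nonzero) blast
qed

text \<open>A vector which is orthogonal, for the form, to all entries of a list annihilates the power.\<close>

lemma wedge_power_zero:
  assumes "length vs = 2 * j" "x \<in> set vs" "\<And>y. y \<in> set vs \<Longrightarrow> \<omega> [x, y] = 0 \<and> \<omega> [y, x] = 0"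
  shows "wedge_power \<omega> j vs = 0"
  using assms
proof (induction j arbitrary: vs)
  case (Suc j)
  have len: "length vs = 2 + 2 * j" using Suc.prems by simp
  have key: "\<omega> (take 2 ws) * wedge_power \<omega> j (drop 2 ws) = 0"
    if "mset ws = mset vs" for ws
  proof -
    have ws: "length ws = 2 + 2 * j" "set ws = set vs" using that len by (metis size_mset, metis set_mset_mset)
    then obtain a b zs where abz: "ws = a # b # zs" "length zs = 2 * j"
      by (cases ws; cases "tl ws") auto
    consider "x = a" | "x = b" | "x \<in> set zs" using Suc.prems(2) ws abz by auto
    then show ?thesis
    proof cases
      case 3
      then have "wedge_power \<omega> j zs = 0"
        using Suc.IH[OF abz(2)] Suc.prems(3) ws abz by auto
      then show ?thesis by (simp add: abz)
    qed (use Suc.prems(3) ws abz in \<open>auto simp: abz\<close>)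
  qed
  have "wedge (*) 2 (2 * j) \<omega> (wedge_power \<omega> j) vs = 0"
    unfolding wedge_permute_list[OF len]
  proof (rule scaleR_eq_0_iff[THEN iffD2], rule disjI2, rule sum.neutral, rule ballI)
    fix \<sigma> assume "\<sigma> \<in> {\<sigma>. \<sigma> permutes {..<2 + 2 * j}}"
    then have "mset (permute_list \<sigma> vs) = mset vs" using len by (intro mset_permute_list) simp
    from key[OF this] show "of_int (sign \<sigma>) *\<^sub>R (\<omega> (take 2 (permute_list \<sigma> vs)) * wedge_power \<omega> j (drop 2 (permute_list \<sigma> vs))) = 0"
      by simp
  qed
  then show ?case by simp
qed simp

lemma alt_wedge_power: "alt (2 * j) (wedge_power \<omega> j)"
proof (cases j)
  case 0
  then show ?thesis by (auto simp: alt_def)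
next
  case (Suc i)
  then show ?thesis using alt_wedge[of 2 "2 * i"] by simp
qed

lemma mlin_wedge_power:
  assumes "mlin 2 \<omega>" shows "mlin (2 * j) (wedge_power \<omega> j)"
proof (induction j)
  case 0
  then show ?case by (simp add: mlin_def)
next
  case (Suc j)
  then show ?case using mlin_wedge[OF assms Suc.IH] by simp
qed

lemma Jstd_Jstd [simp]: "Jstd (Jstd v) = - v"
  by (simp add: Jstd_def vec_eq_iff mult.assoc[symmetric])

lemma linear_Jstd: "linear Jstd"
  by (auto simp: linear_iff Jstd_def vec_eq_iff algebra_simps scaleR_conv_of_real)

lemmas Jstd_linear = linear_add[OF linear_Jstd] linear_scale[OF linear_Jstd] linear_diff[OF linear_Jstd]
  linear_neg[OF linear_Jstd] linear_0[OF linear_Jstd]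

definition hermitian :: "(complex ^ 'n::finite \<Rightarrow> complex ^ 'n \<Rightarrow> real) \<Rightarrow> bool" where
  "hermitian m \<longleftrightarrow> inner_form m \<and> (\<forall>v w. m (Jstd v) (Jstd w) = m v w)"

definition unitary :: "(complex ^ 'n::finite \<Rightarrow> complex ^ 'n \<Rightarrow> real) \<Rightarrow> (complex ^ 'n) list \<Rightarrow> bool" where
  "unitary m us \<longleftrightarrow> distinct (pairs Jstd us) \<and>
    (\<forall>e\<in>set (pairs Jstd us). \<forall>f\<in>set (pairs Jstd us). m e f = (if e = f then 1 else 0))"

lemma hermitian_inner_form: "hermitian m \<Longrightarrow> inner_form m"
  and hermitian_J: "hermitian m \<Longrightarrow> m (Jstd v) (Jstd w) = m v w"
  by (auto simp: hermitian_def)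

lemma hermitian_J_left: "hermitian m \<Longrightarrow> m (Jstd v) w = - m v (Jstd w)"
  using hermitian_J[of m v "Jstd w"] by (simp add: inner_form_bilinear[OF hermitian_inner_form])

lemma mlin_2I:
  assumes "\<And>y. linear (\<lambda>x. \<alpha> [x, y])" "\<And>x. linear (\<lambda>y. \<alpha> [x, y])"
  shows "mlin 2 \<alpha>"
  unfolding mlin_def
proof (intro allI impI)
  fix us vs :: "'a list" assume "length us + Suc (length vs) = 2"
  then consider y where "us = []" "vs = [y]" | y where "us = [y]" "vs = []"
    by (cases us; cases vs) auto
  then show "linear (\<lambda>x. \<alpha> (us @ x # vs))" using assms by cases auto
qed

lemma mlin_herm_form:
  assumes "hermitian m" shows "mlin 2 (herm_form m)"
proof (rule mlin_2I)
  note m = hermitian_inner_form[OF assms]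
  show "linear (\<lambda>x. herm_form m [x, y])" for y
    by (simp add: herm_form_def linear_iff Jstd_linear inner_form_bilinear[OF m])
  show "linear (\<lambda>y. herm_form m [x, y])" for x
    by (simp add: herm_form_def linear_iff inner_form_bilinear[OF m])
qed

lemma herm_form_skew:
  assumes "hermitian m" shows "herm_form m [y, x] = - herm_form m [x, y]"
  using hermitian_J_left[OF assms, of y x] inner_form_sym[OF hermitian_inner_form[OF assms], of y "Jstd x"]
  by (simp add: herm_form_def)

lemma unitary_subset:
  assumes "unitary m us" "distinct us'" "set us' \<subseteq> set us"
  shows "unitary m us'"
proof -
  have sub: "set (pairs Jstd us') \<subseteq> set (pairs Jstd us)" using assms(3) unfolding set_pairs by blast
  have "inj_on Jstd (set us)" "set us \<inter> Jstd ` set us = {}"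
    using assms(1) unfolding unitary_def distinct_pairs by blast+
  then have "distinct (pairs Jstd us')" unfolding distinct_pairs
    using assms(2,3) inj_on_subset by blast
  then show ?thesis using assms(1) sub unfolding unitary_def by blast
qed

lemma herm_form_unitary:
  assumes m: "hermitian m" and us: "unitary m us" and xy: "x \<in> set (pairs Jstd us)" "y \<in> set (pairs Jstd us)"
    and "\<And>u. u \<in> set us \<Longrightarrow> \<not> (x = u \<and> y = Jstd u) \<and> \<not> (y = u \<and> x = Jstd u)"
  shows "herm_form m [x, y] = 0"
proof -
  note bil = inner_form_bilinear[OF hermitian_inner_form[OF m]]
  consider "x \<in> set us" | u where "u \<in> set us" "x = Jstd u" using xy(1) unfolding set_pairs by blast
  then show ?thesis
  proof cases
    case 1
    then have "Jstd x \<in> set (pairs Jstd us)" by (simp add: set_pairs)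
    then show ?thesis using 1 us xy assms(5)[of x] unfolding unitary_def herm_form_def by auto
  next
    case 2
    then have "u \<in> set (pairs Jstd us)" by (simp add: set_pairs)
    then have "m u y = 0" using 2 us xy assms(5)[of u] unfolding unitary_def by auto
    then show ?thesis by (simp add: herm_form_def 2 bil)
  qed
qed

text \<open>If the missing vectors \<open>x\<close> and \<open>y\<close> do not form a pair, then the partner \<open>x'\<close> of \<open>x\<close> is in the list, and
  the Hermitian form vanishes between \<open>x'\<close> and the whole list.\<close>

lemma wedge_power_unitary_zero:
  assumes m: "hermitian m" and us: "unitary m us"
    and xy: "x \<in> set (pairs Jstd us)" and d: "distinct (x # y # ws)"
    and set: "set (x # y # ws) = set (pairs Jstd us)" and len: "length ws = 2 * j"
    and np: "\<And>u. u \<in> set us \<Longrightarrow> \<not> (x = u \<and> y = Jstd u) \<and> \<not> (y = u \<and> x = Jstd u)"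
  shows "wedge_power (herm_form m) j ws = 0"
proof -
  have dis: "inj_on Jstd (set us)" "set us \<inter> Jstd ` set us = {}"
    using us unfolding unitary_def distinct_pairs by blast+
  have dis2: "u \<noteq> Jstd v" "Jstd v \<noteq> u" if "u \<in> set us" "v \<in> set us" for u v
    using dis(2) that by blast+
  obtain x' where x': "x' \<in> set (pairs Jstd us)" "x' \<noteq> x" "x' \<noteq> y"
    "\<forall>z\<in>set (pairs Jstd us). z \<noteq> x \<longrightarrow> (\<forall>u\<in>set us. \<not> (x' = u \<and> z = Jstd u) \<and> \<not> (z = u \<and> x' = Jstd u))"
  proof -
    consider "x \<in> set us" | u where "u \<in> set us" "x = Jstd u" using xy(1) unfolding set_pairs by blast
    then show thesis
    proof cases
      case 1
      show thesis
        by (rule that[of "Jstd x"]) (use 1 dis(1) dis2 np[of x] in \<open>auto simp: set_pairs inj_on_def\<close>)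
    next
      case 2
      show thesis
        by (rule that[of u]) (use 2 dis(1) dis2 np[of u] in \<open>auto simp: set_pairs inj_on_def\<close>)
    qed
  qed
  show ?thesis
  proof (rule wedge_power_zero[OF len])
    show "x' \<in> set ws" using x' set by auto
    fix y' assume "y' \<in> set ws"
    then have y': "y' \<in> set (pairs Jstd us)" "y' \<noteq> x" using set d by auto
    have "herm_form m [x', y'] = 0"
      by (rule herm_form_unitary[OF m us x'(1) y'(1)]) (use x'(4) y' in blast)
    then show "herm_form m [x', y'] = 0 \<and> herm_form m [y', x'] = 0"
      using herm_form_skew[OF m, of y' x'] by simp
  qed
qed

lemma wedge_2_unitary:
  fixes F :: "(complex ^ 'n::finite) list \<Rightarrow> 'b::real_vector"
  assumes m: "hermitian m" and F: "\<And>x y. F [y, x] = - F [x, y]"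
    and us: "unitary m us" "length us = Suc j"
    and val: "\<And>us'. length us' = j \<Longrightarrow> unitary m us' \<Longrightarrow> wedge_power (herm_form m) j (pairs Jstd us') = c"
  shows "wedge (\<lambda>\<xi> r. r *\<^sub>R \<xi>) 2 (2 * j) F (wedge_power (herm_form m) j) (pairs Jstd us)
    = c *\<^sub>R (\<Sum>u\<in>set us. F [u, Jstd u])"
proof (rule wedge_2_pairs[where F = F, OF alt_wedge_power F us(2)])
  show "distinct (pairs Jstd us)" using us(1) unfolding unitary_def by blast
  show "wedge_power (herm_form m) j ws = 0"
    if "x \<in> set (pairs Jstd us)" "y \<in> set (pairs Jstd us)" "distinct (x # y # ws)"
      "set (x # y # ws) = set (pairs Jstd us)" "length ws = 2 * j"
      "\<And>u. u \<in> set us \<Longrightarrow> \<not> (x = u \<and> y = Jstd u) \<and> \<not> (y = u \<and> x = Jstd u)" for x y ws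
    using wedge_power_unitary_zero[OF m us(1) that(1,3,4,5,6)] .
  show "wedge_power (herm_form m) j (pairs Jstd us') = c"
    if "length us' = j" "distinct us'" "set us' \<subseteq> set us" for us'
    using val[OF that(1) unitary_subset[OF us(1) that(2,3)]] .
qed

lemma wedge_power_unitary:
  assumes m: "hermitian m" and us: "unitary m us"
  shows "wedge_power (herm_form m) (length us) (pairs Jstd us) = fact (length us)"
proof -
  have "wedge_power (herm_form m) j (pairs Jstd us) = fact j" if "length us = j" "unitary m us" for j us
    using that
  proof (induction j arbitrary: us)
    case (Suc j)
    have scale: "(\<lambda>\<xi> r. r *\<^sub>R \<xi>) = ((*) :: real \<Rightarrow> real \<Rightarrow> real)" by (auto simp: fun_eq_iff)
    have one: "herm_form m [u, Jstd u] = 1" if "u \<in> set us" for u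
      using Suc.prems(2) that unfolding unitary_def herm_form_def by (auto simp: set_pairs)
    have "distinct us" using Suc.prems(2) unfolding unitary_def distinct_pairs by blast
    then have "card (set us) = Suc j" using Suc.prems(1) distinct_card by metis
    moreover have "wedge (\<lambda>\<xi> r. r *\<^sub>R \<xi>) 2 (2 * j) (herm_form m) (wedge_power (herm_form m) j) (pairs Jstd us)
        = fact j *\<^sub>R (\<Sum>u\<in>set us. herm_form m [u, Jstd u])"
      using Suc by (intro wedge_2_unitary[where F = "herm_form m", OF m herm_form_skew[OF m]]) auto
    ultimately show ?case using one unfolding scale by (simp add: algebra_simps)
  qed simp
  then show ?thesis using us by blast
qed

text \<open>A maximal unitary list spans: a unit vector orthogonal to it and to its image under \<open>J\<close> could be added.\<close>

lemma exists_unitary_basis: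
  fixes m :: "complex ^ 'n::finite \<Rightarrow> complex ^ 'n \<Rightarrow> real"
  assumes h: "hermitian m"
  shows "\<exists>us. unitary m us \<and> length us = CARD('n) \<and> orthonormal_basis m (set (pairs Jstd us))"
proof -
  note m = hermitian_inner_form[OF h]
  note bil = inner_form_bilinear[OF m]
  have self: "m w (Jstd w) = 0" for w
    using hermitian_J_left[OF h, of w w] inner_form_sym[OF m, of "Jstd w" w] by simp
  have dim: "DIM(complex ^ 'n) = 2 * CARD('n)" by simp
  let ?U = "\<lambda>us. unitary m us"
  have bd: "length us < Suc (2 * CARD('n))" if "?U us" for us
  proof -
    have "independent (set (pairs Jstd us))"
      using that orthonormal_independent[OF m] unfolding unitary_def by blast
    then have "card (set (pairs Jstd us)) \<le> DIM(complex ^ 'n)" using independent_bound by blast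
    then show ?thesis using that distinct_card[of "pairs Jstd us"] unfolding unitary_def dim by simp
  qed
  have "?U []" by (simp add: unitary_def)
  then obtain us where us: "?U us" "\<And>us'. ?U us' \<Longrightarrow> length us' \<le> length us"
    using ex_has_greatest_nat[of ?U "[]" length "Suc (2 * CARD('n))"] bd by (metis less_imp_le)
  let ?E = "set (pairs Jstd us)"
  have on: "m e f = (if e = f then 1 else 0)" if "e \<in> ?E" "f \<in> ?E" for e f
    using us(1) that unfolding unitary_def by blast
  have "v \<in> span ?E" for v
  proof (rule ccontr)
    assume v: "v \<notin> span ?E"
    define w where "w = v - (\<Sum>e\<in>?E. m v e *\<^sub>R e)"
    have "(\<Sum>e\<in>?E. m v e *\<^sub>R e) \<in> span ?E" by (intro span_sum span_scale span_base)
    then have "w \<noteq> 0" using v unfolding w_def by auto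
    then have pos: "m w w > 0" by (rule inner_form_pos[OF m])
    have we: "m w e = 0" if "e \<in> ?E" for e
    proof -
      have "m (\<Sum>e\<in>?E. m v e *\<^sub>R e) e = (\<Sum>f\<in>?E. m v f * m f e)" by (rule inner_form_sum[OF m])
      also have "\<dots> = (\<Sum>f\<in>?E. if f = e then m v f else 0)"
        using that on by (intro sum.cong) auto
      finally show ?thesis using that by (simp add: w_def bil)
    qed
    define u where "u = (1 / sqrt (m w w)) *\<^sub>R w"
    have uu: "m u u = 1" using pos by (simp add: u_def bil)
    have ue: "m u e = 0" if "e \<in> ?E" for e using we[OF that] by (simp add: u_def bil)
    have Jue: "m (Jstd u) e = 0" if e: "e \<in> ?E" for e
    proof -
      have "m u (Jstd e) = 0"
      proof (cases "e \<in> set us")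
        case True
        then show ?thesis by (intro ue) (simp add: set_pairs)
      next
        case False
        then obtain a where "a \<in> set us" "e = Jstd a" using e by (auto simp: set_pairs)
        then show ?thesis using ue[of a] by (simp add: set_pairs bil)
      qed
      then show ?thesis using hermitian_J_left[OF h] by simp
    qed
    have JuJu: "m (Jstd u) (Jstd u) = 1" using uu hermitian_J[OF h] by simp
    have eu: "m e u = 0" "m e (Jstd u) = 0" if "e \<in> ?E" for e
      using ue[OF that] Jue[OF that] inner_form_sym[OF m] by metis+
    have uJ: "m u (Jstd u) = 0" "m (Jstd u) u = 0" using self inner_form_sym[OF m] by metis+
    have ne: "u \<notin> ?E" "Jstd u \<notin> ?E" "u \<noteq> Jstd u" using uu ue JuJu Jue uJ by force+
    have "?U (u # us)"
      unfolding unitary_def pairs_simps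
    proof (intro conjI ballI)
      show "distinct (u # Jstd u # pairs Jstd us)" using ne us(1) unfolding unitary_def by auto
      fix e f assume "e \<in> set (u # Jstd u # pairs Jstd us)" "f \<in> set (u # Jstd u # pairs Jstd us)"
      then show "m e f = (if e = f then 1 else 0)"
        using uu ue JuJu Jue uJ ne eu on by auto
    qed
    then show False using us(2)[of "u # us"] by simp
  qed
  then have ob: "orthonormal_basis m ?E"
    using on unfolding orthonormal_basis_def by auto
  have "2 * length us = 2 * CARD('n)"
    using card_orthonormal_basis[OF m ob] distinct_card[of "pairs Jstd us"] us(1) unfolding unitary_def dim by simp
  then show ?thesis using us(1) ob by auto
qed

lemma trace_basis_independent:
  fixes f :: "'a::euclidean_space \<Rightarrow> 'a \<Rightarrow> 'b::real_vector"
  assumes "inner_form m" "orthonormal_basis m E" "orthonormal_basis m E'"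
    and "\<And>y. linear (\<lambda>x. f x y)" "\<And>x. linear (f x)"
  shows "(\<Sum>e\<in>E. f e e) = (\<Sum>e\<in>E'. f e e)"
  using trace_change_of_basis[OF assms(1,2,1,3), of "\<lambda>x. x" f] assms(4,5) by simp

text \<open>The equation \<open>F \<and> \<omega>\<^sup>n\<^sup>-\<^sup>1 = (z / n) \<omega>\<^sup>n\<close>, evaluated on a unitary basis.  The factor 2 appears since a real
  orthonormal basis contains both vectors of a pair \<open>u, J u\<close>.\<close>

lemma hermitian_einstein_trace:
  fixes F :: "(complex ^ 'n::finite) list \<Rightarrow> 'b::real_vector"
  assumes h: "hermitian m" and E: "orthonormal_basis m E"
    and F: "\<And>x y. F [y, x] = - F [x, y]" "\<And>y. linear (\<lambda>x. F [x, y])"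
    and he: "\<And>vs. length vs = 2 * CARD('n) \<Longrightarrow>
      wedge (\<lambda>\<xi> r. r *\<^sub>R \<xi>) 2 (2 * (CARD('n) - 1)) F (wedge_power (herm_form m) (CARD('n) - 1)) vs
      = (wedge_power (herm_form m) CARD('n) vs / real CARD('n)) *\<^sub>R z"
  shows "(\<Sum>e\<in>E. F [e, Jstd e]) = 2 *\<^sub>R z"
proof -
  note m = hermitian_inner_form[OF h]
  obtain us where us: "unitary m us" "length us = CARD('n)" "orthonormal_basis m (set (pairs Jstd us))"
    using exists_unitary_basis[OF h] by blast
  define j where "j = CARD('n) - 1"
  have j: "CARD('n) = Suc j" by (simp add: j_def)
  have "fact j *\<^sub>R (\<Sum>u\<in>set us. F [u, Jstd u])
      = wedge (\<lambda>\<xi> r. r *\<^sub>R \<xi>) 2 (2 * j) F (wedge_power (herm_form m) j) (pairs Jstd us)"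
    by (rule wedge_2_unitary[where F = F, OF h F(1) us(1), symmetric]) (use us(2) j wedge_power_unitary[OF h] in auto)
  also have "\<dots> = (fact CARD('n) / real CARD('n)) *\<^sub>R z"
    using he[of "pairs Jstd us"] wedge_power_unitary[OF h us(1)] us(2) unfolding j_def by simp
  also have "fact CARD('n) / real CARD('n) = fact j" unfolding j by simp
  finally have S: "(\<Sum>u\<in>set us. F [u, Jstd u]) = z" by simp
  have dis: "inj_on Jstd (set us)" "set us \<inter> Jstd ` set us = {}"
    using us unfolding unitary_def distinct_pairs by blast+
  have lin: "linear (\<lambda>y. F [x, Jstd y])" for x
  proof -
    have "linear (\<lambda>y. - F [y, x])" by (rule linear_compose_neg[OF F(2)])
    then have "linear (\<lambda>y. F [x, y])" by (simp add: F(1)[of x, symmetric])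
    from linear_compose[OF linear_Jstd this] show ?thesis by (simp add: o_def)
  qed
  have "(\<Sum>e\<in>E. F [e, Jstd e]) = (\<Sum>e\<in>set (pairs Jstd us). F [e, Jstd e])"
    by (rule trace_basis_independent[OF m E us(3), where f = "\<lambda>x y. F [x, Jstd y]"]) (use F(2) lin in auto)
  also have "\<dots> = (\<Sum>u\<in>set us. F [u, Jstd u]) + (\<Sum>u\<in>set us. F [Jstd u, Jstd (Jstd u)])"
    unfolding set_pairs using dis by (simp add: sum.union_disjoint sum.reindex)
  also have "(\<Sum>u\<in>set us. F [Jstd u, Jstd (Jstd u)]) = (\<Sum>u\<in>set us. F [u, Jstd u])"
  proof (rule sum.cong[OF refl])
    fix u show "F [Jstd u, Jstd (Jstd u)] = F [u, Jstd u]"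
      using F(1)[where x = "- u" and y = "Jstd u"] linear_neg[OF F(2)[of "Jstd u"], of u] by simp
  qed
  finally show ?thesis using S by (simp add: scaleR_2)
qed

section \<open>The Hodge star\<close>

text \<open>The properties of the volume form on which the calculus of the Hodge star rests.\<close>

locale oriented_orthonormal_basis =
  fixes m :: "'a::euclidean_space \<Rightarrow> 'a \<Rightarrow> real" and E :: "'a set" and vol :: "'a list \<Rightarrow> real"
  assumes m: "inner_form m" and E: "orthonormal_basis m E"
    and alt_vol: "alt (DIM('a)) vol" and mlin_vol: "mlin (DIM('a)) vol"
    and vol_sq: "\<And>bs. bs \<in> Ls E (DIM('a)) \<Longrightarrow> distinct bs \<Longrightarrow> vol bs * vol bs = 1"
begin

lemmas fin_E = finite_orthonormal_basis[OF m E] and card_E = card_orthonormal_basis[OF m E]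

text \<open>The square of the Hodge star, up to normalization.  Only the rearrangements \<open>ws\<close> of the basis vectors
  missing in \<open>as\<close> contribute, and for those only the rearrangements \<open>es\<close> of \<open>as\<close>.\<close>

lemma double_star_on_basis:
  fixes \<alpha> :: "'a list \<Rightarrow> 'b::real_vector"
  assumes kl: "DIM('a) = k + l" and \<alpha>: "alt k \<alpha>" and as: "as \<in> Ls E k"
  shows "(\<Sum>ws\<in>Ls E l. \<Sum>es\<in>Ls E k. (vol (as @ ws) * vol (es @ ws)) *\<^sub>R \<alpha> es) = (fact k * fact l) *\<^sub>R \<alpha> as"
proof (cases "distinct as")
  case False
  have "vol (as @ ws) = 0" if "ws \<in> Ls E l" for ws
    using alt_repeated[OF alt_vol, of "as @ ws"] False length_Ls[OF as] length_Ls[OF that] kl by simp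
  then show ?thesis using alt_repeated[OF \<alpha> length_Ls[OF as] False] by simp
next
  case True
  have cas: "card (set as) = k" "set as \<subseteq> E" using distinct_card[OF True] as by (auto simp: Ls_def)
  have full: "set ws = E" if "distinct ws" "ws \<in> Ls E (k + l)" for ws
    using that fin_E card_E kl distinct_card[of ws] by (intro card_subset_eq) (auto simp: Ls_def)
  let ?D = "permutations_of_set (E - set as)"
  have cD: "card (E - set as) = l" using cas card_E kl fin_E by (simp add: card_Diff_subset finite_subset)
  have inner: "(\<Sum>es\<in>Ls E k. (vol (as @ ws) * vol (es @ ws)) *\<^sub>R \<alpha> es) = (if ws \<in> ?D then fact k *\<^sub>R \<alpha> as else 0)"
    if ws: "ws \<in> Ls E l" for ws
  proof (cases "distinct (as @ ws)")
    case d: True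
    then have "set ws = E - set as" using full[OF d] ws as by (auto simp: Ls_def)
    then have wsD: "ws \<in> ?D" using d by (auto simp: permutations_of_set_def)
    have "(\<Sum>es\<in>Ls E k. vol (es @ ws) *\<^sub>R \<alpha> es) = fact k *\<^sub>R (vol (as @ ws) *\<^sub>R \<alpha> as)"
    proof (rule sum_alt_product[OF fin_E _ \<alpha> cas(2) True length_Ls[OF as]])
      show "alt k (\<lambda>us. vol (us @ ws))"
        using alt_vol kl length_Ls[OF ws] by (intro alt_append_left) simp
      fix es assume es: "es \<in> Ls E k" "distinct es" "set es \<noteq> set as"
      have "\<not> distinct (es @ ws)"
      proof
        assume d2: "distinct (es @ ws)"
        then have "set es = E - set ws" using full[OF d2] ws es by (auto simp: Ls_def)
        then show False using es(3) d full[OF d] ws as by (auto simp: Ls_def)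
      qed
      then have "vol (es @ ws) = 0"
        using alt_repeated[OF alt_vol, of "es @ ws"] kl length_Ls[OF ws] length_Ls[OF es(1)] by simp
      then show "vol (es @ ws) *\<^sub>R \<alpha> es = 0" by simp
    qed
    then have "(\<Sum>es\<in>Ls E k. (vol (as @ ws) * vol (es @ ws)) *\<^sub>R \<alpha> es)
        = vol (as @ ws) *\<^sub>R (fact k *\<^sub>R (vol (as @ ws) *\<^sub>R \<alpha> as))"
      by (simp flip: scaleR_scaleR scaleR_sum_right)
    also have "\<dots> = fact k *\<^sub>R ((vol (as @ ws) * vol (as @ ws)) *\<^sub>R \<alpha> as)" by (simp add: mult.left_commute)
    also have "vol (as @ ws) * vol (as @ ws) = 1"
      using as ws kl d by (intro vol_sq) (auto simp: Ls_def)
    finally show ?thesis using wsD by simp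
  next
    case d: False
    then have "ws \<notin> ?D" using True by (auto simp: permutations_of_set_def)
    moreover have "vol (as @ ws) = 0"
      using alt_repeated[OF alt_vol, of "as @ ws"] d length_Ls[OF as] length_Ls[OF ws] kl by simp
    ultimately show ?thesis by simp
  qed
  have sub: "?D \<subseteq> Ls E l"
    using cD distinct_card by (fastforce simp: permutations_of_set_def Ls_def)
  have "(\<Sum>ws\<in>Ls E l. \<Sum>es\<in>Ls E k. (vol (as @ ws) * vol (es @ ws)) *\<^sub>R \<alpha> es)
      = (\<Sum>ws\<in>Ls E l. if ws \<in> ?D then fact k *\<^sub>R \<alpha> as else 0)"
    by (rule sum.cong[OF refl inner])
  also have "\<dots> = (\<Sum>ws\<in>?D. fact k *\<^sub>R \<alpha> as)"
    using sub finite_Ls[OF fin_E] by (simp add: sum.If_cases Int_absorb1)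
  also have "\<dots> = (fact k * fact l) *\<^sub>R \<alpha> as"
    using fin_E cD by (simp add: sum_constant_scaleR mult.commute)
  finally show ?thesis .
qed

lemma double_star:
  fixes \<alpha> :: "'a list \<Rightarrow> 'b::real_vector"
  assumes kl: "DIM('a) = k + l" and \<alpha>: "alt k \<alpha>" "mlin k \<alpha>" and as: "length as = k"
  shows "(\<Sum>ws\<in>Ls E l. \<Sum>es\<in>Ls E k. (vol (as @ ws) * vol (es @ ws)) *\<^sub>R \<alpha> es) = (fact k * fact l) *\<^sub>R \<alpha> as"
proof (rule mlin_eq_on_basis[OF m E _ _ double_star_on_basis[OF kl \<alpha>(1)] as])
  show "mlin k (\<lambda>as. \<Sum>ws\<in>Ls E l. \<Sum>es\<in>Ls E k. (vol (as @ ws) * vol (es @ ws)) *\<^sub>R \<alpha> es)"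
    unfolding mlin_def
  proof (intro allI impI linear_compose_sum ballI)
    fix us vs ws es :: "'a list" assume len: "length us + Suc (length vs) = k" and ws: "ws \<in> Ls E l"
    have "linear (\<lambda>x. vol (us @ x # vs @ ws))"
      using len length_Ls[OF ws] kl by (intro mlinD[OF mlin_vol]) simp
    then show "linear (\<lambda>x. (vol ((us @ x # vs) @ ws) * vol (es @ ws)) *\<^sub>R \<alpha> es)"
      by (simp add: linear_iff algebra_simps scaleR_add_left)
  qed
  show "mlin k (\<lambda>as. (fact k * fact l) *\<^sub>R \<alpha> as)"
    using \<alpha>(2) unfolding mlin_def by (auto intro!: linear_compose_scale_right)
qed

text \<open>The algebraic core of \<open>* d *\<close> and of \<open>* (A \<and> * _)\<close>.  In even dimension the lengths \<open>k\<close> and \<open>l\<close> have different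
  parities, so that \<open>ws\<close> and \<open>vs\<close> may be exchanged without a sign.\<close>

lemma star_wedge_star:
  fixes A :: "'a \<Rightarrow> 'a list \<Rightarrow> 'b::real_vector"
  assumes kl: "DIM('a) = Suc k + l" and ev: "even (DIM('a))"
    and A: "\<And>x. x \<in> E \<Longrightarrow> alt (Suc k) (A x)" "\<And>x. x \<in> E \<Longrightarrow> mlin (Suc k) (A x)" and vs: "length vs = k"
  shows "(1 / fact l) *\<^sub>R (\<Sum>x\<in>E. \<Sum>ws\<in>Ls E l. vol (x # ws @ vs) *\<^sub>R
      ((1 / fact (Suc k)) *\<^sub>R (\<Sum>es\<in>Ls E (Suc k). vol (es @ ws) *\<^sub>R A x es))) = (\<Sum>x\<in>E. A x (x # vs))"
proof -
  have "even (l * k)" using ev kl by auto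
  then have sw: "vol (x # ws @ vs) = vol ((x # vs) @ ws)" if "ws \<in> Ls E l" for x ws
    using alt_swap_blocks[OF alt_vol, of "[x]" ws vs "[]"] length_Ls[OF that] vs kl by simp
  have "(\<Sum>ws\<in>Ls E l. vol (x # ws @ vs) *\<^sub>R ((1 / fact (Suc k)) *\<^sub>R (\<Sum>es\<in>Ls E (Suc k). vol (es @ ws) *\<^sub>R A x es)))
      = fact l *\<^sub>R A x (x # vs)" if x: "x \<in> E" for x
  proof -
    have "(\<Sum>ws\<in>Ls E l. vol (x # ws @ vs) *\<^sub>R ((1 / fact (Suc k)) *\<^sub>R (\<Sum>es\<in>Ls E (Suc k). vol (es @ ws) *\<^sub>R A x es)))
      = (1 / fact (Suc k)) *\<^sub>R (\<Sum>ws\<in>Ls E l. \<Sum>es\<in>Ls E (Suc k). (vol ((x # vs) @ ws) * vol (es @ ws)) *\<^sub>R A x es)"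
      unfolding scaleR_sum_right by (intro sum.cong) (auto simp: sw mult_ac)
    also have "\<dots> = (1 / fact (Suc k)) *\<^sub>R ((fact (Suc k) * fact l) *\<^sub>R A x (x # vs))"
      by (subst double_star[OF kl A(1,2)[OF x]]) (use vs in auto)
    finally show ?thesis by simp
  qed
  then show ?thesis by (simp add: scaleR_sum_right cong: sum.cong)
qed

text \<open>Now \<open>l\<close> is odd, and moving \<open>ws\<close> past the single vector \<open>v\<close> produces the sign of the right-hand side.\<close>

lemma star_wedge_star_3:
  fixes F :: "'a list \<Rightarrow> 'b::real_vector" and H :: "'a list \<Rightarrow> real"
  assumes kl: "DIM('a) = 3 + l" and ev: "even (DIM('a))" and H: "alt 3 H" "mlin 3 H"
  shows "(1 / fact (2 + l)) *\<^sub>R (\<Sum>ws\<in>Ls E (2 + l). vol (ws @ [v]) *\<^sub>R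
      wedge (\<lambda>\<xi> r. r *\<^sub>R \<xi>) 2 l F (\<lambda>us. (1 / fact 3) *\<^sub>R (\<Sum>es\<in>Ls E 3. vol (es @ us) *\<^sub>R H es)) ws)
    = - (1 / 2) *\<^sub>R (\<Sum>e\<in>E. \<Sum>f\<in>E. H [e, f, v] *\<^sub>R F [e, f])"
proof -
  have odd: "odd l" using ev kl by auto
  have sw: "vol (us @ ws @ [v]) = - vol ((us @ [v]) @ ws)" if "ws \<in> Ls E l" "us \<in> Ls E 2" for us ws
    using alt_swap_blocks[OF alt_vol, of us ws "[v]" "[]"] length_Ls[OF that(1)] length_Ls[OF that(2)] kl odd by simp
  have in1: "(\<Sum>ws\<in>Ls E l. vol (us @ ws @ [v]) * ((1 / fact 3) * (\<Sum>es\<in>Ls E 3. vol (es @ ws) * H es)))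
      = - fact l * H (us @ [v])" if us: "us \<in> Ls E 2" for us
  proof -
    have "(\<Sum>ws\<in>Ls E l. vol (us @ ws @ [v]) * ((1 / fact 3) * (\<Sum>es\<in>Ls E 3. vol (es @ ws) * H es)))
      = - (1 / fact 3) * (\<Sum>ws\<in>Ls E l. \<Sum>es\<in>Ls E 3. (vol ((us @ [v]) @ ws) * vol (es @ ws)) *\<^sub>R H es)"
      unfolding sum_distrib_left by (intro sum.cong) (auto simp: sw[OF _ us] mult_ac)
    also have "\<dots> = - (1 / fact 3) * ((fact 3 * fact l) *\<^sub>R H (us @ [v]))"
      by (subst double_star[OF kl H]) (use length_Ls[OF us] in auto)
    finally show ?thesis by simp
  qed
  have in2: "(\<Sum>ws\<in>Ls E l. vol ((us @ ws) @ [v]) *\<^sub>R (((1 / fact 3) *\<^sub>R (\<Sum>es\<in>Ls E 3. vol (es @ ws) *\<^sub>R H es)) *\<^sub>R F us))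
      = (- fact l * H (us @ [v])) *\<^sub>R F us" if us: "us \<in> Ls E 2" for us
    unfolding in1[OF us, symmetric] scaleR_sum_left by (rule sum.cong) simp_all
  have "alt (2 + l) (\<lambda>ws. vol (ws @ [v]))"
    using alt_vol kl by (intro alt_append_left) (simp add: numeral_3_eq_3)
  from sum_alt_wedge[OF this, where E = E and m = "\<lambda>\<xi> r. r *\<^sub>R \<xi>" and \<alpha> = F and \<beta> = "\<lambda>us. (1 / fact 3) *\<^sub>R (\<Sum>es\<in>Ls E 3. vol (es @ us) *\<^sub>R H es)"]
  have "(\<Sum>ws\<in>Ls E (2 + l). vol (ws @ [v]) *\<^sub>R
      wedge (\<lambda>\<xi> r. r *\<^sub>R \<xi>) 2 l F (\<lambda>us. (1 / fact 3) *\<^sub>R (\<Sum>es\<in>Ls E 3. vol (es @ us) *\<^sub>R H es)) ws)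
    = (fact (2 + l) / (fact 2 * fact l)) *\<^sub>R (\<Sum>us\<in>Ls E 2. (- fact l * H (us @ [v])) *\<^sub>R F us)"
    by (simp only: in2 cong: sum.cong)
  also have "\<dots> = fact (2 + l) *\<^sub>R (- (1 / 2) *\<^sub>R (\<Sum>us\<in>Ls E 2. H (us @ [v]) *\<^sub>R F us))"
    unfolding scaleR_sum_right by (intro sum.cong) (auto simp: fact_2)
  finally show ?thesis by (simp add: sum_Ls_2 del: fact_Suc)
qed

text \<open>Paired with an alternating form, all slots for the derivative in the exterior derivative contribute
  equally.\<close>

lemma sum_alt_alternating_sum:
  fixes Y :: "'a \<Rightarrow> 'a list \<Rightarrow> 'b::real_vector" and g :: "'a list \<Rightarrow> real"
  assumes g: "alt (Suc l) g"
  shows "(\<Sum>ws\<in>Ls E (Suc l). g ws *\<^sub>R (\<Sum>i<Suc l. (- 1) ^ i *\<^sub>R Y (ws ! i) (take i ws @ drop (Suc i) ws)))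
    = real (Suc l) *\<^sub>R (\<Sum>x\<in>E. \<Sum>ws\<in>Ls E l. g (x # ws) *\<^sub>R Y x ws)"
proof -
  have one: "(\<Sum>ws\<in>Ls E (Suc l). g ws *\<^sub>R ((- 1) ^ i *\<^sub>R Y (ws ! i) (take i ws @ drop (Suc i) ws)))
     = (\<Sum>x\<in>E. \<Sum>ws\<in>Ls E l. g (x # ws) *\<^sub>R Y x ws)" if i: "i < Suc l" for i
  proof -
    obtain j where l: "l = i + j" using i less_Suc_eq_le le_Suc_ex by metis
    have "(\<Sum>ws\<in>Ls E (Suc l). g ws *\<^sub>R ((- 1) ^ i *\<^sub>R Y (ws ! i) (take i ws @ drop (Suc i) ws)))
      = (\<Sum>us\<in>Ls E i. \<Sum>x\<in>E. \<Sum>zs\<in>Ls E j. g (us @ x # zs) *\<^sub>R ((- 1) ^ i *\<^sub>R Y x (us @ zs)))"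
      unfolding l add_Suc_right[symmetric]
      by (subst sum_Ls_add) (auto simp: sum_Ls_Suc length_Ls nth_append intro!: sum.cong)
    also have "\<dots> = (\<Sum>us\<in>Ls E i. \<Sum>x\<in>E. \<Sum>zs\<in>Ls E j. g (x # us @ zs) *\<^sub>R Y x (us @ zs))"
    proof (intro sum.cong refl)
      fix us x zs assume "us \<in> Ls E i" "zs \<in> Ls E j"
      then have "g (us @ x # zs) = (- 1) ^ i * g (x # us @ zs)"
        using alt_move[OF g, of "[]" us zs x] by (simp add: length_Ls l)
      then show "g (us @ x # zs) *\<^sub>R ((- 1) ^ i *\<^sub>R Y x (us @ zs)) = g (x # us @ zs) *\<^sub>R Y x (us @ zs)"
        by (simp add: mult.assoc[symmetric] mult.commute power_mult_distrib[symmetric] flip: power_mult_distrib)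
    qed
    also have "\<dots> = (\<Sum>x\<in>E. \<Sum>us\<in>Ls E i. \<Sum>zs\<in>Ls E j. g (x # us @ zs) *\<^sub>R Y x (us @ zs))"
      by (rule sum.swap)
    also have "\<dots> = (\<Sum>x\<in>E. \<Sum>ws\<in>Ls E l. g (x # ws) *\<^sub>R Y x ws)"
      unfolding l by (simp add: sum_Ls_add)
    finally show ?thesis .
  qed
  have "(\<Sum>ws\<in>Ls E (Suc l). g ws *\<^sub>R (\<Sum>i<Suc l. (- 1) ^ i *\<^sub>R Y (ws ! i) (take i ws @ drop (Suc i) ws)))
     = (\<Sum>i<Suc l. \<Sum>ws\<in>Ls E (Suc l). g ws *\<^sub>R ((- 1) ^ i *\<^sub>R Y (ws ! i) (take i ws @ drop (Suc i) ws)))"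
    unfolding scaleR_sum_right by (rule sum.swap)
  also have "\<dots> = (\<Sum>i<Suc l. \<Sum>x\<in>E. \<Sum>ws\<in>Ls E l. g (x # ws) *\<^sub>R Y x ws)"
    by (rule sum.cong[OF refl one]) simp
  also have "\<dots> = real (Suc l) *\<^sub>R (\<Sum>x\<in>E. \<Sum>ws\<in>Ls E l. g (x # ws) *\<^sub>R Y x ws)"
    by (simp only: sum_constant_scaleR card_lessThan)
  finally show ?thesis .
qed

end

lemma alt_vol_form: "alt (DIM(complex ^ 'n)) (vol_form (m :: complex ^ 'n::finite \<Rightarrow> complex ^ 'n \<Rightarrow> real))"
  using alt_wedge_power[of "CARD('n)" "herm_form m"] unfolding alt_def vol_form_def by (simp add: mult.commute)

lemma mlin_vol_form:
  fixes m :: "complex ^ 'n::finite \<Rightarrow> complex ^ 'n \<Rightarrow> real"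
  assumes "hermitian m" shows "mlin (DIM(complex ^ 'n)) (vol_form m)"
  using mlin_wedge_power[OF mlin_herm_form[OF assms], of "CARD('n)"] unfolding mlin_def vol_form_def
  by (auto simp: linear_iff add_divide_distrib mult.commute)

text \<open>The sum of \<open>vol\<^sup>2\<close> over all lists of basis vectors is an iterated trace, hence independent of the basis.
  It is \<open>(2n)!\<close> times the value of \<open>vol\<^sup>2\<close> on any distinct list, and that value is 1 on a unitary basis.\<close>

lemma vol_form_orthonormal:
  fixes m :: "complex ^ 'n::finite \<Rightarrow> complex ^ 'n \<Rightarrow> real"
  assumes h: "hermitian m" and E: "orthonormal_basis m E"
  shows "oriented_orthonormal_basis m E (vol_form m)"
proof
  note m = hermitian_inner_form[OF h]
  show "inner_form m" "orthonormal_basis m E" by fact+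
  show "alt (DIM(complex ^ 'n)) (vol_form m)" by (rule alt_vol_form)
  show ml: "mlin (DIM(complex ^ 'n)) (vol_form m)" by (rule mlin_vol_form[OF h])
  let ?N = "DIM(complex ^ 'n)"
  obtain us where us: "unitary m us" "length us = CARD('n)" "orthonormal_basis m (set (pairs Jstd us))"
    using exists_unitary_basis[OF h] by blast
  have v1: "vol_form m (pairs Jstd us) = 1"
    using wedge_power_unitary[OF h us(1)] us(2) by (simp add: vol_form_def)
  have tot: "(\<Sum>es\<in>Ls E ?N. vol_form m es *\<^sub>R vol_form m es) = fact ?N *\<^sub>R (vol_form m bs *\<^sub>R vol_form m bs)"
    if E: "orthonormal_basis m E" and bs: "bs \<in> Ls E ?N" "distinct bs" for E bs
  proof (rule sum_alt_product[OF _ alt_vol_form alt_vol_form])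
    have fin: "finite E" and card: "card E = ?N"
      using finite_orthonormal_basis[OF m E] card_orthonormal_basis[OF m E] by auto
    show "finite E" by fact
    show "set bs \<subseteq> E" "distinct bs" "length bs = ?N" using bs by (auto simp: Ls_def)
    have full: "set ws = E" if "ws \<in> Ls E ?N" "distinct ws" for ws
      using that fin card distinct_card[of ws] by (intro card_subset_eq) (auto simp: Ls_def)
    show "vol_form m ws *\<^sub>R vol_form m ws = 0"
      if "ws \<in> Ls E ?N" "distinct ws" "set ws \<noteq> set bs" for ws
      using that full[OF that(1,2)] full[OF bs] by simp
  qed
  fix bs assume bs: "bs \<in> Ls E ?N" "distinct bs"
  have "(\<Sum>es\<in>Ls E ?N. vol_form m es *\<^sub>R vol_form m es)
      = (\<Sum>es\<in>Ls (set (pairs Jstd us)) ?N. vol_form m es *\<^sub>R vol_form m (map (\<lambda>x. x) es))"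
  proof (rule trace_list_change_of_basis[OF m E m us(3), where F = "\<lambda>us vs. vol_form m us *\<^sub>R vol_form m vs"])
    show "mlin ?N (\<lambda>us. vol_form m us *\<^sub>R vol_form m vs)" "mlin ?N (\<lambda>us. vol_form m vs *\<^sub>R vol_form m us)" for vs
      using ml unfolding mlin_def by (auto simp: linear_iff algebra_simps)
  qed simp
  also have "\<dots> = fact ?N *\<^sub>R (vol_form m (pairs Jstd us) *\<^sub>R vol_form m (pairs Jstd us))"
    using tot[OF us(3), of "pairs Jstd us"] us(1,2) by (simp add: Ls_def unitary_def)
  finally show "vol_form m bs * vol_form m bs = 1"
    using tot[OF E bs] v1 by simp
qed

section \<open>Musical isomorphism\<close>

lemma sharp_inner:
  assumes m: "inner_form m" and f: "linear \<phi>"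
  shows "m (sharp m \<phi>) w = \<phi> w"
proof -
  obtain E where E: "orthonormal_basis m E" using exists_orthonormal_basis[OF m] by blast
  let ?u = "\<Sum>e\<in>E. \<phi> e *\<^sub>R e"
  have "m ?u w = \<phi> w" for w
  proof -
    have "m ?u w = (\<Sum>e\<in>E. \<phi> e * m e w)" by (rule inner_form_sum[OF m])
    also have "\<dots> = \<phi> w"
      using linear_orthonormal_expansion[OF m E f, of w] by (simp add: inner_form_sym[OF m, of w] mult.commute)
    finally show ?thesis .
  qed
  moreover have "u = ?u" if "\<forall>w. m u w = \<phi> w" for u
    using that calculation by (intro inner_form_eqI[OF m]) simp
  ultimately have "\<forall>w. m (sharp m \<phi>) w = \<phi> w"
    unfolding sharp_def by (intro theI[where P = "\<lambda>u. \<forall>w. m u w = \<phi> w"]) auto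
  then show ?thesis by blast
qed

lemma sharp_eqI:
  assumes "inner_form m" "\<And>w. m u w = \<phi> w" shows "sharp m \<phi> = u"
proof -
  have "\<phi> = m u" using assms(2) by auto
  then have "linear \<phi>" using inner_form_linear_right[OF assms(1)] by simp
  then show ?thesis using sharp_inner[OF assms(1)] assms(2) by (intro inner_form_eqI[OF assms(1)]) simp
qed

text \<open>A metric depending continuously on a point is bounded below locally uniformly: expand in a basis
  which is orthonormal at \<open>p\<close>.\<close>

lemma metric_lower_bound:
  fixes g :: "'w::real_normed_vector \<Rightarrow> 'a::euclidean_space \<Rightarrow> 'a \<Rightarrow> real"
  assumes g: "\<And>q. q \<in> U \<Longrightarrow> inner_form (g q)" and U: "open U" "p \<in> U" and E: "orthonormal_basis (g p) E"
    and cont: "\<And>a b. continuous (at p) (\<lambda>q. g q a b)"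
  shows "\<exists>C>0. eventually (\<lambda>q. \<forall>v. norm v \<le> C * (\<Sum>e\<in>E. \<bar>g q v e\<bar>)) (nhds p)"
proof -
  note gp = g[OF U(2)]
  have fin: "finite E" by (rule finite_orthonormal_basis[OF gp E])
  define C where "C = 2 * ((\<Sum>e\<in>E. norm e) + 1)"
  \<comment> \<open>Deviations of this size cost at most half of the sum \<open>S\<close> below.\<close>
  define \<epsilon> where "\<epsilon> = 1 / (2 * (real (card E) + 1))"
  have C: "C > 0" unfolding C_def by (simp add: add_nonneg_pos sum_nonneg)
  have \<epsilon>: "\<epsilon> > 0" "real (card E) * \<epsilon> \<le> 1/2" by (auto simp: \<epsilon>_def field_simps)
  have "eventually (\<lambda>q. dist (g q f e) (g p f e) < \<epsilon>) (nhds p)" for f e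
    using cont[of f e] \<epsilon>(1) unfolding isCont_def tendsto_at_iff_tendsto_nhds[of "\<lambda>q. g q f e" p]
    by (intro tendstoD)
  then have "eventually (\<lambda>q. \<forall>f\<in>E. \<forall>e\<in>E. dist (g q f e) (g p f e) < \<epsilon>) (nhds p)"
    using fin by (intro eventually_ball_finite ballI) auto
  moreover have "eventually (\<lambda>q. q \<in> U) (nhds p)" by (rule eventually_nhds_in_open[OF U])
  ultimately have "eventually (\<lambda>q. \<forall>v. norm v \<le> C * (\<Sum>e\<in>E. \<bar>g q v e\<bar>)) (nhds p)"
  proof eventually_elim
    case (elim q)
    show ?case
    proof
      fix v
      define S where "S = (\<Sum>f\<in>E. \<bar>g p v f\<bar>)"
      have S0: "S \<ge> 0" by (simp add: S_def sum_nonneg)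
      have diff: "\<bar>g p v e\<bar> - S * \<epsilon> \<le> \<bar>g q v e\<bar>" if e: "e \<in> E" for e
      proof -
        have "g q v e - g p v e = (\<Sum>f\<in>E. g p v f * (g q f e - g p f e))"
          using linear_orthonormal_expansion[OF gp E inner_form_linear_left[OF g[OF elim(2)]], of v e]
            linear_orthonormal_expansion[OF gp E inner_form_linear_left[OF gp], of v e]
          by (simp add: sum_subtractf right_diff_distrib)
        also have "\<bar>\<dots>\<bar> \<le> (\<Sum>f\<in>E. \<bar>g p v f * (g q f e - g p f e)\<bar>)" by (rule sum_abs)
        also have "\<dots> \<le> (\<Sum>f\<in>E. \<bar>g p v f\<bar> * \<epsilon>)"
        proof (rule sum_mono)
          fix f assume "f \<in> E"
          then have "\<bar>g q f e - g p f e\<bar> \<le> \<epsilon>" using elim(1) e by (force simp: dist_real_def intro: less_imp_le)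
          then show "\<bar>g p v f * (g q f e - g p f e)\<bar> \<le> \<bar>g p v f\<bar> * \<epsilon>"
            unfolding abs_mult by (rule mult_left_mono) simp
        qed
        also have "\<dots> = S * \<epsilon>" by (simp add: S_def sum_distrib_right)
        finally show ?thesis by linarith
      qed
      have "S - real (card E) * (S * \<epsilon>) = (\<Sum>e\<in>E. \<bar>g p v e\<bar> - S * \<epsilon>)" by (simp add: S_def sum_subtractf)
      also have "\<dots> \<le> (\<Sum>e\<in>E. \<bar>g q v e\<bar>)" by (rule sum_mono) (rule diff)
      finally have "S - real (card E) * (S * \<epsilon>) \<le> (\<Sum>e\<in>E. \<bar>g q v e\<bar>)" .
      moreover have "real (card E) * (S * \<epsilon>) \<le> S / 2"
        using mult_left_mono[OF \<epsilon>(2) S0] by (simp add: mult_ac)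
      ultimately have half: "S \<le> 2 * (\<Sum>e\<in>E. \<bar>g q v e\<bar>)" by linarith
      have "norm v = norm (\<Sum>e\<in>E. g p v e *\<^sub>R e)" using orthonormal_expansion[OF gp E, of v] by simp
      also have "\<dots> \<le> (\<Sum>e\<in>E. \<bar>g p v e\<bar> * norm e)" by (rule order_trans[OF norm_sum]) simp
      also have "\<dots> \<le> (\<Sum>e\<in>E. \<bar>g p v e\<bar> * (\<Sum>e\<in>E. norm e))"
        using fin by (intro sum_mono mult_left_mono member_le_sum) auto
      also have "\<dots> = S * (\<Sum>e\<in>E. norm e)" by (simp add: S_def sum_distrib_right)
      also have "\<dots> \<le> (2 * (\<Sum>e\<in>E. \<bar>g q v e\<bar>)) * ((\<Sum>e\<in>E. norm e) + 1)"
        using half S0 by (intro mult_mono) (auto simp: sum_nonneg)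
      also have "\<dots> = C * (\<Sum>e\<in>E. \<bar>g q v e\<bar>)" by (simp add: C_def)
      finally show "norm v \<le> C * (\<Sum>e\<in>E. \<bar>g q v e\<bar>)" .
    qed
  qed
  then show ?thesis using C by blast
qed

text \<open>Implicit differentiation of \<open>g q (u q) w = \<phi> q w\<close>: the equation determines a candidate \<open>u'\<close>, and the
  lower bound on the metric turns the error \<open>\<rho>\<close> of the equation into one of \<open>u\<close>.\<close>

lemma sharp_differentiable:
  fixes g :: "'w::real_normed_vector \<Rightarrow> complex ^ 'n::finite \<Rightarrow> complex ^ 'n \<Rightarrow> real"
  assumes g: "\<And>q. q \<in> U \<Longrightarrow> inner_form (g q)" and U: "open U" "p \<in> U"
    and g': "\<And>a b. ((\<lambda>q. g q a b) has_derivative (\<lambda>h. g' h a b)) (at p)"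
    and \<phi>: "\<And>q. q \<in> U \<Longrightarrow> linear (\<phi> q)" and \<phi>': "\<And>w. ((\<lambda>q. \<phi> q w) has_derivative (\<lambda>h. \<phi>' h w)) (at p)"
  obtains u' where "((\<lambda>q. sharp (g q) (\<phi> q)) has_derivative u') (at p)"
    "\<And>h w. g p (u' h) w = \<phi>' h w - g' h (sharp (g p) (\<phi> p)) w"
proof -
  note gp = g[OF U(2)]
  have evU: "eventually (\<lambda>q. q \<in> U) (nhds p)" by (rule eventually_nhds_in_open[OF U])
  obtain E where E: "orthonormal_basis (g p) E" using exists_orthonormal_basis[OF gp] by blast
  have fin: "finite E" by (rule finite_orthonormal_basis[OF gp E])
  define u where "u q = sharp (g q) (\<phi> q)" for q
  have u: "g q (u q) w = \<phi> q w" if "q \<in> U" for q w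
    unfolding u_def using sharp_inner[OF g[OF that] \<phi>[OF that]] .
  define u' where "u' h = (\<Sum>e\<in>E. (\<phi>' h e - g' h (u p) e) *\<^sub>R e)" for h
  have bl: "bounded_linear u'" unfolding u'_def
    by (intro bounded_linear_sum bounded_linear_scaleR_const bounded_linear_sub
        has_derivative_bounded_linear[OF \<phi>'] has_derivative_bounded_linear[OF g'])
  have u'e: "g p (u' h) e = \<phi>' h e - g' h (u p) e" if "e \<in> E" for h e
  proof -
    have "g p (u' h) e = (\<Sum>f\<in>E. (\<phi>' h f - g' h (u p) f) * g p f e)"
      unfolding u'_def by (rule inner_form_sum[OF gp])
    also have "\<dots> = (\<Sum>f\<in>E. if f = e then \<phi>' h f - g' h (u p) f else 0)"
      using that orthonormal_basis_D[OF gp E] by (intro sum.cong) auto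
    finally show ?thesis using that fin by simp
  qed
  define \<rho> where "\<rho> e q = \<phi> q e - g q (u p) e - g q (u' (q - p)) e" for e q
  have g'0: "g' h 0 b = 0" for h b
  proof -
    have "((\<lambda>q. 0::real) has_derivative (\<lambda>h. g' h 0 b)) (at p)"
      by (rule has_derivative_transform_nhds[OF g'])
        (use evU g in \<open>auto elim!: eventually_mono simp: inner_form_bilinear\<close>)
    then show ?thesis using has_derivative_unique[OF has_derivative_const] by metis
  qed
  have \<rho>': "(\<rho> e has_derivative (\<lambda>h. 0)) (at p)" if e: "e \<in> E" for e
  proof -
    have w: "((\<lambda>q. u' (q - p)) has_derivative u') (at p)"
      by (rule bounded_linear.has_derivative[OF bl, where g = "\<lambda>q. q - p" and g' = "\<lambda>h. h"])
        (auto intro!: derivative_eq_intros)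
    have u0: "u' 0 = 0" using bl by (rule linear_simps(3))
    have "((\<lambda>q. g q (u' (q - p)) e) has_derivative (\<lambda>h. g' h (u' (p - p)) e + g p (u' h) e)) (at p)"
      by (rule has_derivative_linear_family[where L = "\<lambda>q v. g q v e", OF finite_dimensional_euclidean g' _ w])
        (use evU in \<open>auto elim!: eventually_mono intro!: inner_form_linear_left g\<close>)
    then have "((\<lambda>q. g q (u' (q - p)) e) has_derivative (\<lambda>h. \<phi>' h e - g' h (u p) e)) (at p)"
      using u'e[OF e] by (simp add: u0 g'0)
    from has_derivative_diff[OF has_derivative_diff[OF \<phi>'[of e] g'[of "u p" e]] this]
    show ?thesis unfolding \<rho>_def by simp
  qed
  have \<rho>p: "\<rho> e p = 0" for e
    using u[OF U(2), of e] linear_simps(3)[OF bl] by (simp add: \<rho>_def inner_form_bilinear[OF gp])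
  have "continuous (at p) (\<lambda>q. g q a b)" for a b using g' has_derivative_continuous by blast
  then obtain C where C: "C > 0" "eventually (\<lambda>q. \<forall>v. norm v \<le> C * (\<Sum>e\<in>E. \<bar>g q v e\<bar>)) (nhds p)"
    using metric_lower_bound[where g = g, OF g U E] by blast
  have bound: "eventually (\<lambda>q. norm (u q - u p - u' (q - p)) \<le> C * (\<Sum>e\<in>E. \<bar>\<rho> e q\<bar>)) (nhds p)"
    using C(2) evU
  proof eventually_elim
    case (elim q)
    have "g q (u q - u p - u' (q - p)) e = \<rho> e q" for e
      using u[OF elim(2)] by (simp add: \<rho>_def inner_form_bilinear[OF g[OF elim(2)]])
    then show ?case using elim(1)[rule_format, of "u q - u p - u' (q - p)"] by simp
  qed
  have uder: "(u has_derivative u') (at p)"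
    unfolding has_derivative_iff_norm
  proof (intro conjI bl)
    have "((\<lambda>q. \<bar>\<rho> e q\<bar> / norm (q - p)) \<longlongrightarrow> 0) (at p)" if "e \<in> E" for e
      using \<rho>'[OF that] unfolding has_derivative_iff_norm by (simp add: \<rho>p)
    then have "((\<lambda>q. C * (\<Sum>e\<in>E. \<bar>\<rho> e q\<bar> / norm (q - p))) \<longlongrightarrow> C * (\<Sum>e\<in>E. 0)) (at p)"
      by (intro tendsto_mult_left tendsto_sum) auto
    then have lim: "((\<lambda>q. C * (\<Sum>e\<in>E. \<bar>\<rho> e q\<bar> / norm (q - p))) \<longlongrightarrow> 0) (at p)" by simp
    show "((\<lambda>q. norm (u q - u p - u' (q - p)) / norm (q - p)) \<longlongrightarrow> 0) (at p)"
    proof (rule Lim_null_comparison[OF _ lim])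
      have "eventually (\<lambda>q. norm (u q - u p - u' (q - p)) \<le> C * (\<Sum>e\<in>E. \<bar>\<rho> e q\<bar>)) (at p)"
        using bound by (simp add: eventually_nhds_conv_at)
      then show "eventually (\<lambda>q. norm (norm (u q - u p - u' (q - p)) / norm (q - p))
          \<le> C * (\<Sum>e\<in>E. \<bar>\<rho> e q\<bar> / norm (q - p))) (at p)"
      proof eventually_elim
        case (elim q)
        have "norm (norm (u q - u p - u' (q - p)) / norm (q - p)) \<le> (C * (\<Sum>e\<in>E. \<bar>\<rho> e q\<bar>)) / norm (q - p)"
          using elim by (simp add: divide_right_mono)
        also have "\<dots> = C * (\<Sum>e\<in>E. \<bar>\<rho> e q\<bar> / norm (q - p))" by (simp flip: sum_divide_distrib)
        finally show ?case .
      qed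
    qed
  qed
  have "g p (u' h) w = \<phi>' h w - g' h (u p) w" for h w
  proof -
    have "((\<lambda>q. g q (u q) w) has_derivative (\<lambda>h. g' h (u p) w + g p (u' h) w)) (at p)"
      by (rule has_derivative_linear_family[where L = "\<lambda>q v. g q v w", OF finite_dimensional_euclidean g' _ uder])
        (use evU in \<open>auto elim!: eventually_mono intro!: inner_form_linear_left g\<close>)
    then have "((\<lambda>q. \<phi> q w) has_derivative (\<lambda>h. g' h (u p) w + g p (u' h) w)) (at p)"
      by (rule has_derivative_transform_nhds) (use evU u in \<open>auto elim!: eventually_mono\<close>)
    from has_derivative_unique[OF this \<phi>'] have "g' h (u p) w + g p (u' h) w = \<phi>' h w" by metis
    then show ?thesis by simp
  qed
  then show thesis using that[of u'] uder unfolding u_def by blast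
qed

section \<open>The form \<open>d\<^sup>c \<omega>\<close>\<close>

lemma sum_Pow_lessThan_Suc:
  "(\<Sum>T\<in>Pow {..<Suc n}. f T) = (\<Sum>T\<in>Pow {..<n}. f T) + (\<Sum>T\<in>Pow {..<n}. f (insert n T))"
proof -
  have "inj_on (insert n) (Pow {..<n})"
    by (intro inj_onI) (metis Diff_insert_absorb PowD lessThan_iff less_irrefl subset_iff)
  moreover have "Pow {..<n} \<inter> insert n ` Pow {..<n} = {}" by auto
  ultimately show ?thesis
    by (simp add: lessThan_Suc Pow_insert sum.union_disjoint sum.reindex)
qed

lemma subsets_of_2: "{S. S \<subseteq> {..<2::nat} \<and> card S = 0} = {{}}" "{S. S \<subseteq> {..<2::nat} \<and> card S = 1} = {{0}, {1}}"
    "{S. S \<subseteq> {..<2::nat} \<and> card S = 2} = {{0, 1}}"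
  and subsets_of_3: "{S. S \<subseteq> {..<3::nat} \<and> card S = 1} = {{0}, {1}, {2}}"
    "{S. S \<subseteq> {..<3::nat} \<and> card S = 2} = {{0, 1}, {0, 2}, {1, 2}}"
proof -
  have 2: "S \<subseteq> {..<2} \<longleftrightarrow> S \<in> {{}, {0}, {1}, {0, 1}}" for S :: "nat set"
  proof -
    have "{..<2::nat} = {0, 1}" by auto
    then have "Pow {..<2::nat} = {{}, {0}, {1}, {0, 1}}" by (auto simp: Pow_insert)
    then show ?thesis by (simp only: Pow_iff[symmetric])
  qed
  have 3: "S \<subseteq> {..<3} \<longleftrightarrow> S \<in> {{}, {0}, {1}, {2}, {0, 1}, {0, 2}, {1, 2}, {0, 1, 2}}" for S :: "nat set"
  proof -
    have "{..<3::nat} = {0, 1, 2}" by auto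
    then have "Pow {..<3::nat} = {{}, {0}, {1}, {2}, {0, 1}, {0, 2}, {1, 2}, {0, 1, 2}}" by (auto simp: Pow_insert)
    then show ?thesis by (simp only: Pow_iff[symmetric])
  qed
  show "{S. S \<subseteq> {..<2::nat} \<and> card S = 0} = {{}}" "{S. S \<subseteq> {..<2::nat} \<and> card S = 1} = {{0}, {1}}"
    "{S. S \<subseteq> {..<2::nat} \<and> card S = 2} = {{0, 1}}" unfolding 2 by auto
  show "{S. S \<subseteq> {..<3::nat} \<and> card S = 1} = {{0}, {1}, {2}}"
    "{S. S \<subseteq> {..<3::nat} \<and> card S = 2} = {{0, 1}, {0, 2}, {1, 2}}" unfolding 3 by auto
qed

lemma type_part_2:
  assumes a: "\<And>x y. \<alpha> [J x, J y] = \<alpha> [x, y]" "\<And>x y. \<alpha> [J x, y] = - \<alpha> [x, J y]"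
  shows "type_part J 0 2 \<alpha> [v, w] = 0" "type_part J 2 0 \<alpha> [v, w] = 0" "type_part J 1 1 \<alpha> [v, w] = \<alpha> [v, w]"
proof -
  have up: "[0..<2] = [0, 1::nat]" by (simp add: upt_rec)
  have P: "(\<Sum>T\<in>Pow {..<2}. f T) = f {} + f {0} + f {1} + f {0, 1}" for f :: "nat set \<Rightarrow> complex"
    by (simp add: numeral_2_eq_2 sum_Pow_lessThan_Suc insert_commute)
  show "type_part J 0 2 \<alpha> [v, w] = 0" "type_part J 2 0 \<alpha> [v, w] = 0"
    unfolding type_part_def add_0 add_0_right subsets_of_2 P up using a[of v w] by simp_all
  show "type_part J 1 1 \<alpha> [v, w] = \<alpha> [v, w]"
    unfolding type_part_def one_add_one subsets_of_2 P up using a[of v w] by simp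
qed

text \<open>On 3-forms without parts of type \<open>(3, 0)\<close> and \<open>(0, 3)\<close> the right-hand side is
  \<open>- \<alpha> (J a, J b, J c)\<close>.\<close>

lemma type_part_3:
  "\<i> * (type_part J 1 2 \<alpha> [a, b, c] - type_part J 2 1 \<alpha> [a, b, c])
    = - (\<alpha> [J a, b, c] + \<alpha> [a, J b, c] + \<alpha> [a, b, J c]) / 4 - 3 * \<alpha> [J a, J b, J c] / 4"
proof -
  have up: "[0..<3] = [0, 1, 2::nat]" by (simp add: upt_rec)
  have P: "(\<Sum>T\<in>Pow {..<3}. f T) = f {} + f {0} + f {1} + f {2} + f {0, 1} + f {0, 2} + f {1, 2} + f {0, 1, 2}"
    for f :: "nat set \<Rightarrow> complex"
    by (simp add: numeral_3_eq_3 numeral_2_eq_2 sum_Pow_lessThan_Suc insert_commute)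
  have 12: "1 + 2 = (3::nat)" "2 + 1 = (3::nat)" by simp_all
  have S1: "(\<Sum>S\<in>{{0}, {1}, {2}}. f S) = f {0} + f {1} + f {2}"
    and S2: "(\<Sum>S\<in>{{0, 1}, {0, 2}, {1, 2}}. f S) = f {0, 1} + f {0, 2} + f {1, 2}" for f :: "nat set \<Rightarrow> complex"
    by (simp_all add: doubleton_eq_iff)
  show ?thesis
    unfolding type_part_def 12 subsets_of_3 S1 S2 P up
    by (simp add: field_simps)
qed

lemma altI:
  fixes \<alpha> :: "'a list \<Rightarrow> 'b::real_vector"
  assumes "\<And>ws i j. length ws = k \<Longrightarrow> i < j \<Longrightarrow> j < k \<Longrightarrow>
      \<alpha> (permute_list (Transposition.transpose i j) ws) = - \<alpha> ws"
  shows "alt k \<alpha>"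
proof -
  have sw: "\<alpha> (permute_list (Transposition.transpose i j) ws) = - \<alpha> ws"
    if "length ws = k" "i \<noteq> j" "i < k" "j < k" for ws i j
    using assms[OF that(1), of i j] assms[OF that(1), of j i] that
    by (cases "i < j") (auto simp: transpose_commute)
  have "\<forall>ws. length ws = k \<longrightarrow> \<alpha> (permute_list \<sigma> ws) = of_int (sign \<sigma>) *\<^sub>R \<alpha> ws" if "\<sigma> permutes {..<k}" for \<sigma>
    using finite_lessThan that
  proof (induction rule: permutes_rev_induct)
    case (swap a b p)
    show ?case
    proof (cases "a = b")
      case False
      show ?thesis
      proof (intro allI impI)
        fix ws :: "'a list" assume ws: "length ws = k"
        let ?t = "Transposition.transpose a b"
        have t: "?t permutes {..<k}" using swap by (intro permutes_swap_id) auto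
        have "sign (p \<circ> ?t) = sign p * sign ?t"
          using swap t by (intro sign_compose) (auto intro: permutes_imp_permutation[rotated])
        then have "sign (p \<circ> ?t) = - sign p" using False by (simp add: sign_swap_id)
        moreover have "permute_list (p \<circ> ?t) ws = permute_list ?t (permute_list p ws)"
          using t ws by (intro permute_list_compose) simp
        ultimately show "\<alpha> (permute_list (p \<circ> ?t) ws) = of_int (sign (p \<circ> ?t)) *\<^sub>R \<alpha> ws"
          using swap sw[of "permute_list p ws" a b] ws False by simp
      qed
    qed (use swap in simp)
  qed simp
  then show ?thesis unfolding alt_def by blast
qed

lemma alt_2I:
  fixes \<alpha> :: "'a list \<Rightarrow> 'b::real_vector"
  assumes "\<And>x y. \<alpha> [y, x] = - \<alpha> [x, y]"
  shows "alt 2 \<alpha>"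
proof (rule altI)
  fix ws :: "'a list" and i j :: nat assume "length ws = 2" "i < j" "j < 2"
  then obtain x y where "ws = [x, y]" "i = 0" "j = 1"
    by (auto simp: numeral_2_eq_2 length_Suc_conv)
  then show "\<alpha> (permute_list (Transposition.transpose i j) ws) = - \<alpha> ws"
    using assms[of x y] by (simp add: permute_list_def)
qed

lemma alt_3I:
  fixes \<alpha> :: "'a list \<Rightarrow> 'b::real_vector"
  assumes 1: "\<And>x y z. \<alpha> [y, x, z] = - \<alpha> [x, y, z]" and 2: "\<And>x y z. \<alpha> [x, z, y] = - \<alpha> [x, y, z]"
  shows "alt 3 \<alpha>"
proof (rule altI)
  fix ws :: "'a list" and i j :: nat assume a: "length ws = 3" "i < j" "j < 3"
  then obtain x y z where ws: "ws = [x, y, z]" by (auto simp: numeral_3_eq_3 length_Suc_conv)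
  have 3: "\<alpha> [z, y, x] = - \<alpha> [x, y, z]" using 1[of y z x] 2[of y x z] 1[of x y z] by simp
  from a consider "i = 0" "j = 1" | "i = 0" "j = 2" | "i = 1" "j = 2" by linarith
  then show "\<alpha> (permute_list (Transposition.transpose i j) ws) = - \<alpha> ws"
    by cases (use 1[of x y z] 2[of x y z] 3 in \<open>simp_all add: ws permute_list_def Transposition.transpose_def numeral_2_eq_2\<close>)
qed

lemma mlin_3I:
  assumes "\<And>y z. linear (\<lambda>x. \<alpha> [x, y, z])" "\<And>x z. linear (\<lambda>y. \<alpha> [x, y, z])" "\<And>x y. linear (\<lambda>z. \<alpha> [x, y, z])"
  shows "mlin 3 \<alpha>"
  unfolding mlin_def
proof (intro allI impI)
  fix us vs :: "'a list" assume "length us + Suc (length vs) = 3"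
  then consider y z where "us = []" "vs = [y, z]" | x z where "us = [x]" "vs = [z]" | x y where "us = [x, y]" "vs = []"
    by (cases us; cases vs; cases "tl us"; cases "tl vs") auto
  then show "linear (\<lambda>x. \<alpha> (us @ x # vs))" using assms by cases auto
qed

lemma type_part_3_cong:
  assumes "\<And>x y z. \<alpha> [x, y, z] = \<beta> [x, y, z]" "r + s = 3"
  shows "type_part J r s \<alpha> [a, b, c] = type_part J r s \<beta> [a, b, c]"
proof -
  have "[0..<3] = [0, 1, 2::nat]" by (simp add: upt_rec)
  then show ?thesis unfolding type_part_def assms(2) using assms(1) by simp
qed

section \<open>The Levi-Civita and Bismut connections\<close>

locale hermitian_chart =
  fixes U :: "(complex ^ 'n::finite) set" and g :: "'n metric"
  assumes open_U: "open U" and herm: "\<And>q. q \<in> U \<Longrightarrow> hermitian (g q)"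
    and smooth_g: "\<And>a b. smooth_on U (\<lambda>q. g q a b)"
begin

definition dg where "dg p x a b = frechet_derivative (\<lambda>q. g q a b) (at p) x"

lemma inner_g: "q \<in> U \<Longrightarrow> inner_form (g q)" by (rule hermitian_inner_form[OF herm])

lemmas g_bil = inner_form_bilinear[OF inner_g]
lemmas g_sym = inner_form_sym[OF inner_g]
lemmas g_J = hermitian_J[OF herm]
lemmas g_J_left = hermitian_J_left[OF herm]

lemma eventually_U: "p \<in> U \<Longrightarrow> eventually (\<lambda>q. q \<in> U) (nhds p)"
  by (rule eventually_nhds_in_open[OF open_U])

lemma transform_U:
  assumes "(f has_derivative D) (at p)" "p \<in> U" "\<And>q. q \<in> U \<Longrightarrow> f q = h q"
  shows "(h has_derivative D) (at p)"
  using has_derivative_transform_within_open[OF assms(1) open_U assms(2)] assms(3) by blast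

lemma dg_has_derivative: "p \<in> U \<Longrightarrow> ((\<lambda>q. g q a b) has_derivative (\<lambda>x. dg p x a b)) (at p)"
  using smooth_on_differentiable[OF smooth_g] frechet_derivative_works unfolding dg_def by blast

lemma smooth_dg: "smooth_on U (\<lambda>p. dg p x a b)"
  unfolding dg_def by (rule smooth_on_frechet_derivative[OF smooth_g])

lemma dg_eqI:
  assumes "p \<in> U" "\<And>q. q \<in> U \<Longrightarrow> g q a b = f q" "(f has_derivative D) (at p)"
  shows "dg p x a b = D x"
  using has_derivative_unique[OF dg_has_derivative[OF assms(1)] transform_U[OF assms(3,1)]] assms(2) by metis

lemma dg_bil:
  assumes p: "p \<in> U"
  shows "dg p (x + y) a b = dg p x a b + dg p y a b" "dg p (c *\<^sub>R x) a b = c * dg p x a b"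
    "dg p (- x) a b = - dg p x a b"
    "dg p x (a + a') b = dg p x a b + dg p x a' b" "dg p x (c *\<^sub>R a) b = c * dg p x a b" "dg p x (- a) b = - dg p x a b"
    "dg p x a (b + b') = dg p x a b + dg p x a b'" "dg p x a (c *\<^sub>R b) = c * dg p x a b" "dg p x a (- b) = - dg p x a b"
proof -
  note l = has_derivative_linear[OF dg_has_derivative[OF p]]
  show "dg p (x + y) a b = dg p x a b + dg p y a b" "dg p (c *\<^sub>R x) a b = c * dg p x a b" "dg p (- x) a b = - dg p x a b"
    using linear_add[OF l] linear_scale[OF l] linear_neg[OF l] by simp_all
  note d = dg_has_derivative[OF p]
  show "dg p x (a + a') b = dg p x a b + dg p x a' b"
    by (rule dg_eqI[OF p _ has_derivative_add[OF d d]]) (simp add: g_bil)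
  show "dg p x (c *\<^sub>R a) b = c * dg p x a b"
    by (rule dg_eqI[OF p _ has_derivative_mult_right[OF d]]) (simp add: g_bil)
  show "dg p x (- a) b = - dg p x a b"
    by (rule dg_eqI[OF p _ has_derivative_minus[OF d]]) (simp add: g_bil)
  show "dg p x a (b + b') = dg p x a b + dg p x a b'"
    by (rule dg_eqI[OF p _ has_derivative_add[OF d d]]) (simp add: g_bil)
  show "dg p x a (c *\<^sub>R b) = c * dg p x a b"
    by (rule dg_eqI[OF p _ has_derivative_mult_right[OF d]]) (simp add: g_bil)
  show "dg p x a (- b) = - dg p x a b"
    by (rule dg_eqI[OF p _ has_derivative_minus[OF d]]) (simp add: g_bil)
qed

lemma dg_sym: "p \<in> U \<Longrightarrow> dg p x a b = dg p x b a"
  by (rule dg_eqI[OF _ _ dg_has_derivative]) (auto simp: g_sym)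

lemma dg_JJ: "p \<in> U \<Longrightarrow> dg p x (Jstd a) (Jstd b) = dg p x a b"
  by (rule dg_eqI[OF _ _ dg_has_derivative]) (auto simp: g_J)

lemma dg_J: "p \<in> U \<Longrightarrow> dg p x (Jstd a) b = - dg p x a (Jstd b)"
  using dg_JJ[of p x a "Jstd b"] by (simp add: dg_bil)

lemma ext_d_omega: "ext_d (omega g) p [a, b, c] = dg p a (Jstd b) c - dg p b (Jstd a) c + dg p c (Jstd a) b"
  by (simp add: ext_d_def omega_def herm_form_def dg_def numeral_3_eq_3)

text \<open>This is \<open>d\<omega> (J a, J b, J c)\<close>, i.e. the form \<open>- d\<^sup>c \<omega>\<close>, written out in derivatives of the metric.\<close>

definition H where "H p a b c = dg p (Jstd a) (Jstd b) c - dg p (Jstd b) (Jstd a) c + dg p (Jstd c) (Jstd a) b"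

text \<open>As \<open>\<omega>\<close> is of type \<open>(1, 1)\<close>, the forms \<open>\<partial>\<omega>\<close> and \<open>\<partial>\<close>-bar \<open>\<omega>\<close> are the parts of \<open>d\<omega>\<close> of types \<open>(2, 1)\<close> and
  \<open>(1, 2)\<close>.\<close>

lemma dc_omega_eq:
  assumes p: "p \<in> U"
  shows "dc_omega g p [a, b, c] = - complex_of_real (H p a b c)"
proof -
  let ?\<alpha> = "\<lambda>q vs. complex_of_real (omega g q vs)"
  let ?T = "\<lambda>r. ext_d (\<lambda>q. type_part Jstd r (2 - r) (?\<alpha> q)) p"
  have a: "?\<alpha> q [Jstd x, Jstd y] = ?\<alpha> q [x, y]" "?\<alpha> q [Jstd x, y] = - ?\<alpha> q [x, Jstd y]" if "q \<in> U" for q x y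
    using that by (simp_all add: omega_def herm_form_def g_J g_bil) (simp add: g_J_left g_bil)
  have z: "type_part Jstd 0 2 (?\<alpha> q) [x, y] = 0" "type_part Jstd 2 0 (?\<alpha> q) [x, y] = 0"
    "type_part Jstd 1 1 (?\<alpha> q) [x, y] = ?\<alpha> q [x, y]" if "q \<in> U" for q x y
    using type_part_2[of "?\<alpha> q" Jstd x y] a[OF that] by blast+
  have fd0: "frechet_derivative (\<lambda>q. f q) (at p) x = 0" if "\<And>q. q \<in> U \<Longrightarrow> f q = 0" for f :: "complex ^ 'n \<Rightarrow> complex" and x
    using frechet_derivative_eq[OF transform_U[OF has_derivative_const p, of 0 f]] that by simp
  have fd1: "frechet_derivative (\<lambda>q. f q) (at p) x = of_real (frechet_derivative h (at p) x)"
    if "\<And>q. q \<in> U \<Longrightarrow> f q = of_real (h q)" "h differentiable (at p)" for f :: "complex ^ 'n \<Rightarrow> complex" and h x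
  proof -
    have "(h has_derivative frechet_derivative h (at p)) (at p)" using that(2) frechet_derivative_works by blast
    from frechet_derivative_eq[OF transform_U[OF has_derivative_of_real[OF this] p, of f]] that(1)
    show ?thesis by simp
  qed
  have dw: "(\<lambda>q. omega g q [x, y]) differentiable (at p)" for x y
    using dg_has_derivative[OF p] unfolding omega_def herm_form_def differentiable_def by auto
  have T0: "?T 0 [x, y, z] = 0" and T2: "?T 2 [x, y, z] = 0" for x y z
    unfolding ext_d_def by (simp_all add: numeral_3_eq_3 fd0 z)
  have fdT: "frechet_derivative (\<lambda>q. type_part Jstd (Suc 0) (Suc 0) (?\<alpha> q) [x, y]) (at p) v
      = of_real (frechet_derivative (\<lambda>q. omega g q [x, y]) (at p) v)" for x y v
    by (rule fd1[OF _ dw]) (use z(3) in simp)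
  have T1: "?T 1 [x, y, z] = of_real (ext_d (omega g) p [x, y, z])" for x y z
    unfolding ext_d_def by (simp add: numeral_3_eq_3 fdT)
  have zero: "type_part Jstd r s (\<lambda>vs. 0) ws = 0" for r s and ws :: "(complex ^ 'n) list"
    by (simp add: type_part_def)
  let ?\<tau> = "\<lambda>vs. complex_of_real (ext_d (omega g) p vs)"
  have del: "del Jstd 2 ?\<alpha> p [a, b, c] = type_part Jstd 2 1 ?\<tau> [a, b, c]"
  proof -
    have "del Jstd 2 ?\<alpha> p [a, b, c] = type_part Jstd 1 2 (?T 0) [a, b, c] + type_part Jstd 2 1 (?T 1) [a, b, c]
        + type_part Jstd 3 0 (?T 2) [a, b, c]"
      unfolding del_def by (simp add: numeral_2_eq_2 numeral_3_eq_3)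
    also have "type_part Jstd 1 2 (?T 0) [a, b, c] = type_part Jstd 1 2 (\<lambda>vs. 0) [a, b, c]"
      by (rule type_part_3_cong, rule T0, simp)
    also have "type_part Jstd 3 0 (?T 2) [a, b, c] = type_part Jstd 3 0 (\<lambda>vs. 0) [a, b, c]"
      by (rule type_part_3_cong, rule T2, simp)
    also have "type_part Jstd 2 1 (?T 1) [a, b, c] = type_part Jstd 2 1 ?\<tau> [a, b, c]"
      by (rule type_part_3_cong, rule T1, simp)
    finally show ?thesis by (simp add: zero)
  qed
  have delbar: "delbar Jstd 2 ?\<alpha> p [a, b, c] = type_part Jstd 1 2 ?\<tau> [a, b, c]"
  proof -
    have "delbar Jstd 2 ?\<alpha> p [a, b, c] = type_part Jstd 0 3 (?T 0) [a, b, c] + type_part Jstd 1 2 (?T 1) [a, b, c]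
        + type_part Jstd 2 1 (?T 2) [a, b, c]"
      unfolding delbar_def by (simp add: numeral_2_eq_2 numeral_3_eq_3)
    also have "type_part Jstd 0 3 (?T 0) [a, b, c] = type_part Jstd 0 3 (\<lambda>vs. 0) [a, b, c]"
      by (rule type_part_3_cong, rule T0, simp)
    also have "type_part Jstd 2 1 (?T 2) [a, b, c] = type_part Jstd 2 1 (\<lambda>vs. 0) [a, b, c]"
      by (rule type_part_3_cong, rule T2, simp)
    also have "type_part Jstd 1 2 (?T 1) [a, b, c] = type_part Jstd 1 2 ?\<tau> [a, b, c]"
      by (rule type_part_3_cong, rule T1, simp)
    finally show ?thesis by (simp add: zero)
  qed
  have "dc_omega g p [a, b, c] = \<i> * (type_part Jstd 1 2 ?\<tau> [a, b, c] - type_part Jstd 2 1 ?\<tau> [a, b, c])"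
    unfolding dc_omega_def dc_def del delbar ..
  also have "\<dots> = of_real (- (ext_d (omega g) p [Jstd a, b, c] + ext_d (omega g) p [a, Jstd b, c] + ext_d (omega g) p [a, b, Jstd c]) / 4
      - 3 * ext_d (omega g) p [Jstd a, Jstd b, Jstd c] / 4)"
    unfolding type_part_3 by simp
  also have "- (ext_d (omega g) p [Jstd a, b, c] + ext_d (omega g) p [a, Jstd b, c] + ext_d (omega g) p [a, b, Jstd c]) / 4
      - 3 * ext_d (omega g) p [Jstd a, Jstd b, Jstd c] / 4 = - H p a b c"
    unfolding ext_d_omega H_def by (simp add: dg_bil[OF p] dg_JJ[OF p] dg_J[OF p] field_simps)
  finally show ?thesis by simp
qed

lemma torsion_eq: "p \<in> U \<Longrightarrow> torsion g p [a, b, c] = H p a b c"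
  by (simp add: torsion_def dc_omega_eq)

lemma ext_d_omega_H: "p \<in> U \<Longrightarrow> ext_d (omega g) p [a, b, c] = - H p (Jstd a) (Jstd b) (Jstd c)"
  unfolding ext_d_omega H_def by (simp add: dg_bil dg_JJ dg_J)

lemma H_alt:
  assumes "p \<in> U"
  shows "H p b a c = - H p a b c" "H p a c b = - H p a b c"
  using dg_J[OF assms, of "Jstd c" b a] dg_sym[OF assms, of "Jstd c" b "Jstd a"]
    dg_J[OF assms, of "Jstd a" c b] dg_sym[OF assms, of "Jstd a" c "Jstd b"]
  unfolding H_def by linarith+

lemma H_lin:
  assumes "p \<in> U"
  shows "linear (\<lambda>x. H p x b c)" "linear (\<lambda>x. H p a x c)" "linear (\<lambda>x. H p a b x)"
  unfolding H_def linear_iff by (simp_all add: dg_bil[OF assms] Jstd_linear algebra_simps)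

lemma alt_torsion:
  assumes p: "p \<in> U" shows "alt 3 (torsion g p)"
  by (rule alt_3I; unfold torsion_eq[OF p]) (rule H_alt[OF p])+

lemma mlin_torsion:
  assumes p: "p \<in> U" shows "mlin 3 (torsion g p)"
  by (rule mlin_3I; unfold torsion_eq[OF p]) (rule H_lin[OF p])+

lemma dH_has_derivative:
  assumes p: "p \<in> U"
  shows "((\<lambda>q. H q a b c) has_derivative frechet_derivative (\<lambda>q. H q a b c) (at p)) (at p)"
proof -
  have "(\<lambda>q. dg q x a b) differentiable (at p)" for x a b
    by (rule smooth_on_differentiable[OF smooth_dg p])
  then have "(\<lambda>q. H q a b c) differentiable (at p)"
    unfolding H_def by (intro differentiable_add differentiable_diff)
  then show ?thesis using frechet_derivative_works by blast
qed

definition dH where "dH p x a b c = frechet_derivative (\<lambda>q. H q a b c) (at p) x"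

definition Gam where "Gam = levi_civita g"
definition Gb where "Gb = bismut g"
text \<open>\<open>S\<close> is the torsion of the Bismut connection, as a vector-valued form.\<close>

definition S where "S p v w = sharp (g p) (\<lambda>u. H p v w u)"

lemma g_Gam: "p \<in> U \<Longrightarrow> g p (Gam p v w) u = (dg p v w u + dg p w v u - dg p u v w) / 2"
  unfolding Gam_def levi_civita_def dg_def[symmetric]
  by (subst sharp_inner[OF inner_g]) (auto simp: linear_iff dg_bil algebra_simps add_divide_distrib)

lemma g_S: "p \<in> U \<Longrightarrow> g p (S p v w) u = H p v w u"
  unfolding S_def by (rule sharp_inner[OF inner_g H_lin(3)])

lemma Gb_eq: "p \<in> U \<Longrightarrow> Gb p v w = Gam p v w + (1 / 2) *\<^sub>R S p v w"
proof -
  assume p: "p \<in> U"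
  have "sharp (g p) (\<lambda>u. Re (dc_omega g p [v, w, u])) = - S p v w"
    by (rule sharp_eqI[OF inner_g[OF p]]) (simp add: dc_omega_eq p g_bil g_S)
  then show ?thesis unfolding Gb_def bismut_def Gam_def by simp
qed

lemma Gam_sym: "p \<in> U \<Longrightarrow> Gam p v w = Gam p w v"
  by (rule inner_form_eqI[OF inner_g]) (auto simp: g_Gam dg_sym[of p _ v w])

lemma Gam_metric: "p \<in> U \<Longrightarrow> g p (Gam p x a) b + g p a (Gam p x b) = dg p x a b"
  using g_sym[of p a "Gam p x b"] dg_sym[of p x a b] dg_sym[of p a x b] dg_sym[of p b x a]
  by (simp add: g_Gam field_simps)

lemma Gam_lin: "p \<in> U \<Longrightarrow> linear (\<lambda>v. Gam p v w)" "p \<in> U \<Longrightarrow> linear (\<lambda>w. Gam p v w)"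
  unfolding linear_iff by (auto intro!: inner_form_eqI[OF inner_g] simp: g_Gam g_bil dg_bil algebra_simps)
   (auto simp: field_simps)

lemma S_lin: "p \<in> U \<Longrightarrow> linear (\<lambda>v. S p v w)" "p \<in> U \<Longrightarrow> linear (\<lambda>w. S p v w)"
  unfolding linear_iff
  by (auto intro!: inner_form_eqI[OF inner_g] simp: g_S g_bil linear_add[OF H_lin(1)] linear_add[OF H_lin(2)]
      linear_scale[OF H_lin(1)] linear_scale[OF H_lin(2)])

lemma S_skew: "p \<in> U \<Longrightarrow> S p v w = - S p w v" "p \<in> U \<Longrightarrow> g p (S p x a) b = - g p a (S p x b)"
proof -
  assume p: "p \<in> U"
  show "S p v w = - S p w v"
    by (rule inner_form_eqI[OF inner_g[OF p]]) (simp add: g_S[OF p] g_bil[OF p] H_alt(1)[OF p, of v w])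
  show "g p (S p x a) b = - g p a (S p x b)"
    using H_alt(2)[OF p, of x a b] by (simp add: g_S[OF p] g_sym[OF p, of a])
qed

lemma Gb_lin: "p \<in> U \<Longrightarrow> linear (\<lambda>v. Gb p v w)" "p \<in> U \<Longrightarrow> linear (\<lambda>w. Gb p v w)"
  by (simp_all add: Gb_eq linear_compose_add Gam_lin linear_compose_scale_right S_lin)

lemma g_Gb: "p \<in> U \<Longrightarrow> g p (Gb p v w) u = g p (Gam p v w) u + H p v w u / 2"
  by (simp add: Gb_eq g_bil g_S)

lemma Gb_metric: "p \<in> U \<Longrightarrow> g p (Gb p x a) b + g p a (Gb p x b) = dg p x a b"
  using Gam_metric[of p x a b] g_sym[of p a "Gb p x b"] g_sym[of p a "Gam p x b"] H_alt(2)[of p x a b]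
  by (simp add: g_Gb)

text \<open>The Bismut connection preserves the complex structure.  With the Christoffel symbols and \<open>H\<close> written
  in terms of \<open>dg\<close>, this is a linear identity between first derivatives of the metric.\<close>

lemma Gb_J: "p \<in> U \<Longrightarrow> Gb p v (Jstd w) = Jstd (Gb p v w)"
proof (rule inner_form_eqI[OF inner_g], assumption)
  fix u assume p: "p \<in> U"
  note J = dg_JJ[OF p] dg_J[OF p] dg_bil[OF p]
  have "g p (Jstd (Gb p v w)) u = - g p (Gb p v w) (Jstd u)" by (rule g_J_left[OF p])
  moreover have "g p (Gb p v (Jstd w)) u + g p (Gb p v w) (Jstd u) = 0"
    using dg_sym[OF p, of "Jstd w" v u] dg_sym[OF p, of "Jstd u" v w] dg_sym[OF p, of w v "Jstd u"]
      dg_sym[OF p, of u v "Jstd w"] dg_sym[OF p, of v w u]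
    unfolding g_Gb[OF p] g_Gam[OF p] H_def by (simp add: J field_simps)
  ultimately show "g p (Gb p v (Jstd w)) u = g p (Jstd (Gb p v w)) u" by simp
qed

lemma Gam_differentiable: 
  assumes p: "p \<in> U" shows "\<exists>D. ((\<lambda>q. Gam q v w) has_derivative D) (at p)"
proof -
  have d: "((\<lambda>q. dg q x a b) has_derivative frechet_derivative (\<lambda>q. dg q x a b) (at p)) (at p)" for x a b
    using smooth_on_differentiable[OF smooth_dg p] frechet_derivative_works by blast
  obtain u' where "((\<lambda>q. sharp (g q) (\<lambda>u. (1 / 2) * (dg q v w u + dg q w v u - dg q u v w))) has_derivative u') (at p)"
  proof (rule sharp_differentiable[where g = g, OF inner_g open_U p dg_has_derivative[OF p]])
    show "linear (\<lambda>u. (1 / 2) * (dg q v w u + dg q w v u - dg q u v w))" if "q \<in> U" for q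
      using that by (auto simp: linear_iff dg_bil algebra_simps add_divide_distrib)
    show "((\<lambda>q. (1 / 2) * (dg q v w u + dg q w v u - dg q u v w)) has_derivative
      (\<lambda>h. (1 / 2) * (frechet_derivative (\<lambda>q. dg q v w u) (at p) h + frechet_derivative (\<lambda>q. dg q w v u) (at p) h
        - frechet_derivative (\<lambda>q. dg q u v w) (at p) h))) (at p)" for u
      by (intro has_derivative_mult_right has_derivative_add has_derivative_diff d)
  qed auto
  then show ?thesis unfolding Gam_def levi_civita_def dg_def[symmetric] by blast
qed

lemma S_differentiable: 
  assumes p: "p \<in> U" shows "\<exists>D. ((\<lambda>q. S q v w) has_derivative D) (at p)"
proof -
  obtain u' where "((\<lambda>q. sharp (g q) (\<lambda>u. H q v w u)) has_derivative u') (at p)"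
    by (rule sharp_differentiable[where g = g, OF inner_g open_U p dg_has_derivative[OF p] H_lin(3) dH_has_derivative[OF p]]) auto
  then show ?thesis unfolding S_def by blast
qed

end

section \<open>Derivatives of forms and of the Hodge star\<close>

text \<open>The action of an endomorphism as a derivation, with the sign opposite to the natural action on forms.\<close>

definition act :: "('a \<Rightarrow> 'a) \<Rightarrow> ('a list \<Rightarrow> 'b::comm_monoid_add) \<Rightarrow> 'a list \<Rightarrow> 'b" where
  "act T \<alpha> vs = (\<Sum>i<length vs. \<alpha> (vs[i := T (vs ! i)]))"

lemma act_permute_list:
  assumes s: "\<sigma> permutes {..<length vs}"
  shows "act T \<alpha> (permute_list \<sigma> vs) = act T (\<lambda>ws. \<alpha> (permute_list \<sigma> ws)) vs"
proof -
  have upd: "(permute_list \<sigma> vs)[i := T (permute_list \<sigma> vs ! i)] = permute_list \<sigma> (vs[\<sigma> i := T (vs ! \<sigma> i)])"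
    if i: "i < length vs" for i
  proof (rule nth_equalityI)
    fix j assume "j < length ((permute_list \<sigma> vs)[i := T (permute_list \<sigma> vs ! i)])"
    then have j: "j < length vs" by simp
    have si: "\<sigma> i < length vs" "\<sigma> j < length vs" using permutes_in_image[OF s] i j by auto
    have inj: "\<sigma> i = \<sigma> j \<longleftrightarrow> i = j" using permutes_inj[OF s] by (auto dest: injD)
    show "(permute_list \<sigma> vs)[i := T (permute_list \<sigma> vs ! i)] ! j = permute_list \<sigma> (vs[\<sigma> i := T (vs ! \<sigma> i)]) ! j"
      using i j si inj s by (simp add: nth_list_update permute_list_nth)
  qed simp
  have "act T \<alpha> (permute_list \<sigma> vs) = (\<Sum>i<length vs. \<alpha> (permute_list \<sigma> (vs[\<sigma> i := T (vs ! \<sigma> i)])))"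
    unfolding act_def by (intro sum.cong) (auto simp: upd)
  also have "\<dots> = (\<Sum>i<length vs. \<alpha> (permute_list \<sigma> (vs[i := T (vs ! i)])))"
    using sum.permute[OF s, of "\<lambda>i. \<alpha> (permute_list \<sigma> (vs[i := T (vs ! i)]))"] by (simp add: o_def)
  finally show ?thesis by (simp add: act_def)
qed

lemma alt_act:
  fixes \<alpha> :: "'a list \<Rightarrow> 'b::real_vector"
  assumes "alt k \<alpha>" shows "alt k (act T \<alpha>)"
  unfolding alt_def
proof (intro allI impI)
  fix ws :: "'a list" and \<sigma> assume ws: "length ws = k" and s: "\<sigma> permutes {..<k}"
  show "act T \<alpha> (permute_list \<sigma> ws) = of_int (sign \<sigma>) *\<^sub>R act T \<alpha> ws"
    unfolding act_permute_list[OF s[folded ws]] unfolding act_def scaleR_sum_right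
    using altD[OF assms _ s] ws by (intro sum.cong) auto
qed

lemma act_Cons: "act T \<alpha> (x # vs) = \<alpha> (T x # vs) + act T (\<lambda>ws. \<alpha> (x # ws)) vs"
  unfolding act_def by (simp add: sum.lessThan_Suc_shift del: sum.lessThan_Suc)

lemma act_append: "act T \<alpha> (us @ vs) = act T (\<lambda>ws. \<alpha> (ws @ vs)) us + act T (\<lambda>ws. \<alpha> (us @ ws)) vs"
  by (induction us arbitrary: \<alpha>) (simp_all add: act_Cons add.assoc, simp add: act_def)

lemma act_mult:
  fixes \<alpha> \<beta> :: "'a list \<Rightarrow> real"
  shows "act T (\<lambda>ws. \<alpha> (take (length us) ws) * \<beta> (drop (length us) ws)) (us @ vs)
    = act T \<alpha> us * \<beta> vs + \<alpha> us * act T \<beta> vs"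
  unfolding act_append by (simp add: act_def sum_distrib_left sum_distrib_right)

lemma mlin_act:
  fixes \<alpha> :: "'a::real_vector list \<Rightarrow> 'b::real_vector"
  assumes "mlin k \<alpha>" "linear T" shows "mlin k (act T \<alpha>)"
  using assms(1)
proof (induction k arbitrary: \<alpha>)
  case 0
  then show ?case by (simp add: mlin_def)
next
  case (Suc k)
  show ?case unfolding mlin_def
  proof (intro allI impI)
    fix us vs :: "'a list" assume len: "length us + Suc (length vs) = Suc k"
    show "linear (\<lambda>x. act T \<alpha> (us @ x # vs))"
    proof (cases us)
      case Nil
      have 1: "linear (\<lambda>x. \<alpha> (x # ws))" if "length ws = k" for ws
        using mlinD[OF Suc.prems, of "[]" ws] that by simp
      have "linear (\<lambda>x. \<alpha> (T x # vs))"
        using linear_compose[OF assms(2) 1, of vs] len Nil by (simp add: o_def)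
      moreover have "linear (\<lambda>x. act T (\<lambda>ws. \<alpha> (x # ws)) vs)"
        unfolding act_def using len Nil by (intro linear_compose_sum ballI 1) simp
      ultimately show ?thesis unfolding Nil append_Nil act_Cons by (rule linear_compose_add)
    next
      case (Cons u us')
      have 1: "mlin k (\<lambda>ws. \<alpha> (u # ws))" for u by (rule mlin_Cons[OF Suc.prems])
      have "linear (\<lambda>x. \<alpha> (T u # us' @ x # vs))"
        by (rule mlinD[OF 1]) (use len Cons in simp)
      moreover have "linear (\<lambda>x. act T (\<lambda>ws. \<alpha> (u # ws)) (us' @ x # vs))"
        by (rule mlinD[OF Suc.IH[OF 1]]) (use len Cons in simp)
      ultimately show ?thesis unfolding Cons append_Cons act_Cons by (rule linear_compose_add)
    qed
  qed
qed

lemma act_sum: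
  fixes \<alpha> :: "'a::real_vector list \<Rightarrow> 'b::real_vector"
  assumes "mlin k \<alpha>" "length vs = k"
  shows "act (\<lambda>v. T1 v + c *\<^sub>R T2 v) \<alpha> vs = act T1 \<alpha> vs + c *\<^sub>R act T2 \<alpha> vs"
  using assms
proof (induction k arbitrary: \<alpha> vs)
  case 0
  then show ?case by (simp add: act_def)
next
  case (Suc k)
  obtain x ws where vs: "vs = x # ws" "length ws = k" using Suc.prems(2) by (cases vs) auto
  have lin: "linear (\<lambda>x. \<alpha> (x # ws))" using mlinD[OF Suc.prems(1), of "[]" ws] vs by simp
  show ?case unfolding vs act_Cons using Suc.IH[OF mlin_Cons[OF Suc.prems(1)] vs(2)]
    by (simp add: linear_add[OF lin] linear_scale[OF lin] scaleR_add_right)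
qed

text \<open>A skew endomorphism has trace zero: its diagonal entries vanish, and the others put the same basis
  vector twice into the volume form.\<close>

lemma (in oriented_orthonormal_basis) act_skew_vol:
  assumes T: "\<And>a b. m (T a) b = - m a (T b)" and es: "es \<in> Ls E (DIM('a))"
  shows "act T vol es = 0"
proof (cases "distinct es")
  case False
  then show ?thesis using alt_repeated[OF alt_act[OF alt_vol] length_Ls[OF es]] by blast
next
  case True
  have sE: "set es = E"
    using True fin_E card_E distinct_card[OF True] es by (intro card_subset_eq) (auto simp: Ls_def)
  have "vol (es[i := T (es ! i)]) = 0" if "i < length es" for i
  proof -
    let ?e = "es ! i"
    have upd: "es[i := y] = take i es @ y # drop (Suc i) es" for y by (rule upd_conv_take_nth_drop[OF that])
    have lin: "linear (\<lambda>y. vol (es[i := y]))"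
      unfolding upd using that length_Ls[OF es] by (intro mlinD[OF mlin_vol]) simp
    have "vol (es[i := T ?e]) = (\<Sum>f\<in>E. m (T ?e) f *\<^sub>R vol (es[i := f]))"
      by (rule linear_orthonormal_expansion[OF m E lin])
    also have "\<dots> = 0"
    proof (rule sum.neutral, rule ballI)
      fix f assume f: "f \<in> E"
      show "m (T ?e) f *\<^sub>R vol (es[i := f]) = 0"
      proof (cases "f = ?e")
        case True
        then show ?thesis using T[of f f] inner_form_sym[OF m, of f "T f"] by simp
      next
        case False
        then obtain j where j: "j < length es" "f = es ! j" "j \<noteq> i" using f sE by (metis in_set_conv_nth)
        then have "es[i := f] ! i = es[i := f] ! j" using that by simp
        then have "\<not> distinct (es[i := f])" using j that by (metis length_list_update nth_eq_iff_index_eq)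
        then have "vol (es[i := f]) = 0" using alt_repeated[OF alt_vol] length_Ls[OF es] by simp
        then show ?thesis by simp
      qed
    qed
    finally show ?thesis .
  qed
  then show ?thesis unfolding act_def by simp
qed

lemma eq_neg_self_imp_zero:
  assumes "x = - x" shows "x = (0 :: 'b::real_vector)"
proof -
  have "2 *\<^sub>R x = x + x" by (rule scaleR_2)
  also have "\<dots> = 0" using assms by (simp only: eq_neg_iff_add_eq_0)
  finally show ?thesis by simp
qed

text \<open>Against an alternating form the Christoffel symbols of a torsion-free connection cancel.\<close>

lemma sum_alt_symmetric:
  fixes g :: "'a list \<Rightarrow> real" and \<beta> :: "'a list \<Rightarrow> 'b::real_vector"
  assumes g: "alt (Suc l) g" and sym: "\<And>x y. T x y = T y x"
  shows "(\<Sum>x\<in>E. \<Sum>ws\<in>Ls E l. g (x # ws) *\<^sub>R act (T x) \<beta> ws) = 0"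
proof -
  have "(\<Sum>x\<in>E. \<Sum>ws\<in>Ls E l. g (x # ws) *\<^sub>R \<beta> (ws[i := T x (ws ! i)])) = 0" if i: "i < l" for i
  proof -
    obtain j where l: "l = i + Suc j" using i less_iff_Suc_add by auto
    let ?S = "\<Sum>x\<in>E. \<Sum>ws\<in>Ls E l. g (x # ws) *\<^sub>R \<beta> (ws[i := T x (ws ! i)])"
    let ?f = "\<lambda>us zs x e. g (x # us @ e # zs) *\<^sub>R \<beta> (us @ T x e # zs)"
    have S: "?S = (\<Sum>us\<in>Ls E i. \<Sum>zs\<in>Ls E j. \<Sum>x\<in>E. \<Sum>e\<in>E. ?f us zs x e)"
    proof -
      have "?S = (\<Sum>x\<in>E. \<Sum>us\<in>Ls E i. \<Sum>e\<in>E. \<Sum>zs\<in>Ls E j. ?f us zs x e)"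
        unfolding l sum_Ls_add sum_Ls_Suc
        by (intro sum.cong) (auto simp: length_Ls list_update_append nth_append)
      also have "\<dots> = (\<Sum>us\<in>Ls E i. \<Sum>x\<in>E. \<Sum>e\<in>E. \<Sum>zs\<in>Ls E j. ?f us zs x e)" by (rule sum.swap)
      also have "\<dots> = (\<Sum>us\<in>Ls E i. \<Sum>x\<in>E. \<Sum>zs\<in>Ls E j. \<Sum>e\<in>E. ?f us zs x e)"
        by (intro sum.cong refl) (rule sum.swap)
      also have "\<dots> = (\<Sum>us\<in>Ls E i. \<Sum>zs\<in>Ls E j. \<Sum>x\<in>E. \<Sum>e\<in>E. ?f us zs x e)"
        by (intro sum.cong refl) (rule sum.swap)
      finally show ?thesis .
    qed
    have "(\<Sum>x\<in>E. \<Sum>e\<in>E. ?f us zs x e) = 0" if us: "us \<in> Ls E i" and zs: "zs \<in> Ls E j" for us zs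
    proof -
      have anti: "g (x # us @ e # zs) = - g (e # us @ x # zs)" for x e
        using alt_move[OF g, of "[x]" us zs e] alt_move[OF g, of "[e]" us zs x] alt_swap[OF g, of "[]" "us @ zs" x e]
          length_Ls[OF us] length_Ls[OF zs] by (simp add: l)
      have "(\<Sum>x\<in>E. \<Sum>e\<in>E. ?f us zs x e) = (\<Sum>e\<in>E. \<Sum>x\<in>E. ?f us zs x e)" by (rule sum.swap)
      also have "\<dots> = (\<Sum>e\<in>E. \<Sum>x\<in>E. - ?f us zs e x)"
        using anti sym by (intro sum.cong refl) (metis scaleR_minus_left)
      also have "\<dots> = - (\<Sum>x\<in>E. \<Sum>e\<in>E. ?f us zs x e)" by (simp add: sum_negf)
      finally show ?thesis by (rule eq_neg_self_imp_zero)
    qed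
    then have "(\<Sum>us\<in>Ls E i. \<Sum>zs\<in>Ls E j. \<Sum>x\<in>E. \<Sum>e\<in>E. ?f us zs x e) = (\<Sum>us\<in>Ls E i. \<Sum>zs\<in>Ls E j. 0)"
      by (intro sum.cong refl)
    then show ?thesis unfolding S by simp
  qed
  then have "(\<Sum>i<l. \<Sum>x\<in>E. \<Sum>ws\<in>Ls E l. g (x # ws) *\<^sub>R \<beta> (ws[i := T x (ws ! i)])) = 0" by simp
  also have "(\<Sum>i<l. \<Sum>x\<in>E. \<Sum>ws\<in>Ls E l. g (x # ws) *\<^sub>R \<beta> (ws[i := T x (ws ! i)]))
      = (\<Sum>x\<in>E. \<Sum>i<l. \<Sum>ws\<in>Ls E l. g (x # ws) *\<^sub>R \<beta> (ws[i := T x (ws ! i)]))" by (rule sum.swap)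
  also have "\<dots> = (\<Sum>x\<in>E. \<Sum>ws\<in>Ls E l. \<Sum>i<l. g (x # ws) *\<^sub>R \<beta> (ws[i := T x (ws ! i)]))"
    by (intro sum.cong refl) (rule sum.swap)
  also have "\<dots> = (\<Sum>x\<in>E. \<Sum>ws\<in>Ls E l. g (x # ws) *\<^sub>R act (T x) \<beta> ws)"
    unfolding act_def scaleR_sum_right by (intro sum.cong refl) (simp add: length_Ls)
  finally show ?thesis .
qed

lemma has_derivative_mlin:
  fixes \<alpha> :: "'x::real_normed_vector \<Rightarrow> 'v::real_normed_vector list \<Rightarrow> 'b::real_normed_vector"
  assumes fd: "finite_dimensional TYPE('v)"
    and "\<And>q. q \<in> W \<Longrightarrow> mlin k (\<alpha> q)" and W: "open W" "p \<in> W"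
    and "\<And>vs. length vs = k \<Longrightarrow> ((\<lambda>q. \<alpha> q vs) has_derivative (\<lambda>h. \<alpha>' h vs)) (at p)"
    and P: "\<And>b. ((\<lambda>q. P q b) has_derivative (\<lambda>h. P' h b)) (at p)" and Pp: "\<And>b. P p b = b"
    and "length vs = k"
  shows "((\<lambda>q. \<alpha> q (map (P q) vs)) has_derivative (\<lambda>h. \<alpha>' h vs + act (P' h) (\<alpha> p) vs)) (at p)"
  using assms(2,5,8)
proof (induction k arbitrary: \<alpha> \<alpha>' vs)
  case 0
  then show ?case by (simp add: act_def)
next
  case (Suc k)
  obtain x ws where vs: "vs = x # ws" "length ws = k" using Suc.prems(3) by (cases vs) auto
  have L: "((\<lambda>q. \<alpha> q (v # map (P q) ws)) has_derivative
      (\<lambda>h. \<alpha>' h (v # ws) + act (P' h) (\<lambda>ws. \<alpha> p (v # ws)) ws)) (at p)" for v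
  proof (rule Suc.IH[where \<alpha> = "\<lambda>q ws. \<alpha> q (v # ws)" and \<alpha>' = "\<lambda>h ws. \<alpha>' h (v # ws)", OF _ _ vs(2)])
    show "mlin k (\<lambda>ws. \<alpha> q (v # ws))" if "q \<in> W" for q by (rule mlin_Cons[OF Suc.prems(1)[OF that]])
    show "((\<lambda>q. \<alpha> q (v # us)) has_derivative (\<lambda>h. \<alpha>' h (v # us))) (at p)" if "length us = k" for us
      using Suc.prems(2)[of "v # us"] that by simp
  qed
  have "((\<lambda>q. \<alpha> q (P q x # map (P q) ws)) has_derivative
     (\<lambda>h. (\<alpha>' h (P p x # ws) + act (P' h) (\<lambda>ws. \<alpha> p (P p x # ws)) ws) + \<alpha> p (P' h x # map (P p) ws))) (at p)"
  proof (rule has_derivative_linear_family[where L = "\<lambda>q v. \<alpha> q (v # map (P q) ws)", OF fd L _ P])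
    show "eventually (\<lambda>q. linear (\<lambda>v. \<alpha> q (v # map (P q) ws))) (nhds p)"
      using eventually_nhds_in_open[OF W]
    proof eventually_elim
      case (elim q)
      show ?case using mlinD[OF Suc.prems(1)[OF elim], of "[]" "map (P q) ws"] vs(2) by simp
    qed
  qed
  then show ?case by (simp add: vs Pp act_Cons map_idI add_ac)
qed

lemma onb_orthonormal_basis: "inner_form m \<Longrightarrow> orthonormal_basis m (onb m)"
  using someI_ex[OF exists_orthonormal_basis[of m]] unfolding onb_def orthonormal_basis_def by blast

lemma hodge_Ls: "hodge m k \<alpha> ws = (1 / fact k) *\<^sub>R (\<Sum>es\<in>Ls (onb m) k. vol_form m (es @ ws) *\<^sub>R \<alpha> es)"
  unfolding hodge_def Ls_def ..

context hermitian_chart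
begin

text \<open>\<open>frame_change p q\<close> transports the metric at \<open>p\<close> to the one at \<open>q\<close>, contravariantly; it serves to
  write traces with respect to a varying metric in a fixed basis.\<close>

definition frame_change where "frame_change p q b = sharp (g q) (g p b)"

lemma g_frame_change: "p \<in> U \<Longrightarrow> q \<in> U \<Longrightarrow> g q (frame_change p q b) w = g p b w"
  unfolding frame_change_def by (rule sharp_inner[OF inner_g inner_form_linear_right[OF inner_g]])

lemma frame_change_id: "p \<in> U \<Longrightarrow> frame_change p p b = b"
  unfolding frame_change_def by (rule sharp_eqI[OF inner_g]) auto

lemma frame_change_derivative:
  assumes p: "p \<in> U"
  shows "\<exists>P'. (\<forall>b. ((\<lambda>q. frame_change p q b) has_derivative (\<lambda>h. P' h b)) (at p)) \<and>
    (\<forall>h b w. g p (P' h b) w = - dg p h b w)"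
proof -
  have "\<exists>u'. ((\<lambda>q. frame_change p q b) has_derivative u') (at p) \<and> (\<forall>h w. g p (u' h) w = - dg p h b w)" for b
  proof -
    obtain u' where u: "((\<lambda>q. sharp (g q) (g p b)) has_derivative u') (at p)"
      "\<And>h w. g p (u' h) w = 0 - dg p h (sharp (g p) (g p b)) w"
    proof (rule sharp_differentiable[where g = g and \<phi> = "\<lambda>q. g p b", OF inner_g open_U p dg_has_derivative[OF p]])
      show "linear (g p b)" by (rule inner_form_linear_right[OF inner_g[OF p]])
      show "((\<lambda>q. g p b w) has_derivative (\<lambda>h. 0)) (at p)" for w by simp
    qed auto
    then show ?thesis using frame_change_id[OF p, of b] unfolding frame_change_def by auto
  qed
  then obtain u' where u': "\<And>b. ((\<lambda>q. frame_change p q b) has_derivative u' b) (at p)"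
    "\<And>b h w. g p (u' b h) w = - dg p h b w" by metis
  show ?thesis by (rule exI[of _ "\<lambda>h b. u' b h"]) (use u' in auto)
qed

lemma trace_frame_change_derivative:
  assumes p: "p \<in> U" and E: "orthonormal_basis (g p) E"
    and P: "\<And>b w. g p (P b) w = - (g p (T b) w + g p b (T w))"
    and f: "\<And>y. linear (\<lambda>x. f x y)" "\<And>x. linear (f x)"
  shows "(\<Sum>e\<in>E. f e (P e)) = - (\<Sum>e\<in>E. f e (T e)) - (\<Sum>e\<in>E. f (T e) e)"
proof -
  note ex = linear_orthonormal_expansion[OF inner_g[OF p] E]
  have "(\<Sum>e\<in>E. f e (P e)) = (\<Sum>e\<in>E. \<Sum>c\<in>E. g p (P e) c *\<^sub>R f e c)"
    by (intro sum.cong refl) (rule ex[OF f(2)])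
  also have "\<dots> = (\<Sum>e\<in>E. \<Sum>c\<in>E. - (g p (T e) c *\<^sub>R f e c) - g p (T c) e *\<^sub>R f e c)"
    by (intro sum.cong refl) (simp add: P g_sym[OF p, of _ "T _"] algebra_simps)
  also have "\<dots> = - (\<Sum>e\<in>E. \<Sum>c\<in>E. g p (T e) c *\<^sub>R f e c) - (\<Sum>e\<in>E. \<Sum>c\<in>E. g p (T c) e *\<^sub>R f e c)"
    by (simp add: sum_subtractf sum_negf)
  also have "(\<Sum>e\<in>E. \<Sum>c\<in>E. g p (T e) c *\<^sub>R f e c) = (\<Sum>e\<in>E. f e (T e))"
    by (intro sum.cong refl) (rule ex[OF f(2), symmetric])
  also have "(\<Sum>e\<in>E. \<Sum>c\<in>E. g p (T c) e *\<^sub>R f e c) = (\<Sum>c\<in>E. \<Sum>e\<in>E. g p (T c) e *\<^sub>R f e c)" by (rule sum.swap)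
  also have "\<dots> = (\<Sum>c\<in>E. f (T c) c)"
    by (intro sum.cong refl) (rule ex[OF f(1), symmetric])
  finally show ?thesis .
qed

text \<open>Traces commute with the derivative of any metric connection.\<close>

lemma trace_has_derivative:
  fixes f :: "complex ^ 'n \<Rightarrow> complex ^ 'n \<Rightarrow> complex ^ 'n \<Rightarrow> 'b::real_normed_vector"
  assumes p: "p \<in> U" and E: "orthonormal_basis (g p) E"
    and T: "\<And>x a b. g p (T x a) b + g p a (T x b) = dg p x a b"
    and f: "\<And>q y. q \<in> U \<Longrightarrow> linear (\<lambda>x. f q x y)" "\<And>q x. q \<in> U \<Longrightarrow> linear (f q x)"
    and f': "\<And>a b. ((\<lambda>q. f q a b) has_derivative (\<lambda>x. f' x a b)) (at p)"
  shows "((\<lambda>q. \<Sum>e\<in>onb (g q). f q e e) has_derivative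
    (\<lambda>x. \<Sum>e\<in>E. f' x e e - f p (T x e) e - f p e (T x e))) (at p)"
proof -
  obtain P' where P': "\<And>b. ((\<lambda>q. frame_change p q b) has_derivative (\<lambda>h. P' h b)) (at p)"
    "\<And>h b w. g p (P' h b) w = - dg p h b w"
    using frame_change_derivative[OF p] by blast
  have 1: "(\<Sum>b\<in>E. f q b (frame_change p q b)) = (\<Sum>e\<in>onb (g q). f q e e)" if q: "q \<in> U" for q
    by (rule trace_change_of_basis[OF inner_g[OF q] onb_orthonormal_basis[OF inner_g[OF q]] inner_g[OF p] E, symmetric])
      (use g_frame_change[OF p q] f[OF q] in auto)
  have 2: "((\<lambda>q. f q b (frame_change p q b)) has_derivative (\<lambda>h. f' h b (frame_change p p b) + f p b (P' h b))) (at p)" for b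
    by (rule has_derivative_linear_family[OF finite_dimensional_euclidean f' _ P'(1)])
      (use eventually_U[OF p] f(2) in \<open>auto elim: eventually_mono\<close>)
  have 3: "((\<lambda>q. \<Sum>b\<in>E. f q b (frame_change p q b)) has_derivative
      (\<lambda>h. \<Sum>b\<in>E. f' h b (frame_change p p b) + f p b (P' h b))) (at p)"
    by (intro has_derivative_sum 2)
  have "(\<Sum>b\<in>E. f' h b (frame_change p p b) + f p b (P' h b)) = (\<Sum>e\<in>E. f' h e e - f p (T h e) e - f p e (T h e))" for h
    using trace_frame_change_derivative[OF p E, of "P' h" "T h" "f p"] P'(2)[of h] T[of h] f[OF p]
    by (simp add: frame_change_id[OF p] sum.distrib sum_subtractf)
  with transform_U[OF 3 p 1] show ?thesis by simp
qed

text \<open>\<open>\<omega>\<close> is parallel for the Bismut connection, and so are its powers.\<close>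

lemma wedge_power_has_derivative:
  assumes p: "p \<in> U" and "length vs = 2 * j"
  shows "((\<lambda>q. wedge_power (omega g q) j vs) has_derivative
    (\<lambda>x. act (Gb p x) (wedge_power (omega g p) j) vs)) (at p)"
  using assms(2)
proof (induction j arbitrary: vs)
  case 0
  then show ?case by (simp add: act_def)
next
  case (Suc j)
  have len: "length vs = 2 + 2 * j" using Suc.prems by simp
  let ?G = "\<lambda>q ws. omega g q (take 2 ws) * wedge_power (omega g q) j (drop 2 ws)"
  have om: "((\<lambda>q. omega g q [a, b]) has_derivative (\<lambda>x. act (Gb p x) (omega g p) [a, b])) (at p)" for a b
  proof -
    have "dg p x (Jstd a) b = act (Gb p x) (omega g p) [a, b]" for x
      using Gb_metric[OF p, of x "Jstd a" b] by (simp add: act_Cons act_def omega_def herm_form_def Gb_J[OF p])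
    then show ?thesis using dg_has_derivative[OF p, of "Jstd a" b] by (simp add: omega_def herm_form_def)
  qed
  have G: "((\<lambda>q. ?G q ws) has_derivative (\<lambda>x. act (Gb p x) (?G p) ws)) (at p)" if ws: "length ws = 2 + 2 * j" for ws
  proof -
    obtain a b zs where abz: "ws = [a, b] @ zs" "length zs = 2 * j"
      using ws by (cases ws; cases "tl ws") auto
    have "((\<lambda>q. omega g q [a, b] * wedge_power (omega g q) j zs) has_derivative
      (\<lambda>x. omega g p [a, b] * act (Gb p x) (wedge_power (omega g p) j) zs + act (Gb p x) (omega g p) [a, b] * wedge_power (omega g p) j zs)) (at p)"
      by (rule has_derivative_mult[OF om Suc.IH[OF abz(2)]])
    moreover have "act (Gb p x) (?G p) ws = act (Gb p x) (omega g p) [a, b] * wedge_power (omega g p) j zs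
       + omega g p [a, b] * act (Gb p x) (wedge_power (omega g p) j) zs" for x
      using act_mult[of "Gb p x" "omega g p" "[a, b]" "wedge_power (omega g p) j" zs] unfolding abz(1) by (simp add: numeral_2_eq_2)
    ultimately show ?thesis by (simp add: abz(1) add.commute)
  qed
  let ?P = "{\<sigma>. \<sigma> permutes {..<2 + 2 * j}}"
  have W: "wedge_power (omega g q) (Suc j) ws = (1 / (fact 2 * fact (2 * j))) *\<^sub>R (\<Sum>\<sigma>\<in>?P. of_int (sign \<sigma>) *\<^sub>R ?G q (permute_list \<sigma> ws))"
    if "length ws = 2 + 2 * j" for q ws
    using wedge_permute_list[OF that, of "(*)" "omega g q" "wedge_power (omega g q) j"] by simp
  have "((\<lambda>q. wedge_power (omega g q) (Suc j) vs) has_derivative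
     (\<lambda>x. (1 / (fact 2 * fact (2 * j))) *\<^sub>R (\<Sum>\<sigma>\<in>?P. of_int (sign \<sigma>) *\<^sub>R act (Gb p x) (?G p) (permute_list \<sigma> vs)))) (at p)"
    unfolding W[OF len] using len by (intro has_derivative_scaleR_right has_derivative_sum G) simp
  moreover have "(1 / (fact 2 * fact (2 * j))) *\<^sub>R (\<Sum>\<sigma>\<in>?P. of_int (sign \<sigma>) *\<^sub>R act T (?G p) (permute_list \<sigma> vs))
      = act T (wedge_power (omega g p) (Suc j)) vs" for T
  proof -
    have "(\<Sum>\<sigma>\<in>?P. of_int (sign \<sigma>) *\<^sub>R act T (?G p) (permute_list \<sigma> vs))
      = (\<Sum>\<sigma>\<in>?P. \<Sum>i<length vs. of_int (sign \<sigma>) *\<^sub>R ?G p (permute_list \<sigma> (vs[i := T (vs ! i)])))"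
    proof (rule sum.cong[OF refl])
      fix \<sigma> assume "\<sigma> \<in> ?P"
      then have s: "\<sigma> permutes {..<length vs}" using len by simp
      show "of_int (sign \<sigma>) *\<^sub>R act T (?G p) (permute_list \<sigma> vs)
        = (\<Sum>i<length vs. of_int (sign \<sigma>) *\<^sub>R ?G p (permute_list \<sigma> (vs[i := T (vs ! i)])))"
        unfolding act_permute_list[OF s] unfolding act_def by (rule scaleR_sum_right)
    qed
    also have "\<dots> = (\<Sum>i<length vs. \<Sum>\<sigma>\<in>?P. of_int (sign \<sigma>) *\<^sub>R ?G p (permute_list \<sigma> (vs[i := T (vs ! i)])))"
      by (rule sum.swap)
    also have "(1 / (fact 2 * fact (2 * j))) *\<^sub>R \<dots> = act T (wedge_power (omega g p) (Suc j)) vs"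
      unfolding act_def scaleR_sum_right[of _ _ "{..<length vs}"]
      by (rule sum.cong[OF refl]) (simp only: W length_list_update len)
    finally show ?thesis .
  qed
  ultimately show ?case by simp
qed

text \<open>The Bismut and the Levi-Civita connection differ by a skew endomorphism, which annihilates the volume
  form; so the latter is parallel for both.\<close>

lemma vol_has_derivative:
  assumes p: "p \<in> U" and E: "orthonormal_basis (g p) E" and es: "es \<in> Ls E (DIM(complex ^ 'n))"
  shows "((\<lambda>q. vol_form (g q) es) has_derivative (\<lambda>x. act (Gam p x) (vol_form (g p)) es)) (at p)"
proof -
  interpret oriented_orthonormal_basis "g p" E "vol_form (g p)" by (rule vol_form_orthonormal[OF herm[OF p] E])
  have len: "length es = 2 * CARD('n)" using length_Ls[OF es] by simp
  have "((\<lambda>q. wedge_power (omega g q) CARD('n) es / fact CARD('n)) has_derivative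
      (\<lambda>x. act (Gb p x) (wedge_power (omega g p) CARD('n)) es / fact CARD('n))) (at p)"
    by (rule bounded_linear.has_derivative[OF bounded_linear_divide wedge_power_has_derivative[OF p len]])
  moreover have "act (Gb p x) (wedge_power (omega g p) CARD('n)) es / fact CARD('n) = act (Gam p x) (vol_form (g p)) es" for x
  proof -
    have "act (Gb p x) (wedge_power (omega g p) CARD('n)) es / fact CARD('n) = act (Gb p x) (vol_form (g p)) es"
      by (simp add: act_def vol_form_def omega_def sum_divide_distrib)
    also have "act (Gb p x) (vol_form (g p)) es = act (Gam p x) (vol_form (g p)) es + (1/2) *\<^sub>R act (S p x) (vol_form (g p)) es"
    proof -
      have "Gb p x = (\<lambda>v. Gam p x v + (1/2) *\<^sub>R S p x v)" by (auto simp: Gb_eq[OF p])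
      then show ?thesis by (simp only: act_sum[OF mlin_vol length_Ls[OF es]])
    qed
    also have "act (S p x) (vol_form (g p)) es = 0"
      by (rule act_skew_vol[OF _ es]) (rule S_skew(2)[OF p])
    finally show ?thesis by simp
  qed
  ultimately show ?thesis by (simp add: vol_form_def omega_def)
qed

end

section \<open>Codifferentials as divergences\<close>

lemma hodge_add: "hodge m k (\<lambda>vs. \<alpha> vs + \<beta> vs) ws = hodge m k \<alpha> ws + hodge m k \<beta> ws"
  by (simp add: hodge_def scaleR_add_right sum.distrib)

context hermitian_chart
begin

lemma hodge_frame:
  fixes \<alpha> :: "(complex ^ 'n) list \<Rightarrow> 'b::real_vector"
  assumes p: "p \<in> U" and E: "orthonormal_basis (g p) E" and q: "q \<in> U"
    and \<alpha>: "mlin k \<alpha>" and len: "DIM(complex ^ 'n) = k + length ws"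
  shows "hodge (g q) k \<alpha> ws = (1 / fact k) *\<^sub>R
    (\<Sum>es\<in>Ls E k. vol_form (g q) (es @ ws) *\<^sub>R \<alpha> (map (frame_change p q) es))"
proof -
  have vol: "mlin k (\<lambda>us. vol_form (g q) (us @ ws))"
    using mlin_vol_form[OF herm[OF q]] unfolding len by (rule mlin_append_left)
  have "(\<Sum>es\<in>Ls (onb (g q)) k. vol_form (g q) (es @ ws) *\<^sub>R \<alpha> es)
      = (\<Sum>es\<in>Ls E k. vol_form (g q) (es @ ws) *\<^sub>R \<alpha> (map (frame_change p q) es))"
  proof (rule trace_list_change_of_basis[OF inner_g[OF q] onb_orthonormal_basis[OF inner_g[OF q]] inner_g[OF p] E,
        where F = "\<lambda>us vs. vol_form (g q) (us @ ws) *\<^sub>R \<alpha> vs"])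
    show "g q (frame_change p q b) w = g p b w" for b w by (rule g_frame_change[OF p q])
    show "mlin k (\<lambda>us. vol_form (g q) (us @ ws) *\<^sub>R \<alpha> vs)" for vs
      using vol unfolding mlin_def by (auto simp: linear_iff scaleR_add_left)
    show "mlin k (\<lambda>vs. vol_form (g q) (us @ ws) *\<^sub>R \<alpha> vs)" for us
      using \<alpha> unfolding mlin_def by (auto intro: linear_compose_scale_right)
  qed
  then show ?thesis unfolding hodge_Ls by simp
qed

text \<open>\<open>P\<close> is the derivative of the change of frame.  For a metric connection \<open>T\<close>, the contraction with the
  varying metric is parallel: this is the product rule for it, summed over all slots.\<close>

lemma sum_Ls_frame_change:
  fixes V :: "(complex ^ 'n) list \<Rightarrow> real" and \<alpha> :: "(complex ^ 'n) list \<Rightarrow> 'b::real_vector"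
  assumes p: "p \<in> U" and E: "orthonormal_basis (g p) E"
    and P: "\<And>b w. g p (P b) w = - (g p (T b) w + g p b (T w))"
    and "mlin k V" "mlin k \<alpha>"
  shows "(\<Sum>es\<in>Ls E k. act T V es *\<^sub>R \<alpha> es + V es *\<^sub>R act P \<alpha> es + V es *\<^sub>R act T \<alpha> es) = 0"
  using assms(4,5)
proof (induction k arbitrary: V \<alpha>)
  case 0
  then show ?case by (simp add: act_def Ls_0)
next
  case (Suc k)
  let ?h = "\<lambda>e es. V (T e # es) *\<^sub>R \<alpha> (e # es) + V (e # es) *\<^sub>R \<alpha> (P e # es) + V (e # es) *\<^sub>R \<alpha> (T e # es)"
  have head: "(\<Sum>e\<in>E. ?h e es) = 0" if es: "es \<in> Ls E k" for es
  proof -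
    have lV: "linear (\<lambda>x. V (x # es))" and l\<alpha>: "linear (\<lambda>x. \<alpha> (x # es))"
      using mlinD[OF Suc.prems(1), of "[]" es] mlinD[OF Suc.prems(2), of "[]" es] length_Ls[OF es] by simp_all
    have "linear (\<lambda>x. V (x # es) *\<^sub>R \<alpha> (y # es))" for y
      by (simp add: linear_iff linear_add[OF lV] linear_scale[OF lV] scaleR_add_left)
    moreover have "linear (\<lambda>y. V (x # es) *\<^sub>R \<alpha> (y # es))" for x by (rule linear_compose_scale_right[OF l\<alpha>])
    ultimately show ?thesis
      using trace_frame_change_derivative[OF p E P, of "\<lambda>x y. V (x # es) *\<^sub>R \<alpha> (y # es)"]
      by (simp add: sum.distrib)
  qed
  let ?t = "\<lambda>e es. act T (\<lambda>ws. V (e # ws)) es *\<^sub>R \<alpha> (e # es) + V (e # es) *\<^sub>R act P (\<lambda>ws. \<alpha> (e # ws)) es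
       + V (e # es) *\<^sub>R act T (\<lambda>ws. \<alpha> (e # ws)) es"
  have tail: "(\<Sum>es\<in>Ls E k. ?t e es) = 0" for e
    by (rule Suc.IH[OF mlin_Cons[OF Suc.prems(1)] mlin_Cons[OF Suc.prems(2)]])
  have "(\<Sum>es\<in>Ls E (Suc k). act T V es *\<^sub>R \<alpha> es + V es *\<^sub>R act P \<alpha> es + V es *\<^sub>R act T \<alpha> es)
      = (\<Sum>e\<in>E. \<Sum>es\<in>Ls E k. ?h e es + ?t e es)"
    unfolding sum_Ls_Suc by (intro sum.cong refl) (simp add: act_Cons algebra_simps)
  also have "\<dots> = (\<Sum>e\<in>E. \<Sum>es\<in>Ls E k. ?h e es) + (\<Sum>e\<in>E. \<Sum>es\<in>Ls E k. ?t e es)"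
    by (simp only: sum.distrib)
  also have "(\<Sum>e\<in>E. \<Sum>es\<in>Ls E k. ?h e es) = (\<Sum>es\<in>Ls E k. \<Sum>e\<in>E. ?h e es)" by (rule sum.swap)
  also have "\<dots> = 0" using head by (rule sum.neutral[OF ballI])
  also have "(\<Sum>e\<in>E. \<Sum>es\<in>Ls E k. ?t e es) = 0" using tail by (rule sum.neutral[OF ballI])
  finally show ?case by simp
qed

text \<open>The Hodge star is parallel: its derivative is the star of the covariant derivative, up to the
  Christoffel symbols acting on the remaining arguments.\<close>

lemma hodge_has_derivative:
  fixes \<alpha> :: "complex ^ 'n \<Rightarrow> (complex ^ 'n) list \<Rightarrow> 'b::real_normed_vector"
  assumes p: "p \<in> U" and E: "orthonormal_basis (g p) E"
    and \<alpha>: "\<And>q. q \<in> U \<Longrightarrow> mlin k (\<alpha> q)"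
    and \<alpha>': "\<And>vs. length vs = k \<Longrightarrow> ((\<lambda>q. \<alpha> q vs) has_derivative (\<lambda>x. \<alpha>' x vs)) (at p)"
    and len: "DIM(complex ^ 'n) = k + l" and ws: "ws \<in> Ls E l"
  shows "((\<lambda>q. hodge (g q) k (\<alpha> q) ws) has_derivative
    (\<lambda>x. (1 / fact k) *\<^sub>R (\<Sum>es\<in>Ls E k. vol_form (g p) (es @ ws) *\<^sub>R (\<alpha>' x es - act (Gam p x) (\<alpha> p) es))
      + act (Gam p x) (\<lambda>ws. (1 / fact k) *\<^sub>R (\<Sum>es\<in>Ls E k. vol_form (g p) (es @ ws) *\<^sub>R \<alpha> p es)) ws)) (at p)"
proof -
  let ?v = "vol_form (g p)"
  have lws: "length ws = l" by (rule length_Ls[OF ws])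
  obtain P' where P': "\<And>b. ((\<lambda>q. frame_change p q b) has_derivative (\<lambda>h. P' h b)) (at p)"
    "\<And>h b w. g p (P' h b) w = - dg p h b w"
    using frame_change_derivative[OF p] by blast
  have P2: "g p (P' x b) w = - (g p (Gam p x b) w + g p b (Gam p x w))" for x b w
    using P'(2)[of x b w] Gam_metric[OF p, of x b w] by simp
  have map_id: "map (frame_change p p) es = es" for es by (simp add: frame_change_id[OF p] map_idI)
  have one: "((\<lambda>q. vol_form (g q) (es @ ws) *\<^sub>R \<alpha> q (map (frame_change p q) es)) has_derivative
     (\<lambda>x. ?v (es @ ws) *\<^sub>R (\<alpha>' x es + act (P' x) (\<alpha> p) es) + act (Gam p x) ?v (es @ ws) *\<^sub>R \<alpha> p (map (frame_change p p) es))) (at p)"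
    if es: "es \<in> Ls E k" for es
  proof (rule has_derivative_scaleR)
    show "((\<lambda>q. vol_form (g q) (es @ ws)) has_derivative (\<lambda>x. act (Gam p x) ?v (es @ ws))) (at p)"
      by (rule vol_has_derivative[OF p E]) (use es ws len in \<open>auto simp: Ls_def\<close>)
    show "((\<lambda>q. \<alpha> q (map (frame_change p q) es)) has_derivative (\<lambda>x. \<alpha>' x es + act (P' x) (\<alpha> p) es)) (at p)"
      by (rule has_derivative_mlin[OF finite_dimensional_euclidean \<alpha> open_U p \<alpha>' P'(1) frame_change_id[OF p] length_Ls[OF es]])
  qed
  have all: "((\<lambda>q. (1 / fact k) *\<^sub>R (\<Sum>es\<in>Ls E k. vol_form (g q) (es @ ws) *\<^sub>R \<alpha> q (map (frame_change p q) es))) has_derivative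
     (\<lambda>x. (1 / fact k) *\<^sub>R (\<Sum>es\<in>Ls E k. ?v (es @ ws) *\<^sub>R (\<alpha>' x es + act (P' x) (\<alpha> p) es)
        + act (Gam p x) ?v (es @ ws) *\<^sub>R \<alpha> p (map (frame_change p p) es)))) (at p)"
    by (intro has_derivative_scaleR_right has_derivative_sum one)
  have eq: "(1 / fact k) *\<^sub>R (\<Sum>es\<in>Ls E k. vol_form (g q) (es @ ws) *\<^sub>R \<alpha> q (map (frame_change p q) es))
      = hodge (g q) k (\<alpha> q) ws" if q: "q \<in> U" for q
    using hodge_frame[OF p E q \<alpha>[OF q]] len lws by simp
  have "(1 / fact k) *\<^sub>R (\<Sum>es\<in>Ls E k. ?v (es @ ws) *\<^sub>R (\<alpha>' x es + act (P' x) (\<alpha> p) es)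
        + act (Gam p x) ?v (es @ ws) *\<^sub>R \<alpha> p (map (frame_change p p) es))
      = (1 / fact k) *\<^sub>R (\<Sum>es\<in>Ls E k. ?v (es @ ws) *\<^sub>R (\<alpha>' x es - act (Gam p x) (\<alpha> p) es))
      + act (Gam p x) (\<lambda>ws. (1 / fact k) *\<^sub>R (\<Sum>es\<in>Ls E k. ?v (es @ ws) *\<^sub>R \<alpha> p es)) ws" for x
  proof -
    have vol: "mlin k (\<lambda>us. ?v (us @ ws))"
      using mlin_vol_form[OF herm[OF p]] unfolding len lws[symmetric] by (rule mlin_append_left)
    have z: "(\<Sum>es\<in>Ls E k. act (Gam p x) (\<lambda>us. ?v (us @ ws)) es *\<^sub>R \<alpha> p es
        + ?v (es @ ws) *\<^sub>R act (P' x) (\<alpha> p) es + ?v (es @ ws) *\<^sub>R act (Gam p x) (\<alpha> p) es) = 0"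
      by (rule sum_Ls_frame_change[OF p E P2 vol \<alpha>[OF p]])
    have a: "act (Gam p x) (\<lambda>ws. (1 / fact k) *\<^sub>R (\<Sum>es\<in>Ls E k. ?v (es @ ws) *\<^sub>R \<alpha> p es)) ws
      = (1 / fact k) *\<^sub>R (\<Sum>es\<in>Ls E k. act (Gam p x) (\<lambda>ws. ?v (es @ ws)) ws *\<^sub>R \<alpha> p es)"
      unfolding act_def scaleR_sum_right scaleR_sum_left by (rule sum.swap)
    have "(\<Sum>es\<in>Ls E k. ?v (es @ ws) *\<^sub>R (\<alpha>' x es + act (P' x) (\<alpha> p) es)
        + act (Gam p x) ?v (es @ ws) *\<^sub>R \<alpha> p (map (frame_change p p) es))
      = (\<Sum>es\<in>Ls E k. ?v (es @ ws) *\<^sub>R (\<alpha>' x es - act (Gam p x) (\<alpha> p) es))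
      + (\<Sum>es\<in>Ls E k. act (Gam p x) (\<lambda>ws. ?v (es @ ws)) ws *\<^sub>R \<alpha> p es)
      + (\<Sum>es\<in>Ls E k. act (Gam p x) (\<lambda>us. ?v (us @ ws)) es *\<^sub>R \<alpha> p es
        + ?v (es @ ws) *\<^sub>R act (P' x) (\<alpha> p) es + ?v (es @ ws) *\<^sub>R act (Gam p x) (\<alpha> p) es)"
      unfolding sum.distrib[symmetric] by (intro sum.cong refl) (simp add: act_append map_id algebra_simps)
    then show ?thesis unfolding a z by (simp add: scaleR_add_right)
  qed
  with transform_U[OF all p eq] show ?thesis by simp
qed

text \<open>In \<open>* d *\<close> the derivative passes the inner star, the Christoffel symbols of the torsion-free connection
  cancel in the remaining slots, and the two stars compose to the identity: a divergence is left.\<close>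

lemma star_d_star:
  fixes \<alpha> :: "complex ^ 'n \<Rightarrow> (complex ^ 'n) list \<Rightarrow> 'b::real_normed_vector"
  assumes p: "p \<in> U"
    and \<alpha>: "\<And>q. q \<in> U \<Longrightarrow> mlin (Suc k) (\<alpha> q)" "\<And>q. q \<in> U \<Longrightarrow> alt (Suc k) (\<alpha> q)"
    and \<alpha>': "\<And>vs. length vs = Suc k \<Longrightarrow> ((\<lambda>q. \<alpha> q vs) has_derivative (\<lambda>x. \<alpha>' x vs)) (at p)"
    and len: "DIM(complex ^ 'n) = Suc k + l" and vs: "length vs = k"
  shows "hodge (g p) (Suc l) (ext_d (\<lambda>q. hodge (g q) (Suc k) (\<alpha> q)) p) vs
    = (\<Sum>x\<in>onb (g p). \<alpha>' x (x # vs) - act (Gam p x) (\<alpha> p) (x # vs))"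
proof -
  define E where "E = onb (g p)"
  have E: "orthonormal_basis (g p) E" unfolding E_def by (rule onb_orthonormal_basis[OF inner_g[OF p]])
  let ?v = "vol_form (g p)"
  interpret oriented_orthonormal_basis "g p" E ?v by (rule vol_form_orthonormal[OF herm[OF p] E])
  define A where "A x es = \<alpha>' x es - act (Gam p x) (\<alpha> p) es" for x es
  define \<beta> where "\<beta> q = hodge (g q) (Suc k) (\<alpha> q)" for q
  define X where "X \<gamma> ws = (1 / fact (Suc k)) *\<^sub>R (\<Sum>es\<in>Ls E (Suc k). ?v (es @ ws) *\<^sub>R (\<gamma> es :: 'b))" for \<gamma> ws
  have altA: "alt (Suc k) (A x)" for x
  proof -
    have "alt (Suc k) (\<alpha>' x)"
      unfolding alt_def
    proof (intro allI impI)
      fix ws :: "(complex ^ 'n) list" and \<sigma> assume ws: "length ws = Suc k" and s: "\<sigma> permutes {..<Suc k}"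
      have "((\<lambda>q. of_int (sign \<sigma>) *\<^sub>R \<alpha> q ws) has_derivative (\<lambda>x. of_int (sign \<sigma>) *\<^sub>R \<alpha>' x ws)) (at p)"
        by (rule has_derivative_scaleR_right[OF \<alpha>'[OF ws]])
      then have "((\<lambda>q. \<alpha> q (permute_list \<sigma> ws)) has_derivative (\<lambda>x. of_int (sign \<sigma>) *\<^sub>R \<alpha>' x ws)) (at p)"
        by (rule transform_U[OF _ p]) (simp add: altD[OF \<alpha>(2) ws s])
      moreover have "((\<lambda>q. \<alpha> q (permute_list \<sigma> ws)) has_derivative (\<lambda>x. \<alpha>' x (permute_list \<sigma> ws))) (at p)"
        using ws by (intro \<alpha>') simp
      ultimately show "\<alpha>' x (permute_list \<sigma> ws) = of_int (sign \<sigma>) *\<^sub>R \<alpha>' x ws"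
        using has_derivative_unique by metis
    qed
    then show ?thesis using alt_act[OF \<alpha>(2)[OF p]] unfolding alt_def A_def by (simp add: scaleR_diff_right)
  qed
  have mlinA: "mlin (Suc k) (A x)" for x
  proof -
    have "mlin (Suc k) (\<alpha>' x)"
      unfolding mlin_def
    proof (intro allI impI)
      fix us ws :: "(complex ^ 'n) list" assume l: "length us + Suc (length ws) = Suc k"
      have d: "((\<lambda>q. \<alpha> q (us @ y # ws)) has_derivative (\<lambda>x. \<alpha>' x (us @ y # ws))) (at p)" for y
        using l by (intro \<alpha>') simp
      have lin: "linear (\<lambda>y. \<alpha> q (us @ y # ws))" if "q \<in> U" for q by (rule mlinD[OF \<alpha>(1)[OF that] l])
      show "linear (\<lambda>y. \<alpha>' x (us @ y # ws))"
        unfolding linear_iff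
      proof (intro conjI allI)
        fix y z c
        have "((\<lambda>q. \<alpha> q (us @ (y + z) # ws)) has_derivative (\<lambda>x. \<alpha>' x (us @ y # ws) + \<alpha>' x (us @ z # ws))) (at p)"
          by (rule transform_U[OF has_derivative_add[OF d d] p]) (simp add: linear_add[OF lin])
        then show "\<alpha>' x (us @ (y + z) # ws) = \<alpha>' x (us @ y # ws) + \<alpha>' x (us @ z # ws)"
          using has_derivative_unique[OF d] by metis
        have "((\<lambda>q. \<alpha> q (us @ (c *\<^sub>R y) # ws)) has_derivative (\<lambda>x. c *\<^sub>R \<alpha>' x (us @ y # ws))) (at p)"
          by (rule transform_U[OF has_derivative_scaleR_right[OF d] p]) (simp add: linear_scale[OF lin])
        then show "\<alpha>' x (us @ (c *\<^sub>R y) # ws) = c *\<^sub>R \<alpha>' x (us @ y # ws)"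
          using has_derivative_unique[OF d] by metis
      qed
    qed
    then show ?thesis using mlin_act[OF \<alpha>(1)[OF p] Gam_lin(2)[OF p]] unfolding mlin_def A_def
      by (auto intro: linear_compose_sub)
  qed
  have der: "frechet_derivative (\<lambda>q. \<beta> q ws) (at p) x = X (A x) ws + act (Gam p x) (X (\<alpha> p)) ws"
    if ws: "ws \<in> Ls E l" for ws x
    using frechet_derivative_eq[OF hodge_has_derivative[OF p E \<alpha>(1) \<alpha>' len ws]]
    unfolding \<beta>_def X_def A_def by metis
  have g': "alt (Suc l) (\<lambda>ws. ?v (ws @ vs))"
    using alt_vol len vs by (intro alt_append_left) (simp add: add.commute)
  have "hodge (g p) (Suc l) (ext_d \<beta> p) vs
     = (1 / fact (Suc l)) *\<^sub>R (\<Sum>ws\<in>Ls E (Suc l). ?v (ws @ vs) *\<^sub>R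
        (\<Sum>i<Suc l. (- 1) ^ i *\<^sub>R frechet_derivative (\<lambda>q. \<beta> q (take i ws @ drop (Suc i) ws)) (at p) (ws ! i)))"
    unfolding hodge_Ls E_def[symmetric] ext_d_def
    by (intro arg_cong[where f = "\<lambda>x. _ *\<^sub>R x"] sum.cong refl) (simp only: length_Ls)
  also have "\<dots> = (1 / fact (Suc l)) *\<^sub>R (real (Suc l) *\<^sub>R (\<Sum>x\<in>E. \<Sum>ws\<in>Ls E l. ?v (x # ws @ vs) *\<^sub>R
      frechet_derivative (\<lambda>q. \<beta> q ws) (at p) x))"
    by (subst sum_alt_alternating_sum[OF g', where Y = "\<lambda>x ws. frechet_derivative (\<lambda>q. \<beta> q ws) (at p) x"]) simp
  also have "(\<Sum>x\<in>E. \<Sum>ws\<in>Ls E l. ?v (x # ws @ vs) *\<^sub>R frechet_derivative (\<lambda>q. \<beta> q ws) (at p) x)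
      = (\<Sum>x\<in>E. \<Sum>ws\<in>Ls E l. ?v (x # ws @ vs) *\<^sub>R X (A x) ws)
        + (\<Sum>x\<in>E. \<Sum>ws\<in>Ls E l. ?v ((x # ws) @ vs) *\<^sub>R act (Gam p x) (X (\<alpha> p)) ws)"
    by (simp add: der scaleR_add_right sum.distrib)
  also have "(\<Sum>x\<in>E. \<Sum>ws\<in>Ls E l. ?v ((x # ws) @ vs) *\<^sub>R act (Gam p x) (X (\<alpha> p)) ws) = 0"
    by (rule sum_alt_symmetric[OF g']) (rule Gam_sym[OF p])
  also have "(1 / fact (Suc l)) *\<^sub>R (real (Suc l) *\<^sub>R ((\<Sum>x\<in>E. \<Sum>ws\<in>Ls E l. ?v (x # ws @ vs) *\<^sub>R X (A x) ws) + 0))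
      = (1 / fact l) *\<^sub>R (\<Sum>x\<in>E. \<Sum>ws\<in>Ls E l. ?v (x # ws @ vs) *\<^sub>R X (A x) ws)"
  proof -
    have "1 / fact (Suc l) * real (Suc l) = 1 / (fact l :: real)" by simp
    then show ?thesis by (simp only: scaleR_scaleR add_0_right)
  qed
  also have "\<dots> = (\<Sum>x\<in>E. A x (x # vs))"
    unfolding X_def by (rule star_wedge_star[OF len _ altA mlinA vs]) simp
  finally show ?thesis unfolding A_def \<beta>_def E_def .
qed

lemma star_wedge_1_star:
  fixes \<alpha> :: "(complex ^ 'n) list \<Rightarrow> 'b::real_vector"
  assumes p: "p \<in> U" and \<alpha>: "mlin (Suc k) \<alpha>" "alt (Suc k) \<alpha>" and lm: "\<And>x. linear (m x)"
    and len: "DIM(complex ^ 'n) = Suc k + l" and vs: "length vs = k"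
  shows "hodge (g p) (Suc l) (wedge m 1 l (\<lambda>us. a (us ! 0)) (hodge (g p) (Suc k) \<alpha>)) vs
    = (\<Sum>x\<in>onb (g p). m (a x) (\<alpha> (x # vs)))"
proof -
  define E where "E = onb (g p)"
  have E: "orthonormal_basis (g p) E" unfolding E_def by (rule onb_orthonormal_basis[OF inner_g[OF p]])
  let ?v = "vol_form (g p)"
  interpret oriented_orthonormal_basis "g p" E ?v by (rule vol_form_orthonormal[OF herm[OF p] E])
  have g': "alt (1 + l) (\<lambda>ws. ?v (ws @ vs))"
    using alt_vol len vs by (intro alt_append_left) (simp add: add.commute)
  have "hodge (g p) (Suc l) (wedge m 1 l (\<lambda>us. a (us ! 0)) (hodge (g p) (Suc k) \<alpha>)) vs
     = (1 / fact (Suc l)) *\<^sub>R (\<Sum>ws\<in>Ls E (1 + l). ?v (ws @ vs) *\<^sub>R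
       wedge m 1 l (\<lambda>us. a (us ! 0)) (hodge (g p) (Suc k) \<alpha>) ws)"
    unfolding hodge_Ls[of _ "Suc l"] E_def[symmetric] by simp
  also have "\<dots> = (1 / fact (Suc l)) *\<^sub>R ((fact (1 + l) / (fact 1 * fact l)) *\<^sub>R
      (\<Sum>us\<in>Ls E 1. \<Sum>ws\<in>Ls E l. ?v ((us @ ws) @ vs) *\<^sub>R m (a (us ! 0)) (hodge (g p) (Suc k) \<alpha> ws)))"
    by (subst sum_alt_wedge[OF g']) simp
  also have "\<dots> = (1 / fact l) *\<^sub>R (\<Sum>x\<in>E. \<Sum>ws\<in>Ls E l. ?v (x # ws @ vs) *\<^sub>R m (a x) (hodge (g p) (Suc k) \<alpha> ws))"
    by (simp add: sum_Ls_1 del: fact_Suc)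
  also have "\<dots> = (1 / fact l) *\<^sub>R (\<Sum>x\<in>E. \<Sum>ws\<in>Ls E l. ?v (x # ws @ vs) *\<^sub>R
      ((1 / fact (Suc k)) *\<^sub>R (\<Sum>es\<in>Ls E (Suc k). ?v (es @ ws) *\<^sub>R m (a x) (\<alpha> es))))"
    unfolding hodge_Ls[of _ "Suc k"] E_def[symmetric] by (simp add: linear_scale[OF lm] linear_sum[OF lm])
  also have "\<dots> = (\<Sum>x\<in>E. m (a x) (\<alpha> (x # vs)))"
  proof (rule star_wedge_star[OF len _ _ _ vs, where A = "\<lambda>x es. m (a x) (\<alpha> es)"])
    show "alt (Suc k) (\<lambda>es. m (a x) (\<alpha> es))" for x
      using \<alpha>(2) unfolding alt_def by (simp add: linear_scale[OF lm])
    show "mlin (Suc k) (\<lambda>es. m (a x) (\<alpha> es))" for x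
      unfolding mlin_def
    proof (intro allI impI)
      fix us vs :: "(complex ^ 'n) list" assume "length us + Suc (length vs) = Suc k"
      from linear_compose[OF mlinD[OF \<alpha>(1) this] lm[of "a x"]]
      show "linear (\<lambda>y. m (a x) (\<alpha> (us @ y # vs)))" by (simp add: o_def)
    qed
  qed simp
  finally show ?thesis unfolding E_def .
qed

text \<open>In real dimension two there are no 3-forms.  This case is separate since the degree \<open>2n - 3\<close> of \<open>*H\<close> is
  truncated there.\<close>

lemma H_zero_in_dimension_1: "CARD('n) = 1 \<Longrightarrow> q \<in> U \<Longrightarrow> H q a b c = 0"
proof -
  assume n: "CARD('n) = 1" and q: "q \<in> U"
  have E: "orthonormal_basis (g q) (onb (g q))" by (rule onb_orthonormal_basis[OF inner_g[OF q]])
  have "torsion g q [a, b, c] = (\<lambda>vs. 0) [a, b, c]"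
  proof (rule mlin_eq_on_basis[OF inner_g[OF q] E mlin_torsion[OF q]])
    show "mlin 3 (\<lambda>vs. 0)" by (simp add: mlin_def linear_zero)
    fix es assume es: "es \<in> Ls (onb (g q)) 3"
    have "card (onb (g q)) = 2" using card_orthonormal_basis[OF inner_g[OF q] E] n by simp
    then have "\<not> distinct es"
      using es card_mono[OF finite_orthonormal_basis[OF inner_g[OF q] E], of "set es"] distinct_card[of es]
      by (auto simp: Ls_def)
    then show "torsion g q es = 0" using alt_repeated[OF alt_torsion[OF q] length_Ls[OF es]] by simp
  qed simp
  then show ?thesis by (simp add: torsion_eq[OF q])
qed

lemma hodge_torsion_zero_in_dimension_1:
  assumes "CARD('n) = 1" "q \<in> U" shows "hodge (g q) 3 (torsion g q) ws = 0"
proof -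
  have "torsion g q es = 0" if es: "es \<in> Ls (onb (g q)) 3" for es
  proof -
    obtain a b c where "es = [a, b, c]" using length_Ls[OF es] by (auto simp: numeral_3_eq_3 length_Suc_conv)
    then show ?thesis using H_zero_in_dimension_1[OF assms] torsion_eq[OF assms(2)] by simp
  qed
  then show ?thesis unfolding hodge_Ls by simp
qed

lemma codiff_torsion:
  assumes p: "p \<in> U"
  shows "codiff g 3 (torsion g) p [v, w] = - (\<Sum>x\<in>onb (g p).
    dH p x x v w - H p (Gam p x x) v w - H p x (Gam p x v) w - H p x v (Gam p x w))"
proof (cases "CARD('n) = 1")
  case True
  have "frechet_derivative (\<lambda>q. hodge (g q) 3 (torsion g q) ws) (at p) x = 0" for ws x
    using frechet_derivative_eq[OF transform_U[OF has_derivative_const p, of 0 "\<lambda>q. hodge (g q) 3 (torsion g q) ws"]]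
      hodge_torsion_zero_in_dimension_1[OF True] by simp
  then have "codiff g 3 (torsion g) p [v, w] = 0" by (simp add: codiff_def hodge_Ls ext_d_def)
  moreover have "dH p x a b c = 0" for x a b c unfolding dH_def
    using frechet_derivative_eq[OF transform_U[OF has_derivative_const p, of 0 "\<lambda>q. H q a b c"]]
      H_zero_in_dimension_1[OF True] by simp
  ultimately show ?thesis using H_zero_in_dimension_1[OF True p] by simp
next
  case False
  then have "CARD('n) \<ge> 2" using zero_less_card_finite[where 'a = 'n] by linarith
  then obtain l where l: "2 * CARD('n) = 3 + l" using le_Suc_ex[of 3 "2 * CARD('n)"] by auto
  have "hodge (g p) (Suc l) (ext_d (\<lambda>q. hodge (g q) (Suc 2) (torsion g q)) p) [v, w]
    = (\<Sum>x\<in>onb (g p). frechet_derivative (\<lambda>q. torsion g q (x # [v, w])) (at p) x - act (Gam p x) (torsion g p) (x # [v, w]))"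
  proof (rule star_d_star[OF p])
    show "mlin (Suc 2) (torsion g q)" "alt (Suc 2) (torsion g q)" if "q \<in> U" for q
      using mlin_torsion[OF that] alt_torsion[OF that] by simp_all
    show "((\<lambda>q. torsion g q vs) has_derivative frechet_derivative (\<lambda>q. torsion g q vs) (at p)) (at p)"
      if "length vs = Suc 2" for vs
    proof -
      obtain a b c where "vs = [a, b, c]" using \<open>length vs = Suc 2\<close> by (auto simp: numeral_2_eq_2 length_Suc_conv)
      then have "((\<lambda>q. torsion g q vs) has_derivative frechet_derivative (\<lambda>q. H q a b c) (at p)) (at p)"
        using transform_U[OF dH_has_derivative[OF p] p, of a b c "\<lambda>q. torsion g q vs"] torsion_eq by simp
      then show ?thesis using frechet_derivative_eq by metis
    qed
  qed (use l in auto)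
  moreover have "frechet_derivative (\<lambda>q. torsion g q [a, b, c]) (at p) x = dH p x a b c" for a b c x
    using frechet_derivative_eq[OF transform_U[OF dH_has_derivative[OF p] p, of a b c "\<lambda>q. torsion g q [a, b, c]"]]
      torsion_eq by (simp add: dH_def)
  ultimately show ?thesis using l
    by (simp add: codiff_def act_Cons act_def torsion_eq[OF p] numeral_3_eq_3 algebra_simps)
qed

lemma star_F_wedge_star_torsion:
  fixes F :: "(complex ^ 'n) list \<Rightarrow> 'b::real_vector"
  assumes p: "p \<in> U"
  shows "hodge (g p) (2 * CARD('n) - 1) (wedge (\<lambda>\<xi> r. r *\<^sub>R \<xi>) 2 (2 * CARD('n) - 3) F (hodge (g p) 3 (torsion g p))) [v]
    = - (1 / 2) *\<^sub>R (\<Sum>e\<in>onb (g p). \<Sum>f\<in>onb (g p). H p e f v *\<^sub>R F [e, f])"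
proof (cases "CARD('n) = 1")
  case True
  have "hodge (g p) 3 (torsion g p) = (\<lambda>ws. 0)" using hodge_torsion_zero_in_dimension_1[OF True p] by auto
  then show ?thesis using H_zero_in_dimension_1[OF True p] by (simp add: hodge_Ls wedge_def)
next
  case False
  then have "CARD('n) \<ge> 2" using zero_less_card_finite[where 'a = 'n] by linarith
  then obtain l where l: "2 * CARD('n) = 3 + l" using le_Suc_ex[of 3 "2 * CARD('n)"] by auto
  define E where "E = onb (g p)"
  have E: "orthonormal_basis (g p) E" unfolding E_def by (rule onb_orthonormal_basis[OF inner_g[OF p]])
  interpret oriented_orthonormal_basis "g p" E "vol_form (g p)" by (rule vol_form_orthonormal[OF herm[OF p] E])
  have 1: "DIM(complex ^ 'n) = 3 + l" using l by simp
  have star: "hodge (g p) 3 (torsion g p) = (\<lambda>us. (1 / fact 3) *\<^sub>R (\<Sum>es\<in>Ls E 3. vol_form (g p) (es @ us) *\<^sub>R torsion g p es))"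
    unfolding E_def by (rule ext) (rule hodge_Ls)
  have 2: "2 * CARD('n) - 1 = 2 + l" "2 * CARD('n) - 3 = l" using l by simp_all
  show ?thesis
    unfolding 2 star hodge_Ls[of _ "2 + l"] E_def[symmetric]
    using star_wedge_star_3[OF 1 _ alt_torsion[OF p] mlin_torsion[OF p], of v F] by (simp add: torsion_eq[OF p])
qed

end

section \<open>Curvature of the Levi-Civita and Bismut connections\<close>

context hermitian_chart
begin

text \<open>\<open>nablaH\<close> and \<open>DH\<close> are the covariant derivatives of \<open>H\<close> for the Levi-Civita and the Bismut connection, \<open>dH4\<close> is its
  exterior derivative, \<open>Rm\<close> and \<open>RB\<close> are the curvature tensors.\<close>

definition ddg where "ddg p v x a b = frechet_derivative (\<lambda>q. dg q x a b) (at p) v"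
definition dGam where "dGam p v w x = frechet_derivative (\<lambda>q. Gam q w x) (at p) v"
definition dS where "dS p v w x = frechet_derivative (\<lambda>q. S q w x) (at p) v"
definition nablaH where
  "nablaH p v a b c = dH p v a b c - H p (Gam p v a) b c - H p a (Gam p v b) c - H p a b (Gam p v c)"
definition DH where
  "DH p v a b c = dH p v a b c - H p (Gb p v a) b c - H p a (Gb p v b) c - H p a b (Gb p v c)"
definition dH4 where "dH4 p a b c d = dH p a b c d - dH p b a c d + dH p c a b d - dH p d a b c"
definition Rm where "Rm p v w x y = g p (curvature Gam p v w x) y"
definition RB where "RB p v w x y = g p (curvature Gb p v w x) y"

lemma ddg_has_derivative: "p \<in> U \<Longrightarrow> ((\<lambda>q. dg q x a b) has_derivative (\<lambda>v. ddg p v x a b)) (at p)"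
  using smooth_on_differentiable[OF smooth_dg] frechet_derivative_works unfolding ddg_def by blast

lemma dGam_has_derivative: "p \<in> U \<Longrightarrow> ((\<lambda>q. Gam q w x) has_derivative (\<lambda>v. dGam p v w x)) (at p)"
  using Gam_differentiable[of p w x] frechet_derivative_eq unfolding dGam_def by metis

lemma dS_has_derivative: "p \<in> U \<Longrightarrow> ((\<lambda>q. S q w x) has_derivative (\<lambda>v. dS p v w x)) (at p)"
  using S_differentiable[of p w x] frechet_derivative_eq unfolding dS_def by metis

lemma dH_has_derivative': "p \<in> U \<Longrightarrow> ((\<lambda>q. H q a b c) has_derivative (\<lambda>v. dH p v a b c)) (at p)"
  unfolding dH_def by (rule dH_has_derivative)

lemma derivative_unique_U:
  assumes p: "p \<in> U" and "(f has_derivative D) (at p)" "(h has_derivative D') (at p)"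
    and "\<And>q. q \<in> U \<Longrightarrow> f q = h q"
  shows "D v = D' v"
  using has_derivative_unique[OF transform_U[OF assms(2) p assms(4)] assms(3)] by metis

lemma g_has_derivative:
  assumes p: "p \<in> U" and w: "(w has_derivative w') (at p)"
  shows "((\<lambda>q. g q (w q) b) has_derivative (\<lambda>h. dg p h (w p) b + g p (w' h) b)) (at p)"
  by (rule has_derivative_linear_family[where L = "\<lambda>q v. g q v b", OF finite_dimensional_euclidean dg_has_derivative[OF p] _ w])
    (use eventually_U[OF p] in \<open>auto elim!: eventually_mono intro!: inner_form_linear_left inner_g\<close>)

lemma ddg_sym:
  assumes p: "p \<in> U" shows "ddg p v x a b = ddg p x v a b"
proof -
  have "(\<lambda>q. g q a b) differentiable (at q)" if "q \<in> U" for q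
    using dg_has_derivative[OF that] differentiable_def by blast
  from second_derivative_symmetric[OF open_U p this ddg_has_derivative[OF p, unfolded dg_def] ddg_has_derivative[OF p, unfolded dg_def]]
  show ?thesis by simp
qed

lemma dGam_sym: "p \<in> U \<Longrightarrow> dGam p v w x = dGam p v x w"
  by (rule derivative_unique_U[OF _ dGam_has_derivative dGam_has_derivative]) (auto intro: Gam_sym)

text \<open>The derivative of the compatibility of the Levi-Civita connection with the metric.  Its symmetry in \<open>v\<close>
  and \<open>x\<close> is the skew-symmetry of the curvature in the last two arguments.\<close>

lemma ddg_eq:
  assumes p: "p \<in> U"
  shows "ddg p v x a b = g p (Gam p v (Gam p x a)) b + g p (Gam p x a) (Gam p v b) + g p (dGam p v x a) b
    + g p (Gam p v (Gam p x b)) a + g p (Gam p x b) (Gam p v a) + g p (dGam p v x b) a"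
proof -
  have 1: "((\<lambda>q. g q (Gam q x a) b + g q (Gam q x b) a) has_derivative
      (\<lambda>h. (dg p h (Gam p x a) b + g p (dGam p h x a) b) + (dg p h (Gam p x b) a + g p (dGam p h x b) a))) (at p)"
    by (intro has_derivative_add g_has_derivative[OF p] dGam_has_derivative[OF p])
  have "ddg p v x a b = (dg p v (Gam p x a) b + g p (dGam p v x a) b) + (dg p v (Gam p x b) a + g p (dGam p v x b) a)"
  proof (rule derivative_unique_U[OF p ddg_has_derivative[OF p] 1])
    fix q assume q: "q \<in> U"
    show "dg q x a b = g q (Gam q x a) b + g q (Gam q x b) a"
      using Gam_metric[OF q, of x a b] g_sym[OF q, of a "Gam q x b"] by simp
  qed
  then show ?thesis
    using Gam_metric[OF p, of v "Gam p x a" b] Gam_metric[OF p, of v "Gam p x b" a] by simp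
qed

lemma Rm_eq:
  assumes p: "p \<in> U"
  shows "Rm p v w x y = g p (dGam p v w x) y - g p (dGam p w v x) y
     + g p (Gam p v (Gam p w x)) y - g p (Gam p w (Gam p v x)) y"
  unfolding Rm_def curvature_def dGam_def[symmetric] by (simp add: g_bil[OF p])

lemma Rm_skew: "p \<in> U \<Longrightarrow> Rm p v w y x = - Rm p v w x y" "p \<in> U \<Longrightarrow> Rm p w v x y = - Rm p v w x y"
proof -
  assume p: "p \<in> U"
  show "Rm p v w y x = - Rm p v w x y"
    using ddg_eq[OF p, of v w x y] ddg_eq[OF p, of w v x y] ddg_sym[OF p, of v w x y]
      g_sym[OF p, of "Gam p w x" "Gam p v y"] g_sym[OF p, of "Gam p w y" "Gam p v x"]
    unfolding Rm_eq[OF p] by linarith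
  show "Rm p w v x y = - Rm p v w x y" unfolding Rm_eq[OF p] by linarith
qed

lemma Rm_Bianchi:
  assumes p: "p \<in> U" shows "Rm p v w x y + Rm p w x v y + Rm p x v w y = 0"
  unfolding Rm_eq[OF p]
  using dGam_sym[OF p, of v w x] dGam_sym[OF p, of w v x] dGam_sym[OF p, of x v w]
    Gam_sym[OF p, of w x] Gam_sym[OF p, of v x] Gam_sym[OF p, of v w] by simp

lemma Rm_pair_sym:
  assumes p: "p \<in> U" shows "Rm p v w x y = Rm p x y v w"
proof -
  note B = Rm_Bianchi[OF p] and s1 = Rm_skew(1)[OF p] and s2 = Rm_skew(2)[OF p]
  have "2 * Rm p v w x y = 2 * Rm p x y v w"
    using B[of v w x y] B[of w x y v] B[of x y v w] B[of y v w x]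
      s1[of w x y v] s1[of x v y w] s1[of x y w v] s1[of y w x v] s1[of v w y x] s1[of y v x w] s1[of v x y w]
      s2[of x v w y] s2[of w y v x] s2[of w y x v] s2[of v y w x] s2[of w x v y] s2[of v y x w] 
      s2[of x v y w] s1[of v x w y] s1[of w y x v] s1[of v y w x] s1[of v y x w] s1[of w y v x] s1[of w x v y]
      s2[of w v x y] s2[of y x v w]
    by argo
  then show ?thesis by simp
qed

lemma Rm_Bianchi_right:
  assumes p: "p \<in> U" shows "Rm p v x y z + Rm p v y z x + Rm p v z x y = 0"
  using Rm_Bianchi[OF p, of x y z v] Rm_pair_sym[OF p, of v x y z] Rm_pair_sym[OF p, of v y z x] Rm_pair_sym[OF p, of v z x y]
    Rm_skew(1)[OF p, of y z x v] Rm_skew(1)[OF p, of z x y v] Rm_skew(1)[OF p, of x y z v]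
  by argo

lemma H_arg:
  assumes "p \<in> U"
  shows "H p (x + y) b c = H p x b c + H p y b c" "H p a (x + y) c = H p a x c + H p a y c" "H p a b (x + y) = H p a b x + H p a b y"
    "H p (r *\<^sub>R x) b c = r * H p x b c" "H p a (r *\<^sub>R x) c = r * H p a x c" "H p a b (r *\<^sub>R x) = r * H p a b x"
    "H p (- x) b c = - H p x b c" "H p a (- x) c = - H p a x c" "H p a b (- x) = - H p a b x"
  using linear_add[OF H_lin(1)[OF assms]] linear_add[OF H_lin(2)[OF assms]] linear_add[OF H_lin(3)[OF assms]]
    linear_scale[OF H_lin(1)[OF assms]] linear_scale[OF H_lin(2)[OF assms]] linear_scale[OF H_lin(3)[OF assms]]
    linear_neg[OF H_lin(1)[OF assms]] linear_neg[OF H_lin(2)[OF assms]] linear_neg[OF H_lin(3)[OF assms]]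
  by simp_all

lemma dH_alt:
  assumes p: "p \<in> U" shows "dH p v b a c = - dH p v a b c" "dH p v a c b = - dH p v a b c"
  by (rule derivative_unique_U[OF p dH_has_derivative'[OF p] has_derivative_minus[OF dH_has_derivative'[OF p]]], rule H_alt, assumption)+

lemma dH_lin:
  assumes p: "p \<in> U"
  shows "linear (\<lambda>v. dH p v a b c)" "linear (\<lambda>x. dH p v x b c)" "linear (\<lambda>x. dH p v a x c)" "linear (\<lambda>x. dH p v a b x)"
proof -
  note d = dH_has_derivative'[OF p]
  show "linear (\<lambda>v. dH p v a b c)" by (rule has_derivative_linear[OF d])
  have add: "dH p v (x + y) b c = dH p v x b c + dH p v y b c" for x y b c
    by (rule derivative_unique_U[OF p d has_derivative_add[OF d d]]) (simp add: H_arg)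
  have sc: "dH p v (r *\<^sub>R x) b c = r * dH p v x b c" for r x b c
    by (rule derivative_unique_U[OF p d has_derivative_mult_right[OF d]]) (simp add: H_arg)
  show 1: "linear (\<lambda>x. dH p v x b c)" for b c by (simp add: linear_iff add sc)
  have "(\<lambda>x. dH p v a x c) = (\<lambda>x. - dH p v x a c)" for a c by (rule ext) (rule dH_alt(1)[OF p])
  then show 2: "linear (\<lambda>x. dH p v a x c)" for a c by (simp only: linear_compose_neg[OF 1])
  have "(\<lambda>x. dH p v a b x) = (\<lambda>x. - dH p v a x b)" by (rule ext) (rule dH_alt(2)[OF p])
  then show "linear (\<lambda>x. dH p v a b x)" by (simp only: linear_compose_neg[OF 2])
qed

lemma nablaH_alt:
  assumes p: "p \<in> U" shows "nablaH p v b a c = - nablaH p v a b c" "nablaH p v a c b = - nablaH p v a b c"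
  unfolding nablaH_def
  using dH_alt(1)[OF p, of v b a c] H_alt(1)[OF p, of a "Gam p v b" c] H_alt(1)[OF p, of "Gam p v a" b c] H_alt(1)[OF p, of a b "Gam p v c"]
    dH_alt(2)[OF p, of v a c b] H_alt(2)[OF p, of "Gam p v a" b c] H_alt(2)[OF p, of a b "Gam p v c"] H_alt(2)[OF p, of a "Gam p v b" c]
  by linarith+

lemma g_dS:
  assumes p: "p \<in> U"
  shows "g p (dS p v w x) y = dH p v w x y - g p (Gam p v (S p w x)) y - H p w x (Gam p v y)"
proof -
  have "dH p v w x y = dg p v (S p w x) y + g p (dS p v w x) y"
    by (rule derivative_unique_U[OF p dH_has_derivative'[OF p] g_has_derivative[OF p dS_has_derivative[OF p]]])
      (simp add: g_S)
  then show ?thesis using Gam_metric[OF p, of v "S p w x" y] g_S[OF p, of w x "Gam p v y"] by simp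
qed

lemma Gb_has_derivative: 
  assumes p: "p \<in> U" shows "((\<lambda>q. Gb q w x) has_derivative (\<lambda>v. dGam p v w x + (1/2) *\<^sub>R dS p v w x)) (at p)"
  by (rule transform_U[OF has_derivative_add[OF dGam_has_derivative[OF p] has_derivative_scaleR_right[OF dS_has_derivative[OF p]]] p])
    (simp add: Gb_eq)

text \<open>The Bismut connection is \<open>\<nabla> + S / 2\<close>: its curvature has a linear and a quadratic correction.\<close>

lemma RB_eq:
  assumes p: "p \<in> U"
  shows "RB p v w x y = Rm p v w x y + (nablaH p v w x y - nablaH p w v x y) / 2
     + (H p v (S p w x) y - H p w (S p v x) y) / 4"
proof -
  note l = linear_add[OF Gam_lin(2)[OF p]] linear_scale[OF Gam_lin(2)[OF p]] linear_add[OF S_lin(2)[OF p]] linear_scale[OF S_lin(2)[OF p]]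
  have c: "curvature Gb p v w x = (dGam p v w x + (1/2) *\<^sub>R dS p v w x) - (dGam p w v x + (1/2) *\<^sub>R dS p w v x)
      + Gb p v (Gb p w x) - Gb p w (Gb p v x)"
    unfolding curvature_def frechet_derivative_eq[OF Gb_has_derivative[OF p]] ..
  have "RB p v w x y = Rm p v w x y + (g p (dS p v w x) y - g p (dS p w v x) y
      + g p (Gam p v (S p w x)) y + H p v (Gam p w x) y - g p (Gam p w (S p v x)) y - H p w (Gam p v x) y) / 2
      + (H p v (S p w x) y - H p w (S p v x) y) / 4"
    unfolding RB_def c Rm_eq[OF p] Gb_eq[OF p]
    by (simp add: l g_bil[OF p] g_S[OF p] H_arg[OF p] field_simps)
  also have "\<dots> = Rm p v w x y + (nablaH p v w x y - nablaH p w v x y) / 2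
      + (H p v (S p w x) y - H p w (S p v x) y) / 4"
    unfolding g_dS[OF p] nablaH_def using Gam_sym[OF p, of v w] by (simp add: field_simps)
  finally show ?thesis .
qed

lemma HS_eq:
  assumes p: "p \<in> U" shows "H p v (S p w x) y = - g p (S p w x) (S p v y)"
  using g_S[OF p, of v y "S p w x"] g_sym[OF p, of "S p w x" "S p v y"] H_alt(2)[OF p, of v y "S p w x"] by simp

lemma RB_skew: "p \<in> U \<Longrightarrow> RB p v w y x = - RB p v w x y" "p \<in> U \<Longrightarrow> RB p w v x y = - RB p v w x y"
proof -
  assume p: "p \<in> U"
  show "RB p v w y x = - RB p v w x y"
    unfolding RB_eq[OF p] HS_eq[OF p]
    using Rm_skew(1)[OF p, of v w y x] nablaH_alt(2)[OF p, of v w y x] nablaH_alt(2)[OF p, of w v y x]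
      g_sym[OF p, of "S p w x" "S p v y"] g_sym[OF p, of "S p v x" "S p w y"] by argo
  show "RB p w v x y = - RB p v w x y"
    unfolding RB_eq[OF p] using Rm_skew(2)[OF p, of w v x y] by argo
qed

lemma curvature_Gb_J:
  assumes p: "p \<in> U" shows "curvature Gb p v w (Jstd x) = Jstd (curvature Gb p v w x)"
proof -
  have bJ: "bounded_linear (Jstd :: complex ^ 'n \<Rightarrow> complex ^ 'n)"
    by (rule linear_imp_bounded_linear[OF finite_dimensional_euclidean linear_Jstd])
  have "frechet_derivative (\<lambda>q. Gb q w (Jstd x)) (at p) v = Jstd (frechet_derivative (\<lambda>q. Gb q w x) (at p) v)" for v w
    unfolding frechet_derivative_eq[OF Gb_has_derivative[OF p]]
    by (rule derivative_unique_U[OF p Gb_has_derivative[OF p] bounded_linear.has_derivative[OF bJ Gb_has_derivative[OF p]]])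
      (simp add: Gb_J)
  then show ?thesis unfolding curvature_def by (simp add: Gb_J[OF p] Jstd_linear)
qed

lemma RB_J: "p \<in> U \<Longrightarrow> RB p v w (Jstd x) y = - RB p v w x (Jstd y)"
  unfolding RB_def by (simp add: curvature_Gb_J g_J_left)

lemma DH_eq:
  assumes p: "p \<in> U"
  shows "DH p v a b c = nablaH p v a b c - (H p (S p v a) b c + H p a (S p v b) c + H p a b (S p v c)) / 2"
  unfolding DH_def nablaH_def Gb_eq[OF p] by (simp add: H_arg[OF p] field_simps)

lemma dH4_eq:
  assumes p: "p \<in> U"
  shows "dH4 p a b c d = nablaH p a b c d - nablaH p b a c d + nablaH p c a b d - nablaH p d a b c"
  unfolding dH4_def nablaH_def
  using Gam_sym[OF p, of b a] Gam_sym[OF p, of c a] Gam_sym[OF p, of d a] Gam_sym[OF p, of c b] Gam_sym[OF p, of d b] Gam_sym[OF p, of d c]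
    H_alt(1)[OF p, of "Gam p a c" b d] H_alt(1)[OF p, of "Gam p b c" a d]
    H_alt(2)[OF p, of b c "Gam p a d"] H_alt(2)[OF p, of a c "Gam p b d"]  H_alt(2)[OF p, of a b "Gam p c d"]
    H_alt(1)[OF p, of "Gam p a d" b c] H_alt(2)[OF p, of b "Gam p a d" c] H_alt(1)[OF p, of "Gam p b d" a c] H_alt(2)[OF p, of a "Gam p b d" c]
  by simp

lemma H_cyclic: "p \<in> U \<Longrightarrow> H p a b c = H p b c a"
  using H_alt(1)[of p b a c] H_alt(2)[of p b c a] by simp

text \<open>The first Bianchi identity of the Bismut connection, as a cyclic sum over the last three arguments.
  The quadratic terms in \<open>S\<close> combine to those by which \<open>DH\<close> differs from \<open>nablaH\<close>.\<close>

lemma RB_Bianchi: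
  assumes p: "p \<in> U"
  shows "RB p v x y z + RB p v y z x + RB p v z x y = DH p v x y z + dH4 p v x y z / 2"
proof -
  have h: "H p (S p v x) y z = g p (S p y z) (S p v x)" "H p x (S p v y) z = g p (S p z x) (S p v y)"
     "H p x y (S p v z) = g p (S p x y) (S p v z)"
    using H_cyclic[OF p, of "S p v x" y z] H_cyclic[OF p, of z x "S p v y"] by (simp_all only: g_S[OF p])
  have sk: "g p (S p v a) (S p b c) = - g p (S p c b) (S p v a)" for a b c
    using S_skew(1)[OF p, of b c] g_sym[OF p, of "S p v a" "S p c b"] by (simp add: g_bil[OF p])
  have q: "H p x (S p v y) z = g p (S p z x) (S p v y)" "H p y (S p v z) x = g p (S p x y) (S p v z)"
    "H p z (S p v x) y = g p (S p y z) (S p v x)"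
    "H p v (S p x y) z = - g p (S p x y) (S p v z)" "H p v (S p y z) x = - g p (S p y z) (S p v x)"
    "H p v (S p z x) y = - g p (S p z x) (S p v y)"
    by (simp_all only: HS_eq[OF p] sk minus_minus)
  have n: "nablaH p v y z x = nablaH p v x y z" "nablaH p v z x y = nablaH p v x y z"
    using nablaH_alt(1)[OF p, of v y x z] nablaH_alt(2)[OF p, of v y z x] nablaH_alt(1)[OF p, of v z x y]
      nablaH_alt(2)[OF p, of v x z y] by argo+
  show ?thesis
    unfolding RB_eq[OF p] DH_eq[OF p] dH4_eq[OF p] h q n
    using Rm_Bianchi_right[OF p, of v x y z] nablaH_alt(2)[OF p, of y v z x]
    by argo
qed

end

section \<open>Traces of the curvature identities\<close>

lemma hermitian_orthonormal_basis_J: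
  assumes m: "hermitian m" and E: "orthonormal_basis m E"
  shows "orthonormal_basis m (Jstd ` E)"
proof -
  have inj: "Jstd e = Jstd f \<longleftrightarrow> e = f" for e f :: "complex ^ 'n"
    using Jstd_Jstd[of e] Jstd_Jstd[of f] by (metis neg_equal_iff_equal)
  have "surj Jstd" by (metis Jstd_Jstd minus_minus surj_def Jstd_linear(4))
  then have "span (Jstd ` E) = UNIV"
    using E linear_span_image[OF linear_Jstd, of E] unfolding orthonormal_basis_def by simp
  then show ?thesis using E unfolding orthonormal_basis_def by (auto simp: hermitian_J[OF m] inj)
qed

lemma trace_J_J:
  assumes m: "hermitian m" and E: "orthonormal_basis m E"
    and f: "\<And>y. linear (\<lambda>x. f x y)" "\<And>x. linear (f x)"
  shows "(\<Sum>e\<in>E. f (Jstd e) (Jstd e)) = (\<Sum>e\<in>E. f e e)"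
proof -
  have "inj_on Jstd E" by (rule inj_on_inverseI[of _ "\<lambda>v. - Jstd v"]) simp
  then show ?thesis
    using trace_basis_independent[OF hermitian_inner_form[OF m] hermitian_orthonormal_basis_J[OF m E] E f]
    by (simp add: sum.reindex)
qed

lemma trace_J_move:
  assumes m: "hermitian m" and E: "orthonormal_basis m E"
    and f: "\<And>y. linear (\<lambda>x. f x y)" "\<And>x. linear (f x)"
  shows "(\<Sum>e\<in>E. f (Jstd e) e) = - (\<Sum>e\<in>E. f e (Jstd e))"
proof -
  have "linear (\<lambda>y. f x (Jstd y))" for x using linear_compose[OF linear_Jstd f(2)] by (simp add: o_def)
  then have "(\<Sum>e\<in>E. f (Jstd e) (Jstd (Jstd e))) = (\<Sum>e\<in>E. f e (Jstd e))"
    using trace_J_J[OF m E, of "\<lambda>x y. f x (Jstd y)"] f(1) by blast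
  then have "- (\<Sum>e\<in>E. f (Jstd e) e) = (\<Sum>e\<in>E. f e (Jstd e))" by (simp add: linear_neg[OF f(2)] sum_negf)
  then show ?thesis by (metis minus_minus)
qed

context hermitian_chart
begin

definition phi where "phi p w = lee_form g p [w]"
definition dphi where "dphi p v w = frechet_derivative (\<lambda>q. phi q w) (at p) v"

lemma onb_basis: "p \<in> U \<Longrightarrow> orthonormal_basis (g p) (onb (g p))"
  by (rule onb_orthonormal_basis[OF inner_g])

lemma phi_eq: "p \<in> U \<Longrightarrow> phi p w = (1 / 2) * (\<Sum>e\<in>onb (g p). H p (Jstd w) (Jstd e) e)"
  using H_cyclic[of p "Jstd w" "Jstd _"] by (simp add: phi_def lee_form_def ext_d_omega_H H_arg)

lemma linear_phi: "p \<in> U \<Longrightarrow> linear (phi p)"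
proof -
  assume p: "p \<in> U"
  have "linear (\<lambda>w. H p (Jstd w) (Jstd e) e)" for e
    using linear_compose[OF linear_Jstd H_lin(1)[OF p]] by (simp add: o_def)
  then have "linear (\<lambda>w. (1 / 2) * (\<Sum>e\<in>onb (g p). H p (Jstd w) (Jstd e) e))"
    using linear_compose_scale_right[OF linear_compose_sum, of "onb (g p)" "\<lambda>e w. H p (Jstd w) (Jstd e) e" "1/2"]
    by (simp only: real_scaleR_def simp_thms ball_triv)
  moreover have "phi p = (\<lambda>w. (1 / 2) * (\<Sum>e\<in>onb (g p). H p (Jstd w) (Jstd e) e))"
    using phi_eq[OF p] by auto
  ultimately show ?thesis by simp
qed

lemma H_J_bilinear:
  assumes "p \<in> U"
  shows "linear (\<lambda>x. H p a (Jstd x) y)" "linear (H p a (Jstd x))"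
  using linear_compose[OF linear_Jstd H_lin(2)[OF assms]] H_lin(3)[OF assms] by (simp_all add: o_def)

text \<open>The Bismut connection preserves \<open>J\<close> and \<open>g\<close>, so that the trace which defines the Lee form may be
  differentiated term by term.\<close>

lemma phi_has_derivative:
  assumes p: "p \<in> U"
  shows "((\<lambda>q. phi q w) has_derivative
    (\<lambda>v. (1 / 2) * (\<Sum>e\<in>onb (g p). DH p v (Jstd w) (Jstd e) e) + phi p (Gb p v w))) (at p)"
proof -
  have "((\<lambda>q. \<Sum>e\<in>onb (g q). H q (Jstd w) (Jstd e) e) has_derivative
    (\<lambda>v. \<Sum>e\<in>onb (g p). dH p v (Jstd w) (Jstd e) e - H p (Jstd w) (Jstd (Gb p v e)) e - H p (Jstd w) (Jstd e) (Gb p v e))) (at p)"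
    by (rule trace_has_derivative[OF p onb_basis[OF p] Gb_metric[OF p] H_J_bilinear dH_has_derivative'[OF p]])
  from transform_U[OF has_derivative_mult_right[OF this, of "1/2"] p, of "\<lambda>q. phi q w"]
  have "((\<lambda>q. phi q w) has_derivative
    (\<lambda>v. 1/2 * (\<Sum>e\<in>onb (g p). dH p v (Jstd w) (Jstd e) e - H p (Jstd w) (Jstd (Gb p v e)) e - H p (Jstd w) (Jstd e) (Gb p v e)))) (at p)"
    by (simp add: phi_eq)
  moreover have "1/2 * (\<Sum>e\<in>onb (g p). dH p v (Jstd w) (Jstd e) e - H p (Jstd w) (Jstd (Gb p v e)) e - H p (Jstd w) (Jstd e) (Gb p v e))
     = (1 / 2) * (\<Sum>e\<in>onb (g p). DH p v (Jstd w) (Jstd e) e) + phi p (Gb p v w)" for v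
    unfolding phi_eq[OF p] distrib_left[symmetric] sum.distrib[symmetric]
    by (intro arg_cong[where f = "\<lambda>x. 1/2 * x"] sum.cong refl) (simp add: DH_def Gb_J[OF p])
  ultimately show ?thesis by (simp only:)
qed

lemma dphi_has_derivative: "p \<in> U \<Longrightarrow> ((\<lambda>q. phi q w) has_derivative (\<lambda>v. dphi p v w)) (at p)"
  unfolding dphi_def by (rule frechet_derivative_works[THEN iffD1, OF differentiableI[OF phi_has_derivative]])

lemma dphi_eq: "p \<in> U \<Longrightarrow> dphi p v w = (1 / 2) * (\<Sum>e\<in>onb (g p). DH p v (Jstd w) (Jstd e) e) + phi p (Gb p v w)"
  by (rule fun_cong[OF has_derivative_unique[OF dphi_has_derivative phi_has_derivative]])

lemma linear_Rm:
  assumes p: "p \<in> U"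
  shows "linear (\<lambda>w. Rm p v w x y)"
proof -
  have "(\<lambda>w. Rm p v w x y) = (\<lambda>w. g p (curvature Gam p x y v) w)"
    using Rm_pair_sym[OF p, of v _ x y] by (simp add: Rm_def)
  then show ?thesis by (simp only: inner_form_linear_right[OF inner_g[OF p]])
qed

lemma linear_nablaH:
  assumes p: "p \<in> U"
  shows "linear (\<lambda>v. nablaH p v a b c)" "linear (\<lambda>x. nablaH p v x b c)"
proof -
  note c = linear_compose[unfolded o_def]
  show "linear (\<lambda>v. nablaH p v a b c)" unfolding nablaH_def
    by (intro linear_compose_sub dH_lin[OF p] c[OF Gam_lin(1)[OF p] H_lin(1)[OF p]]
        c[OF Gam_lin(1)[OF p] H_lin(2)[OF p]] c[OF Gam_lin(1)[OF p] H_lin(3)[OF p]])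
  show "linear (\<lambda>x. nablaH p v x b c)" unfolding nablaH_def
    by (intro linear_compose_sub dH_lin[OF p] c[OF Gam_lin(2)[OF p] H_lin(1)[OF p]] H_lin[OF p])
qed

lemma linear_RB:
  assumes p: "p \<in> U"
  shows "linear (\<lambda>x. RB p v w x y)" "linear (RB p v w x)" "linear (\<lambda>w. RB p v w x y)"
proof -
  note c = linear_compose[unfolded o_def]
  show 1: "linear (RB p v w x)" for x unfolding RB_def by (rule inner_form_linear_right[OF inner_g[OF p]])
  have "(\<lambda>x. RB p v w x y) = (\<lambda>x. - RB p v w y x)" by (rule ext) (rule RB_skew(1)[OF p])
  then show "linear (\<lambda>x. RB p v w x y)" by (simp only: linear_compose_neg[OF 1])
  have "linear (\<lambda>w. Rm p v w x y + (1/2) *\<^sub>R (nablaH p v w x y - nablaH p w v x y)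
     + (1/4) *\<^sub>R (H p v (S p w x) y - H p w (S p v x) y))"
    by (intro linear_compose_add linear_compose_scale_right linear_compose_sub linear_Rm[OF p] linear_nablaH[OF p]
        c[OF S_lin(1)[OF p] H_lin(2)[OF p]] H_lin[OF p])
  then show "linear (\<lambda>w. RB p v w x y)" unfolding RB_eq[OF p] by (simp add: field_simps)
qed

definition RicB where "RicB p v w = (\<Sum>e\<in>onb (g p). RB p e v w e)"

text \<open>The trace of the Bianchi identity for the arguments \<open>v\<close>, \<open>J w\<close>, \<open>J e\<close>, \<open>e\<close>.  The first summand gives the Bismut
  Ricci form; as the curvature commutes with \<open>J\<close>, the two others both give minus the Ricci tensor.  On the
  right-hand side the trace of \<open>DH\<close> is the derivative of the Lee form.\<close>

lemma bismut_ricci_RicB: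
  assumes p: "p \<in> U"
  shows "bismut_ricci g p v (Jstd w) - RicB p v w
    = dphi p v w - phi p (Gb p v w) + (1 / 4) * (\<Sum>e\<in>onb (g p). dH4 p v (Jstd w) (Jstd e) e)"
proof -
  let ?E = "onb (g p)"
  note h = herm[OF p] and E = onb_basis[OF p]
  have 1: "(\<Sum>e\<in>?E. RB p v (Jstd w) (Jstd e) e) = 2 * bismut_ricci g p v (Jstd w)"
    by (simp add: bismut_ricci_def RB_def Gb_def)
  have ee: "(\<Sum>e\<in>?E. RB p v (Jstd e) (Jstd e) w) = (\<Sum>e\<in>?E. RB p v e e w)"
    by (rule trace_J_J[OF h E linear_RB(3)[OF p] linear_RB(1)[OF p]])
  have "(\<Sum>e\<in>?E. RB p v (Jstd e) e (Jstd w)) = (\<Sum>e\<in>?E. - RB p v (Jstd e) (Jstd e) w)"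
    by (rule sum.cong[OF refl]) (simp add: RB_J[OF p])
  also have "\<dots> = (\<Sum>e\<in>?E. - RB p v e e w)" using ee by (simp only: sum_negf)
  also have "\<dots> = - RicB p v w" unfolding RicB_def sum_negf[symmetric]
  proof (rule sum.cong[OF refl])
    fix e show "- RB p v e e w = - RB p e v w e"
      using RB_skew(1)[OF p, of v e w e] RB_skew(2)[OF p, of v e w e] by simp
  qed
  finally have 2: "(\<Sum>e\<in>?E. RB p v (Jstd e) e (Jstd w)) = - RicB p v w" .
  have 3: "(\<Sum>e\<in>?E. RB p v e (Jstd w) (Jstd e)) = - RicB p v w" unfolding RicB_def sum_negf[symmetric]
  proof (rule sum.cong[OF refl])
    fix e show "RB p v e (Jstd w) (Jstd e) = - RB p e v w e"
      using RB_J[OF p, of v e w "Jstd e"] RB_skew(2)[OF p, of v e w e] linear_neg[OF linear_RB(2)[OF p, of v e w]] by simp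
  qed
  have "(\<Sum>e\<in>?E. RB p v (Jstd w) (Jstd e) e) + (\<Sum>e\<in>?E. RB p v (Jstd e) e (Jstd w)) + (\<Sum>e\<in>?E. RB p v e (Jstd w) (Jstd e))
    = (\<Sum>e\<in>?E. DH p v (Jstd w) (Jstd e) e) + (\<Sum>e\<in>?E. dH4 p v (Jstd w) (Jstd e) e) / 2"
    unfolding sum.distrib[symmetric] sum_divide_distrib by (rule sum.cong[OF refl]) (rule RB_Bianchi[OF p])
  then show ?thesis unfolding 1 2 3 dphi_eq[OF p] by simp
qed

lemma codiff_torsion_nablaH:
  assumes p: "p \<in> U"
  shows "codiff g 3 (torsion g) p [v, w] = - (\<Sum>e\<in>onb (g p). nablaH p e e v w)"
  unfolding codiff_torsion[OF p] nablaH_def ..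

lemma codiff_skew: 
  assumes p: "p \<in> U" shows "codiff g 3 (torsion g) p [w, v] = - codiff g 3 (torsion g) p [v, w]"
  unfolding codiff_torsion_nablaH[OF p] sum_negf[symmetric] by (rule sum.cong[OF refl]) (simp add: nablaH_alt(2)[OF p, of _ _ v w])

text \<open>The trace of the formula for \<open>RB\<close>: the derivative of \<open>H\<close> becomes the codifferential, the quadratic term
  becomes \<open>H\<^sup>2\<close>.\<close>

lemma RicB_eq:
  assumes p: "p \<in> U"
  shows "RicB p v w = ricci g p v w - codiff g 3 (torsion g) p [v, w] / 2 - torsion_sq g p v w / 4"
proof -
  let ?E = "onb (g p)"
  have "RB p e v w e = Rm p e v w e + nablaH p e e v w / 2 - (\<Sum>f\<in>?E. torsion g p [e, f, v] * torsion g p [e, f, w]) / 4" for e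
  proof -
    have "nablaH p e v w e = nablaH p e e v w" "nablaH p v e w e = 0"
      using nablaH_alt(2)[OF p, of e v e w] nablaH_alt(1)[OF p, of e e v w]
        nablaH_alt(1)[OF p, of v e w e] nablaH_alt(2)[OF p, of v w e e] by simp_all
    moreover have "H p e (S p v w) e = 0" using H_alt(1)[OF p, of e "S p v w" e] H_alt(2)[OF p, of "S p v w" e e] by simp
    moreover have "H p v (S p e w) e = (\<Sum>f\<in>?E. torsion g p [e, f, v] * torsion g p [e, f, w])"
    proof -
      have "H p v (S p e w) e = g p (S p e w) (S p e v)"
        using H_cyclic[OF p, of e v "S p e w"] g_S[OF p, of e v "S p e w"] g_sym[OF p, of "S p e w" "S p e v"] by simp
      also have "\<dots> = (\<Sum>f\<in>?E. g p (S p e w) f * g p (S p e v) f)" by (rule parseval[OF inner_g[OF p] onb_basis[OF p]])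
      also have "\<dots> = (\<Sum>f\<in>?E. torsion g p [e, f, v] * torsion g p [e, f, w])"
      proof (rule sum.cong[OF refl])
        fix f show "g p (S p e w) f * g p (S p e v) f = torsion g p [e, f, v] * torsion g p [e, f, w]"
          unfolding g_S[OF p] torsion_eq[OF p] H_alt(2)[OF p, of e f w] H_alt(2)[OF p, of e f v] by simp
      qed
      finally show ?thesis .
    qed
    ultimately show ?thesis unfolding RB_eq[OF p] by simp
  qed
  then show ?thesis unfolding RicB_def codiff_torsion_nablaH[OF p] ricci_def Rm_def[symmetric] Gam_def[symmetric] torsion_sq_def
    by (simp add: sum.distrib sum_subtractf sum_divide_distrib)
qed

lemma ricci_sym:
  assumes p: "p \<in> U" shows "ricci g p v w = ricci g p w v"
  unfolding ricci_def Rm_def[symmetric] Gam_def[symmetric]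
proof (rule sum.cong[OF refl])
  fix e show "Rm p e v w e = Rm p e w v e"
    using Rm_pair_sym[OF p, of e v w e] Rm_skew(1)[OF p, of w e v e] Rm_skew(2)[OF p, of e w v e] by simp
qed

lemma g_lee_field: "p \<in> U \<Longrightarrow> g p (lee_field g p) w = phi p w"
  unfolding lee_field_def phi_def[symmetric] by (rule sharp_inner[OF inner_g linear_phi[unfolded fun_eq_iff]])

lemma lie_deriv_lee:
  assumes p: "p \<in> U"
  shows "lie_deriv_metric (lee_field g) g p v w = dphi p v w + dphi p w v - 2 * phi p (Gam p v w)"
proof -
  let ?Y = "lee_field g"
  obtain u' where u: "((\<lambda>q. sharp (g q) (phi q)) has_derivative u') (at p)"
    "\<And>h w. g p (u' h) w = dphi p h w - dg p h (sharp (g p) (phi p)) w"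
    using sharp_differentiable[where g = g, OF inner_g open_U p dg_has_derivative[OF p] linear_phi dphi_has_derivative[OF p]] by metis
  have Y: "?Y = (\<lambda>q. sharp (g q) (phi q))" by (rule ext) (simp add: lee_field_def phi_def[abs_def])
  have "frechet_derivative ?Y (at p) = u'" unfolding Y by (rule frechet_derivative_eq[OF u(1)])
  then have "lie_deriv_metric ?Y g p v w = dg p (?Y p) v w + g p (u' v) w + g p v (u' w)"
    by (simp add: lie_deriv_metric_def dg_def)
  also have "g p v (u' w) = g p (u' w) v" by (rule g_sym[OF p])
  finally have "lie_deriv_metric ?Y g p v w = dg p (?Y p) v w + (dphi p v w - dg p v (?Y p) w) + (dphi p w v - dg p w (?Y p) v)"
    unfolding u(2) Y .
  moreover have "phi p (Gam p v w) = (dg p v w (?Y p) + dg p w v (?Y p) - dg p (?Y p) v w) / 2"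
    using g_Gam[OF p, of v w "?Y p"] g_lee_field[OF p, of "Gam p v w"] g_sym[OF p, of "?Y p" "Gam p v w"] by simp
  ultimately show ?thesis using dg_sym[OF p, of v w "?Y p"] dg_sym[OF p, of w v "?Y p"] by (simp add: field_simps)
qed

lemma phi_Gb: "p \<in> U \<Longrightarrow> phi p (Gb p v w) = phi p (Gam p v w) + H p v w (lee_field g p) / 2"
  using g_Gb[of p v w "lee_field g p"] g_lee_field[of p] g_sym[of p "lee_field g p"] by metis

lemma ext_d_lee: "p \<in> U \<Longrightarrow> ext_d (lee_form g) p [v, w] = dphi p v w - dphi p w v"
  by (simp add: ext_d_def dphi_def phi_def)

text \<open>The symmetric and the skew part of one equation for the Ricci tensor of the Bismut connection: \<open>Rc\<close>,
  \<open>H\<^sup>2\<close> and \<open>Q\<close> are symmetric, \<open>d\<^sup>*H\<close> is skew, and the derivative of the Lee form splits into the Lie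
  derivative of the metric and the exterior derivative.\<close>

lemma coupled_equations_from_RicB:
  fixes Q :: "complex ^ 'n \<Rightarrow> complex ^ 'n \<Rightarrow> complex"
  assumes p: "p \<in> U"
    and eq: "\<And>v w. complex_of_real (RicB p v w + dphi p v w - phi p (Gb p v w)) + Q v w = 0"
    and sym: "\<And>v w. Q v w = Q w v"
  shows "complex_of_real (ricci g p v w - (1 / 4) * torsion_sq g p v w
      + (1 / 2) * lie_deriv_metric (lee_field g) g p v w) + Q v w = 0"
    and "codiff g 3 (torsion g) p [v, w] - ext_d (lee_form g) p [v, w] + torsion g p [lee_field g p, v, w] = 0"
proof -
  define R where "R v w = RicB p v w + dphi p v w - phi p (Gb p v w)" for v w
  have R: "complex_of_real (R v w) = - Q v w" for v w using eq[of v w] unfolding R_def by (metis add_eq_0_iff2)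
  have "complex_of_real (R v w) = complex_of_real (R w v)" unfolding R by (simp add: sym[of v w])
  then have skew: "R v w = R w v" by simp
  have Re: "R v w = ricci g p v w - codiff g 3 (torsion g) p [v, w] / 2 - torsion_sq g p v w / 4 + dphi p v w
      - phi p (Gam p v w) - H p (lee_field g p) v w / 2" for v w
    unfolding R_def RicB_eq[OF p] phi_Gb[OF p] using H_cyclic[OF p, of "lee_field g p" v w] by simp
  have ts: "torsion_sq g p w v = torsion_sq g p v w" unfolding torsion_sq_def by (simp add: mult.commute)
  have Hs: "H p (lee_field g p) w v = - H p (lee_field g p) v w" by (rule H_alt(2)[OF p])
  have 1: "codiff g 3 (torsion g) p [v, w] - (dphi p v w - dphi p w v) + H p (lee_field g p) v w = 0"
    using skew ricci_sym[OF p, of v w] unfolding Re codiff_skew[OF p, of v w] ts Hs Gam_sym[OF p, of w v] by argo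
  then show "codiff g 3 (torsion g) p [v, w] - ext_d (lee_form g) p [v, w] + torsion g p [lee_field g p, v, w] = 0"
    by (simp add: ext_d_lee[OF p] torsion_eq[OF p])
  have "R v w = ricci g p v w - (1 / 4) * torsion_sq g p v w + (1 / 2) * lie_deriv_metric (lee_field g) g p v w"
    unfolding Re lie_deriv_lee[OF p] using 1 by argo
  then show "complex_of_real (ricci g p v w - (1 / 4) * torsion_sq g p v w
      + (1 / 2) * lie_deriv_metric (lee_field g) g p v w) + Q v w = 0"
    using R[of v w] by simp
qed

lemma ext_d_dc_omega:
  assumes p: "p \<in> U"
  shows "ext_d (dc_omega g) p [a, b, c, d] = - complex_of_real (dH4 p a b c d)"
proof -
  have "frechet_derivative (\<lambda>q. dc_omega g q [a, b, c]) (at p) x = - complex_of_real (dH p x a b c)" for a b c x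
  proof -
    have "((\<lambda>q. dc_omega g q [a, b, c]) has_derivative (\<lambda>x. - complex_of_real (dH p x a b c))) (at p)"
      by (rule transform_U[OF has_derivative_minus[OF has_derivative_of_real[OF dH_has_derivative'[OF p]]] p]) (simp add: dc_omega_eq)
    from frechet_derivative_eq[OF this] show ?thesis by metis
  qed
  then show ?thesis unfolding ext_d_def dH4_def by (simp add: numeral_eq_Suc)
qed

end

section \<open>Curvature of a connection on a Hermitian chart\<close>

lemma transpose_comp_permutation:
  "permutation q \<Longrightarrow> permutation (Transposition.transpose a b \<circ> q)"
  "permutation q \<Longrightarrow> sign (Transposition.transpose a b \<circ> q) = (if a = b then 1 else - 1) * sign q"
  by (simp_all add: permutation_compose permutation_swap_id sign_compose sign_swap_id)

text \<open>The 24 permutations fall into three classes of eight with equal contributions.\<close>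

lemma wedge_2_2:
  fixes B :: "'b::real_vector \<Rightarrow> 'b \<Rightarrow> complex"
  assumes B: "\<And>\<eta>. linear (\<lambda>\<xi>. B \<xi> \<eta>)" "\<And>\<xi> \<eta>. B \<xi> \<eta> = B \<eta> \<xi>" and F: "\<And>x y. F [y, x] = - F [x, y]"
  shows "wedge B 2 2 F F [a, b, c, d]
    = 2 * (B (F [a, b]) (F [c, d]) - B (F [a, c]) (F [b, d]) + B (F [a, d]) (F [b, c]))"
proof -
  have n: "B (- x) y = - B x y" "B x (- y) = - B x y" for x y
    using linear_neg[OF B(1)] B(2) by metis+
  have 4: "{..<2 + 2} = insert 0 (insert 1 (insert 2 (insert (3::nat) {})))" by auto
  have l: "[0..<2] = [0, 1::nat]" "[2..<2+2] = [2, 3::nat]" by (simp_all add: upt_rec)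
  have s: "(\<Sum>\<sigma> | \<sigma> permutes {..<2 + 2}. of_int (sign \<sigma>) *\<^sub>R
      B (F (map (\<lambda>i. [a, b, c, d] ! \<sigma> i) [0..<2])) (F (map (\<lambda>i. [a, b, c, d] ! \<sigma> i) [2..<2 + 2])))
    = 8 * (B (F [a, b]) (F [c, d]) - B (F [a, c]) (F [b, d]) + B (F [a, d]) (F [b, c]))"
    unfolding 4 l
    by (simp add: sum_over_permutations_insert transpose_comp_permutation permutation_swap_id sign_swap_id Transposition.transpose_def
      F[of b a] F[of c a] F[of d a] F[of c b] F[of d b] F[of d c] n
      B(2)[of "F [c, d]" "F [a, b]"] B(2)[of "F [b, d]" "F [a, c]"] B(2)[of "F [b, c]" "F [a, d]"])
  show ?thesis unfolding wedge_def s by (simp add: scaleR_conv_of_real)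
qed

locale hermitian_connection_chart =
  hermitian_chart U g + Lie: complex_Lie G
  for U :: "(complex ^ 'n::finite) set" and g :: "'n metric" and G :: "('g, 'v::real_normed_vector) lie_group" +
  fixes A :: "complex ^ 'n \<Rightarrow> complex ^ 'n \<Rightarrow> 'v"
  assumes smooth_A: "\<And>v. smooth_on U (\<lambda>p. A p v)" and linear_A: "\<And>p. p \<in> U \<Longrightarrow> linear (A p)"
    and curvature_J: "\<And>p v w. p \<in> U \<Longrightarrow> curv_form G A p [Jstd v, Jstd w] = curv_form G A p [v, w]"
begin

text \<open>\<open>DAF\<close> is the covariant derivative of \<open>F\<close> as a function with values in the adjoint bundle, for fixed
  arguments; \<open>DF\<close> adds the Bismut connection on the arguments.\<close>

definition F where "F p v w = curv_form G A p [v, w]"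
definition dA where "dA p v w = frechet_derivative (\<lambda>q. A q w) (at p) v"
definition ddA where "ddA p x v w = frechet_derivative (\<lambda>q. dA q v w) (at p) x"
definition dF where "dF p x v w = frechet_derivative (\<lambda>q. F q v w) (at p) x"
definition DAF where "DAF p x v w = dF p x v w + bracket G (A p x) (F p v w)"
definition DF where "DF p x v w = DAF p x v w - F p (Gb p x v) w - F p v (Gb p x w)"

lemmas bracket_left = bounded_linear.linear[OF Lie.bounded_linear_bracket_left]
  and bracket_right = bounded_linear.linear[OF Lie.bounded_linear_bracket_right]
lemmas bracket_linear = linear_add[OF bracket_left] linear_diff[OF bracket_left] linear_scale[OF bracket_left]
  linear_neg[OF bracket_left] linear_0[OF bracket_left]
  linear_add[OF bracket_right] linear_diff[OF bracket_right] linear_scale[OF bracket_right]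
  linear_neg[OF bracket_right] linear_0[OF bracket_right]

lemma dA_has_derivative: "p \<in> U \<Longrightarrow> ((\<lambda>q. A q w) has_derivative (\<lambda>v. dA p v w)) (at p)"
  using smooth_on_differentiable[OF smooth_A] frechet_derivative_works unfolding dA_def by blast

lemma ddA_has_derivative: "p \<in> U \<Longrightarrow> ((\<lambda>q. dA q v w) has_derivative (\<lambda>x. ddA p x v w)) (at p)"
  using smooth_on_differentiable[OF smooth_on_frechet_derivative[OF smooth_A]] frechet_derivative_works
  unfolding ddA_def dA_def by blast

lemma ddA_sym:
  assumes p: "p \<in> U" shows "ddA p x v w = ddA p v x w"
  by (rule second_derivative_symmetric[OF open_U p smooth_on_differentiable[OF smooth_A]
        ddA_has_derivative[OF p, unfolded dA_def] ddA_has_derivative[OF p, unfolded dA_def]])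

lemma F_eq: "F p v w = dA p v w - dA p w v + bracket G (A p v) (A p w)"
  unfolding F_def Lie.curv_form_eq dA_def ..

lemma F_skew: "F p w v = - F p v w"
  unfolding F_eq using Lie.bracket_antisym[of "A p w" "A p v"] by simp

lemma linear_F: "p \<in> U \<Longrightarrow> linear (\<lambda>v. F p v w)" "p \<in> U \<Longrightarrow> linear (F p v)"
proof -
  show 1: "linear (\<lambda>v. F p v w)" if p: "p \<in> U" for w p
  proof -
    note d = dA_has_derivative[OF p]
    have "dA p w (x + y) = dA p w x + dA p w y" for x y
      by (rule derivative_unique_U[OF p d has_derivative_add[OF d d]]) (simp add: linear_add[OF linear_A])
    moreover have "dA p w (r *\<^sub>R x) = r *\<^sub>R dA p w x" for r x
      by (rule derivative_unique_U[OF p d has_derivative_scaleR_right[OF d]]) (simp add: linear_scale[OF linear_A])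
    ultimately have "linear (dA p w)" by (simp add: linear_iff)
    then show ?thesis unfolding F_eq
      by (intro linear_compose_add linear_compose_sub has_derivative_linear[OF d]
          linear_compose[OF linear_A[OF p] bracket_left, unfolded o_def])
  qed
  have "F p v = (\<lambda>w. - F p w v)" for p by (rule ext) (rule F_skew)
  then show "p \<in> U \<Longrightarrow> linear (F p v)" using linear_compose_neg[OF 1] by simp
qed

lemma mlin_F: "p \<in> U \<Longrightarrow> mlin 2 (curv_form G A p)"
  by (rule mlin_2I) (use linear_F in \<open>simp_all add: F_def[abs_def]\<close>)

lemma alt_F: "alt 2 (curv_form G A p)"
  by (rule alt_2I) (rule F_skew[unfolded F_def])

lemma F_has_derivative:
  assumes p: "p \<in> U"
  shows "((\<lambda>q. F q v w) has_derivative (\<lambda>x. ddA p x v w - ddA p x w v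
    + (bracket G (dA p x v) (A p w) + bracket G (A p v) (dA p x w)))) (at p)"
  unfolding F_eq
  by (intro has_derivative_add has_derivative_diff ddA_has_derivative[OF p] Lie.bracket_has_derivative dA_has_derivative[OF p])

lemma dF_has_derivative:
  assumes p: "p \<in> U" shows "((\<lambda>q. F q v w) has_derivative (\<lambda>x. dF p x v w)) (at p)"
  unfolding dF_def by (rule frechet_derivative_works[THEN iffD1, OF differentiableI[OF F_has_derivative[OF p]]])

lemma dF_eq:
  assumes p: "p \<in> U"
  shows "dF p x v w = ddA p x v w - ddA p x w v + (bracket G (dA p x v) (A p w) + bracket G (A p v) (dA p x w))"
  by (rule fun_cong[OF has_derivative_unique[OF dF_has_derivative[OF p] F_has_derivative[OF p]]])

text \<open>The second derivatives of \<open>A\<close> cancel by symmetry, the terms with one derivative in pairs, and the cubic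
  terms by the Jacobi identity.\<close>

lemma DAF_Bianchi:
  assumes p: "p \<in> U" shows "DAF p x v w + DAF p v w x + DAF p w x v = 0"
proof -
  have a: "bracket G (dA p x v) (A p w) = - bracket G (A p w) (dA p x v)" for x v w by (rule Lie.bracket_antisym)
  have J: "bracket G (A p x) (bracket G (A p v) (A p w)) + bracket G (A p v) (bracket G (A p w) (A p x))
      + bracket G (A p w) (bracket G (A p x) (A p v)) = 0"
    using Lie.Jacobi[of "A p x" "A p v" "A p w"] Lie.bracket_antisym[of "bracket G (A p x) (A p v)" "A p w"]
      Lie.bracket_antisym[of "A p w" "A p x"] by (simp add: bracket_linear)
  have "DAF p x v w + DAF p v w x + DAF p w x v
     = bracket G (A p x) (bracket G (A p v) (A p w)) + bracket G (A p v) (bracket G (A p w) (A p x))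
      + bracket G (A p w) (bracket G (A p x) (A p v))"
    unfolding DAF_def dF_eq[OF p] F_eq a
    by (simp add: bracket_linear ddA_sym[OF p, of v x w] ddA_sym[OF p, of w x v] ddA_sym[OF p, of w v x])
  then show ?thesis using J by simp
qed

end

context hermitian_connection_chart
begin

lemma F_JJ: "p \<in> U \<Longrightarrow> F p (Jstd v) (Jstd w) = F p v w"
  unfolding F_def by (rule curvature_J)

lemma F_J: 
  assumes p: "p \<in> U" shows "F p (Jstd v) w = - F p v (Jstd w)"
  using F_JJ[OF p, of v "Jstd w"] by (simp add: linear_neg[OF linear_F(2)[OF p]]) (metis minus_minus)

lemma F_trace_symmetric:
  assumes p: "p \<in> U" shows "F p v (Jstd w) = F p w (Jstd v)"
  using F_J[OF p, of v w] F_skew[of p w "Jstd v"] by simp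

text \<open>In the cyclic sum the Christoffel symbols combine to the torsion of the Bismut connection.\<close>

lemma DF_Bianchi:
  assumes p: "p \<in> U"
  shows "DF p x v w + DF p v w x + DF p w x v = - (F p (S p x v) w + F p (S p v w) x + F p (S p w x) v)"
proof -
  have s: "F p (Gb p x v) w - F p (Gb p v x) w = F p (S p x v) w" for x v w
  proof -
    have "Gb p x v - Gb p v x = S p x v"
      using Gam_sym[OF p, of x v] S_skew(1)[OF p, of v x] by (simp add: Gb_eq[OF p] scaleR_2[symmetric] flip: scaleR_left.add)
    then show ?thesis using linear_diff[OF linear_F(1)[OF p], of "Gb p x v" "Gb p v x" w] by simp
  qed
  have "F p v (Gb p x w) = - F p (Gb p x w) v" for x v w by (rule F_skew)
  then show ?thesis unfolding DF_def using DAF_Bianchi[OF p, of x v w] s[of x v w] s[of v w x] s[of w x v]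
    by (simp add: algebra_simps)
qed

lemma dF_skew: "p \<in> U \<Longrightarrow> dF p x w v = - dF p x v w"
  by (rule derivative_unique_U[OF _ dF_has_derivative has_derivative_minus[OF dF_has_derivative]]) (auto intro: F_skew)

lemma DF_skew: 
  assumes p: "p \<in> U" shows "DF p x w v = - DF p x v w"
  unfolding DF_def DAF_def dF_skew[OF p, of x w v] F_skew[of p w v] F_skew[of p "Gb p x v" w] F_skew[of p "Gb p x w" v]
  by (simp add: bracket_linear)

lemma linear_dF:
  assumes p: "p \<in> U"
  shows "linear (\<lambda>x. dF p x v w)" "linear (\<lambda>v. dF p x v w)"
proof -
  note d = dF_has_derivative[OF p]
  show "linear (\<lambda>x. dF p x v w)" by (rule has_derivative_linear[OF d])
  show "linear (\<lambda>v. dF p x v w)" unfolding linear_iff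
  proof (intro conjI allI)
    show "dF p x (a + b) w = dF p x a w + dF p x b w" for a b
      by (rule derivative_unique_U[OF p d has_derivative_add[OF d d]]) (simp add: linear_add[OF linear_F(1)])
    show "dF p x (c *\<^sub>R a) w = c *\<^sub>R dF p x a w" for c a
      by (rule derivative_unique_U[OF p d has_derivative_scaleR_right[OF d]]) (simp add: linear_scale[OF linear_F(1)])
  qed
qed

lemma linear_DF:
  assumes p: "p \<in> U"
  shows "linear (\<lambda>x. DF p x v w)" "linear (\<lambda>v. DF p x v w)"
proof -
  note c = linear_compose[unfolded o_def]
  show "linear (\<lambda>x. DF p x v w)" unfolding DF_def DAF_def
    by (intro linear_compose_add linear_compose_sub linear_dF[OF p] c[OF linear_A[OF p] bracket_left]
        c[OF Gb_lin(1)[OF p] linear_F(1)[OF p]] c[OF Gb_lin(1)[OF p] linear_F(2)[OF p]])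
  show "linear (\<lambda>v. DF p x v w)" unfolding DF_def DAF_def
    by (intro linear_compose_add linear_compose_sub linear_dF[OF p] c[OF linear_F(1)[OF p] bracket_right]
        c[OF Gb_lin(2)[OF p] linear_F(1)[OF p]] linear_F(1)[OF p])
qed

lemma DF_JJ: 
  assumes p: "p \<in> U" shows "DF p x (Jstd v) (Jstd w) = DF p x v w"
proof -
  have "dF p x (Jstd v) (Jstd w) = dF p x v w"
    by (rule derivative_unique_U[OF p dF_has_derivative[OF p] dF_has_derivative[OF p]]) (rule F_JJ)
  then show ?thesis by (simp add: DF_def DAF_def F_JJ[OF p] Gb_J[OF p])
qed

text \<open>The Hermitian-Einstein condition is parallel, as the Bismut connection preserves \<open>J\<close> and the metric.\<close>

lemma sum_DF_J_zero:
  assumes p: "p \<in> U" and HE: "\<And>q. q \<in> U \<Longrightarrow> (\<Sum>e\<in>onb (g q). F q e (Jstd e)) = \<zeta>"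
    and central: "\<And>v. bracket G (A p v) \<zeta> = 0"
  shows "(\<Sum>e\<in>onb (g p). DF p x e (Jstd e)) = 0"
proof -
  have l: "linear (\<lambda>y. F q x (Jstd y))" if "q \<in> U" for q x
    by (rule linear_compose[OF linear_Jstd linear_F(2)[OF that], unfolded o_def])
  have "((\<lambda>q. \<Sum>e\<in>onb (g q). F q e (Jstd e)) has_derivative
    (\<lambda>x. \<Sum>e\<in>onb (g p). dF p x e (Jstd e) - F p (Gb p x e) (Jstd e) - F p e (Jstd (Gb p x e)))) (at p)"
    by (rule trace_has_derivative[OF p onb_basis[OF p] Gb_metric[OF p] linear_F(1) l dF_has_derivative[OF p]])
  then have 1: "(\<Sum>e\<in>onb (g p). dF p x e (Jstd e) - F p (Gb p x e) (Jstd e) - F p e (Jstd (Gb p x e))) = 0"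
    by (rule derivative_unique_U[OF p _ has_derivative_const[of \<zeta>]]) (rule HE)
  have "(\<Sum>e\<in>onb (g p). bracket G (A p x) (F p e (Jstd e))) = bracket G (A p x) \<zeta>"
    unfolding HE[OF p, symmetric] by (rule linear_sum[OF bracket_right, symmetric])
  then have 2: "(\<Sum>e\<in>onb (g p). bracket G (A p x) (F p e (Jstd e))) = 0" using central by simp
  have "(\<Sum>e\<in>onb (g p). DF p x e (Jstd e))
     = (\<Sum>e\<in>onb (g p). (dF p x e (Jstd e) - F p (Gb p x e) (Jstd e) - F p e (Jstd (Gb p x e))) + bracket G (A p x) (F p e (Jstd e)))"
    by (rule sum.cong[OF refl]) (simp add: DF_def DAF_def Gb_J[OF p])
  then show ?thesis unfolding sum.distrib 1 2 by simp
qed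

lemma sum_S_J:
  assumes p: "p \<in> U"
  shows "(\<Sum>e\<in>onb (g p). S p e (Jstd e)) = - 2 *\<^sub>R Jstd (lee_field g p)"
proof (rule inner_form_eqI[OF inner_g[OF p]])
  fix w
  have "g p (\<Sum>e\<in>onb (g p). S p e (Jstd e)) w = (\<Sum>e\<in>onb (g p). H p e (Jstd e) w)"
    using inner_form_sum[OF inner_g[OF p], where c = "\<lambda>_. 1" and x = "\<lambda>e. S p e (Jstd e)" and A = "onb (g p)" and z = w] by (simp add: g_S[OF p])
  also have "\<dots> = (\<Sum>e\<in>onb (g p). H p (Jstd (Jstd w)) (Jstd e) e)"
  proof (rule sum.cong[OF refl])
    fix e show "H p e (Jstd e) w = H p (Jstd (Jstd w)) (Jstd e) e"
      using H_cyclic[OF p, of w e "Jstd e"] H_alt(2)[OF p, of w "Jstd e" e] by (simp add: H_arg[OF p])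
  qed
  also have "\<dots> = 2 * phi p (Jstd w)" by (simp add: phi_eq[OF p])
  also have "\<dots> = g p (- 2 *\<^sub>R Jstd (lee_field g p)) w"
    using g_J_left[OF p, of "lee_field g p" w] g_lee_field[OF p, of "Jstd w"] by (simp add: g_bil[OF p])
  finally show "g p (\<Sum>e\<in>onb (g p). S p e (Jstd e)) w = g p (- 2 *\<^sub>R Jstd (lee_field g p)) w" .
qed

text \<open>\<open>S x\<close> is skew, whereas \<open>F (v, J w)\<close> is symmetric in \<open>v\<close> and \<open>w\<close>.\<close>

lemma sum_F_S:
  assumes p: "p \<in> U"
  shows "(\<Sum>e\<in>onb (g p). F p (S p x e) (Jstd e)) = 0"
proof (rule eq_neg_self_imp_zero)
  let ?E = "onb (g p)"
  have ex: "F p (S p x e) (Jstd e) = (\<Sum>f\<in>?E. H p x e f *\<^sub>R F p f (Jstd e))" for e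
    using linear_orthonormal_expansion[OF inner_g[OF p] onb_basis[OF p] linear_F(1)[OF p, of "Jstd e"], of "S p x e"]
    unfolding g_S[OF p] .
  have "(\<Sum>e\<in>?E. F p (S p x e) (Jstd e)) = (\<Sum>e\<in>?E. \<Sum>f\<in>?E. H p x e f *\<^sub>R F p f (Jstd e))" unfolding ex ..
  also have "\<dots> = (\<Sum>f\<in>?E. \<Sum>e\<in>?E. H p x e f *\<^sub>R F p f (Jstd e))" by (rule sum.swap)
  also have "\<dots> = (\<Sum>f\<in>?E. \<Sum>e\<in>?E. - (H p x f e *\<^sub>R F p e (Jstd f)))"
  proof (intro sum.cong refl)
    fix f e show "H p x e f *\<^sub>R F p f (Jstd e) = - (H p x f e *\<^sub>R F p e (Jstd f))"
      using H_alt(2)[OF p, of x e f] F_trace_symmetric[OF p, of f e] by simp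
  qed
  also have "\<dots> = - (\<Sum>e\<in>?E. F p (S p x e) (Jstd e))" unfolding ex sum_negf ..
  finally show "(\<Sum>e\<in>?E. F p (S p x e) (Jstd e)) = - (\<Sum>e\<in>?E. F p (S p x e) (Jstd e))" .
qed

text \<open>The divergence of the curvature with respect to the Bismut connection, from the Bianchi identity for
  \<open>e\<close>, \<open>J e\<close>, \<open>J v\<close>.  As \<open>F\<close> is of type \<open>(1, 1)\<close>, two of the three derivative terms equal the divergence; the
  third one vanishes by the Hermitian-Einstein condition, and the torsion contributes its trace, the
  Lee field.\<close>

lemma sum_DF:
  assumes p: "p \<in> U" and zero: "\<And>x. (\<Sum>e\<in>onb (g p). DF p x e (Jstd e)) = 0"
  shows "(\<Sum>e\<in>onb (g p). DF p e e v) = F p (lee_field g p) v"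
proof -
  let ?E = "onb (g p)" and ?w = "Jstd v"
  note h = herm[OF p] and E = onb_basis[OF p]
  have 1: "(\<Sum>e\<in>?E. DF p e (Jstd e) ?w) = (\<Sum>e\<in>?E. DF p e e v)" by (simp only: DF_JJ[OF p])
  have "(\<Sum>e\<in>?E. DF p (Jstd e) ?w e) = (\<Sum>e\<in>?E. DF p (Jstd e) (Jstd e) v)"
  proof (rule sum.cong[OF refl])
    fix e
    have "DF p (Jstd e) ?w e = - DF p (Jstd e) e ?w" by (rule DF_skew[OF p])
    also have "DF p (Jstd e) e ?w = DF p (Jstd e) (Jstd e) (Jstd ?w)" by (simp only: DF_JJ[OF p])
    also have "\<dots> = - DF p (Jstd e) (Jstd e) v"
      using DF_skew[OF p, of "Jstd e" "- v" "Jstd e"] DF_skew[OF p, of "Jstd e" v "Jstd e"]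
        linear_neg[OF linear_DF(2)[OF p, where x = "Jstd e" and w = "Jstd e"], of v] by simp
    finally show "DF p (Jstd e) ?w e = DF p (Jstd e) (Jstd e) v" by simp
  qed
  also have "\<dots> = (\<Sum>e\<in>?E. DF p e e v)" by (rule trace_J_J[OF h E linear_DF[OF p]])
  finally have 2: "(\<Sum>e\<in>?E. DF p (Jstd e) ?w e) = (\<Sum>e\<in>?E. DF p e e v)" .
  have 3: "(\<Sum>e\<in>?E. F p (S p e (Jstd e)) ?w) = - 2 *\<^sub>R F p (lee_field g p) v"
    unfolding linear_sum[OF linear_F(1)[OF p], symmetric] sum_S_J[OF p]
    by (simp add: linear_scale[OF linear_F(1)[OF p]] linear_neg[OF linear_F(1)[OF p]] F_JJ[OF p])
  have l: "linear (\<lambda>x. F p (S p ?w x) y)" for y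
    by (rule linear_compose[OF S_lin(2)[OF p] linear_F(1)[OF p], unfolded o_def])
  have "(\<Sum>e\<in>?E. F p (S p ?w (Jstd e)) e) = 0"
    using trace_J_move[OF h E l linear_F(2)[OF p]] sum_F_S[OF p, of ?w] by simp
  moreover have "(\<Sum>e\<in>?E. F p (S p (Jstd e) ?w) e) = - (\<Sum>e\<in>?E. F p (S p ?w (Jstd e)) e)"
    unfolding sum_negf[symmetric]
  proof (rule sum.cong[OF refl])
    fix e
    have "F p (S p (Jstd e) ?w) e = F p (- S p ?w (Jstd e)) e" by (rule arg_cong[OF S_skew(1)[OF p]])
    also have "\<dots> = - F p (S p ?w (Jstd e)) e" by (rule linear_neg[OF linear_F(1)[OF p]])
    finally show "F p (S p (Jstd e) ?w) e = - F p (S p ?w (Jstd e)) e" .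
  qed
  ultimately have 4: "(\<Sum>e\<in>?E. F p (S p (Jstd e) ?w) e) = 0" by simp
  have "(\<Sum>e\<in>?E. DF p e (Jstd e) ?w) + (\<Sum>e\<in>?E. DF p (Jstd e) ?w e) + (\<Sum>e\<in>?E. DF p ?w e (Jstd e))
     = - ((\<Sum>e\<in>?E. F p (S p e (Jstd e)) ?w) + (\<Sum>e\<in>?E. F p (S p (Jstd e) ?w) e) + (\<Sum>e\<in>?E. F p (S p ?w e) (Jstd e)))"
    unfolding sum.distrib[symmetric] sum_negf[symmetric] by (rule sum.cong[OF refl]) (rule DF_Bianchi[OF p])
  then have "2 *\<^sub>R (\<Sum>e\<in>?E. DF p e e v) = 2 *\<^sub>R F p (lee_field g p) v"
    unfolding 1 2 3 4 sum_F_S[OF p] zero by (simp add: scaleR_2)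
  then show ?thesis by simp
qed

text \<open>The covariant codifferential is minus the divergence for the Levi-Civita connection; passing to the Bismut
  connection produces the contraction of \<open>H\<close> with \<open>F\<close>.\<close>

lemma cov_codiff_F:
  assumes p: "p \<in> U"
  shows "cov_codiff G g A 2 (curv_form G A) p [v]
    = - (\<Sum>e\<in>onb (g p). DF p e e v) + (1 / 2) *\<^sub>R (\<Sum>e\<in>onb (g p). \<Sum>f\<in>onb (g p). H p e f v *\<^sub>R F p e f)"
proof -
  let ?E = "onb (g p)"
  obtain l where l: "2 * CARD('n) = Suc 1 + l" using zero_less_card_finite[where 'a = 'n]
    by (metis One_nat_def Suc_1 Suc_leI le_Suc_ex mult_le_mono2 nat_mult_1_right plus_1_eq_Suc)
  have len: "DIM(complex ^ 'n) = Suc 1 + l" using l by simp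
  have d: "((\<lambda>q. curv_form G A q vs) has_derivative (\<lambda>x. dF p x (vs ! 0) (vs ! 1))) (at p)" if len2: "length vs = Suc 1" for vs
  proof -
    obtain a b where "vs = [a, b]" using len2 by (auto simp: length_Suc_conv)
    then show ?thesis using dF_has_derivative[OF p, of a b] by (simp add: F_def)
  qed
  have 1: "hodge (g p) (Suc l) (ext_d (\<lambda>q. hodge (g q) (Suc 1) (curv_form G A q)) p) [v]
    = (\<Sum>x\<in>?E. dF p x x v - act (Gam p x) (curv_form G A p) (x # [v]))"
    using star_d_star[OF p, of 1 "curv_form G A", OF _ _ d len] mlin_F alt_F by (simp add: numeral_2_eq_2)
  have 2: "hodge (g p) (Suc l) (wedge (bracket G) 1 l (\<lambda>us. A p (us ! 0)) (hodge (g p) (Suc 1) (curv_form G A p))) [v]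
    = (\<Sum>x\<in>?E. bracket G (A p x) (curv_form G A p (x # [v])))"
    by (rule star_wedge_1_star[OF p _ _ bracket_right len]) (use mlin_F[OF p] alt_F in \<open>simp_all add: numeral_2_eq_2\<close>)
  have "2 * CARD('n) + 1 - 2 = Suc l" "2 * CARD('n) - 2 = l" using l by auto
  then have "cov_codiff G g A 2 (curv_form G A) p [v]
     = - (\<Sum>x\<in>?E. (dF p x x v - act (Gam p x) (curv_form G A p) (x # [v])) + bracket G (A p x) (curv_form G A p (x # [v])))"
    unfolding cov_codiff_def cov_ext_d_def sum.distrib 1[symmetric] 2[symmetric] hodge_add[symmetric]
    by (simp add: numeral_2_eq_2)
  also have "\<dots> = - (\<Sum>x\<in>?E. DF p x x v + (1 / 2) *\<^sub>R F p x (S p x v))"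
  proof (intro arg_cong[where f = uminus] sum.cong refl)
    fix x
    have "S p x x = 0" using S_skew(1)[OF p, of x x] by (rule eq_neg_self_imp_zero)
    then have "Gb p x x = Gam p x x" by (simp add: Gb_eq[OF p])
    then show "(dF p x x v - act (Gam p x) (curv_form G A p) (x # [v])) + bracket G (A p x) (curv_form G A p (x # [v]))
      = DF p x x v + (1 / 2) *\<^sub>R F p x (S p x v)"
      by (simp add: act_def DF_def DAF_def Gb_eq[OF p, of x v] linear_add[OF linear_F(2)[OF p]] linear_scale[OF linear_F(2)[OF p]])
         (simp add: F_def)
  qed
  also have "\<dots> = - (\<Sum>e\<in>?E. DF p e e v) - (1 / 2) *\<^sub>R (\<Sum>e\<in>?E. F p e (S p e v))"
    by (simp add: sum.distrib scaleR_sum_right)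
  also have "(\<Sum>e\<in>?E. F p e (S p e v)) = - (\<Sum>e\<in>?E. \<Sum>f\<in>?E. H p e f v *\<^sub>R F p e f)"
    unfolding sum_negf[symmetric]
  proof (rule sum.cong[OF refl])
    fix e
    have "F p e (S p e v) = (\<Sum>f\<in>?E. H p e v f *\<^sub>R F p e f)"
      using linear_orthonormal_expansion[OF inner_g[OF p] onb_basis[OF p] linear_F(2)[OF p, of e], of "S p e v"]
      unfolding g_S[OF p] .
    also have "\<dots> = (\<Sum>f\<in>?E. - (H p e f v *\<^sub>R F p e f))"
    proof (rule sum.cong[OF refl])
      fix f show "H p e v f *\<^sub>R F p e f = - (H p e f v *\<^sub>R F p e f)" using H_alt(2)[OF p, of e v f] by simp
    qed
    finally show "F p e (S p e v) = (\<Sum>f\<in>?E. - (H p e f v *\<^sub>R F p e f))" .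
  qed
  finally show ?thesis by simp
qed

end

section \<open>The coupled equations\<close>

context hermitian_connection_chart
begin

text \<open>In the trace of \<open>\<langle>F \<and> F\<rangle> (v, J w, J e, e)\<close>, one of the three terms contains the trace of \<open>F\<close>, i.e. \<open>z\<close>, and the
  other two coincide.  Thus \<open>dH = \<langle>F \<and> F\<rangle>\<close> contributes \<open>- \<langle>z, F\<rangle>\<close>, which is the Bismut Ricci form, and the
  contraction of \<open>F\<close> with itself.\<close>

lemma RicB_equation:
  fixes B :: "'v \<Rightarrow> 'v \<Rightarrow> complex"
  assumes p: "p \<in> U"
    and B: "\<And>\<eta>. linear (\<lambda>\<xi>. B \<xi> \<eta>)" "\<And>\<xi> \<eta>. B \<xi> \<eta> = B \<eta> \<xi>"
    and HE: "(\<Sum>e\<in>onb (g p). F p e (Jstd e)) = 2 *\<^sub>R z"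
    and rho: "\<And>v w. complex_of_real (bismut_ricci g p v w) + B z (F p v w) = 0"
    and ddc: "\<And>a b c d. ext_d (dc_omega g) p [a, b, c, d]
      + wedge B 2 2 (curv_form G A p) (curv_form G A p) [a, b, c, d] = 0"
  shows "complex_of_real (RicB p v w + dphi p v w - phi p (Gb p v w))
    + (\<Sum>e\<in>onb (g p). B (F p e v) (F p e w)) = 0"
proof -
  let ?E = "onb (g p)"
  note h = herm[OF p] and E = onb_basis[OF p]
  define Q where "Q = (\<Sum>e\<in>?E. B (F p e v) (F p e w))"
  have B': "linear (B \<xi>)" for \<xi>
  proof -
    have "B \<xi> = (\<lambda>\<eta>. B \<eta> \<xi>)" by (rule ext) (rule B(2))
    then show ?thesis by (simp only: B(1))
  qed
  have sk: "B (F p v e) (F p w f) = B (F p e v) (F p f w)" for e f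
    unfolding F_skew[of p v e] F_skew[of p w f] by (simp add: linear_neg[OF B(1)] linear_neg[OF B'])
  have Q1: "(\<Sum>e\<in>?E. B (F p v e) (F p w e)) = Q" unfolding Q_def sk ..
  have "(\<Sum>e\<in>?E. B (F p v (Jstd e)) (F p w (Jstd e))) = (\<Sum>e\<in>?E. B (F p v e) (F p w e))"
    by (rule trace_J_J[OF h E linear_compose[OF linear_F(2)[OF p] B(1), unfolded o_def]
          linear_compose[OF linear_F(2)[OF p] B', unfolded o_def]])
  then have Q2: "(\<Sum>e\<in>?E. B (F p v (Jstd e)) (F p w (Jstd e))) = Q" unfolding Q1 .
  have "(\<Sum>e\<in>?E. F p (Jstd e) e) = - (2 *\<^sub>R z)"
    unfolding HE[symmetric] by (rule trace_J_move[OF h E linear_F[OF p]])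
  then have "(\<Sum>e\<in>?E. B (F p v (Jstd w)) (F p (Jstd e) e)) = B (F p v (Jstd w)) (- (2 *\<^sub>R z))"
    unfolding linear_sum[OF B', symmetric] by simp
  then have Q3: "(\<Sum>e\<in>?E. B (F p v (Jstd w)) (F p (Jstd e) e)) = - 2 * B z (F p v (Jstd w))"
    using B(2)[of z "F p v (Jstd w)"] by (simp add: linear_neg[OF B'] linear_scale[OF B'] scaleR_conv_of_real)
  have d: "complex_of_real (dH4 p v (Jstd w) (Jstd e) e)
     = 2 * (B (F p v (Jstd w)) (F p (Jstd e) e) + B (F p v (Jstd e)) (F p w (Jstd e)) + B (F p v e) (F p w e))" for e
  proof -
    have "wedge B 2 2 (curv_form G A p) (curv_form G A p) [v, Jstd w, Jstd e, e]
      = 2 * (B (F p v (Jstd w)) (F p (Jstd e) e) - B (F p v (Jstd e)) (F p (Jstd w) e) + B (F p v e) (F p (Jstd w) (Jstd e)))"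
      unfolding F_def by (rule wedge_2_2[where F = "curv_form G A p", OF B F_skew[of p, unfolded F_def]])
    also have "F p (Jstd w) (Jstd e) = F p w e" by (rule F_JJ[OF p])
    also have "F p (Jstd w) e = - F p w (Jstd e)" by (rule F_J[OF p])
    finally show ?thesis using ddc[of v "Jstd w" "Jstd e" e] unfolding ext_d_dc_omega[OF p]
      by (simp add: linear_neg[OF B'])
  qed
  have "complex_of_real (\<Sum>e\<in>?E. dH4 p v (Jstd w) (Jstd e) e)
     = 2 * ((\<Sum>e\<in>?E. B (F p v (Jstd w)) (F p (Jstd e) e)) + (\<Sum>e\<in>?E. B (F p v (Jstd e)) (F p w (Jstd e)))
        + (\<Sum>e\<in>?E. B (F p v e) (F p w e)))"
    by (simp add: d sum.distrib sum_distrib_left)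
  then have 1: "complex_of_real (\<Sum>e\<in>?E. dH4 p v (Jstd w) (Jstd e) e) = - 4 * B z (F p v (Jstd w)) + 4 * Q"
    unfolding Q1 Q2 Q3 by simp
  have 2: "complex_of_real (bismut_ricci g p v (Jstd w)) = - B z (F p v (Jstd w))"
    using rho[of v "Jstd w"] by (rule eq_neg_iff_add_eq_0[THEN iffD2])
  have "RicB p v w + dphi p v w - phi p (Gb p v w)
      = bismut_ricci g p v (Jstd w) - (1 / 4) * (\<Sum>e\<in>?E. dH4 p v (Jstd w) (Jstd e) e)"
    using bismut_ricci_RicB[OF p, of v w] by simp
  then have "complex_of_real (RicB p v w + dphi p v w - phi p (Gb p v w))
    = complex_of_real (bismut_ricci g p v (Jstd w)) - (1 / 4) * complex_of_real (\<Sum>e\<in>?E. dH4 p v (Jstd w) (Jstd e) e)"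
    by (simp only: of_real_diff of_real_mult of_real_divide of_real_1 of_real_numeral)
  then show ?thesis unfolding 1 2 Q_def[symmetric] by (simp add: diff_divide_distrib)
qed

text \<open>The three terms are two expressions for the divergence of \<open>F\<close> and the contraction of \<open>H\<close> with \<open>F\<close> by
  which these differ.\<close>

lemma curvature_equation:
  assumes p: "p \<in> U" and HE: "\<And>q. q \<in> U \<Longrightarrow> (\<Sum>e\<in>onb (g q). F q e (Jstd e)) = \<zeta>"
    and central: "\<And>v. bracket G (A p v) \<zeta> = 0"
  shows "cov_codiff G g A 2 (curv_form G A) p [v] + curv_form G A p [lee_field g p, v]
    + hodge (g p) (2 * CARD('n) - 1)
        (wedge (\<lambda>\<xi> r. r *\<^sub>R \<xi>) 2 (2 * CARD('n) - 3) (curv_form G A p) (hodge (g p) 3 (torsion g p))) [v] = 0"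
proof -
  have "(\<Sum>e\<in>onb (g p). DF p x e (Jstd e)) = 0" for x by (rule sum_DF_J_zero[OF p HE central])
  note div = sum_DF[OF p this]
  show ?thesis unfolding cov_codiff_F[OF p] star_F_wedge_star_torsion[OF p] div by (simp add: F_def)
qed

end

theorem proposition5p6:
  fixes X :: "('x, complex ^ 'n::finite) cmfd"
    and G :: "('g, 'v::real_normed_vector) lie_group"
    and B :: "'v \<Rightarrow> 'v \<Rightarrow> complex"
    and P :: "('x, 'p, 'g) pbundle"
    and K :: "'g set" and h :: "'p set"
    and \<theta> :: "('x, complex ^ 'n, 'p, 'v) conn"
    and g :: "('x, complex ^ 'n) chart \<Rightarrow> 'n metric"
    and z :: 'v
  assumes "complex_manifold X" and "cstr X = Jstd"
    and "complex_reductive G" and "admissible_pairing G B"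
    and "holo_principal_bundle X G P"
    and "maximal_compact G K" and "reduction X G P K h"
    and "chern_connection X G P K h \<theta>"
    and "hermitian_metric X g"
    and "z \<in> lie_algebra G K" and "\<forall>\<xi>\<in>lie_algebra G K. bracket G z \<xi> = 0"
    and "coupled_hermitian_einstein X G B P h \<theta> g z"
  shows "\<forall>c s. c \<in> atlas X \<and> reduced_section X G P h s \<longrightarrow>
    (\<forall>p \<in> snd c ` (fst c \<inter> fst s).
      let H = torsion (g c); F = curv_form G (\<theta> s c); n = CARD('n);
          \<phi> = lee_form (g c); Y = lee_field (g c)
      in
        (\<forall>v w. complex_of_real (ricci (g c) p v w - (1 / 4) * torsion_sq (g c) p v w
                + (1 / 2) * lie_deriv_metric Y (g c) p v w)
              + (\<Sum>e\<in>onb (g c p). B (F p [e, v]) (F p [e, w])) = 0) \<and>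
        (\<forall>v w. codiff (g c) 3 H p [v, w] - ext_d \<phi> p [v, w] + H p [Y p, v, w] = 0) \<and>
        (\<forall>v. cov_codiff G (g c) (\<theta> s c) 2 F p [v] + F p [Y p, v]
              + hodge (g c p) (2 * n - 1)
                  (wedge (\<lambda>\<xi> r. r *\<^sub>R \<xi>) 2 (2 * n - 3) (F p) (hodge (g c p) 3 (H p))) [v] = 0))"
proof (intro allI impI ballI)
  fix c s p
  assume cs: "c \<in> atlas X \<and> reduced_section X G P h s" and p: "p \<in> snd c ` (fst c \<inter> fst s)"
  then have c: "c \<in> atlas X" and s: "reduced_section X G P h s" by auto
  define U where "U = snd c ` (fst c \<inter> fst s)"
  have pU: "p \<in> U" using p U_def by simp
  have G: "complex_lie_group G" and GK: "complexification_of G K"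
    using assms(3,6) unfolding complex_reductive_def by auto
  have K: "subgroup K G" using assms(6) unfolding maximal_compact_def compact_subgroup_def by blast
  interpret Lie: complex_Lie G by unfold_locales (rule G)
  have ss: "smooth_section X G P s" using s unfolding reduced_section_def by blast
  then have "openin (mtop X) (fst c \<inter> fst s)"
    using open_chart_domain[OF assms(1) c] unfolding smooth_section_def local_section_def by blast
  from open_image_chart[OF assms(1) c this] have U: "open U" unfolding U_def by blast
  have conn: "connection X G P \<theta>" using assms(8) unfolding chern_connection_def by blast
  have Ak: "\<theta> s c q v \<in> lie_algebra G K" if "q \<in> U" for q v
    using assms(8) s c that unfolding chern_connection_def U_def by blast
  interpret hermitian_connection_chart U "g c" G "\<theta> s c"
  proof (intro hermitian_connection_chart.intro hermitian_chart.intro hermitian_connection_chart_axioms.intro)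
    show "complex_Lie G" by unfold_locales
    show "open U" by (rule U)
    have sub: "U \<subseteq> snd c ` fst c" unfolding U_def by auto
    note hm = assms(9)[unfolded hermitian_metric_def, THEN conjunct1, rule_format, OF c]
    show "hermitian (g c q)" if "q \<in> U" for q
      using hm that sub unfolding hermitian_def inner_form_def by blast
    show "smooth_on U (\<lambda>q. g c q a b)" for a b using hm smooth_on_subset[OF _ sub] by blast
    show "smooth_on U (\<lambda>p. \<theta> s c p v)" for v unfolding U_def by (rule connection_smooth[OF conn ss c])
    show "linear (\<theta> s c q)" if "q \<in> U" for q using connection_linear[OF conn ss c] that unfolding U_def by blast
    show "curv_form G (\<theta> s c) q [Jstd v, Jstd w] = curv_form G (\<theta> s c) q [v, w]" if "q \<in> U" for q v w
      using Lie.chern_curvature_type_11[OF assms(1,5) K GK assms(8) c s] that unfolding U_def assms(2) by blast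
  qed
  have eqs: "(\<forall>vs. length vs = 2 * CARD('n) \<longrightarrow>
      wedge (\<lambda>\<xi> r. r *\<^sub>R \<xi>) 2 (2 * (CARD('n) - 1)) (curv_form G (\<theta> s c) q) (wedge_power (omega (g c) q) (CARD('n) - 1)) vs
      = (wedge_power (omega (g c) q) CARD('n) vs / real CARD('n)) *\<^sub>R z) \<and>
    (\<forall>v w. complex_of_real (bismut_ricci (g c) q v w) + B z (curv_form G (\<theta> s c) q [v, w]) = 0) \<and>
    (\<forall>vs. length vs = 4 \<longrightarrow> ext_d (dc_omega (g c)) q vs + wedge B 2 2 (curv_form G (\<theta> s c) q) (curv_form G (\<theta> s c) q) vs = 0)"
    if "q \<in> U" for q
    using assms(12) cs that unfolding coupled_hermitian_einstein_def Let_def U_def by blast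
  note pairing = assms(4)[unfolded admissible_pairing_def]
  have B: "linear (\<lambda>\<xi>. B \<xi> \<eta>)" for \<eta> by (rule pairing[THEN conjunct1, THEN spec])
  have Bsym: "B \<xi> \<eta> = B \<eta> \<xi>" for \<xi> \<eta>
    by (rule pairing[THEN conjunct2, THEN conjunct2, THEN conjunct1, THEN spec, THEN spec])
  have HE: "(\<Sum>e\<in>onb (g c q). F q e (Jstd e)) = 2 *\<^sub>R z" if q: "q \<in> U" for q
    unfolding F_def
  proof (rule hermitian_einstein_trace[OF herm[OF q] onb_basis[OF q] F_skew[unfolded F_def] linear_F(1)[OF q, unfolded F_def]])
    fix vs :: "(complex ^ 'n) list" assume vs: "length vs = 2 * CARD('n)"
    show "wedge (\<lambda>\<xi> r. r *\<^sub>R \<xi>) 2 (2 * (CARD('n) - 1)) (curv_form G (\<theta> s c) q) (wedge_power (herm_form (g c q)) (CARD('n) - 1)) vs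
      = (wedge_power (herm_form (g c q)) CARD('n) vs / real CARD('n)) *\<^sub>R z"
      using eqs[OF q] vs unfolding omega_def by blast
  qed
  have central: "bracket G (\<theta> s c p v) (2 *\<^sub>R z) = 0" for v
    using assms(11) Ak[OF pU, of v] Lie.bracket_antisym[of "\<theta> s c p v" z] by (simp add: bracket_linear)
  have ric: "complex_of_real (RicB p v w + dphi p v w - phi p (Gb p v w))
      + (\<Sum>e\<in>onb (g c p). B (F p e v) (F p e w)) = 0" for v w
    by (rule RicB_equation[OF pU B Bsym HE[OF pU]]) (use eqs[OF pU] in \<open>auto simp: F_def\<close>)
  note eq12 = coupled_equations_from_RicB[OF pU ric]
  have sym: "(\<Sum>e\<in>onb (g c p). B (F p e v) (F p e w)) = (\<Sum>e\<in>onb (g c p). B (F p e w) (F p e v))" for v w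
    by (rule sum.cong[OF refl]) (rule Bsym)
  show "let H = torsion (g c); F = curv_form G (\<theta> s c); n = CARD('n);
          \<phi> = lee_form (g c); Y = lee_field (g c)
      in
        (\<forall>v w. complex_of_real (ricci (g c) p v w - (1 / 4) * torsion_sq (g c) p v w
                + (1 / 2) * lie_deriv_metric Y (g c) p v w)
              + (\<Sum>e\<in>onb (g c p). B (F p [e, v]) (F p [e, w])) = 0) \<and>
        (\<forall>v w. codiff (g c) 3 H p [v, w] - ext_d \<phi> p [v, w] + H p [Y p, v, w] = 0) \<and>
        (\<forall>v. cov_codiff G (g c) (\<theta> s c) 2 F p [v] + F p [Y p, v]
              + hodge (g c p) (2 * n - 1)
                  (wedge (\<lambda>\<xi> r. r *\<^sub>R \<xi>) 2 (2 * n - 3) (F p) (hodge (g c p) 3 (H p))) [v] = 0)"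
    unfolding Let_def using eq12[OF sym] curvature_equation[OF pU HE central] unfolding F_def by blast
qed

end
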